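(* Let $X\subseteq K^m$-type set $X$ (a subset of $\mathrm{VF}^m$) be existentially definable and let $f\colon X\to \mathrm{VF}$ be an existentially definable function, where "existentially definable" means defined by an existential $\mathcal{L}_{\mathrm{RV}}$-formula either (a) without parameters, or (b) with parameters from a fixed non-Archimedean local field $K_0$ of characteristic zero. In case (a), for every non-Archimedean local field $K$ of characteristic zero, and in case (b), for every finite field extension $K$ of $K_0$, one has for every finite field extension $L\geq K$: \[\operatorname{ind}^L_X(|f|)\leq \operatorname{ind}^K_X(|f|).\]
   Context: Valued fields and $\mathcal{L}_{\mathrm{RV}}$: for a valued field $K$ with valuation ring $\mathcal{O}_K$, maximal ideal $\mathcal{M}_K$, value group $\Gamma$ and valuation $\mathrm{ord}$, and a positive integer $N$, put $\mathrm{RV}_N^\times=K^\times/(1+N\mathcal{M}_K)$, $\mathrm{RV}_N=\mathrm{RV}_N^\times\cup\{0\}$, $\mathrm{rv}_N\colon K\to\mathrm{RV}_N$ the projection with $\mathrm{rv}_N(0)=0$ (and also the induced maps $\mathrm{RV}_M\to\mathrm{RV}_N$ for $N\mid M$). For $\xi_0,\dots,\xi_d\in\mathrm{RV}_N$ let $\sum_i\xi_i=\{\mathrm{rv}_N(\sum_i x_i)\mid x_i\in K,\mathrm{rv}_N(x_i)=\xi_i\}$; for $A\subseteq\mathrm{RV}_N$ write $\mathrm{ord}(A)\le\delta$ if every element of $A$ has order $\le\delta$. The multisorted language $\mathcal{L}_{\mathrm{RV}}$ has sorts $\mathrm{VF}$ and $\mathrm{RV}_N$ ($N\geq1$): the ring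 language on $\mathrm{VF}$; on each $\mathrm{RV}_N$ constants $0,1$, a binary function $\cdot$, a binary relation $\mid$ and a ternary relation $\oplus$; function symbols $\mathrm{rv}_N\colon\mathrm{VF}\to\mathrm{RV}_N$ and $\mathrm{rv}_{N,M}\colon \mathrm{RV}_M\to\mathrm{RV}_N$ ($N\mid M$); and relation symbols $P_{N,d}$ on $\mathrm{RV}_N\times\mathrm{RV}_{N^2}^{d+1}$. In a valued field $K$ these are interpreted naturally: $\cdot$ is the group multiplication on $\mathrm{RV}_N^\times$ extended by $0$, $1=\mathrm{rv}_N(1)$, $\mathrm{rv}_N(x)\mid\mathrm{rv}_N(y)$ iff $\mathrm{ord}\,x\le\mathrm{ord}\,y$, $\oplus(\xi_1,\xi_2,\xi_3)$ iff there are $x_i\in K$ with $\mathrm{rv}_N(x_i)=\xi_i$ and $x_1+x_2=x_3$, and $P_{N,d}(\xi,\zeta_0,\dots,\zeta_d)$ iff $\xi\in\mathrm{RV}_N^\times$ and for some (equivalently all) $a_i\in K$ with $\mathrm{rv}_{N^2}(a_i)=\zeta_i$: $\mathrm{ord}(\sum_{i=1}^d\mathrm{rv}_N(ia_i)\xi^{i-1})\le\min_{1\le i\le d}\mathrm{ord}(a_i\xi^{i-1})+\mathrm{ord}\,N$ and there is $\tilde\xi\in\mathrm{RV}_{N^2}$ with $\mathrm{rv}_N(\tilde\xi)=\xi$ and $0\in\sum_{i=0}^d\mathrm{rv}_{N^2}(a_i)\tilde\xi^i$. An existential formula is one of the form $\exists y\,\varphi(x,y)$ with $\varphi$ quantifier-free.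 A definable set $X$ is the family $(X_K)_K$ of sets defined by a formula in each field $K$; a definable function $f\colon X\to Y$ is a family of functions $f_K\colon X_K\to Y_K$ with domain exactly $X_K$ whose graphs are defined by one formula; it is existentially definable if its graph is given by an existential formula. $K$-index: for a non-Archimedean local field $K$ with residue field of cardinality $q_K$ and uniformizer $\pi$, let $|\cdot|_K$ be the absolute value with $|\pi|_K=q_K^{-1}$, and equip $K^m$ with the Haar measure normalized so that $\mathcal{O}_K^m$ has measure 1. Then $\operatorname{ind}^K_X(|f|)$ is the supremum of all $s\in\mathbb{R}_{>0}$ with $\int_{X_K}|f_K(x)|_K^s\,dx<+\infty$, set to $0$ if no such $s$ exists and to $+\infty$ if the set of such $s$ is unbounded. *)

theory Defs
  imports "HOL-Algebra.Ring" "HOL-Analysis.Analysis"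
begin

record 'a vfield = "'a ring" + vord :: "'a \<Rightarrow> int"

definition natF :: "'a vfield \<Rightarrow> nat \<Rightarrow> 'a" where
  "natF F n = add_pow F n (monoid.one F)"

definition eord :: "'a vfield \<Rightarrow> 'a \<Rightarrow> ereal" where
  "eord F x = (if x = ring.zero F then \<infinity> else ereal (real_of_int (vord F x)))"

definition valued_field :: "'a vfield \<Rightarrow> bool" where
  "valued_field F \<longleftrightarrow> field F \<and>
     (\<forall>x\<in>carrier F. \<forall>y\<in>carrier F. x \<noteq> ring.zero F \<longrightarrow> y \<noteq> ring.zero F \<longrightarrow>
        vord F (monoid.mult F x y) = vord F x + vord F y) \<and>
     (\<forall>x\<in>carrier F. \<forall>y\<in>carrier F. x \<noteq> ring.zero F \<longrightarrow> y \<noteq> ring.zero F \<longrightarrow> ring.add F x y \<noteq> ring.zero F \<longrightarrow>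
        min (vord F x) (vord F y) \<le> vord F (ring.add F x y)) \<and>
     (\<forall>n::int. \<exists>x\<in>carrier F. x \<noteq> ring.zero F \<and> vord F x = n)"

definition vO :: "'a vfield \<Rightarrow> 'a set" where
  "vO F = {x \<in> carrier F. x = ring.zero F \<or> 0 \<le> vord F x}"

definition vM :: "'a vfield \<Rightarrow> 'a set" where
  "vM F = {x \<in> carrier F. x = ring.zero F \<or> 0 < vord F x}"

definition res_classes :: "'a vfield \<Rightarrow> 'a set set" where
  "res_classes F = (\<lambda>x. {y \<in> vO F. a_minus F y x \<in> vM F}) ` vO F"

definition qK :: "'a vfield \<Rightarrow> nat" where
  "qK F = card (res_classes F)"

definition complete_vf :: "'a vfield \<Rightarrow> bool" where
  "complete_vf F \<longleftrightarrow> (\<forall>s::nat \<Rightarrow> 'a. (\<forall>k. s k \<in> carrier F) \<longrightarrow>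
      (\<forall>n::int. \<exists>k0. \<forall>i\<ge>k0. \<forall>j\<ge>k0. ereal (real_of_int n) \<le> eord F (a_minus F (s i) (s j))) \<longrightarrow>
      (\<exists>a\<in>carrier F. \<forall>n::int. \<exists>k0. \<forall>i\<ge>k0. ereal (real_of_int n) \<le> eord F (a_minus F (s i) a)))"

definition local_field0 :: "'a vfield \<Rightarrow> bool" where
  "local_field0 F \<longleftrightarrow> valued_field F \<and> complete_vf F \<and> finite (res_classes F) \<and>
     (\<forall>n::nat. 0 < n \<longrightarrow> natF F n \<noteq> ring.zero F)"

definition finite_ext :: "'a vfield \<Rightarrow> 'b vfield \<Rightarrow> ('a \<Rightarrow> 'b) \<Rightarrow> bool" where
  "finite_ext K L e \<longleftrightarrow> e \<in> ring_hom K L \<and>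
     (\<forall>x\<in>carrier K. x \<noteq> ring.zero K \<longrightarrow> (0 \<le> vord K x \<longleftrightarrow> 0 \<le> vord L (e x))) \<and>
     (\<exists>bs. set bs \<subseteq> carrier L \<and> (\<forall>y\<in>carrier L. \<exists>cs. length cs = length bs \<and> set cs \<subseteq> carrier K \<and>
          y = finsum L (\<lambda>i. monoid.mult L (e (cs ! i)) (bs ! i)) {..<length bs}))"

section \<open>The sorts RV_N (elements represented as cosets x(1+N M), resp. {0})\<close>

definition rv :: "'a vfield \<Rightarrow> nat \<Rightarrow> 'a \<Rightarrow> 'a set" where
  "rv F N x = (if x = ring.zero F then {ring.zero F} else
     {y \<in> carrier F. y \<noteq> ring.zero F \<and>
        eord F (natF F N) < eord F (a_minus F (monoid.mult F y (m_inv F x)) (monoid.one F))})"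

definition RVs :: "'a vfield \<Rightarrow> nat \<Rightarrow> 'a set set" where
  "RVs F N = rv F N ` carrier F"

definition rep :: "'a set \<Rightarrow> 'a" where
  "rep A = (SOME x. x \<in> A)"

datatype 'p vterm = VVar nat | VConst 'p | VZero | VOne
  | VAdd "'p vterm" "'p vterm" | VNeg "'p vterm" | VMul "'p vterm" "'p vterm"

text \<open>RVar N i: i-th variable of sort RV_N; RProj N r: rv_{N,M}(r)\<close>
datatype 'p rterm = RVar nat nat | RZero nat | ROne nat | RMul "'p rterm" "'p rterm"
  | Rv nat "'p vterm" | RProj nat "'p rterm"

text \<open>RP N xi zetas: P_{N,d}(xi, zeta_0..zeta_d) with d+1 = length zetas\<close>
datatype 'p qf = QTrue | VEq "'p vterm" "'p vterm" | REq "'p rterm" "'p rterm"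
  | RDvd "'p rterm" "'p rterm" | ROplus "'p rterm" "'p rterm" "'p rterm"
  | RP nat "'p rterm" "'p rterm list"
  | QNot "'p qf" | QAnd "'p qf" "'p qf" | QOr "'p qf" "'p qf"

fun rsort :: "'p rterm \<Rightarrow> nat" where
  "rsort (RVar N i) = N"
| "rsort (RZero N) = N"
| "rsort (ROne N) = N"
| "rsort (RMul a b) = rsort a"
| "rsort (Rv N t) = N"
| "rsort (RProj N r) = N"

fun rwf :: "'p rterm \<Rightarrow> bool" where
  "rwf (RVar N i) = (1 \<le> N)"
| "rwf (RZero N) = (1 \<le> N)"
| "rwf (ROne N) = (1 \<le> N)"
| "rwf (RMul a b) = (rwf a \<and> rwf b \<and> rsort a = rsort b)"
| "rwf (Rv N t) = (1 \<le> N)"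
| "rwf (RProj N r) = (1 \<le> N \<and> rwf r \<and> N dvd rsort r)"

fun qwf :: "'p qf \<Rightarrow> bool" where
  "qwf QTrue = True"
| "qwf (VEq s t) = True"
| "qwf (REq a b) = (rwf a \<and> rwf b \<and> rsort a = rsort b)"
| "qwf (RDvd a b) = (rwf a \<and> rwf b \<and> rsort a = rsort b)"
| "qwf (ROplus a b c) = (rwf a \<and> rwf b \<and> rwf c \<and> rsort a = rsort b \<and> rsort b = rsort c)"
| "qwf (RP N x zs) = (1 \<le> N \<and> rwf x \<and> rsort x = N \<and> 2 \<le> length zs \<and>
      (\<forall>z\<in>set zs. rwf z \<and> rsort z = N ^ 2))"
| "qwf (QNot p) = qwf p"
| "qwf (QAnd p q) = (qwf p \<and> qwf q)"
| "qwf (QOr p q) = (qwf p \<and> qwf q)"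

fun vconsts :: "'p vterm \<Rightarrow> 'p set" where
  "vconsts (VConst p) = {p}"
| "vconsts (VAdd s t) = vconsts s \<union> vconsts t"
| "vconsts (VNeg s) = vconsts s"
| "vconsts (VMul s t) = vconsts s \<union> vconsts t"
| "vconsts _ = {}"

fun rconsts :: "'p rterm \<Rightarrow> 'p set" where
  "rconsts (RMul a b) = rconsts a \<union> rconsts b"
| "rconsts (Rv N t) = vconsts t"
| "rconsts (RProj N r) = rconsts r"
| "rconsts _ = {}"

fun qconsts :: "'p qf \<Rightarrow> 'p set" where
  "qconsts QTrue = {}"
| "qconsts (VEq s t) = vconsts s \<union> vconsts t"
| "qconsts (REq a b) = rconsts a \<union> rconsts b"
| "qconsts (RDvd a b) = rconsts a \<union> rconsts b"
| "qconsts (ROplus a b c) = rconsts a \<union> rconsts b \<union> rconsts c"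
| "qconsts (RP N x zs) = rconsts x \<union> \<Union>(rconsts ` set zs)"
| "qconsts (QNot p) = qconsts p"
| "qconsts (QAnd p q) = qconsts p \<union> qconsts q"
| "qconsts (QOr p q) = qconsts p \<union> qconsts q"

fun vval :: "'a vfield \<Rightarrow> ('p \<Rightarrow> 'a) \<Rightarrow> (nat \<Rightarrow> 'a) \<Rightarrow> 'p vterm \<Rightarrow> 'a" where
  "vval F c \<rho> (VVar i) = \<rho> i"
| "vval F c \<rho> (VConst p) = c p"
| "vval F c \<rho> VZero = ring.zero F"
| "vval F c \<rho> VOne = monoid.one F"
| "vval F c \<rho> (VAdd s t) = ring.add F (vval F c \<rho> s) (vval F c \<rho> t)"
| "vval F c \<rho> (VNeg s) = a_inv F (vval F c \<rho> s)"
| "vval F c \<rho> (VMul s t) = monoid.mult F (vval F c \<rho> s) (vval F c \<rho> t)"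

fun rval :: "'a vfield \<Rightarrow> ('p \<Rightarrow> 'a) \<Rightarrow> (nat \<Rightarrow> 'a) \<Rightarrow> (nat \<times> nat \<Rightarrow> 'a set) \<Rightarrow> 'p rterm \<Rightarrow> 'a set" where
  "rval F c \<rho> \<sigma> (RVar N i) = \<sigma> (N, i)"
| "rval F c \<rho> \<sigma> (RZero N) = rv F N (ring.zero F)"
| "rval F c \<rho> \<sigma> (ROne N) = rv F N (monoid.one F)"
| "rval F c \<rho> \<sigma> (RMul a b) =
     rv F (rsort a) (monoid.mult F (rep (rval F c \<rho> \<sigma> a)) (rep (rval F c \<rho> \<sigma> b)))"
| "rval F c \<rho> \<sigma> (Rv N t) = rv F N (vval F c \<rho> t)"
| "rval F c \<rho> \<sigma> (RProj N r) = rv F N (rep (rval F c \<rho> \<sigma> r))"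

definition rdvd :: "'a vfield \<Rightarrow> 'a set \<Rightarrow> 'a set \<Rightarrow> bool" where
  "rdvd F \<xi> \<eta> \<longleftrightarrow> eord F (rep \<xi>) \<le> eord F (rep \<eta>)"

definition roplus :: "'a vfield \<Rightarrow> 'a set \<Rightarrow> 'a set \<Rightarrow> 'a set \<Rightarrow> bool" where
  "roplus F \<xi>1 \<xi>2 \<xi>3 \<longleftrightarrow> (\<exists>x1\<in>\<xi>1. \<exists>x2\<in>\<xi>2. \<exists>x3\<in>\<xi>3. ring.add F x1 x2 = x3)"

text \<open>P_{N,d}(xi, zeta_0,...,zeta_d), d = length zs - 1, written out literally:
  ord(sum_{i=1}^d rv_N(i a_i) xi^(i-1)) \<le> min_i ord(a_i xi^(i-1)) + ord N means every element
  rv_N(y_1+...+y_d), y_i in rv_N(i a_i x^(i-1)), has order \<le> the bound; and there is a lift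
  xi~ in RV_{N^2} of xi with 0 in sum_{i=0}^d rv_{N^2}(a_i) xi~^i.\<close>
definition rP :: "'a vfield \<Rightarrow> nat \<Rightarrow> 'a set \<Rightarrow> 'a set list \<Rightarrow> bool" where
  "rP F N \<xi> zs \<longleftrightarrow> \<xi> \<noteq> {ring.zero F} \<and>
     (\<exists>a. (\<forall>i<length zs. a i \<in> carrier F \<and> a i \<in> zs ! i) \<and>
        (let d = length zs - 1; x = rep \<xi> in
          (\<forall>y. (\<forall>i\<in>{1..d}. y i \<in> rv F N (monoid.mult F (add_pow F i (a i)) (pow F x (i - 1)))) \<longrightarrow>
              eord F (finsum F y {1..d}) \<le>
                Min ((\<lambda>i. eord F (monoid.mult F (a i) (pow F x (i - 1)))) ` {1..d}) + eord F (natF F N)) \<and>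
          (\<exists>\<xi>t\<in>RVs F (N ^ 2). rv F N (rep \<xi>t) = \<xi> \<and>
              (\<exists>y. (\<forall>i\<in>{0..d}. y i \<in> rv F (N ^ 2) (monoid.mult F (a i) (pow F (rep \<xi>t) i))) \<and>
                   finsum F y {0..d} = ring.zero F))))"

fun sat :: "'a vfield \<Rightarrow> ('p \<Rightarrow> 'a) \<Rightarrow> (nat \<Rightarrow> 'a) \<Rightarrow> (nat \<times> nat \<Rightarrow> 'a set) \<Rightarrow> 'p qf \<Rightarrow> bool" where
  "sat F c \<rho> \<sigma> QTrue = True"
| "sat F c \<rho> \<sigma> (VEq s t) = (vval F c \<rho> s = vval F c \<rho> t)"
| "sat F c \<rho> \<sigma> (REq a b) = (rval F c \<rho> \<sigma> a = rval F c \<rho> \<sigma> b)"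
| "sat F c \<rho> \<sigma> (RDvd a b) = rdvd F (rval F c \<rho> \<sigma> a) (rval F c \<rho> \<sigma> b)"
| "sat F c \<rho> \<sigma> (ROplus a b d) =
     roplus F (rval F c \<rho> \<sigma> a) (rval F c \<rho> \<sigma> b) (rval F c \<rho> \<sigma> d)"
| "sat F c \<rho> \<sigma> (RP N x zs) = rP F N (rval F c \<rho> \<sigma> x) (map (rval F c \<rho> \<sigma>) zs)"
| "sat F c \<rho> \<sigma> (QNot p) = (\<not> sat F c \<rho> \<sigma> p)"
| "sat F c \<rho> \<sigma> (QAnd p q) = (sat F c \<rho> \<sigma> p \<and> sat F c \<rho> \<sigma> q)"
| "sat F c \<rho> \<sigma> (QOr p q) = (sat F c \<rho> \<sigma> p \<or> sat F c \<rho> \<sigma> q)"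

text \<open>The set defined in F^m by the existential formula "exists y. phi(x,y)": the free
  variables x are the VF variables 0..m-1, all other variables are existentially quantified
  (VF variables over F, RV variables of sort N over RV_N(F)).\<close>
definition dset :: "'a vfield \<Rightarrow> ('p \<Rightarrow> 'a) \<Rightarrow> nat \<Rightarrow> 'p qf \<Rightarrow> (nat \<Rightarrow> 'a) set" where
  "dset F c m \<phi> = {x \<in> PiE {..<m} (\<lambda>_. carrier F).
      \<exists>\<rho> \<sigma>. (\<forall>i. \<rho> i \<in> carrier F) \<and> (\<forall>i<m. \<rho> i = x i) \<and>
            (\<forall>N i. 1 \<le> N \<longrightarrow> \<sigma> (N, i) \<in> RVs F N) \<and> sat F c \<rho> \<sigma> \<phi>}"

definition defines_fun :: "'a vfield \<Rightarrow> ('p \<Rightarrow> 'a) \<Rightarrow> nat \<Rightarrow> 'p qf \<Rightarrow> 'p qf \<Rightarrow> bool" where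
  "defines_fun F c m \<phi> \<psi> \<longleftrightarrow> (\<forall>x\<in>PiE {..<m} (\<lambda>_. carrier F).
      (x \<in> dset F c m \<phi> \<longrightarrow> (\<exists>!y. y \<in> carrier F \<and> x(m := y) \<in> dset F c (Suc m) \<psi>)) \<and>
      (x \<notin> dset F c m \<phi> \<longrightarrow> \<not> (\<exists>y\<in>carrier F. x(m := y) \<in> dset F c (Suc m) \<psi>)))"

definition fval :: "'a vfield \<Rightarrow> ('p \<Rightarrow> 'a) \<Rightarrow> nat \<Rightarrow> 'p qf \<Rightarrow> (nat \<Rightarrow> 'a) \<Rightarrow> 'a" where
  "fval F c m \<psi> x = (THE y. y \<in> carrier F \<and> x(m := y) \<in> dset F c (Suc m) \<psi>)"

definition absv :: "'a vfield \<Rightarrow> 'a \<Rightarrow> real" where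
  "absv F y = (if y = ring.zero F then 0 else real (qK F) powr (- real_of_int (vord F y)))"

definition box :: "'a vfield \<Rightarrow> nat \<Rightarrow> (nat \<Rightarrow> 'a) \<Rightarrow> int \<Rightarrow> (nat \<Rightarrow> 'a) set" where
  "box F m a n = {y \<in> PiE {..<m} (\<lambda>_. carrier F).
      \<forall>i<m. ereal (real_of_int n) \<le> eord F (a_minus F (y i) (a i))}"

text \<open>Haar measure on F^m normalized with O^m of measure 1 (the unique measure on the
  sigma-algebra generated by the balls a + pi^n O^m giving them measure q^(-nm))\<close>
definition haar :: "'a vfield \<Rightarrow> nat \<Rightarrow> (nat \<Rightarrow> 'a) measure" where
  "haar F m = (SOME \<mu>. space \<mu> = PiE {..<m} (\<lambda>_. carrier F) \<and>
      sets \<mu> = sigma_sets (PiE {..<m} (\<lambda>_. carrier F))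
                 {box F m a n | a n. a \<in> PiE {..<m} (\<lambda>_. carrier F)} \<and>
      (\<forall>a\<in>PiE {..<m} (\<lambda>_. carrier F). \<forall>n.
          emeasure \<mu> (box F m a n) = ennreal (real (qK F) powr (- real_of_int n * real m))))"

definition ind :: "'a vfield \<Rightarrow> ('p \<Rightarrow> 'a) \<Rightarrow> nat \<Rightarrow> 'p qf \<Rightarrow> 'p qf \<Rightarrow> ereal" where
  "ind F c m \<phi> \<psi> =
     (let S = {s::real. 0 < s \<and>
          (\<integral>\<^sup>+ x. indicator (dset F c m \<phi>) x * ennreal (absv F (fval F c m \<psi> x) powr s) \<partial>haar F m) < \<infinity>}
      in if S = {} then 0 else Sup (ereal ` S))"

end

(*
Only the geometry of L is used. With the RV variables replaced by representatives, the graph of f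
together with the existential witnesses becomes a set over L that is cut out by comparing orders of
polynomials. By cell decomposition in the style of Cohen and Denef it is a finite union of cells. On a
cell there are centers c_i depending on the coordinates below i only; the angular components of the
z_i - c_i are prescribed, their orders v_i run through b + N g_1 + ... + N g_r, and ord f is an affine
function of v that depends only on the first m orders.

Over L every such v is realised by points x of X, in a set of measure comparable to q_L^(-(v_1 + ... + v_m)).
So if |f|^s is integrable over L, the sum of t^(v_1 + ... + v_m + s ord f) over the possible
(v_1, ..., v_m) is finite for t = 1 / q_L. For 0 < t < 1 this finiteness means that the linear part of the
exponent is positive on all g_j that move the first m orders, a condition independent of t.

Let e be the ramification index of L over K. An existential witness over K is one over L, so almost every
point of X_K lies in a cell, and the points of K^m with given orders have measure at most
q_K^(-(v_1 + ... + v_m) / e). Hence the sum for t = q_K^(-1/e) bounds the integral over K.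
*)
theory Submission
 imports Defs "HOL-Computational_Algebra.Polynomial" "HOL-Algebra.QuotRing"
begin

text \<open>The obstacle is that centers are roots of polynomials and not polynomials, so
  differences of centers and polynomials in them have to be controlled again by orders and angular
  components. This is the purpose of tame extensions: norms and angular components in the larger
  ring are governed, piece by piece, by monomials in the smaller one. Induction on the degree keeps
  the extensions by Hensel roots tame. The exponents \<open>e\<close> attached to monomials come
  from slopes of Newton polygons. Witnesses stay as extra coordinates, so no quantifier is
  eliminated. The relations \<open>P_{N,d}\<close> disappear since, by Hensel's lemma, they compare
  the value of a polynomial with its derivative; this is where the square of \<open>N\<close> is
  used. Fields are records on varying carriers. All local fields on one carrier type are therefore
  treated as quotients of one commutative ring, and equality becomes the vanishing of a seminorm.
  The hypothesis on \<open>f\<close> speaks of fields carried by \<open>real\<close>; a local field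
  is separable, so it injects into the reals and has a copy there.\<close>

abbreviation (input) iff_ascii :: "bool => bool => bool" (infixr "<->" 25) where "A <-> B == A = B"

section \<open>Valued rings\<close>

text \<open>A complete discretely valued field of characteristic zero with finite residue field,
  described on a ring that maps onto it: \<open>nm\<close> is a seminorm, and its null elements play
  the part of zero. Hence inverses, limits and the rules for the powers \<open>pw n\<close> of a
  uniformizer hold only up to null elements. \<open>Q\<close> is later the residue
  cardinality.\<close>

locale vring =
 fixes nm :: "'r::comm_ring_1 => real" and Q :: real and pw :: "int => 'r"
 assumes nm_one [simp]: "nm 1 = 1"
  and nm_zero [simp]: "nm 0 = 0"
  and nm_mult: "nm (x*y) = nm x*nm y"
  and nm_add: "nm (x+y) <= max (nm x) (nm y)"
  and Q_gt1: "Q > 1"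
  and nm_val: "nm x = 0 | (EX n::int. nm x = Q powi (- n))"
  and nm_pw: "!!n. nm (pw n) = Q powi (- n)"
  and pw_add: "nm (pw (a+b)-pw a*pw b) = 0"
  and nm_inv: "nm x ~= 0 ==> EX y. nm (x*y-1) = 0"
  and fin_res: "EX U. finite U & (ALL x. nm x <= 1 --> (EX u:U. nm (x-u) < 1))"
  and complete: "!!s::nat => 'r. (!!ee. ee > 0 ==> EX N. ALL i>=N. ALL j>=N. nm (s i-s j) <= ee) ==>
    EX a. ALL ee>0. EX N. ALL i>=N. nm (s i-a) <= ee"
  and char0: "!!n::nat. n > 0 ==> nm (of_nat n) ~= 0"
begin

lemma nm_ge0 [simp]: "nm x >= 0"
 using nm_val[of x] Q_gt1 by (auto intro: zero_le_power_int)

lemma nm_pos: "nm x ~= 0 ==> nm x > 0"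
 using nm_ge0[of x] by linarith

lemma nm_minus_one: "nm (- 1) = 1"
proof -
 have "nm (- 1)*nm (- 1) = 1" using nm_mult[of "-1" "-1"] by simp
 hence "(nm (-1))\<^sup>2 = 1\<^sup>2" by (simp add: power2_eq_square)
 thus ?thesis using nm_ge0[of "-1"] by (metis power2_eq_iff_nonneg zero_le_one)
qed

lemma nm_neg [simp]: "nm (- x) = nm x"
 using nm_mult[of "-1" x] nm_minus_one by simp

lemma nm_minus_commute: "nm (x-y) = nm (y-x)"
 using nm_neg[of "x-y"] by simp

lemma nm_diff: "nm (x-y) <= max (nm x) (nm y)"
 using nm_add[of x "- y"] by simp

lemma nm_add_le: "nm x <= b ==> nm y <= b ==> nm (x+y) <= b"
 using nm_add[of x y] by simp

lemma nm_diff_le: "nm x <= b ==> nm y <= b ==> nm (x-y) <= b"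
 using nm_diff[of x y] by simp

lemma nm_add_less: "nm x < b ==> nm y < b ==> nm (x+y) < b"
 using nm_add[of x y] by simp

lemma nm_diff_less: "nm x < b ==> nm y < b ==> nm (x-y) < b"
 using nm_diff[of x y] by simp

lemma nm_diff_trans: "nm (x-y) <= b ==> nm (y-z) <= b ==> nm (x-z) <= b"
 using nm_add_le[of "x-y" b "y-z"] by simp

lemma nm_diff_trans_less: "nm (x-y) < b ==> nm (y-z) < b ==> nm (x-z) < b"
 using nm_add_less[of "x-y" b "y-z"] by simp

lemma nm_close: assumes "nm (x-y) < nm x" shows "nm y = nm x"
proof -
 have 1: "nm y <= nm x" using nm_diff_le[of x "nm x" "x-y"] assms by simp
 have "nm x <= max (nm (x-y)) (nm y)" using nm_add[of "x-y" y] by simp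
 hence "nm x <= nm y" using assms by linarith
 thus ?thesis using 1 by simp
qed

lemma nm_eq0: assumes "nm (x-y) = 0" shows "nm x = nm y"
proof (cases "nm x = 0")
 case True
 thus ?thesis using nm_diff_le[of x 0 "x-y"] assms nm_ge0[of y] by simp
next
 case False
 thus ?thesis using nm_close[of x y] assms nm_pos by simp
qed

lemma nm_add_dom: "nm y < nm x ==> nm (x+y) = nm x"
 using nm_close[of x "x+y"] by simp

lemma nm_power: "nm (x^n) = nm x^n"
 by (induction n) (simp_all add: nm_mult)

lemma nm_sum_le: "(!!i. i:A ==> nm (f i) <= b) ==> 0 <= b ==> nm (sum f A) <= b"
 by (induction A rule: infinite_finite_induct) (simp_all add: nm_add_le)

lemma nm_sum_less: "(!!i. i:A ==> nm (f i) < b) ==> 0 < b ==> nm (sum f A) < b"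
 by (induction A rule: infinite_finite_induct) (simp_all add: nm_add_less)

lemma nm_of_nat: "nm (of_nat n) <= 1"
 by (induction n) (simp_all add: nm_add_le)

text \<open>Equality in the quotient by the null elements, that is, in the field under
  study.\<close>

definition eqv :: "'r => 'r => bool" where "eqv x y <-> nm (x-y) = 0"

lemma eqv_refl [simp, intro]: "eqv x x" by (simp add: eqv_def)
lemma eqv_sym: "eqv x y ==> eqv y x" by (simp add: eqv_def nm_minus_commute)
lemma eqv_trans [trans]: "eqv x y ==> eqv y z ==> eqv x z"
 unfolding eqv_def using nm_diff_trans[of x y 0 z] nm_ge0[of "x-z"] by simp
lemma eqv_nm: "eqv x y ==> nm x = nm y" unfolding eqv_def by (rule nm_eq0)
lemma eqv_add: "eqv x y ==> eqv a b ==> eqv (x+a) (y+b)"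
 unfolding eqv_def using nm_add_le[of "x-y" 0 "a-b"] nm_ge0[of "x-y+(a-b)"]
 by (metis add_diff_add order_antisym order_refl)
lemma eqv_neg: "eqv x y ==> eqv (- x) (- y)"
 unfolding eqv_def by (metis minus_diff_minus nm_neg)
lemma eqv_diff: "eqv x y ==> eqv a b ==> eqv (x-a) (y-b)"
 using eqv_add[of x y "- a" "- b"] eqv_neg[of a b] by simp
lemma eqv_mult: assumes "eqv x y" "eqv a b" shows "eqv (x*a) (y*b)"
proof -
 have "x*a-y*b = (x-y)*a+y*(a-b)" by (simp add: algebra_simps)
 moreover have "nm ((x-y)*a+y*(a-b)) <= 0"
  using assms by (intro nm_add_le) (simp_all add: nm_mult eqv_def)
 ultimately show ?thesis unfolding eqv_def using nm_ge0 by (metis order_antisym)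
qed
lemma eqv_power: "eqv x y ==> eqv (x^n) (y^n)"
 by (induction n) (simp_all add: eqv_mult)
lemma eqv_sum: "(!!i. i:A ==> eqv (f i) (g i)) ==> eqv (sum f A) (sum g A)"
 by (induction A rule: infinite_finite_induct) (simp_all add: eqv_add)
lemma eqv_0: "eqv x 0 <-> nm x = 0" by (simp add: eqv_def)

text \<open>Null elements get order 0 instead of infinity, so that orders are integers; rules such
  as \<open>ord_mult\<close> therefore carry nonvanishing hypotheses.\<close>

definition ord :: "'r => int" where
 "ord x = (if nm x = 0 then 0 else THE n. nm x = Q powi (- n))"

lemma powi_inj: "Q powi a = Q powi b <-> a = b"
 using Q_gt1 by (metis linorder_neqE power_int_strict_increasing order_less_irrefl)

lemma powi_le: "Q powi a <= Q powi b <-> a <= b"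
 using Q_gt1 by (meson linorder_not_less power_int_increasing power_int_strict_increasing less_imp_le)

lemma powi_less: "Q powi a < Q powi b <-> a < b"
 using powi_le by (meson linorder_not_less)

lemma powi_pos [simp]: "Q powi a > 0" using Q_gt1 by simp

lemma nm_ord: assumes "nm x ~= 0" shows "nm x = Q powi (- ord x)"
proof -
 obtain n where n: "nm x = Q powi (- n)" using nm_val assms by blast
 have "ord x = n"
  unfolding ord_def using assms n powi_inj by (auto intro!: the_equality)
 thus ?thesis using n by simp
qed

lemma ordI: "nm x = Q powi (- n) ==> ord x = n"
 using nm_ord[of x] powi_inj by (metis add.inverse_inverse powi_pos order_less_irrefl)

lemma ord_zero: "nm x = 0 ==> ord x = 0" by (simp add: ord_def)

lemma ord_mult: "nm x ~= 0 ==> nm y ~= 0 ==> ord (x*y) = ord x + ord y"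
 by (rule ordI) (use Q_gt1 in "simp add: nm_mult nm_ord power_int_add[symmetric]")

lemma ord_power: "nm x ~= 0 ==> ord (x^n) = int n * ord x"
 by (induction n) (simp_all add: ord_mult nm_power algebra_simps ordI)

lemma ord_eqv: "nm x = nm y ==> ord x = ord y" by (simp add: ord_def)

lemma nm_eq_iff_ord: "nm x ~= 0 ==> nm y ~= 0 ==> nm x = nm y <-> ord x = ord y"
 using nm_ord ord_eqv by metis

lemma pw_nz [simp]: "nm (pw n) ~= 0" by (simp add: nm_pw) (use Q_gt1 in simp)
lemma ord_pw [simp]: "ord (pw n) = n" by (rule ordI) (simp add: nm_pw)
lemma pw_0: "eqv (pw 0) 1"
proof -
 have "nm (pw 0*(1-pw 0)) = 0" using pw_add[of 0 0] by (simp add: algebra_simps)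
 hence "nm (1-pw 0) = 0" by (simp add: nm_mult nm_pw)
 thus ?thesis by (simp add: eqv_def nm_minus_commute)
qed
lemma pw_add': "eqv (pw (a+b)) (pw a*pw b)" using pw_add by (simp add: eqv_def)
lemma pw_cancel: "eqv (pw a*pw (- a)) 1"
 using pw_add'[of a "- a"] pw_0 eqv_sym eqv_trans by (metis add.right_inverse)

text \<open>The unit part of \<open>x\<close>: the uniformizer is divided out as often as it
  occurs.\<close>

definition nf :: "'r => 'r" where "nf x = x*pw (- ord x)"

lemma nm_nf: "nm x ~= 0 ==> nm (nf x) = 1"
 using nm_ord[of x] Q_gt1 by (simp add: nf_def nm_mult nm_pw power_int_minus)

lemma nm_nf_le: "nm (nf x) <= 1"
 using nm_nf[of x] by (cases "nm x = 0") (simp_all add: nf_def nm_mult)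

lemma nf_mult: assumes "nm x ~= 0" "nm y ~= 0" shows "eqv (nf (x*y)) (nf x*nf y)"
proof -
 have "eqv (pw (- ord x+- ord y)) (pw (- ord x)*pw (- ord y))" by (rule pw_add')
 hence "eqv (x*y*pw (- ord x+- ord y)) (x*y*(pw (- ord x)*pw (- ord y)))"
  by (intro eqv_mult) auto
 thus ?thesis using assms by (simp add: nf_def ord_mult algebra_simps)
qed

lemma nf_pw: assumes "nm x ~= 0" shows "eqv (nf x*pw (ord x)) x"
proof -
 have "eqv (x*(pw (ord x)*pw (- ord x))) (x*1)" by (intro eqv_mult pw_cancel) auto
 thus ?thesis by (simp add: nf_def algebra_simps)
qed

section \<open>Angular components modulo powers of the uniformizer\<close>

definition ep :: "nat => real" where "ep k = Q powi (- int k)"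

lemma ep_pos [simp]: "ep k > 0" by (simp add: ep_def)
lemma ep_mono: "k <= l ==> ep l <= ep k" by (simp add: ep_def powi_le)
lemma ep_le1: "ep k <= 1" using powi_le[of "- int k" 0] by (simp add: ep_def)
lemma ep_ex: assumes "dl > 0" shows "EX k. ep k < dl"
proof -
 obtain k where "(1/Q)^k < dl" using real_arch_pow_inv[of dl "1/Q"] Q_gt1 assms by auto
 thus ?thesis by (intro exI[of _ k]) (simp add: ep_def power_int_minus power_one_over inverse_eq_divide)
qed

text \<open>The angular component modulo the \<open>k\<close>-th power of the uniformizer, encoded
  as a chosen point of the ball of radius \<open>ep k\<close> around \<open>nf x\<close>. Two points
  with the same ball give the same predicate and hence the same choice, so equality of values means
  congruence of unit parts (\<open>ac_eq_iff\<close>); only such equalities are ever used.\<close>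

definition ac :: "nat => 'r => 'r" where
 "ac k x = (SOME u. nm (u-nf x) <= ep k)"

lemma ac_close: "nm (ac k x-nf x) <= ep k"
 unfolding ac_def by (rule someI[of _ "nf x"]) (simp add: less_imp_le)

lemma ac_eq_iff: "ac k x = ac k y <-> nm (nf x-nf y) <= ep k"
proof
 assume "ac k x = ac k y"
 hence "nm (nf x-ac k x) <= ep k" "nm (ac k x-nf y) <= ep k"
  using ac_close[of k x] ac_close[of k y] by (simp_all add: nm_minus_commute)
 thus "nm (nf x-nf y) <= ep k" by (rule nm_diff_trans)
next
 assume a: "nm (nf x-nf y) <= ep k"
 hence b: "nm (nf y-nf x) <= ep k" by (simp add: nm_minus_commute)
 have "nm (u-nf x) <= ep k <-> nm (u-nf y) <= ep k" for u
  using nm_diff_trans[OF _ a, of u] nm_diff_trans[OF _ b, of u] by blast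
 thus "ac k x = ac k y" by (simp add: ac_def)
qed

lemma ac_mono: "k <= l ==> ac l x = ac l y ==> ac k x = ac k y"
 unfolding ac_eq_iff using ep_mono order_trans by blast

lemma ac_eqv: assumes "eqv x y" shows "ac k x = ac k y"
proof -
 have "eqv (nf x) (nf y)" unfolding nf_def using ord_eqv[OF eqv_nm[OF assms]] assms
  by (simp add: eqv_mult)
 thus ?thesis by (simp add: ac_eq_iff eqv_def less_imp_le)
qed

lemma ac_eq_nm: assumes "nm x ~= 0" "nm x = nm y"
 shows "ac k x = ac k y <-> nm (x-y) <= ep k*nm x"
proof -
 have "nf x-nf y = (x-y)*pw (- ord x)" using ord_eqv[OF assms(2)]
  by (simp add: nf_def algebra_simps)
 hence "nm (nf x-nf y) = nm (x-y)*Q powi (ord x)" by (simp add: nm_mult nm_pw)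
 hence "nm (nf x-nf y)*nm x = nm (x-y)" using nm_ord[OF assms(1)] Q_gt1
  by (simp add: power_int_minus)
 thus ?thesis unfolding ac_eq_iff using nm_pos[OF assms(1)]
  by (metis mult_le_cancel_right_pos)
qed

lemma mult_close:
 assumes "nm (x-x') <= b" "nm (y-y') <= b" "nm x <= 1" "nm y' <= 1" "b >= 0"
 shows "nm (x*y-x'*y') <= b"
proof -
 have "x*y-x'*y' = x*(y-y')+(x-x')*y'" by (simp add: algebra_simps)
 moreover have "nm (x*(y-y')) <= b"
  using mult_mono[OF assms(3) assms(2)] assms(5) by (simp add: nm_mult)
 moreover have "nm ((x-x')*y') <= b"
  using mult_mono[OF assms(1) assms(4)] assms(5) by (simp add: nm_mult)
 ultimately show ?thesis by (simp add: nm_add_le)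
qed

lemma ac_mult:
 assumes "nm x ~= 0" "nm y ~= 0" "nm x' ~= 0" "nm y' ~= 0" "ac k x = ac k x'" "ac k y = ac k y'"
 shows "ac k (x*y) = ac k (x'*y')"
proof -
 have "nm (nf x*nf y-nf x'*nf y') <= ep k"
  using assms by (intro mult_close) (simp_all add: ac_eq_iff nm_nf_le less_imp_le)
 moreover have "nm (nf (x*y)-nf x*nf y) <= ep k" "nm (nf x'*nf y'-nf (x'*y')) <= ep k"
  using nf_mult[OF assms(1,2)] nf_mult[OF assms(3,4)] by (simp_all add: eqv_def nm_minus_commute less_imp_le)
 ultimately show ?thesis unfolding ac_eq_iff using nm_diff_trans by blast
qed

lemma ac_cancel:
 assumes "nm x ~= 0" "nm y ~= 0" "nm x' ~= 0" "nm y' ~= 0" "ac k (x*y) = ac k (x'*y')" "ac k x = ac k x'"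
 shows "ac k y = ac k y'"
proof -
 have "nm (nf (x*y)-nf (x'*y')) <= ep k" using assms(5) by (simp add: ac_eq_iff)
 moreover have "nm (nf x*nf y-nf (x*y)) <= ep k" "nm (nf (x'*y')-nf x'*nf y') <= ep k"
  using nf_mult[OF assms(1,2)] nf_mult[OF assms(3,4)] by (simp_all add: eqv_def nm_minus_commute less_imp_le)
 ultimately have 1: "nm (nf x*nf y-nf x'*nf y') <= ep k" using nm_diff_trans by blast
 have 2: "nm (nf x*nf y'-nf x'*nf y') <= ep k"
  using assms by (intro mult_close) (simp_all add: ac_eq_iff nm_nf_le less_imp_le)
 have "nm (nf x*nf y-nf x*nf y') <= ep k"
  using 1 2 nm_diff_trans nm_minus_commute by metis
 moreover have "nf x*nf y-nf x*nf y' = nf x*(nf y-nf y')" by (simp add: algebra_simps)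
 ultimately show ?thesis using nm_nf[OF assms(1)] by (simp add: nm_mult ac_eq_iff)
qed

lemma ac_approx: assumes "nm x ~= 0" "nm (x-y) <= ep k*nm x" "nm x = nm y"
 shows "ac k x = ac k y"
 using ac_eq_nm assms by blast

lemma ep_Suc: "ep (Suc k) = ep k/Q"
 using Q_gt1 by (simp add: ep_def power_int_diff power_int_add_1 power_int_minus field_simps)

lemma nm_lt1: "nm x < 1 ==> nm x <= 1/Q"
proof (cases "nm x = 0")
 case False
 assume "nm x < 1"
 hence "Q powi (- ord x) < Q powi 0" using nm_ord[OF False] by simp
 hence "- ord x < 0" by (simp only: powi_less)
 hence "- ord x <= - 1" by simp
 hence "Q powi (- ord x) <= Q powi (- 1)" by (simp only: powi_le)
 thus ?thesis using nm_ord[OF False] by (simp add: power_int_minus inverse_eq_divide)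
qed (use Q_gt1 in simp)

text \<open>Induction on \<open>k\<close>, adding one digit: the error left by the first
  \<open>k\<close> digits is rescaled to norm at most 1 and approximated by a residue
  representative.\<close>

lemma fin_res_ep: "EX U. finite U & (ALL x. nm x <= 1 --> (EX u:U. nm (x-u) <= ep k))"
proof (induction k)
 case 0
 show ?case by (rule exI[of _ "{0}"]) (simp add: ep_def)
next
 case (Suc k)
 then obtain U where U: "finite U" "!!x. nm x <= 1 ==> EX u:U. nm (x-u) <= ep k" by blast
 obtain V where V: "finite V" "!!x. nm x <= 1 ==> EX u:V. nm (x-u) < 1" using fin_res by blast
 let ?W = "(%(u, v). u + v * pw (int k)) ` (U \<times> V)"
 have "EX w:?W. nm (x-w) <= ep (Suc k)" if x: "nm x <= 1" for x
 proof -
  obtain u where u: "u:U" "nm (x-u) <= ep k" using U x by blast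
  let ?y = "(x-u)*pw (- int k)"
  have "nm ?y <= ep k*Q powi (int k)" using u by (simp add: nm_mult nm_pw mult_right_mono less_imp_le del: power_int_of_nat)
  also have "... = 1" using Q_gt1 by (simp add: ep_def power_int_minus)
  finally obtain v where v: "v:V" "nm (?y-v) < 1" using V by blast
  have "nm ((?y-v)*pw (int k)) <= 1/Q*ep k"
   unfolding nm_mult nm_pw ep_def by (intro mult_right_mono nm_lt1[OF v(2)]) (simp add: less_imp_le)
  moreover have "eqv ((?y-v)*pw (int k)) (x-(u + v * pw (int k)))"
  proof -
   have "eqv ((x-u)*(pw (int k)*pw (- int k))-v * pw (int k)) ((x-u)*1-v * pw (int k))"
    by (intro eqv_diff eqv_mult pw_cancel) auto
   thus ?thesis by (simp add: algebra_simps)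
  qed
  ultimately have "nm (x-(u + v * pw (int k))) <= ep (Suc k)"
   using eqv_nm by (simp add: ep_Suc)
  thus ?thesis using u v by force
 qed
 thus ?case using U V by (intro exI[of _ ?W]) auto
qed

text \<open>This is where finiteness of the residue field enters cell decomposition: prescribing
  angular components splits a set into finitely many pieces only.\<close>

lemma finite_range_ac: "finite (range (ac k))"
proof -
 obtain U where U: "finite U" "!!x. nm x <= 1 ==> EX u:U. nm (x-u) <= ep k"
  using fin_res_ep by blast
 define g where "g u = (SOME w. nm (w-u) <= ep k)" for u
 have "ac k x:g ` U" for x
 proof -
  obtain u where u: "u:U" "nm (nf x-u) <= ep k" using U nm_nf_le by blast
  have b: "nm (u-nf x) <= ep k" using u by (simp add: nm_minus_commute)
  have "nm (w-nf x) <= ep k <-> nm (w-u) <= ep k" for w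
   using nm_diff_trans[OF _ u(2), of w] nm_diff_trans[OF _ b, of w] by blast
  hence "ac k x = g u" by (simp add: ac_def g_def)
  thus ?thesis using u by blast
 qed
 thus ?thesis using U(1) finite_surj by (metis finite_imageI finite_subset image_subsetI)
qed

section \<open>Taylor expansion and Hensel's lemma\<close>

text \<open>The \<open>i\<close>-th derivative at \<open>c\<close> divided by \<open>i!\<close>,
  read off a substitution so that no division is involved.\<close>

definition tay :: "'r poly => 'r => nat => 'r" where
 "tay p c i = coeff (pcompose p [:c, 1:]) i"

definition tlr :: "'r poly => 'r => 'r poly" where "tlr p c = pcompose p [:c, 1:]"

lemma coeff_tlr: "coeff (tlr p c) i = tay p c i" by (simp add: tlr_def tay_def)

lemma degree_tlr: "degree (tlr p c) <= degree p"
proof -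
 have "degree (pcompose p [:c, 1:]) <= degree p*degree [:c, 1:]" by (rule degree_pcompose_le)
 also have "... <= degree p*1" by (intro mult_le_mono) (auto simp: degree_pCons_le)
 finally show ?thesis by (simp add: tlr_def)
qed

lemma tay_big: "degree p < i ==> tay p c i = 0"
 using degree_tlr[of p c] by (metis coeff_tlr coeff_eq_0 order_le_less_trans)

lemma poly_tlr: "poly (tlr p c) x = poly p (c+x)"
 by (simp add: tlr_def poly_pcompose)

lemma tlr_tlr: "tlr (tlr p c) d = tlr p (c+d)"
 by (simp add: tlr_def pcompose_assoc[symmetric] pcompose_pCons add.commute)

lemma poly_sum_le: "degree p <= n ==> poly p x = (SUM i<=n. coeff p i*x^i)" for x :: 'r
 unfolding poly_altdef by (intro sum.mono_neutral_left) (auto simp: coeff_eq_0 not_le)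

lemma poly_tay: "degree p <= n ==> poly p y = (SUM i<=n. tay p c i*(y-c)^i)"
 using poly_sum_le[of "tlr p c" n "y-c"] degree_tlr[of p c]
 by (simp add: poly_tlr coeff_tlr)

lemma tay_0: "tay p c 0 = poly p c"
 using poly_tlr[of p c 0] by (simp add: poly_0_coeff_0 coeff_tlr)

lemma tay_pCons: "tay (pCons a p) c i = (if i = 0 then a else 0)+c*tay p c i
  +(if i = 0 then 0 else tay p c (i-1))"
 by (cases i) (simp_all add: tay_def pcompose_pCons algebra_simps)

text \<open>The library's derivative is restricted to rings without zero divisors.\<close>

definition dpoly :: "'r poly => 'r poly" where
 "dpoly p = (SUM i<degree p. monom (of_nat (Suc i)*coeff p (Suc i)) i)"

lemma coeff_dpoly: "coeff (dpoly p) i = of_nat (Suc i)*coeff p (Suc i)"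
proof -
 have "coeff (dpoly p) i = (SUM j<degree p. if j = i then of_nat (Suc j)*coeff p (Suc j) else 0)"
  by (simp add: dpoly_def coeff_sum coeff_monom)
 also have "... = of_nat (Suc i)*coeff p (Suc i)"
  by (simp add: sum.delta coeff_eq_0)
 finally show ?thesis .
qed

lemma degree_dpoly: "degree (dpoly p) <= degree p-1"
 by (rule degree_le) (simp add: coeff_dpoly coeff_eq_0)

lemma dpoly_pCons: "dpoly (pCons a p) = p+pCons 0 (dpoly p)"
 by (rule poly_eqI) (simp add: coeff_dpoly coeff_pCons algebra_simps split: nat.split)

lemma tlr_dpoly: "tlr (dpoly p) c = dpoly (tlr p c)"
proof (induction p)
 case 0
 thus ?case by (simp add: dpoly_def tlr_def)
next
 case (pCons a p)
 have 1: "tlr (pCons a q) c = [:a:]+[:c, 1:]*tlr q c" for a and q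
  by (simp add: tlr_def pcompose_pCons)
 have "dpoly ([:a:]+[:c, 1:]*r) = r+[:c, 1:]*dpoly r" for r
  by (rule poly_eqI) (simp add: coeff_dpoly coeff_pCons algebra_simps split: nat.split)
 hence "dpoly (tlr (pCons a p) c) = tlr p c+[:c, 1:]*dpoly (tlr p c)" by (simp add: 1)
 moreover have "tlr (dpoly (pCons a p)) c = tlr p c+[:c, 1:]*tlr (dpoly p) c"
  by (simp add: dpoly_pCons tlr_def pcompose_add pcompose_pCons)
 ultimately show ?case using pCons by simp
qed

lemma tay_dpoly: "tay (dpoly p) c i = of_nat (Suc i)*tay p c (Suc i)"
 by (metis coeff_dpoly coeff_tlr tlr_dpoly)

lemma poly_dpoly: "poly (dpoly p) y = tay p y 1"
 using tay_dpoly[of p y 0] by (simp add: tay_0)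

text \<open>Coefficients are measured relative to a scale \<open>rh\<close>: the polynomial is bounded by \<open>m\<close> on the
  disc of radius \<open>rh\<close>.\<close>

definition bnd :: "real => real => 'r poly => bool" where
 "bnd rh m p <-> (ALL i. nm (coeff p i)*rh^i <= m)"

lemma bnd_pCons: "bnd rh m (pCons a p) ==> nm a <= m"
 unfolding bnd_def by (drule spec[of _ 0]) simp

lemma bnd_m: "bnd rh m p ==> 0 <= rh ==> 0 <= m"
 unfolding bnd_def by (drule spec[of _ 0]) (simp, meson nm_ge0 order_trans)

lemma bnd_add: assumes "bnd rh m p" "bnd rh m q" "0 <= rh" shows "bnd rh m (p+q)"
 unfolding bnd_def
proof
 fix i
 have "nm (coeff p i+coeff q i)*rh^i <= max (nm (coeff p i)) (nm (coeff q i))*rh^i"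
  using assms by (intro mult_right_mono nm_add) auto
 also have "... <= m" using assms unfolding bnd_def max_def by auto
 finally show "nm (coeff (p+q) i)*rh^i <= m" by simp
qed

text \<open>\<open>bnd\<close> bounds the Gauss norm on the closed disc of radius \<open>rh\<close>.
  In an ultrametric space each point of a disc is a center of it, so moving the center within the
  disc preserves the bound. The induction follows Horner's scheme.\<close>

lemma bnd_tlr: assumes "bnd rh m p" "nm d <= rh" "rh > 0" shows "bnd rh m (tlr p d)"
 using assms(1)
proof (induction p arbitrary: m)
 case 0
 thus ?case by (simp add: tlr_def bnd_def)
next
 case (pCons a p)
 have m0: "0 <= m" using pCons bnd_m assms(3) by fastforce
 have a: "nm a <= m" using pCons bnd_pCons by blast
 have "bnd rh (m/rh) p" unfolding bnd_def
 proof
  fix i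
  have "nm (coeff p i)*rh^Suc i <= m" using pCons.prems unfolding bnd_def
   by (drule_tac spec[of _ "Suc i"]) simp
  thus "nm (coeff p i)*rh^i <= m/rh" using assms(3) by (simp add: field_simps)
 qed
 hence IH: "bnd rh (m/rh) (tlr p d)" using pCons.IH by blast
 have e: "tlr (pCons a p) d = [:a:]+([:0,1:]*tlr p d + smult d (tlr p d))"
  by (simp add: tlr_def pcompose_pCons)
 have b1: "bnd rh m [:a:]" unfolding bnd_def using a m0 by (simp add: coeff_pCons split: nat.split)
 have b2: "bnd rh m ([:0,1:]*tlr p d)" unfolding bnd_def
 proof
  fix i show "nm (coeff ([:0, 1:]*tlr p d) i)*rh^i <= m"
  proof (cases i)
   case (Suc j)
   have "nm (coeff (tlr p d) j)*rh^j <= m/rh" using IH by (simp add: bnd_def)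
   thus ?thesis using assms(3) Suc by (simp add: field_simps)
  qed (use m0 in simp)
 qed
 have b3: "bnd rh m (smult d (tlr p d))" unfolding bnd_def
 proof
  fix i
  have "nm d*(nm (coeff (tlr p d) i)*rh^i) <= rh*(m/rh)"
   using IH assms by (intro mult_mono) (auto simp: bnd_def)
  thus "nm (coeff (smult d (tlr p d)) i)*rh^i <= m" using assms(3)
   by (simp add: nm_mult mult.assoc)
 qed
 show ?case unfolding e using b1 b2 b3 assms(3) by (intro bnd_add) auto
qed

text \<open>With \<open>rh\<close> as the unit of length the point \<open>h\<close> has size at most
  \<open>et/rh\<close>, which is at most 1, and every term of degree two or more carries the square
  of this factor.\<close>

lemma bnd_tail:
 assumes "bnd rh m p" "nm h <= et" "et <= rh" "rh > 0"
 shows "nm (poly p h-coeff p 0-coeff p 1*h) <= m*(et/rh)\<^sup>2"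
proof -
 let ?n = "degree p+1"
 have eta: "0 <= et" using assms(2) nm_ge0 order_trans by blast
 have m0: "0 <= m" using bnd_m assms by fastforce
 have "poly p h = (SUM i<=?n. coeff p i*h^i)" by (rule poly_sum_le) simp
 also have "{..?n} = insert 0 (insert 1 {2..?n})" by auto
 finally have "poly p h-coeff p 0-coeff p 1*h = (SUM i:{2..?n}. coeff p i*h^i)" by simp
 moreover have "nm (SUM i:{2..?n}. coeff p i*h^i) <= m*(et/rh)\<^sup>2"
 proof (rule nm_sum_le)
  fix i assume "i:{2..?n}"
  have "nm (coeff p i*h^i) <= nm (coeff p i)*et^i"
   by (simp add: nm_mult nm_power mult_left_mono power_mono assms)
  also have "... = (nm (coeff p i)*rh^i)*(et/rh)^i"
   using assms(4) by (simp add: power_divide)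
  also have "... <= m*(et/rh)^i"
   using assms eta by (intro mult_right_mono) (auto simp: bnd_def)
  also have "... <= m*(et/rh)\<^sup>2"
   using assms eta m0 `i:{2..?n}` by (intro mult_left_mono power_decreasing) (auto simp: divide_le_eq)
  finally show "nm (coeff p i*h^i) <= m*(et/rh)\<^sup>2" .
 qed (use m0 in simp)
 ultimately show ?thesis by simp
qed

lemma bnd_deriv_close:
 assumes "bnd rh m p" "nm h <= et" "et <= rh" "rh > 0"
 shows "nm (tay p h 1-coeff p 1)*rh <= m*(et/rh)"
proof -
 let ?n = "degree p+1"
 have eta: "0 <= et" using assms(2) nm_ge0 order_trans by blast
 have m0: "0 <= m" using bnd_m assms by fastforce
 have "degree (dpoly p) <= ?n" using degree_dpoly[of p] by linarith
 hence "poly (dpoly p) h = (SUM i<=?n. coeff (dpoly p) i*h^i)" by (rule poly_sum_le)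
 also have "{..?n} = insert 0 {1..?n}" by auto
 finally have e: "tay p h 1-coeff p 1 = (SUM i:{1..?n}. coeff (dpoly p) i*h^i)"
  by (simp add: poly_dpoly coeff_dpoly)
 have "nm (SUM i:{1..?n}. coeff (dpoly p) i*h^i) <= m*(et/rh)/rh"
 proof (rule nm_sum_le)
  fix i assume i: "i:{1..?n}"
  have "nm (coeff (dpoly p) i) <= 1*nm (coeff p (Suc i))"
   unfolding coeff_dpoly nm_mult by (intro mult_right_mono nm_of_nat) simp
  hence "nm (coeff (dpoly p) i*h^i) <= nm (coeff p (Suc i))*et^i"
   using eta assms(2) by (simp add: nm_mult nm_power mult_mono power_mono)
  also have "... = (nm (coeff p (Suc i))*rh^Suc i)*(et/rh)^i/rh"
   using assms(4) by (simp add: power_divide)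
  also have "... <= m*(et/rh)^i/rh"
   using assms(1,4) eta spec[OF assms(1)[unfolded bnd_def], of "Suc i"]
   by (intro divide_right_mono mult_right_mono) auto
  also have "... <= m*(et/rh)^1/rh"
   using assms eta m0 i by (intro divide_right_mono mult_left_mono power_decreasing) (auto simp: divide_le_eq)
  finally show "nm (coeff (dpoly p) i*h^i) <= m*(et/rh)/rh" by simp
 qed (use m0 eta assms in simp)
 thus ?thesis using assms(4) unfolding e by (simp add: field_simps del: sum.cl_ivl_Suc)
qed

end

section \<open>Functions determined by finitely many basic sets\<close>

definition agree :: "'z set set => 'z => 'z => bool" where
 "agree bb z z' <-> (ALL B:bb. z:B <-> z':B)"

lemma agree_Un: "agree (bb Un ga) z z' <-> agree bb z z' & agree ga z z'"
 by (auto simp: agree_def)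

definition det :: "'z set set => 'z set => ('z => 'c) => bool" where
 "det BB V F <-> (EX bb. finite bb & bb <= BB & (ALL z:V. ALL z':V. agree bb z z' --> F z = F z'))"

lemma detI:
 assumes "finite bb" "bb <= BB" "!!z z'. z:V ==> z':V ==> agree bb z z' ==> F z = F z'"
 shows "det BB V F"
 unfolding det_def using assms by (intro exI[of _ bb]) simp

lemma det_const [simp]: "det BB V (%z. c)"
 unfolding det_def by (rule exI[of _ "{}"]) simp

lemma det_empty [simp]: "det BB {} F"
 unfolding det_def by (rule exI[of _ "{}"]) simp

lemma det_basic: "B:BB ==> det BB V (%z. z:B)"
 unfolding det_def by (rule exI[of _ "{B}"]) (simp add: agree_def)

lemma detE:
 assumes "det BB V F"
 obtains bb where "finite bb" "bb <= BB" "ALL z:V. ALL z':V. agree bb z z' --> F z = F z'"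
 using assms unfolding det_def by (elim exE conjE)

lemma det_mono:
 assumes "det BB V F" "V' <= V" "BB <= BB'" shows "det BB' V' F"
proof (rule detE[OF assms(1)])
 fix bb assume b: "finite bb" "bb <= BB" and F: "ALL z:V. ALL z':V. agree bb z z' --> F z = F z'"
 show ?thesis
  by (rule detI[OF b(1) order_trans[OF b(2) assms(3)]]) (rule F[rule_format], use assms(2) in auto)
qed

lemma det_dom: "det BB V F ==> V' <= V ==> det BB V' F"
 using det_mono by blast

lemma det_fun:
 assumes "det BB V F" "!!z z'. z:V ==> z':V ==> F z = F z' ==> H z = H z'"
 shows "det BB V H"
proof (rule detE[OF assms(1)])
 fix bb assume b: "finite bb" "bb <= BB" and F: "ALL z:V. ALL z':V. agree bb z z' --> F z = F z'"
 show ?thesis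
  by (rule detI[OF b], rule assms(2), assumption, assumption) (rule F[rule_format])
qed

lemma det_cong: assumes "det BB V F" "!!z. z:V ==> F z = F' z" shows "det BB V F'"
 by (rule det_fun[OF assms(1)]) (simp add: assms(2))

lemma det_comp: assumes "det BB V F" shows "det BB V (%z. f (F z))"
 by (rule det_fun[OF assms]) (rule arg_cong)

lemma det_pair:
 assumes "det BB V F" "det BB V H" shows "det BB V (%z. (F z, H z))"
proof -
 obtain bb where 1: "finite bb" "bb <= BB" "ALL z:V. ALL z':V. agree bb z z' --> F z = F z'"
  by (rule detE[OF assms(1)])
 obtain ga where 2: "finite ga" "ga <= BB" "ALL z:V. ALL z':V. agree ga z z' --> H z = H z'"
  by (rule detE[OF assms(2)])
 show ?thesis
 proof (rule detI[of "bb Un ga"])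
  fix z z' assume z: "z:V" "z':V" and "agree (bb Un ga) z z'"
  hence a: "agree bb z z'" "agree ga z z'" by (simp_all add: agree_Un)
  show "(F z, H z) = (F z', H z')"
   using 1(3)[rule_format, OF z a(1)] 2(3)[rule_format, OF z a(2)] by (rule arg_cong2)
 qed (use 1 2 in auto)
qed

lemma det_op: assumes "det BB V F" "det BB V H" shows "det BB V (%z. f (F z) (H z))"
 by (rule det_fun[OF det_pair[OF assms]]) simp

lemma det_conj: assumes "det BB V P" "det BB V R" shows "det BB V (%z. P z & R z)"
 by (rule det_fun[OF det_pair[OF assms]]) simp

lemma det_not: assumes "det BB V P" shows "det BB V (%z. ~ P z)"
 by (rule det_fun[OF assms]) simp

lemma det_restrict:
 assumes "finite I" "!!i. i:I ==> det BB V (F i)"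
 shows "det BB V (%z. \<lambda>i\<in>I. F i z)"
 using assms
proof (induction I rule: finite_induct)
 case (insert i I)
 have "det BB V (%z. ((\<lambda>i\<in>I. F i z), F i z))" by (intro det_pair insert.IH insert.prems) auto
 thus ?case
 proof (rule det_fun)
  fix z z' assume "(restrict (%i. F i z) I, F i z) = (restrict (%i. F i z') I, F i z')"
  hence a: "restrict (%i. F i z) I = restrict (%i. F i z') I" and b: "F i z = F i z'" by auto
  show "restrict (%i. F i z) (insert i I) = restrict (%i. F i z') (insert i I)"
  proof
   fix j show "restrict (%i. F i z) (insert i I) j = restrict (%i. F i z') (insert i I) j"
    using fun_cong[OF a, of j] b by (auto simp: restrict_def split: if_splits)
  qed
 qed
qed (simp add: restrict_def)

lemma det_ball:
 assumes "finite I" "!!i. i:I ==> det BB V (P i)"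
 shows "det BB V (%z. ALL i:I. P i z)"
proof (rule det_fun[OF det_restrict[OF assms]])
 fix z z' assume e: "restrict (%i. P i z) I = restrict (%i. P i z') I"
 have "P i z = P i z'" if "i:I" for i using fun_cong[OF e, of i] that by simp
 thus "(ALL i:I. P i z) = (ALL i:I. P i z')" by blast
qed

lemma det_finite: assumes "det BB V F" shows "finite (F ` V)"
proof -
 obtain bb where b: "finite bb" "bb <= BB" "ALL z:V. ALL z':V. agree bb z z' --> F z = F z'"
  by (rule detE[OF assms])
 define cl where "cl z = {B:bb. z:B}" for z
 have c: "F z = F z'" if "z:V" "z':V" "cl z = cl z'" for z z'
  by (rule b(3)[rule_format, OF that(1,2)]) (use that(3) in "auto simp: cl_def agree_def")
 have g: "F z = F (SOME z'. z':V & cl z' = cl z)" if "z:V" for z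
 proof -
  have "(SOME z'. z':V & cl z' = cl z):V & cl (SOME z'. z':V & cl z' = cl z) = cl z"
   by (rule someI[of "%z'. z':V & cl z' = cl z" z]) (use that in simp)
  thus ?thesis by (elim conjE) (rule c[OF that], assumption, erule sym)
 qed
 have "F ` V <= (%c. F (SOME z'. z':V & cl z' = c)) ` Pow bb"
 proof
  fix y assume "y:F ` V"
  then obtain z where z: "z:V" "y = F z" by blast
  have "cl z:Pow bb" by (auto simp: cl_def)
  thus "y:(%c. F (SOME z'. z':V & cl z' = c)) ` Pow bb" using g[OF z(1)] z(2) by blast
 qed
 thus ?thesis using b(1) by (meson finite_Pow_iff finite_imageI finite_subset)
qed

text \<open>Definition by cases along \<open>F\<close>: its range is finite, so the basic sets
  needed on the separate fibres are finitely many altogether.\<close>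

lemma det_glue:
 assumes "det BB V F" "!!a. a:F ` V ==> det BB {z:V. F z = a} H"
 shows "det BB V H"
proof -
 obtain bb where b: "finite bb" "bb <= BB" "ALL z:V. ALL z':V. agree bb z z' --> F z = F z'"
  by (rule detE[OF assms(1)])
 define good where "good a ga <-> finite ga & ga <= BB &
   (ALL z:{z:V. F z = a}. ALL z':{z:V. F z = a}. agree ga z z' --> H z = H z')" for a ga
 define ga where "ga a = (SOME ga. good a ga)" for a
 have g: "good a (ga a)" if "a:F ` V" for a
  unfolding ga_def using assms(2)[OF that] unfolding det_def good_def by (rule someI_ex)
 show ?thesis
 proof (rule detI[of "bb Un (UN a:F ` V. ga a)"])
  have g1: "finite (ga a)" "ga a <= BB" if "a:F ` V" for a using g[OF that] by (simp_all add: good_def)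
  show "finite (bb Un (UN a:F ` V. ga a))"
   by (rule finite_UnI[OF b(1) finite_UN_I[OF det_finite[OF assms(1)]]]) (rule g1)
  show "bb Un (UN a:F ` V. ga a) <= BB" by (rule Un_least[OF b(2) UN_least]) (rule g1)
  fix z z' assume z: "z:V" "z':V" and B: "agree (bb Un (UN a:F ` V. ga a)) z z'"
  have F: "F z = F z'" by (rule b(3)[rule_format, OF z]) (use B in "simp add: agree_Un")
  have a: "agree (ga (F z)) z z'" using B z(1) by (auto simp: agree_def)
  have "good (F z) (ga (F z))" by (rule g) (use z(1) in simp)
  hence h: "ALL z1:{z1:V. F z1 = F z}. ALL z2:{z1:V. F z1 = F z}. agree (ga (F z)) z1 z2 --> H z1 = H z2"
   unfolding good_def by (elim conjE)
  show "H z = H z'" by (rule h[rule_format]) (use z F a in auto)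
 qed
qed

lemma det_trans:
 assumes "det BB V F" "!!B. B:BB ==> det BB' V (%z. z:B)"
 shows "det BB' V F"
proof -
 obtain bb where b: "finite bb" "bb <= BB" "ALL z:V. ALL z':V. agree bb z z' --> F z = F z'"
  by (rule detE[OF assms(1)])
 have "det BB' V (%z. \<lambda>B\<in>bb. z:B)" using b(2) by (intro det_restrict b(1) assms(2)) auto
 thus ?thesis
 proof (rule det_fun)
  fix z z' assume z: "z:V" "z':V" and e: "(\<lambda>B\<in>bb. z:B) = (\<lambda>B\<in>bb. z':B)"
  have "z:B <-> z':B" if "B:bb" for B using fun_cong[OF e, of B] that by simp
  hence "agree bb z z'" by (simp add: agree_def)
  thus "F z = F z'" by (rule b(3)[rule_format, OF z])
 qed
qed

text \<open>Inverses are excluded to keep monomials inside a ring of functions. A quotient of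
  monomials is handled as a pair, with its denominator moved to the other side.\<close>

inductive_set mon :: "('z => 'r::comm_ring_1) set => ('z => 'r) set" for G where
 mon_one: "(%z. 1):mon G"
| mon_cons: "f:G ==> g:mon G ==> (%z. f z*g z):mon G"

lemma mon_gen: "f:G ==> f:mon G"
 using mon_cons[OF _ mon_one, of f G] by simp

lemma mon_mult: "f:mon G ==> g:mon G ==> (%z. f z*g z):mon G"
proof (induction rule: mon.induct)
 case (mon_cons f h)
 thus ?case using mon.mon_cons[of f G "%z. h z*g z"] by (simp add: mult.assoc)
qed simp

lemma mon_power: "f:mon G ==> (%z. f z^n):mon G"
 by (induction n) (simp_all add: mon_one mon_mult)

lemma mon_finite: "f:mon G ==> EX G0. finite G0 & G0 <= G & f:mon G0"
proof (induction rule: mon.induct)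
 case mon_one
 thus ?case using mon.mon_one by blast
next
 case (mon_cons f g)
 then obtain G0 where G0: "finite G0" "G0 <= G" "g:mon G0" by blast
 have "mon G0 <= mon (insert f G0)"
 proof
  fix h assume "h:mon G0" thus "h:mon (insert f G0)"
   by induction (auto intro: mon.intros)
 qed
 thus ?case using G0 mon_cons.hyps
  by (intro exI[of _ "insert f G0"]) (auto intro: mon.intros)
qed

lemma mon_mono: assumes "G <= G'" shows "mon G <= mon G'"
proof
 fix h assume "h:mon G" thus "h:mon G'"
  using assms by induction (auto intro: mon.intros)
qed

section \<open>Monomial conditions and locally monomial functions\<close>

context vring
begin

text \<open>In terms of the orders of the generators these are the atoms of Presburger arithmetic,
  linear inequalities and congruences, supplemented by angular components up to depth
  \<open>k\<close>.\<close>

definition Bas :: "('z => 'r) set => nat => 'z set set" where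
 "Bas G k = {{z. nm (f z) <= r*nm (g z)} | f g r. f:mon G & g:mon G}
   Un {{z. ac l (f z) = u} | f l u. f:G & l <= k}
   Un {{z. n dvd (ord (f z)-a)} | f n a. f:mon G & n > 0}"

definition BasA :: "('z => 'r) set => 'z set set" where "BasA G = (UN k. Bas G k)"

lemma Bas_cmp: "f:mon G ==> g:mon G ==> {z. nm (f z) <= r*nm (g z)}:Bas G k"
 unfolding Bas_def by blast

lemma Bas_ac: "f:G ==> l <= k ==> {z. ac l (f z) = u}:Bas G k"
 unfolding Bas_def by blast

lemma Bas_dvd: "f:mon G ==> n > 0 ==> {z. n dvd (ord (f z)-a)}:Bas G k"
 unfolding Bas_def by blast

lemma BasE:
 assumes "B:Bas G k"
 obtains (cmp) f g r where "f:mon G" "g:mon G" "B = {z. nm (f z) <= r*nm (g z)}"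
  | (ac) f l u where "f:G" "l <= k" "B = {z. ac l (f z) = u}"
  | (dvd) f n a where "f:mon G" "n > 0" "B = {z. n dvd (ord (f z)-a)}"
 using assms unfolding Bas_def by blast

lemma Bas_mono: assumes "G <= G'" "k <= k'" shows "Bas G k <= Bas G' k'"
proof
 fix B assume "B:Bas G k" thus "B:Bas G' k'"
 proof (cases rule: BasE)
  case (cmp f g r)
  thus ?thesis using mon_mono[OF assms(1)] by (simp add: Bas_cmp subsetD)
 next
  case (ac f l u)
  thus ?thesis using assms by (simp add: Bas_ac subsetD)
 next
  case (dvd f n a)
  thus ?thesis using mon_mono[OF assms(1)] by (simp add: Bas_dvd subsetD)
 qed
qed

lemma Bas_BasA: "Bas G k <= BasA G" by (auto simp: BasA_def)

lemma BasA_mono: "G <= G' ==> BasA G <= BasA G'"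
 unfolding BasA_def by (rule UN_mono[OF order_refl Bas_mono]) auto

text \<open>At \<open>z\<close> the norm of \<open>h\<close> is that of an \<open>e\<close>-th root
  of a constant times \<open>n/d\<close>. The root is unavoidable because roots of polynomials may
  have norms given by fractional slopes of a Newton polygon.\<close>

definition mono_at :: "('z => 'r) set => ('z => 'r) => 'z => nat \<times> ('z => 'r) \<times> ('z => 'r) \<times> real => bool" where
 "mono_at G h z = (%(e, n, d, c). e >= 1 & c > 0 & n:mon G & d:mon G & nm (n z) ~= 0 &
   nm (d z) ~= 0 & nm (h z)^e*nm (d z) = c*nm (n z))"

lemma mono_atD:
 assumes "mono_at G h z (e, n, d, c)"
 shows "e >= 1" "c > 0" "n:mon G" "d:mon G" "nm (n z) ~= 0" "nm (d z) ~= 0"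
  "nm (h z)^e*nm (d z) = c*nm (n z)"
 using assms by (auto simp: mono_at_def)

text \<open>"Locally monomial": \<open>V\<close> splits into finitely many pieces defined by basic
  sets, and on each piece where \<open>h\<close> is not null, one monomial expression gives its norm
  and its angular component is constant.\<close>

definition LM :: "'z set set => ('z => 'r) set => nat => 'z set => ('z => 'r) => bool" where
 "LM BB G k V h <-> det BB V (%z. nm (h z) = 0) & det BB V (%z. ac k (h z)) &
   (EX X. det BB V X & (ALL z:V. nm (h z) ~= 0 --> mono_at G h z (X z)))"

abbreviation LMA :: "('z => 'r) set => nat => 'z set => ('z => 'r) => bool" where
 "LMA G k V h == LM (BasA G) G k V h"

lemma LM_X:
 assumes "LM BB G k V h"
 shows "EX E N D C. det BB V (%z. (E z, N z, D z, C z)) &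
   (ALL z:V. nm (h z) ~= 0 --> mono_at G h z (E z, N z, D z, C z))"
proof -
 obtain X where X: "det BB V X" "ALL z:V. nm (h z) ~= 0 --> mono_at G h z (X z)"
  using assms unfolding LM_def by blast
 show ?thesis
  by (rule exI[of _ "%z. fst (X z)"], rule exI[of _ "%z. fst (snd (X z))"],
    rule exI[of _ "%z. fst (snd (snd (X z)))"], rule exI[of _ "%z. snd (snd (snd (X z)))"])
    (use X in simp)
qed

lemma LM_I:
 assumes "det BB V (%z. nm (h z) = 0)" "det BB V (%z. ac k (h z))"
  "det BB V (%z. (E z, N z, D z, C z))"
  "!!z. z:V ==> nm (h z) ~= 0 ==> mono_at G h z (E z, N z, D z, C z)"
 shows "LM BB G k V h"
 unfolding LM_def using assms by (intro conjI exI[of _ "%z. (E z, N z, D z, C z)"]) auto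

lemma LM_mono: assumes "LM BB G k V h" "V' <= V" "BB <= BB'" "G <= G'" "k' <= k"
 shows "LM BB' G' k' V' h"
proof -
 obtain X where X: "det BB V X" "ALL z:V. nm (h z) ~= 0 --> mono_at G h z (X z)"
  using assms(1) unfolding LM_def by blast
 have "mono_at G' h z (X z)" if "z:V'" "nm (h z) ~= 0" for z
 proof -
  have "mono_at G h z (X z)" using X(2) that assms(2) by blast
  thus ?thesis using mon_mono[OF assms(4)] by (cases "X z") (auto simp: mono_at_def)
 qed
 moreover have "det BB' V' X" "det BB' V' (%z. nm (h z) = 0)" "det BB' V' (%z. ac k (h z))"
  using assms X(1) unfolding LM_def by (auto intro: det_mono)
 moreover have "det BB' V' (%z. ac k' (h z))"
  by (rule det_fun[OF calculation(4)]) (rule ac_mono[OF assms(5)])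
 ultimately show ?thesis unfolding LM_def by blast
qed

lemma LM_dom: "LM BB G k V h ==> V' <= V ==> LM BB G k V' h"
 by (erule LM_mono) auto

lemma LM_cong:
 assumes "LM BB G k V h" "!!z. z:V ==> eqv (h z) (h' z)" shows "LM BB G k V h'"
proof -
 have n: "!!z. z:V ==> nm (h' z) = nm (h z)" "!!z. z:V ==> ac k (h z) = ac k (h' z)"
  using eqv_nm[OF assms(2)] ac_eqv[OF assms(2)] by simp_all
 obtain X where X: "det BB V X" "ALL z:V. nm (h z) ~= 0 --> mono_at G h z (X z)"
  using assms(1) unfolding LM_def by blast
 have "det BB V (%z. nm (h z) = 0)" "det BB V (%z. ac k (h z))"
  using assms unfolding LM_def by blast+
 hence "det BB V (%z. nm (h' z) = 0)" "det BB V (%z. ac k (h' z))"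
  using n by (auto elim: det_cong)
 thus ?thesis unfolding LM_def using X n by (intro conjI exI[of _ X]) (auto simp: mono_at_def)
qed

lemma LM_zero_det: "LM BB G k V h ==> det BB V (%z. nm (h z) = 0)"
 by (simp add: LM_def)

lemma LM_ac_det: "LM BB G k V h ==> det BB V (%z. ac k (h z))"
 by (simp add: LM_def)

lemma ac_zero: "nm x = 0 ==> nm y = 0 ==> ac k x = ac k y"
 by (rule ac_eqv) (metis eqv_0 eqv_sym eqv_trans)

lemma LM_zero: assumes "!!z. z:V ==> nm (h z) = 0" shows "LM BB G k V h"
 by (rule LM_I[where E = "%z. 1" and N = "%z z. 1" and D = "%z z. 1" and C = "%z. 1"])
  (use assms in "auto intro!: det_fun[OF det_const[of _ _ undefined]] ac_zero")

lemma LM_glue: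
 assumes "det BB V F" "!!a. a:F ` V ==> LM BB G k {z:V. F z = a} h"
 shows "LM BB G k V h"
proof -
 have "EX X. det BB {z:V. F z = a} X & (ALL z:{z:V. F z = a}. nm (h z) ~= 0 --> mono_at G h z (X z))"
  if "a:F ` V" for a using assms(2)[OF that] unfolding LM_def by (elim conjE)
 then obtain X where X: "!!a. a:F ` V ==> det BB {z:V. F z = a} (X a) &
   (ALL z:{z:V. F z = a}. nm (h z) ~= 0 --> mono_at G h z (X a z))" by metis
 have "det BB V (%z. X (F z) z)"
 proof (rule det_glue[OF assms(1)])
  fix a assume "a:F ` V"
  hence "det BB {z:V. F z = a} (X a)" by (rule conjunct1[OF X])
  thus "det BB {z:V. F z = a} (%z. X (F z) z)" by (rule det_cong) simp
 qed
 moreover have "det BB V (%z. nm (h z) = 0)"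
  by (rule det_glue[OF assms(1)]) (rule LM_zero_det[OF assms(2)])
 moreover have "det BB V (%z. ac k (h z))"
  by (rule det_glue[OF assms(1)]) (rule LM_ac_det[OF assms(2)])
 moreover have "mono_at G h z (X (F z) z)" if "z:V" "nm (h z) ~= 0" for z
  using conjunct2[OF X[of "F z"]] that by simp
 ultimately show ?thesis unfolding LM_def by blast
qed

lemma LM_split:
 assumes "det BB V (%z. z:S)" "LM BB G k (V Int S) h" "LM BB G k (V-S) h"
 shows "LM BB G k V h"
proof (rule LM_glue[OF assms(1)])
 fix a assume "a:(%z. z:S) ` V"
 have "{z:V. (z:S) = a} = (if a then V Int S else V-S)" by auto
 thus "LM BB G k {z:V. (z:S) = a} h" using assms by simp
qed

lemma LM_cover:
 assumes "finite I" "V <= (UN i:I. S i)" "!!i. i:I ==> det BB V (%z. z:S i)"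
  "!!i. i:I ==> LM BB G k (V Int S i) h"
 shows "LM BB G k V h"
 using assms
proof (induction I arbitrary: V rule: finite_induct)
 case empty
 thus ?case by (intro LM_zero) auto
next
 case (insert i I)
 have "LM BB G k (V-S i) h"
 proof (rule insert.IH)
  show "V-S i <= (UN i:I. S i)" using insert.prems by blast
  show "det BB (V-S i) (%z. z:S j)" if "j:I" for j using insert.prems(2) that det_dom by (metis Diff_subset insertI2)
  show "LM BB G k ((V-S i) Int S j) h" if "j:I" for j
   using insert.prems(3)[of j] that by (rule_tac LM_dom) auto
 qed
 thus ?case using insert.prems by (intro LM_split[of BB V "S i"]) auto
qed

lemma LM_gen: assumes "g:G" shows "LMA G k V g"
proof (rule LM_I[where E = "%z. 1" and N = "%z. g" and D = "%z z. 1" and C = "%z. 1"])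
 have "{z. nm (g z) <= 0*nm (1::'r)}:Bas G 0" by (rule Bas_cmp[OF mon_gen[OF assms] mon_one])
 hence "det (BasA G) V (%z. z:{z. nm (g z) <= 0*nm (1::'r)})"
  by (intro det_basic) (auto simp: BasA_def)
 thus "det (BasA G) V (%z. nm (g z) = 0)" by (rule det_cong) (simp add: order_antisym_conv)
 have "det (BasA G) V (%z. \<lambda>u\<in>range (ac k). z:{z. ac k (g z) = u})"
 proof (rule det_restrict[OF finite_range_ac det_basic])
  fix u show "{z. ac k (g z) = u}:BasA G" using assms by (auto simp: BasA_def Bas_def)
 qed
 thus "det (BasA G) V (%z. ac k (g z))"
 proof (rule det_fun)
  fix z z' assume "(\<lambda>u\<in>range (ac k). z:{z. ac k (g z) = u}) = (\<lambda>u\<in>range (ac k). z':{z. ac k (g z) = u})"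
  hence "(\<lambda>u\<in>range (ac k). z:{z. ac k (g z) = u}) (ac k (g z)) = (\<lambda>u\<in>range (ac k). z':{z. ac k (g z) = u}) (ac k (g z))"
   by simp
  thus "ac k (g z) = ac k (g z')" by simp
 qed
qed (use mon_gen[OF assms] in "auto simp: mon_one mono_at_def")

lemma LM_one: "LM BB G k V (%z. 1)"
 by (rule LM_I[where E = "%z. 1" and N = "%z z. 1" and D = "%z z. 1" and C = "%z. 1"])
  (auto simp: mon_one mono_at_def)

lemma LM_mult:
 assumes "LM BB G k V h" "LM BB G k V h'" shows "LM BB G k V (%z. h z*h' z)"
proof -
 obtain E N D C where 1: "det BB V (%z. (E z, N z, D z, C z))"
  "ALL z:V. nm (h z) ~= 0 --> mono_at G h z (E z, N z, D z, C z)"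
  using LM_X[OF assms(1)] by blast
 obtain E' N' D' C' where 2: "det BB V (%z. (E' z, N' z, D' z, C' z))"
  "ALL z:V. nm (h' z) ~= 0 --> mono_at G h' z (E' z, N' z, D' z, C' z)"
  using LM_X[OF assms(2)] by blast
 define P where "P z = ((nm (h z) = 0, ac k (h z)), (nm (h' z) = 0, ac k (h' z)))" for z
 have "det BB V P" using assms unfolding P_def LM_def by (intro det_pair) auto
 hence ac: "det BB V (%z. ac k (h z*h' z))"
 proof (rule det_fun)
  fix z z' assume P: "P z = P z'"
  show "ac k (h z*h' z) = ac k (h z'*h' z')"
  proof (cases "nm (h z) = 0 | nm (h' z) = 0")
   case True
   thus ?thesis using P by (intro ac_zero) (auto simp: P_def nm_mult)
  next
   case False
   thus ?thesis using P by (intro ac_mult) (auto simp: P_def)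
  qed
 qed
 have z: "det BB V (%z. nm (h z*h' z) = 0)"
  using det_op[OF LM_zero_det[OF assms(1)] LM_zero_det[OF assms(2)], of "(|)"]
  by (simp add: nm_mult)
 show ?thesis
 proof (rule LM_I[OF z ac, where E = "%z. E z*E' z" and N = "%z w. N z w^E' z*N' z w^E z"
    and D = "%z w. D z w^E' z*D' z w^E z" and C = "%z. C z^E' z*C' z^E z"])
  show "det BB V (%z. (E z*E' z, %w. N z w^E' z*N' z w^E z, %w. D z w^E' z*D' z w^E z,
    C z^E' z*C' z^E z))"
   using det_pair[OF 1(1) 2(1)] by (rule det_fun) auto
 next
  fix z assume z: "z:V" "nm (h z*h' z) ~= 0"
  hence nz: "nm (h z) ~= 0" "nm (h' z) ~= 0" by (auto simp: nm_mult)
  have "nm (h z*h' z)^(E z*E' z)*nm (D z z^E' z*D' z z^E z)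
   = (nm (h z)^E z*nm (D z z))^E' z*(nm (h' z)^E' z*nm (D' z z))^E z"
   unfolding nm_mult nm_power by (simp only: power_mult_distrib power_mult[symmetric] ac_simps)
  also have "... = (C z*nm (N z z))^E' z*(C' z*nm (N' z z))^E z"
   using mono_atD(7)[OF 1(2)[rule_format, OF z(1) nz(1)]] mono_atD(7)[OF 2(2)[rule_format, OF z(1) nz(2)]] by simp
  also have "... = C z^E' z*C' z^E z*nm (N z z^E' z*N' z z^E z)"
   by (simp add: nm_mult nm_power power_mult_distrib algebra_simps)
  finally show "mono_at G (%z. h z*h' z) z (E z*E' z, %w. N z w^E' z*N' z w^E z,
   %w. D z w^E' z*D' z w^E z, C z^E' z*C' z^E z)"
   using mono_atD[OF 1(2)[rule_format, OF z(1) nz(1)]] mono_atD[OF 2(2)[rule_format, OF z(1) nz(2)]] z nz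
   by (simp add: mono_at_def mon_mult mon_power nm_mult nm_power Suc_le_eq)
 qed
qed

lemma LM_power: "LM BB G k V h ==> LM BB G k V (%z. h z^n)"
 by (induction n) (simp_all add: LM_one LM_mult)

lemma LM_mon: "f:mon G ==> (!!g. g:G ==> LM BB G' k V g) ==> LM BB G' k V f"
 by (induction rule: mon.induct) (simp_all add: LM_one LM_mult)

text \<open>\<open>h\<close> has to agree with \<open>f/g\<close> only up to relative precision
  \<open>ep k\<close>: this already fixes its norm and its angular component of depth
  \<open>k\<close>. The slack is needed for quotients that come from a first-order Taylor
  expansion.\<close>

lemma LM_quot:
 assumes "LM BB G k V f" "LM BB G k V g"
  and c: "!!z. z:V ==> nm (g z) ~= 0 & nm (g z*h z) = nm (f z) & nm (g z*h z-f z) <= ep k*nm (f z)"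
 shows "LM BB G k V h"
proof -
 obtain E N D C where 1: "det BB V (%z. (E z, N z, D z, C z))"
  "ALL z:V. nm (f z) ~= 0 --> mono_at G f z (E z, N z, D z, C z)"
  using LM_X[OF assms(1)] by blast
 obtain E' N' D' C' where 2: "det BB V (%z. (E' z, N' z, D' z, C' z))"
  "ALL z:V. nm (g z) ~= 0 --> mono_at G g z (E' z, N' z, D' z, C' z)"
  using LM_X[OF assms(2)] by blast
 have zz: "nm (h z) = 0 <-> nm (f z) = 0" if "z:V" for z using c[OF that] by (auto simp: nm_mult)
 have z: "det BB V (%z. nm (h z) = 0)"
  using LM_zero_det[OF assms(1)] by (rule det_cong) (use zz in auto)
 define P where "P z = (nm (f z) = 0, ac k (f z), ac k (g z))" for z
 have "det BB V P" using assms unfolding P_def LM_def by (intro det_pair) auto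
 hence ac: "det BB V (%z. ac k (h z))"
 proof (rule det_fun)
  fix z z' assume v: "z:V" "z':V" and P: "P z = P z'"
  show "ac k (h z) = ac k (h z')"
  proof (cases "nm (f z) = 0")
   case True
   thus ?thesis using P zz v by (intro ac_zero) (auto simp: P_def)
  next
   case False
   have "ac k (g y*h y) = ac k (f y)" if "y:V" "nm (f y) ~= 0" for y
    using c[OF that(1)] that by (intro ac_approx) auto
   moreover have "nm (f z') ~= 0" using False P by (simp add: P_def)
   ultimately have "ac k (g z*h z) = ac k (g z'*h z')" using P v False by (simp add: P_def)
   thus ?thesis
    using P False v zz c by (intro ac_cancel[of "g z" "h z" "g z'" "h z'"]) (auto simp: P_def)
  qed
 qed
 show ?thesis
 proof (rule LM_I[OF z ac, where E = "%z. E z*E' z" and N = "%z w. N z w^E' z*D' z w^E z"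
    and D = "%z w. D z w^E' z*N' z w^E z" and C = "%z. C z^E' z/C' z^E z"])
  show "det BB V (%z. (E z*E' z, %w. N z w^E' z*D' z w^E z, %w. D z w^E' z*N' z w^E z,
    C z^E' z/C' z^E z))"
   using det_pair[OF 1(1) 2(1)] by (rule det_fun) auto
 next
  fix z assume z: "z:V" "nm (h z) ~= 0"
  hence nz: "nm (f z) ~= 0" "nm (g z) ~= 0" using c zz by auto
  have a: "C z^E' z*nm (N z z)^E' z = nm (f z)^(E z*E' z)*nm (D z z)^E' z"
   using arg_cong[OF mono_atD(7)[OF 1(2)[rule_format, OF z(1) nz(1)]], of "%x. x^E' z"]
   by (simp add: power_mult_distrib power_mult)
  have b: "C' z^E z*nm (N' z z)^E z = nm (g z)^(E z*E' z)*nm (D' z z)^E z"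
   using arg_cong[OF mono_atD(7)[OF 2(2)[rule_format, OF z(1) nz(2)]], of "%x. x^E z"]
   by (simp add: power_mult_distrib power_mult[symmetric] mult.commute[of "E z"])
  have f: "nm (f z) = nm (g z)*nm (h z)" using c[OF z(1)] by (simp add: nm_mult)
  have "nm (g z)^(E z*E' z)*(nm (h z)^(E z*E' z)*nm (D z z^E' z*N' z z^E z))
   = (nm (f z)^(E z*E' z)*nm (D z z)^E' z)*nm (N' z z)^E z"
   by (simp add: f nm_mult nm_power power_mult_distrib algebra_simps)
  also have "... = C z^E' z*nm (N z z)^E' z*(C' z^E z*nm (N' z z)^E z)/C' z^E z"
   unfolding a[symmetric] using mono_atD(2)[OF 2(2)[rule_format, OF z(1) nz(2)]] by (simp add: field_simps)
  also have "... = nm (g z)^(E z*E' z)*(C z^E' z/C' z^E z*nm (N z z^E' z*D' z z^E z))"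
   unfolding b by (simp add: nm_mult nm_power field_simps)
  finally have "nm (h z)^(E z*E' z)*nm (D z z^E' z*N' z z^E z)
   = C z^E' z/C' z^E z*nm (N z z^E' z*D' z z^E z)"
   by (rule mult_left_cancel[THEN iffD1, rotated]) (use nz in simp)
  thus "mono_at G h z (E z*E' z, %w. N z w^E' z*D' z w^E z,
   %w. D z w^E' z*N' z w^E z, C z^E' z/C' z^E z)"
   using mono_atD[OF 1(2)[rule_format, OF z(1) nz(1)]] mono_atD[OF 2(2)[rule_format, OF z(1) nz(2)]] z nz
   by (simp add: mono_at_def mon_mult mon_power nm_mult nm_power Suc_le_eq)
 qed
qed

lemma mon_cmp: assumes "f:mon G" "g:mon G" shows "det (BasA G) V (%z. nm (f z) <= r*nm (g z))"
 using det_basic[OF subsetD[OF Bas_BasA Bas_cmp[OF assms]], of V r] by simp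

lemma mon_dvd: assumes "f:mon G" "n > 0" shows "det (BasA G) V (%z. n dvd (ord (f z)-a))"
 using det_basic[OF subsetD[OF Bas_BasA Bas_dvd[OF assms]], of V a] by simp

text \<open>Where the monomial data of both functions are fixed, raising the inequality to the power
  \<open>e*e'\<close> and clearing denominators leaves a comparison of two monomials. For
  \<open>r <= 0\<close> it merely expresses vanishing.\<close>

lemma LM_cmp:
 assumes "LMA G k V f" "LMA G k' V g" shows "det (BasA G) V (%z. nm (f z) <= r*nm (g z))"
proof (cases "r > 0")
 case False
 have "nm (f z) <= r*nm (g z) <-> nm (f z) = 0 & (r = 0 | nm (g z) = 0)" for z
 proof -
  have "r*nm (g z) <= 0" using False by (intro mult_nonpos_nonneg) auto
  hence "nm (f z) <= r*nm (g z) <-> nm (f z) = 0 & r*nm (g z) = 0"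
   using nm_ge0[of "f z"] by linarith
  thus ?thesis by simp
 qed
 thus ?thesis using det_op[OF LM_zero_det[OF assms(1)] LM_zero_det[OF assms(2)], of "%a b. a & (r = 0 | b)"] by simp
next
 case r: True
 obtain E N D C where 1: "det (BasA G) V (%z. (E z, N z, D z, C z))"
  "ALL z:V. nm (f z) ~= 0 --> mono_at G f z (E z, N z, D z, C z)"
  using LM_X[OF assms(1)] by blast
 obtain E' N' D' C' where 2: "det (BasA G) V (%z. (E' z, N' z, D' z, C' z))"
  "ALL z:V. nm (g z) ~= 0 --> mono_at G g z (E' z, N' z, D' z, C' z)"
  using LM_X[OF assms(2)] by blast
 define T where "T z = (nm (f z) = 0, nm (g z) = 0, (E z, N z, D z, C z), (E' z, N' z, D' z, C' z))" for z
 have T: "det (BasA G) V T" unfolding T_def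
  by (intro det_pair LM_zero_det[OF assms(1)] LM_zero_det[OF assms(2)] 1(1) 2(1))
 show ?thesis
 proof (rule det_glue[OF T])
  fix t assume "t:T ` V"
  then obtain z0 where z0: "z0:V" "t = T z0" by blast
  show "det (BasA G) {z:V. T z = t} (%z. nm (f z) <= r*nm (g z))"
  proof (cases "nm (f z0) = 0 | nm (g z0) = 0")
   case True
   have "(nm (f z) <= r*nm (g z)) = (nm (f z0) = 0)" if "z:{z:V. T z = t}" for z
   proof -
    have z: "nm (f z) = 0 <-> nm (f z0) = 0" "nm (g z) = 0 <-> nm (g z0) = 0" using that z0 by (auto simp: T_def)
    have "0 <= r*nm (g z)" using r by simp
    thus ?thesis using z True nm_ge0[of "f z"] by (auto simp del: nm_ge0)
   qed
   thus ?thesis by (intro det_fun[OF det_const[of _ _ undefined]]) simp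
  next
   case False
   define e n d c e' n' d' c' where defs: "e = E z0" "n = N z0" "d = D z0" "c = C z0"
     "e' = E' z0" "n' = N' z0" "d' = D' z0" "c' = C' z0"
   have "det (BasA G) {z:V. T z = t} (%z. nm (n z^e'*d' z^e) <= (r^(e*e')*c'^e/c^e')*nm (n' z^e*d z^e'))"
    unfolding defs using mono_atD[OF 1(2)[rule_format, OF z0(1)]] mono_atD[OF 2(2)[rule_format, OF z0(1)]] False
    by (intro mon_cmp mon_mult mon_power) auto
   thus ?thesis
   proof (rule det_cong)
    fix z assume "z:{z:V. T z = t}"
    hence z: "z:V" "E z = e" "N z = n" "D z = d" "C z = c" "E' z = e'" "N' z = n'" "D' z = d'" "C' z = c'"
     "nm (f z) ~= 0" "nm (g z) ~= 0" using z0 False by (auto simp: T_def defs)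
    have p: "e >= 1" "e' >= 1" "c > 0" "c' > 0" "nm (n z) > 0" "nm (d z) > 0" "nm (n' z) > 0" "nm (d' z) > 0"
     using mono_atD(1,2,5,6)[OF 1(2)[rule_format, OF z(1,10)]] mono_atD(1,2,5,6)[OF 2(2)[rule_format, OF z(1,11)]] z nm_pos by auto
    have ef: "nm (f z)^e*nm (d z) = c*nm (n z)" using mono_atD(7)[OF 1(2)[rule_format, OF z(1,10)]] z by simp
    have eg: "nm (g z)^e'*nm (d' z) = c'*nm (n' z)" using mono_atD(7)[OF 2(2)[rule_format, OF z(1,11)]] z by simp
    have "nm (f z) <= r*nm (g z) <-> nm (f z)^(e*e') <= (r*nm (g z))^(e*e')"
     using p r by (subst power_mono_iff) auto
    also have "... <-> nm (f z)^(e*e')*(nm (d z)^e'*nm (d' z)^e)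
      <= (r*nm (g z))^(e*e')*(nm (d z)^e'*nm (d' z)^e)"
     using p by (subst mult_le_cancel_right_pos) auto
    also have "nm (f z)^(e*e')*(nm (d z)^e'*nm (d' z)^e) = (c*nm (n z))^e'*nm (d' z)^e"
     unfolding ef[symmetric] by (simp add: power_mult_distrib power_mult)
    also have "(r*nm (g z))^(e*e')*(nm (d z)^e'*nm (d' z)^e) = r^(e*e')*nm (d z)^e'*(c'*nm (n' z))^e"
     unfolding eg[symmetric] by (simp only: power_mult_distrib power_mult[symmetric] ac_simps)
    also have "(c*nm (n z))^e'*nm (d' z)^e <= r^(e*e')*nm (d z)^e'*(c'*nm (n' z))^e <->
      nm (n z^e'*d' z^e) <= (r^(e*e')*c'^e/c^e')*nm (n' z^e*d z^e')"
     using p by (simp add: nm_mult nm_power power_mult_distrib field_simps)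
    finally show "(nm (n z^e'*d' z^e) <= (r^(e*e')*c'^e/c^e')*nm (n' z^e*d z^e'))
      = (nm (f z) <= r*nm (g z))" by simp
   qed
  qed
 qed
qed

text \<open>Multiplying by the root exponent \<open>e\<close> turns the congruence modulo
  \<open>n\<close> into one modulo \<open>e*n\<close> for the difference of the orders of numerator
  and denominator.\<close>

lemma LM_dvd:
 assumes "LMA G k V f" and npos: "n > 0" shows "det (BasA G) V (%z. n dvd (ord (f z)-a))"
proof -
 obtain E N D C where 1: "det (BasA G) V (%z. (E z, N z, D z, C z))"
  "ALL z:V. nm (f z) ~= 0 --> mono_at G f z (E z, N z, D z, C z)"
  using LM_X[OF assms(1)] by blast
 define T where "T z = (nm (f z) = 0, (E z, N z, D z, C z))" for z
 have T: "det (BasA G) V T" unfolding T_def by (intro det_pair LM_zero_det[OF assms(1)] 1(1))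
 show ?thesis
 proof (rule det_glue[OF T])
  fix t assume "t:T ` V"
  then obtain z0 where z0: "z0:V" "t = T z0" by blast
  show "det (BasA G) {z:V. T z = t} (%z. n dvd (ord (f z)-a))"
  proof (cases "nm (f z0) = 0")
   case True
   thus ?thesis using z0
    by (intro det_fun[OF det_const[of _ _ undefined]]) (auto simp: T_def ord_zero)
  next
   case False
   define e m d c where defs: "e = E z0" "m = N z0" "d = D z0" "c = C z0"
   have *: "int e * ord (f z) + ord (d z) = ord (m z)+j" "e >= 1" "nm (m z) ~= 0" "nm (d z) ~= 0"
    if "z:V" "T z = t" "c = Q powi (- j)" for z j
   proof -
    have z: "z:V" "E z = e" "N z = m" "D z = d" "C z = c" "nm (f z) ~= 0"
     using z0 False that by (auto simp: T_def defs)
    show nz: "e >= 1" "nm (m z) ~= 0" "nm (d z) ~= 0" using mono_atD(1,5,6)[OF 1(2)[rule_format, OF z(1,6)]] z by auto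
    have "nm (f z^e*d z) = nm (m z*pw j)"
     using mono_atD(7)[OF 1(2)[rule_format, OF z(1,6)]] z that by (simp add: nm_mult nm_power nm_pw)
    hence "ord (f z^e*d z) = ord (m z*pw j)" by (rule ord_eqv)
    thus "int e * ord (f z) + ord (d z) = ord (m z)+j"
     using nz z by (simp add: ord_mult ord_power nm_power)
   qed
   have z0': "nm (f z0)^e*nm (d z0) = c*nm (m z0)" "nm (m z0) ~= 0" "nm (d z0) ~= 0"
    using mono_atD(5,6,7)[OF 1(2)[rule_format, OF z0(1) False]] by (auto simp: defs)
   hence "c = nm (f z0)^e*nm (d z0)/nm (m z0)" by simp
   hence "c = Q powi (- int e * ord (f z0)-ord (d z0) + ord (m z0))"
    using nm_ord[OF False] nm_ord[OF z0'(2)] nm_ord[OF z0'(3)] Q_gt1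
    by (simp add: power_int_add power_int_diff power_int_minus power_int_mult field_simps)
      (simp add: power_int_minus power_int_mult[symmetric] mult.commute flip: power_int_of_nat)
   then obtain j where j: "c = Q powi (- j)" by (metis add.inverse_inverse)
   \<comment> \<open>The order of the denominator \<open>d\<close> enters with coefficient -1, but
     monomials have no inverses. The nonnegative exponent \<open>2*e*|n|-1\<close> is congruent to
     -1 modulo \<open>e*n\<close> and replaces it.\<close>
   have "det (BasA G) {z:V. T z = t} (%z. (int e*n) dvd (ord (m z*d z^nat (int e*\<bar>n\<bar>*2-1))-(int e*a-j)))"
    unfolding defs using npos mono_atD(1)[OF 1(2)[rule_format, OF z0(1) False]]
    by (intro mon_dvd mon_mult mon_power mono_atD(3,4)[OF 1(2)[rule_format, OF z0(1) False]]) simp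
   moreover have "((int e*n) dvd (ord (m z*d z^nat (int e*\<bar>n\<bar>*2-1))-(int e*a-j))) = (n dvd (ord (f z)-a))"
    if "z:{z:V. T z = t}" for z
   proof -
    have z: "int e * ord (f z) + ord (d z) = ord (m z)+j" "e >= 1" "nm (m z) ~= 0" "nm (d z) ~= 0"
     using *[OF _ _ j] that by auto
    have "0 < int e*\<bar>n\<bar>" using z(2) npos by (intro mult_pos_pos) auto
    hence "int e*\<bar>n\<bar> >= 1" by linarith
    hence "int (nat (int e*\<bar>n\<bar>*2-1)) = int e*\<bar>n\<bar>*2-1" by simp
    hence "ord (m z*d z^nat (int e*\<bar>n\<bar>*2-1)) = ord (m z)+(int e*\<bar>n\<bar>*2-1) * ord (d z)"
     using z by (simp add: ord_mult ord_power nm_power)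
    hence "ord (m z*d z^nat (int e*\<bar>n\<bar>*2-1))-(int e*a-j) = int e*(ord (f z)-a)+(int e*n)*(sgn n*2 * ord (d z))"
     using z(1) by (simp add: algebra_simps abs_sgn)
    moreover have "(int e*n) dvd (int e*(ord (f z)-a)+(int e*n)*(sgn n*2 * ord (d z))) <-> (int e*n) dvd int e*(ord (f z)-a)"
     by (meson dvd_add_left_iff dvd_triv_left)
    moreover have "... <-> n dvd (ord (f z)-a)" using z(2) by simp
    ultimately show ?thesis by simp
   qed
   ultimately show ?thesis by (rule det_cong)
  qed
 qed
qed

lemma LM_det_trans:
 assumes "det (Bas G k) V F" "!!g. g:G ==> LMA G' k V g"
 shows "det (BasA G') V F"
proof (rule det_trans[OF assms(1)])
 fix B assume "B:Bas G k"
 then consider (1) f g r where "f:mon G" "g:mon G" "B = {z. nm (f z) <= r*nm (g z)}"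
  | (2) f l u where "f:G" "l <= k" "B = {z. ac l (f z) = u}"
  | (3) f n a where "f:mon G" "n > 0" "B = {z. n dvd (ord (f z)-a)}"
  unfolding Bas_def by blast
 thus "det (BasA G') V (%z. z:B)"
 proof cases
  case 1
  hence "LMA G' k V f" "LMA G' k V g" using LM_mon assms(2) by blast+
  thus ?thesis using LM_cmp 1 by simp
 next
  case 2
  have "det (BasA G') V (%z. ac l (f z))"
   using LM_ac_det[OF assms(2)[OF 2(1)]] by (rule det_fun) (use 2 ac_mono in blast)
  thus ?thesis using det_comp[of _ _ _ "%x. x = u"] 2 by simp
 next
  case 3
  hence "LMA G' k V f" using LM_mon assms(2) by blast
  thus ?thesis using LM_dvd 3 by simp
 qed
qed

text \<open>Substitution: the monomials in \<open>G\<close> that describe \<open>h\<close> become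
  quotients of monomials in \<open>G'\<close>, and the root exponents multiply. Angular components
  of the generators are needed up to the depth \<open>k\<close> that occurs in the conditions over
  \<open>G\<close>.\<close>

lemma LM_trans:
 assumes "LM (Bas G k) G k' V h" "k' <= k" "!!g. g:G ==> LMA G' k V g"
 shows "LMA G' k' V h"
proof -
 obtain E N D C where 1: "det (Bas G k) V (%z. (E z, N z, D z, C z))"
  "ALL z:V. nm (h z) ~= 0 --> mono_at G h z (E z, N z, D z, C z)"
  using LM_X[OF assms(1)] by blast
 define T where "T z = (nm (h z) = 0, ac k' (h z), (E z, N z, D z, C z))" for z
 have "det (Bas G k) V T" unfolding T_def
  by (intro det_pair LM_zero_det[OF assms(1)] LM_ac_det[OF assms(1)] 1(1))
 hence T: "det (BasA G') V T" using LM_det_trans assms(3) by blast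
 show ?thesis
 proof (rule LM_glue[OF T])
  fix t assume "t:T ` V"
  then obtain z0 where z0: "z0:V" "t = T z0" by blast
  show "LMA G' k' {z:V. T z = t} h"
  proof (cases "nm (h z0) = 0")
   case True
   thus ?thesis using z0 by (intro LM_zero) (auto simp: T_def)
  next
   case False
   define e m d c where defs: "e = E z0" "m = N z0" "d = D z0" "c = C z0"
   have *: "E z = e" "N z = m" "D z = d" "C z = c" "nm (h z) ~= 0" if "z:V" "T z = t" for z
    using z0 False that by (auto simp: T_def defs)
   define W where "W = {z:V. T z = t}"
   have L: "LMA G' k W m" "LMA G' k W d"
    unfolding defs using LM_mon[OF mono_atD(3)[OF 1(2)[rule_format, OF z0(1) False]] assms(3)] LM_mon[OF mono_atD(4)[OF 1(2)[rule_format, OF z0(1) False]] assms(3)] by (auto intro: LM_dom simp: W_def)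
   obtain E1 N1 D1 C1 where 2: "det (BasA G') W (%z. (E1 z, N1 z, D1 z, C1 z))"
    "ALL z:W. nm (m z) ~= 0 --> mono_at G' m z (E1 z, N1 z, D1 z, C1 z)"
    using LM_X[OF L(1)] by blast
   obtain E2 N2 D2 C2 where 3: "det (BasA G') W (%z. (E2 z, N2 z, D2 z, C2 z))"
    "ALL z:W. nm (d z) ~= 0 --> mono_at G' d z (E2 z, N2 z, D2 z, C2 z)"
    using LM_X[OF L(2)] by blast
   show ?thesis unfolding W_def[symmetric]
   proof (rule LM_I[where E = "%z. e*E1 z*E2 z" and N = "%z w. N1 z w^E2 z*D2 z w^E1 z"
     and D = "%z w. D1 z w^E2 z*N2 z w^E1 z" and C = "%z. c^(E1 z*E2 z)*C1 z^E2 z/C2 z^E1 z"])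
    show "det (BasA G') W (%z. nm (h z) = 0)" "det (BasA G') W (%z. ac k' (h z))"
     by (intro det_fun[OF det_const[of _ _ undefined]], auto simp: T_def W_def)+
    show "det (BasA G') W (%z. (e*E1 z*E2 z, %w. N1 z w^E2 z*D2 z w^E1 z,
     %w. D1 z w^E2 z*N2 z w^E1 z, c^(E1 z*E2 z)*C1 z^E2 z/C2 z^E1 z))"
     using det_pair[OF 2(1) 3(1)] by (rule det_fun) auto
   next
    fix z assume z: "z:W" "nm (h z) ~= 0"
    hence zz: "z:V" "T z = t" by (auto simp: W_def)
    note a = *[OF zz]
    have nz: "nm (m z) ~= 0" "nm (d z) ~= 0" "e >= 1" "c > 0" using mono_atD(1,2,5,6)[OF 1(2)[rule_format, OF zz(1) z(2)]] a by auto
    have e1: "nm (h z)^e*nm (d z) = c*nm (m z)" using mono_atD(7)[OF 1(2)[rule_format, OF zz(1) z(2)]] a by simp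
    have p: "C1 z > 0" "C2 z > 0" "nm (N1 z z) ~= 0" "nm (D1 z z) ~= 0" "nm (N2 z z) ~= 0" "nm (D2 z z) ~= 0"
     "E1 z >= 1" "E2 z >= 1"
     using mono_atD(1,2,5,6)[OF 2(2)[rule_format, OF z(1) nz(1)]] mono_atD(1,2,5,6)[OF 3(2)[rule_format, OF z(1) nz(2)]] by auto
    have e2: "nm (m z)^(E1 z*E2 z)*nm (D1 z z)^E2 z = C1 z^E2 z*nm (N1 z z)^E2 z"
     using arg_cong[OF mono_atD(7)[OF 2(2)[rule_format, OF z(1) nz(1)]], of "%x. x^E2 z"] by (simp add: power_mult_distrib power_mult)
    have e3: "nm (d z)^(E1 z*E2 z)*nm (D2 z z)^E1 z = C2 z^E1 z*nm (N2 z z)^E1 z"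
     using arg_cong[OF mono_atD(7)[OF 3(2)[rule_format, OF z(1) nz(2)]], of "%x. x^E1 z"]
     by (simp add: power_mult_distrib power_mult[symmetric] mult.commute[of "E1 z"])
    have e4: "nm (h z)^(e*E1 z*E2 z)*nm (d z)^(E1 z*E2 z) = c^(E1 z*E2 z)*nm (m z)^(E1 z*E2 z)"
     using arg_cong[OF e1, of "%x. x^(E1 z*E2 z)"] by (simp add: power_mult_distrib power_mult[symmetric] mult.assoc)
    have "nm (h z)^(e*E1 z*E2 z)*nm (D1 z z^E2 z*N2 z z^E1 z)*C2 z^E1 z
     = (nm (h z)^(e*E1 z*E2 z)*nm (d z)^(E1 z*E2 z))*nm (D2 z z)^E1 z*nm (D1 z z)^E2 z"
     using e3 by (simp add: nm_mult nm_power algebra_simps)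
    also have "... = c^(E1 z*E2 z)*C1 z^E2 z*nm (N1 z z^E2 z*D2 z z^E1 z)"
     unfolding e4 using e2 by (simp add: nm_mult nm_power algebra_simps)
    finally have "nm (h z)^(e*E1 z*E2 z)*nm (D1 z z^E2 z*N2 z z^E1 z)
     = c^(E1 z*E2 z)*C1 z^E2 z/C2 z^E1 z*nm (N1 z z^E2 z*D2 z z^E1 z)"
     using p by (simp add: field_simps)
    thus "mono_at G' h z (e*E1 z*E2 z, %w. N1 z w^E2 z*D2 z w^E1 z,
     %w. D1 z w^E2 z*N2 z w^E1 z, c^(E1 z*E2 z)*C1 z^E2 z/C2 z^E1 z)"
     using p nz mono_atD[OF 2(2)[rule_format, OF z(1) nz(1)]] mono_atD[OF 3(2)[rule_format, OF z(1) nz(2)]] by (simp add: mono_at_def mon_mult mon_power nm_mult nm_power Suc_le_eq)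
   qed
  qed
 qed
qed

text \<open>Only finitely many generators and one depth occur in a determined function. The tower
  construction depends on this, since it hands a finite set of functions and a fixed depth to its
  induction hypothesis.\<close>

lemma det_BasA_finite:
 assumes "det (BasA G) V F" shows "EX G0 k. finite G0 & G0 <= G & det (Bas G0 k) V F"
proof -
 obtain bb where b: "finite bb" "bb <= BasA G"
  "ALL z:V. ALL z':V. agree bb z z' --> F z = F z'"
  by (rule detE[OF assms])
 have "EX G0 k. finite G0 & G0 <= G & bb <= Bas G0 k" using b(1,2)
 proof (induction bb rule: finite_induct)
  case empty
  show ?case by blast
 next
  case (insert B bb)
  then obtain G0 k where 1: "finite G0" "G0 <= G" "bb <= Bas G0 k" by auto
  obtain k' where "B:Bas G k'" using insert by (auto simp: BasA_def)
  then consider (1) f g r where "f:mon G" "g:mon G" "B = {z. nm (f z) <= r*nm (g z)}"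
   | (2) f l u where "f:G" "l <= k'" "B = {z. ac l (f z) = u}"
   | (3) f n a where "f:mon G" "n > 0" "B = {z. n dvd (ord (f z)-a)}"
   unfolding Bas_def by blast
  hence "EX G1. finite G1 & G1 <= G & B:Bas G1 k'"
  proof cases
   case (1 f g r)
   obtain F1 where F1: "finite F1" "F1 <= G" "f:mon F1" using mon_finite[OF 1(1)] by blast
   obtain F2 where F2: "finite F2" "F2 <= G" "g:mon F2" using mon_finite[OF 1(2)] by blast
   have "f:mon (F1 Un F2)" "g:mon (F1 Un F2)"
    using mon_mono[of F1 "F1 Un F2"] mon_mono[of F2 "F1 Un F2"] F1 F2 by auto
   hence "B:Bas (F1 Un F2) k'" using 1(3) by (simp add: Bas_cmp)
   thus ?thesis using F1 F2 by (intro exI[of _ "F1 Un F2"]) auto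
  next
   case (2 f l u)
   thus ?thesis by (intro exI[of _ "{f}"]) (auto simp: Bas_def)
  next
   case (3 f n a)
   obtain F1 where "finite F1" "F1 <= G" "f:mon F1" using mon_finite[OF 3(1)] by blast
   thus ?thesis using 3(2,3) by (intro exI[of _ F1]) (simp add: Bas_dvd)
  qed
  then obtain G1 where 2: "finite G1" "G1 <= G" "B:Bas G1 k'" by blast
  have "B:Bas (G0 Un G1) (max k k')" using Bas_mono[of G1 "G0 Un G1" k' "max k k'"] 2 by auto
  moreover have "bb <= Bas (G0 Un G1) (max k k')" using Bas_mono[of G0 "G0 Un G1" k "max k k'"] 1 by auto
  ultimately show ?case using 1 2 by (intro exI[of _ "G0 Un G1"] exI[of _ "max k k'"]) auto
 qed
 thus ?thesis using b unfolding det_def by metis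
qed

lemma LMA_finite:
 assumes "LMA G k V h" shows "EX G0 K. finite G0 & G0 <= G & k <= K & LM (Bas G0 K) G0 k V h"
proof -
 obtain E N D C where 1: "det (BasA G) V (%z. (E z, N z, D z, C z))"
  "ALL z:V. nm (h z) ~= 0 --> mono_at G h z (E z, N z, D z, C z)"
  using LM_X[OF assms(1)] by blast
 define T where "T z = (nm (h z) = 0, ac k (h z), (E z, N z, D z, C z))" for z
 have T: "det (BasA G) V T" unfolding T_def
  by (intro det_pair LM_zero_det[OF assms(1)] LM_ac_det[OF assms(1)] 1(1))
 obtain G0 K where G0: "finite G0" "G0 <= G" "det (Bas G0 K) V T" using det_BasA_finite[OF T] by blast
 have fin: "finite (T ` V)" using det_finite[OF T] .
 define W where "W = {z:V. nm (h z) ~= 0}"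
 have W: "mono_at G h z (E z, N z, D z, C z)" if "z:W" for z using 1(2) that by (simp add: W_def)
 have fin2: "finite ((N ` W) Un (D ` W))"
 proof -
  have "N ` W <= (%(_, _, _, n, _, _). n) ` T ` V" "D ` W <= (%(_, _, _, _, d, _). d) ` T ` V"
   by (force simp: T_def W_def)+
  thus ?thesis using fin by (meson finite_Un finite_imageI finite_subset)
 qed
 have "EX H. finite H & H <= G & m:mon H" if "m:N ` W Un D ` W" for m
  using that mono_atD(3,4)[OF W] mon_finite by (elim UnE imageE) blast+
 then obtain H where H: "!!m. m:N ` W Un D ` W ==> finite (H m) & H m <= G & m:mon (H m)" by metis
 define G1 where "G1 = G0 Un (UN m:N ` W Un D ` W. H m)"
 have "finite G1" unfolding G1_def by (rule finite_UnI[OF G0(1) finite_UN_I[OF fin2]]) (use H in blast)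
 moreover have "G1 <= G" unfolding G1_def by (rule Un_least[OF G0(2) UN_least]) (use H in blast)
 moreover have "G0 <= G1" unfolding G1_def by (rule Un_upper1)
 ultimately have G1: "finite G1" "G1 <= G" "G0 <= G1" by auto
 have m: "m:mon G1" if "m:N ` W Un D ` W" for m
  using H[OF that] mon_mono[of "H m" G1] that unfolding G1_def by blast
 have T1: "det (Bas G1 (max k K)) V T"
  by (rule det_mono[OF G0(3) order_refl Bas_mono[OF G1(3)]]) simp
 have "LM (Bas G1 (max k K)) G1 k V h"
 proof (rule LM_I[where E = E and N = N and D = D and C = C])
  show "det (Bas G1 (max k K)) V (%z. nm (h z) = 0)" "det (Bas G1 (max k K)) V (%z. ac k (h z))"
   "det (Bas G1 (max k K)) V (%z. (E z, N z, D z, C z))"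
   by (rule det_fun[OF T1], simp add: T_def)+
  fix z assume "z:V" "nm (h z) ~= 0"
  hence "z:W" by (simp add: W_def)
  thus "mono_at G1 h z (E z, N z, D z, C z)" using W[of z] m by (simp add: mono_at_def)
 qed
 thus ?thesis using G1 by (intro exI[of _ G1] exI[of _ "max k K"]) auto
qed

lemma LMA_trans:
 assumes "!!k. LMA G k V h" "!!g k. g:G ==> LMA G' k V g"
 shows "LMA G' k V h"
proof -
 obtain G0 K where G0: "finite G0" "G0 <= G" "k <= K" "LM (Bas G0 K) G0 k V h"
  using LMA_finite[OF assms(1)] by blast
 show ?thesis by (rule LM_trans[OF G0(4,3)]) (use assms(2) G0 in auto)
qed

section \<open>Hensel's lemma with explicit constants\<close>

lemma bnd_lip:
 assumes "bnd rh m p" "nm h <= rh" "rh > 0"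
 shows "nm (poly p h-coeff p 0) <= m*(nm h/rh)"
proof -
 let ?n = "degree p+1"
 have m0: "0 <= m" using bnd_m assms by fastforce
 have "poly p h = (SUM i<=?n. coeff p i*h^i)" by (rule poly_sum_le) simp
 also have "{..?n} = insert 0 {1..?n}" by auto
 finally have e: "poly p h-coeff p 0 = (SUM i:{1..?n}. coeff p i*h^i)" by simp
 have "nm (SUM i:{1..?n}. coeff p i*h^i) <= m*(nm h/rh)"
 proof (rule nm_sum_le)
  fix i assume i: "i:{1..?n}"
  have "nm (coeff p i*h^i) = (nm (coeff p i)*rh^i)*(nm h/rh)^i"
   using assms(3) by (simp add: power_divide nm_mult nm_power)
  also have "... <= m*(nm h/rh)^i"
   using assms by (intro mult_right_mono) (auto simp: bnd_def)
  also have "... <= m*(nm h/rh)^1"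
   using assms m0 i by (intro mult_left_mono power_decreasing) (auto simp: divide_le_eq)
  finally show "nm (coeff p i*h^i) <= m*(nm h/rh)" by simp
 qed (use m0 assms in simp)
 thus ?thesis by (simp only: e)
qed

lemma coeff_tlr_0: "coeff (tlr p c) 0 = poly p c" by (simp add: coeff_tlr tay_0)
lemma coeff_tlr_1: "coeff (tlr p c) 1 = tay p c 1" by (simp add: coeff_tlr)

lemma tay_tlr: "tay (tlr p c) d i = tay p (c+d) i"
 by (metis coeff_tlr tlr_tlr)

lemma bnd_coeff1: "bnd rh m p ==> nm (coeff p 1)*rh <= m"
 unfolding bnd_def by (drule spec[of _ 1]) simp

text \<open>Quantitative Hensel on a disc of radius \<open>rh\<close> on which the polynomial is
  bounded by \<open>m\<close>: \<open>dl\<close> measures the value and \<open>ee\<close> the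
  derivative, both relative to these units. The condition \<open>dl < ee^2\<close> makes the Newton
  iteration a contraction and also locates the root.\<close>

lemma hensel:
 assumes b: "bnd rh m p" and pos: "rh > 0" "m > 0" "ee > 0"
  and d0: "nm (coeff p 0) <= dl*m" and d1: "ee*m <= nm (coeff p 1)*rh" and small: "dl < ee\<^sup>2"
 shows "EX h. nm h <= dl/ee*rh & nm (poly p h) = 0"
proof (cases "dl <= 0")
 case True
 hence "nm (coeff p 0) <= 0" using d0 pos by (meson mult_nonpos_nonneg less_imp_le order_trans)
 hence n0: "nm (coeff p 0) = 0" using nm_ge0 order_antisym by blast
 have "0 <= dl*m" using d0 nm_ge0 order_trans by blast
 hence "dl = 0" using True pos by (simp add: zero_le_mult_iff)
 thus ?thesis using n0 by (intro exI[of _ 0]) (simp add: poly_0_coeff_0)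
next
 case False
 hence dp: "dl > 0" by simp
 \<comment> \<open>\<open>ka\<close> is the relative length of the first Newton step and
   \<open>tt = dl/ee^2\<close> the factor gained at each step; \<open>ka*ka = dl*tt\<close> says
   that the quadratic error of a step is already absorbed by this gain.\<close>
 define ka tt where "ka = dl/ee" and "tt = ka/ee"
 have kt: "ka > 0" "tt > 0" "tt < 1" "ka*ka = dl*tt"
  using dp pos small by (auto simp: ka_def tt_def power2_eq_square divide_simps)
 have "ee*m <= 1*m" using d1 bnd_coeff1[OF b] by linarith
 hence e1: "ee <= 1" using pos by (simp only: mult_le_cancel_right_pos)
 have k1: "ka <= 1" using small e1 pos dp unfolding ka_def power2_eq_square
  by (simp add: divide_le_eq) (meson less_imp_le mult_le_one mult_left_le order_trans order_less_imp_le)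
 have a1: "nm (coeff p 1) > 0"
 proof -
  have "0 < nm (coeff p 1)*rh" using d1 pos by (meson mult_pos_pos order_less_le_trans)
  thus ?thesis using pos by (simp add: zero_less_mult_iff)
 qed
 obtain b1 where b1: "nm (coeff p 1*b1-1) = 0" using nm_inv[of "coeff p 1"] a1 by auto
 have nb: "nm b1 = 1/nm (coeff p 1)" using nm_eq0[OF b1] a1 by (simp add: nm_mult field_simps)
 have nb1: "nm b1 <= rh/(ee*m)" unfolding nb using d1 a1 pos by (simp add: field_simps)
 \<comment> \<open>Newton's iteration with the slope frozen at its initial value; \<open>b1\<close>
   is the inverse of that slope up to null elements.\<close>
 define s where "s = rec_nat 0 (%_ x. x-poly p x*b1)"
 have s0: "s 0 = 0" and sS: "!!n. s (Suc n) = s n-poly p (s n)*b1" by (simp_all add: s_def)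
 have u: "nm (poly p (s n)*b1) <= ka*rh*tt^n" if "nm (poly p (s n)) <= dl*m*tt^n" for n
 proof -
  have "nm (poly p (s n)*b1) <= (dl*m*tt^n)*(rh/(ee*m))"
   unfolding nm_mult using that nb1 pos dp kt by (intro mult_mono) auto
  thus ?thesis using pos by (simp add: ka_def field_simps)
 qed
 have th: "tt^n <= 1" for n using kt by (simp add: power_le_one)
 have kr: "ka*rh <= rh" using k1 pos by simp
 have inv: "nm (s n) <= ka*rh & nm (poly p (s n)) <= dl*m*tt^n" for n
 proof (induction n)
  case 0
  thus ?case using d0 kt pos by (simp add: s0 poly_0_coeff_0)
 next
  case (Suc n)
  let ?u = "- (poly p (s n)*b1)"
  have un: "nm ?u <= ka*rh*tt^n" using u Suc by simp
  have un': "ka*rh*tt^n <= ka*rh" using th kt pos by simp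
  have sn: "s (Suc n) = s n+?u" by (simp add: sS)
  have 1: "nm (s (Suc n)) <= ka*rh" unfolding sn using Suc un un' by (intro nm_add_le) auto
  have snr: "nm (s n) <= rh" using Suc kr by linarith
  have bt: "bnd rh m (tlr p (s n))" by (rule bnd_tlr[OF b snr pos(1)])
  have "nm (poly (tlr p (s n)) ?u-coeff (tlr p (s n)) 0-coeff (tlr p (s n)) 1*?u) <= m*(ka*rh*tt^n/rh)\<^sup>2"
   using un' kr by (intro bnd_tail[OF bt un _ pos(1)]) linarith
  also have "... = m*(ka*ka)*tt^n*tt^n" using pos by (simp add: power2_eq_square)
  also have "... <= m*(ka*ka)*tt^n*1" using th kt pos by (intro mult_left_mono mult_nonneg_nonneg) auto
  finally have t1: "nm (poly p (s (Suc n))-poly p (s n)-tay p (s n) 1*?u) <= dl*m*tt^Suc n"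
   unfolding poly_tlr sn[symmetric] coeff_tlr_0 coeff_tlr_1 by (simp add: kt(4) algebra_simps)
  have "nm (tay p (s n) 1-coeff p 1)*rh <= m*(ka*rh/rh)"
   using Suc kr pos b by (intro bnd_deriv_close) auto
  hence "nm (tay p (s n) 1-coeff p 1) <= m*ka/rh" using pos by (simp add: field_simps)
  hence "nm ((tay p (s n) 1-coeff p 1)*?u) <= (m*ka/rh)*(ka*rh*tt^n)"
   unfolding nm_mult using un pos kt by (intro mult_mono) auto
  also have "... = m*(ka*ka)*tt^n" using pos by simp
  finally have t2: "nm ((tay p (s n) 1-coeff p 1)*?u) <= dl*m*tt^Suc n"
   by (simp add: kt(4) algebra_simps)
  have "poly p (s n)+coeff p 1*?u = - (poly p (s n)*(coeff p 1*b1-1))" by (simp add: algebra_simps)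
  hence t3: "nm (poly p (s n)+coeff p 1*?u) <= dl*m*tt^Suc n"
   using b1 dp pos kt by (simp add: nm_mult)
  have "poly p (s (Suc n)) = (poly p (s (Suc n))-poly p (s n)-tay p (s n) 1*?u)
   +((tay p (s n) 1-coeff p 1)*?u+(poly p (s n)+coeff p 1*?u))" by (simp add: algebra_simps)
  hence "nm (poly p (s (Suc n))) <= dl*m*tt^Suc n"
   using nm_add_le[OF t1 nm_add_le[OF t2 t3]] by simp
  thus ?case using 1 by simp
 qed
 have step: "nm (s (i+j)-s i) <= ka*rh*tt^i" for i j
 proof (induction j)
  case 0 thus ?case using kt pos by simp
 next
  case (Suc j)
  have "nm (s (Suc (i+j))-s (i+j)) <= ka*rh*tt^(i+j)"
   using u[OF conjunct2[OF inv[of "i+j"]]] nm_neg[of "poly p (s (i+j))*b1"] by (simp add: sS)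
  also have "... <= ka*rh*tt^i" using kt pos by (intro mult_left_mono power_decreasing) auto
  finally have "nm (s (Suc (i+j))-s (i+j)) <= ka*rh*tt^i" .
  hence "nm (s (Suc (i+j))-s i) <= ka*rh*tt^i" using Suc by (rule nm_diff_trans)
  thus ?case by simp
 qed
 have lim0: "EX N. ka*rh*tt^N <= e" if "e > 0" for e
 proof -
  have "0 < e/(ka*rh)" using that kt pos by simp
  then obtain N where "tt^N < e/(ka*rh)" using real_arch_pow_inv kt(3) by blast
  thus ?thesis using kt pos by (intro exI[of _ N]) (simp add: field_simps less_imp_le)
 qed
 have "EX a. ALL e>0. EX N. ALL i>=N. nm (s i-a) <= e"
 proof (rule complete)
  fix e :: real assume "e > 0"
  then obtain N where N: "ka*rh*tt^N <= e" using lim0 by blast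
  have N': "nm (s i-s N) <= e" if "i >= N" for i using step[of N "i-N"] that N by simp
  have "nm (s i-s j) <= e" if "i >= N" "j >= N" for i j
   using nm_diff_trans[OF N'[OF that(1)], of "s j"] N'[OF that(2)] by (simp add: nm_minus_commute)
  thus "EX N. ALL i>=N. ALL j>=N. nm (s i-s j) <= e" by blast
 qed
 then obtain a where a: "!!e. e > 0 ==> EX N. ALL i>=N. nm (s i-a) <= e" by blast
 have na: "nm a <= ka*rh"
 proof -
  obtain N where "nm (s N-a) <= ka*rh" using a[of "ka*rh"] kt pos by auto
  thus ?thesis using inv[of N] nm_diff_le[of "s N" "ka*rh" "s N-a"] by simp
 qed
 have "nm (poly p a) <= e" if e: "e > 0" for e
 proof -
  obtain N1 where N1: "ALL i>=N1. nm (s i-a) <= e*rh/m" using a[of "e*rh/m"] e pos by auto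
  obtain N2 where N2: "tt^N2 < e/(dl*m)" using real_arch_pow_inv[of "e/(dl*m)" tt] e kt pos dp by auto
  define n where "n = max N1 N2"
  have "tt^n <= tt^N2" using kt unfolding n_def by (intro power_decreasing) auto
  hence "dl*m*tt^n <= e" using N2 dp pos by (simp add: field_simps) (meson less_imp_le mult_left_mono mult_pos_pos order_trans)
  hence p1: "nm (poly p (s n)) <= e" using inv[of n] by linarith
  have d: "nm (a-s n) <= e*rh/m" using N1 unfolding n_def by (simp add: nm_minus_commute)
  have snr: "nm (s n) <= rh" using inv[of n] kr by linarith
  have bt: "bnd rh m (tlr p (s n))" by (rule bnd_tlr[OF b snr pos(1)])
  have "nm (a-s n) <= rh" using na inv[of n] kr by (intro nm_diff_le) auto
  hence "nm (poly (tlr p (s n)) (a-s n)-coeff (tlr p (s n)) 0) <= m*(nm (a-s n)/rh)"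
   by (intro bnd_lip[OF bt] pos)
  also have "... <= e" using d pos by (simp add: field_simps)
  finally have "nm (poly p a-poly p (s n)) <= e" by (simp add: poly_tlr coeff_tlr_0)
  thus ?thesis using nm_add_le[OF _ p1] by fastforce
 qed
 hence "nm (poly p a) <= 0" by (rule field_le_epsilon[of _ 0, simplified])
 hence "nm (poly p a) = 0" using nm_ge0 order_antisym by blast
 thus ?thesis using na by (auto simp: ka_def)
qed

text \<open>Closer to a root than \<open>ee*rh\<close> the linear term strictly dominates the tail
  of the expansion, so a second root there can differ only by a null element.\<close>

lemma hensel_unique:
 assumes b: "bnd rh m p" and pos: "rh > 0" "m > 0"
  and d0: "nm (coeff p 0) = 0" and d1: "ee*m <= nm (coeff p 1)*rh"
  and h: "nm h < ee*rh" "nm (poly p h) = 0"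
 shows "nm h = 0"
proof (rule ccontr)
 assume "nm h ~= 0"
 hence hp: "nm h > 0" by (rule nm_pos)
 have "ee*m <= 1*m" using d1 bnd_coeff1[OF b] by linarith
 hence e1: "ee <= 1" using pos by (simp only: mult_le_cancel_right_pos)
 have hr: "nm h <= rh" using h(1) e1 pos by (meson less_imp_le mult_left_le_one_le mult_right_mono order_trans mult_le_cancel_right2 not_le)
 have "nm (poly p h-coeff p 0-coeff p 1*h) <= m*(nm h/rh)\<^sup>2"
  by (intro bnd_tail[OF b _ hr pos(1)]) simp
 moreover have "eqv (poly p h-coeff p 0-coeff p 1*h) (0-0-coeff p 1*h)"
  using d0 h(2) by (intro eqv_diff) (auto simp: eqv_0)
 ultimately have "nm (coeff p 1)*nm h <= m*(nm h/rh)\<^sup>2" using eqv_nm by (fastforce simp: nm_mult)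
 hence "nm (coeff p 1)*rh*rh*nm h <= m*nm h*nm h" using pos by (simp add: field_simps power2_eq_square)
 hence "nm (coeff p 1)*rh*rh <= m*nm h" using hp by simp
 moreover have "ee*m*rh <= nm (coeff p 1)*rh*rh" using d1 pos by simp
 moreover have "m*nm h < m*(ee*rh)" using h pos by simp
 ultimately show False by (simp add: algebra_simps)
qed

text \<open>The ratio \<open>x/y\<close>, with \<open>y\<close> replaced by the power of the
  uniformizer of the same order, is known modulo \<open>ep k\<close> from finitely many comparisons.
  Either both ratios are below \<open>ep k\<close> and negligible, or the thresholds
  \<open>ep l\<close> with \<open>l <= k\<close> pin down the difference of the orders exactly and
  the angular component gives the rest.\<close>

lemma term_close:
 assumes y: "nm y ~= 0" "nm y' ~= 0" and z: "nm x = 0 <-> nm x' = 0" and a: "ac k x = ac k x'"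
  and t: "!!l. l <= k ==> nm x <= ep l*nm y <-> nm x' <= ep l*nm y'" and le: "nm x <= nm y"
 shows "nm (x*pw (- ord y)-x'*pw (- ord y')) <= ep k"
proof (cases "nm x = 0")
 case True
 hence "nm (x*pw (- ord y)) <= ep k" "nm (x'*pw (- ord y')) <= ep k"
  using z by (simp_all add: nm_mult less_imp_le)
 thus ?thesis by (rule nm_diff_le)
next
 case False
 hence x': "nm x' ~= 0" using z by simp
 have thr: "nm u <= ep l*nm v <-> int l <= ord u-ord v" if "nm u ~= 0" "nm v ~= 0" for u v l
 proof -
  have "nm u <= ep l*nm v <-> Q powi (- ord u) <= Q powi (- int l+- ord v)"
   unfolding nm_ord[OF that(1)] nm_ord[OF that(2)] ep_def using Q_gt1 by (subst power_int_add) auto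
  thus ?thesis unfolding powi_le by linarith
 qed
 define De De' where "De = ord x-ord y" and "De' = ord x'-ord y'"
 have T: "int l <= De <-> int l <= De'" if "l <= k" for l
  using t[OF that] thr[OF False y(1), of l] thr[OF x' y(2), of l] by (simp add: De_def De'_def)
 have "ep 0 = 1" by (simp add: ep_def)
 hence D0: "0 <= De" using thr[OF False y(1), of 0] le by (simp add: De_def)
 have sc: "eqv (u*pw (- ord v)) (nf u*pw (ord u-ord v))" if "nm u ~= 0" for u v
 proof -
  have "eqv (pw (- ord u+(ord u-ord v))) (pw (- ord u)*pw (ord u-ord v))" by (rule pw_add')
  hence "eqv (u*pw (- ord v)) (u*(pw (- ord u)*pw (ord u-ord v)))" by (intro eqv_mult) auto
  thus ?thesis by (simp add: nf_def mult.assoc)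
 qed
 show ?thesis
 proof (cases "int k <= De")
  case True
  hence "int k <= De'" using T by blast
  hence "nm x <= ep k*nm y" "nm x' <= ep k*nm y'"
   using True thr False x' y by (simp_all add: De_def De'_def)
  hence "nm (x*pw (- ord y)) <= ep k" "nm (x'*pw (- ord y')) <= ep k"
   using y nm_pos Q_gt1 by (simp_all add: nm_mult nm_pw nm_ord[OF y(1)] nm_ord[OF y(2)] power_int_minus field_simps)
  thus ?thesis by (rule nm_diff_le)
 next
  case F: False
  have l: "nat De <= k" "Suc (nat De) <= k" using F D0 by auto
  have "De' = De" using T[OF l(1)] T[OF l(2)] D0 by auto
  hence e: "nm ((nf x-nf x')*pw De) <= ep k*1"
   unfolding nm_mult using a D0 powi_le[of "-De" 0] by (intro mult_mono) (auto simp: ac_eq_iff nm_pw less_imp_le)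
  have "eqv (x*pw (- ord y)-x'*pw (- ord y')) (nf x*pw De-nf x'*pw De')"
   unfolding De_def De'_def using False x' by (intro eqv_diff sc)
  thus ?thesis using e eqv_nm `De' = De` by (simp add: algebra_simps)
 qed
qed

text \<open>A sum that is at least \<open>ee\<close> times each of its terms is locally monomial:
  divided by its largest term it is known up to \<open>ep K\<close> from the finite data
  \<open>F\<close>, and without cancellation this precision determines its norm and its angular
  component.\<close>

lemma LM_sum:
 assumes fin: "finite I" and LM: "!!i k. i:I ==> LMA G k V (h i)" and e: "ee > 0"
 defines "w == %z. SUM i:I. h i z"
 shows "det (BasA G) V (%z. ALL i:I. ee*nm (h i z) <= nm (w z))"
  and "LMA G k {z:V. ALL i:I. ee*nm (h i z) <= nm (w z)} w"
proof -
 \<comment> \<open>The normalised sum has norm at least \<open>ee\<close>, so absolute precision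
   \<open>ee*ep k\<close> yields relative precision \<open>ep k\<close>.\<close>
 obtain K where K: "ep K < ee*ep k" using ep_ex[of "ee*ep k"] e by auto
 have K2: "ep K < ee"
 proof -
  have "ee*ep k <= ee*1" using e ep_le1[of k] by (intro mult_left_mono) auto
  thus ?thesis using K by linarith
 qed
 define F where "F z = ((\<lambda>i\<in>I. nm (h i z) = 0), (\<lambda>i\<in>I. ac K (h i z)),
   (\<lambda>i\<in>I. \<lambda>j\<in>I. \<lambda>l\<in>{..K}. nm (h i z) <= ep l*nm (h j z)))" for z
 have F: "det (BasA G) V F" unfolding F_def
  by (intro det_pair det_restrict fin finite_atMost LM_zero_det[OF LM] LM_ac_det[OF LM] LM_cmp[OF LM LM])
 have FD: "nm (h i z) = 0 <-> nm (h i z') = 0" "ac K (h i z) = ac K (h i z')"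
   "j:I ==> l <= K ==> nm (h i z) <= ep l*nm (h j z) <-> nm (h i z') <= ep l*nm (h j z')"
  if "F z = F z'" "i:I" for z z' i j l
 proof -
  have f: "(\<lambda>i\<in>I. nm (h i z) = 0) = (\<lambda>i\<in>I. nm (h i z') = 0)" "(\<lambda>i\<in>I. ac K (h i z)) = (\<lambda>i\<in>I. ac K (h i z'))"
   "(\<lambda>i\<in>I. \<lambda>j\<in>I. \<lambda>l\<in>{..K}. nm (h i z) <= ep l*nm (h j z)) = (\<lambda>i\<in>I. \<lambda>j\<in>I. \<lambda>l\<in>{..K}. nm (h i z') <= ep l*nm (h j z'))"
   using that(1) by (simp_all add: F_def)
  show "nm (h i z) = 0 <-> nm (h i z') = 0" "ac K (h i z) = ac K (h i z')"
   using fun_cong[OF f(1), of i] fun_cong[OF f(2), of i] that(2) by simp_all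
  show "nm (h i z) <= ep l*nm (h j z) <-> nm (h i z') <= ep l*nm (h j z')" if "j:I" "l <= K"
   using fun_cong[OF fun_cong[OF fun_cong[OF f(3), of i], of j], of l] `i:I` that by simp
 qed
 have ep0: "ep 0 = 1" by (simp add: ep_def)
 \<comment> \<open>The factor \<open>ep 0\<close>, equal to 1, makes the condition literally one of
   the comparisons stored in \<open>F\<close>, so the chosen index of a largest term depends on
   \<open>F z\<close> alone.\<close>
 define i0 where "i0 z = (SOME i. i:I & (ALL j:I. nm (h j z) <= ep 0*nm (h i z)))" for z
 have i0: "i0 z:I & (ALL j:I. nm (h j z) <= nm (h (i0 z) z))" if "I ~= {}" for z
 proof -
  have fi: "finite ((%i. nm (h i z)) ` I)" "(%i. nm (h i z)) ` I ~= {}" using fin that by auto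
  obtain i where "i:I" "nm (h i z) = Max ((%i. nm (h i z)) ` I)" using Max_in[OF fi] by auto
  moreover have "nm (h j z) <= Max ((%i. nm (h i z)) ` I)" if "j:I" for j using Max_ge[OF fi(1)] that by simp
  ultimately have "i:I & (ALL j:I. nm (h j z) <= ep 0*nm (h i z))" by (simp add: ep0)
  hence "i0 z:I & (ALL j:I. nm (h j z) <= ep 0*nm (h (i0 z) z))" unfolding i0_def by (rule someI)
  thus ?thesis by (simp add: ep0)
 qed
 have i0F: "i0 z = i0 z'" if "F z = F z'" for z z'
 proof -
  have "(i:I & (ALL j:I. nm (h j z) <= ep 0*nm (h i z))) = (i:I & (ALL j:I. nm (h j z') <= ep 0*nm (h i z')))" for i
   using FD(3)[OF that] by blast
  thus ?thesis unfolding i0_def by (simp only:)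
 qed
 \<comment> \<open>The sum measured in units of its largest term; the data in \<open>F\<close> fix
   it up to \<open>ep K\<close>.\<close>
 define W where "W z = w z*pw (- ord (h (i0 z) z))" for z
 have Wcl: "nm (W z-W z') <= ep K" if "F z = F z'" "I ~= {}" "nm (h (i0 z) z) ~= 0" for z z'
 proof -
  let ?i = "i0 z"
  have i: "?i:I" "i0 z' = ?i" using i0[OF that(2)] i0F[OF that(1)] by auto
  have nz': "nm (h ?i z') ~= 0" using FD(1)[OF that(1) i(1)] that(3) by simp
  have "W z-W z' = (SUM j:I. h j z*pw (- ord (h ?i z))-h j z'*pw (- ord (h ?i z')))"
   by (simp add: W_def w_def i(2) sum_distrib_right sum_subtractf)
  moreover have "nm ... <= ep K"
  proof (rule nm_sum_le)
   fix j assume j: "j:I"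
   show "nm (h j z*pw (- ord (h ?i z))-h j z'*pw (- ord (h ?i z'))) <= ep K"
    using i0[OF that(2), of z] j i(1)
    by (intro term_close that(3) nz' FD(1)[OF that(1) j] FD(2)[OF that(1) j] FD(3)[OF that(1) j]) auto
  qed (simp add: less_imp_le)
  ultimately show ?thesis by simp
 qed
 have Wn: "nm (W z)*nm (h (i0 z) z) = nm (w z)" if "nm (h (i0 z) z) ~= 0" for z
  unfolding W_def nm_mult nm_pw using nm_ord[OF that] Q_gt1 by (simp add: power_int_minus)
 define S where "S = {z:V. ALL i:I. ee*nm (h i z) <= nm (w z)}"
 have Siff: "(ALL i:I. ee*nm (h i z) <= nm (w z)) <-> ee <= nm (W z)" if "I ~= {}" "nm (h (i0 z) z) ~= 0" for z
 proof -
  have p: "nm (h (i0 z) z) > 0" using nm_pos that by blast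
  have "(ALL i:I. ee*nm (h i z) <= nm (w z)) <-> ee*nm (h (i0 z) z) <= nm (w z)"
   using i0[OF that(1), of z] e by (meson less_imp_le mult_left_mono order_trans)
  thus ?thesis unfolding Wn[OF that(2), symmetric] using p by (simp only: mult_le_cancel_right_pos)
 qed
 have Weq: "nm (W z') = nm (W z)" if "F z = F z'" "I ~= {}" "nm (h (i0 z) z) ~= 0" "ee <= nm (W z)" for z z'
  using nm_close[of "W z" "W z'"] Wcl[OF that(1-3)] that(4) K2 by simp
 have zz: "nm (h i z) = 0" if "I ~= {}" "nm (h (i0 z) z) = 0" "i:I" for z i
  using i0[OF that(1), of z] that nm_ge0[of "h i z"] by (metis order_antisym)
 have allz: "nm (w z) = 0" if "!!i. i:I ==> nm (h i z) = 0" for z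
  using nm_sum_le[of I "%i. h i z" 0] that order_antisym[OF _ nm_ge0[of "w z"]] by (simp add: w_def)
 have Sdet: "(ALL i:I. ee*nm (h i z) <= nm (w z)) <-> (ALL i:I. ee*nm (h i z') <= nm (w z'))" if FF: "F z = F z'" for z z'
 proof (cases "I = {}")
  case ne: False
  have i: "i0 z:I" "i0 z' = i0 z" using i0[OF ne] i0F[OF FF] by auto
  show ?thesis
  proof (cases "nm (h (i0 z) z) = 0")
   case True
   hence t': "nm (h (i0 z') z') = 0" using FD(1)[OF FF i(1)] i by simp
   have "(ALL i:I. ee*nm (h i z) <= nm (w z))" using zz[OF ne True] by simp
   moreover have "(ALL i:I. ee*nm (h i z') <= nm (w z'))" using zz[OF ne t'] by simp
   ultimately show ?thesis by blast
  next
   case False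
   hence F': "nm (h (i0 z') z') ~= 0" using FD(1)[OF FF i(1)] i by simp
   show ?thesis unfolding Siff[OF ne False] Siff[OF ne F']
    using Weq[OF FF ne False] Weq[OF FF[symmetric] ne F'] by auto
  qed
 qed simp
 show "det (BasA G) V (%z. ALL i:I. ee*nm (h i z) <= nm (w z))"
  by (rule det_fun[OF F]) (rule Sdet)
 show "LMA G k {z:V. ALL i:I. ee*nm (h i z) <= nm (w z)} w"
  unfolding S_def[symmetric]
 proof (cases "I = {}")
  case True
  thus "LMA G k S w" by (intro LM_zero) (simp add: w_def)
 next
  case ne: False
  have "EX X. det (BasA G) V X & (ALL z:V. nm (h i z) ~= 0 --> mono_at G (h i) z (X z))" if "i:I" for i
   using LM[OF that, of 0] unfolding LM_def by blast
  then obtain X where X: "!!i. i:I ==> det (BasA G) V (X i) & (ALL z:V. nm (h i z) ~= 0 --> mono_at G (h i) z (X i z))" by metis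
  define R where "R z = (F z, \<lambda>i\<in>I. X i z)" for z
  have R: "det (BasA G) S R" unfolding R_def
   by (rule det_dom[of _ V]) (intro det_pair det_restrict fin F conjunct1[OF X], auto simp: S_def)
  define rr where "rr z = (if nm (h (i0 z) z) = 0 then 0 else nm (W z))" for z
  have zw: "nm (w z) = 0 <-> nm (h (i0 z) z) = 0" if "z:S" for z
  proof
   assume "nm (w z) = 0"
   hence "ee*nm (h (i0 z) z) <= 0" using that i0[OF ne, of z] by (auto simp: S_def)
   thus "nm (h (i0 z) z) = 0" using e nm_ge0[of "h (i0 z) z"] by (simp add: mult_le_0_iff)
  next
   assume "nm (h (i0 z) z) = 0"
   thus "nm (w z) = 0" by (rule allz[OF zz[OF ne]])
  qed
  have hz: "nm (h (i0 z) z) = 0 <-> nm (h (i0 z') z') = 0" if "F z = F z'" for z z'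
   using FD(1)[OF that, of "i0 z"] i0[OF ne, of z] i0F[OF that] by simp
  have rrF: "rr z = rr z'" if "F z = F z'" "z:S" "z':S" for z z'
  proof (cases "nm (h (i0 z) z) = 0")
   case True thus ?thesis using hz[OF that(1)] by (simp add: rr_def)
  next
   case False
   thus ?thesis using Weq[OF that(1) ne False] Siff[OF ne False] that(2) hz[OF that(1)]
    by (simp add: rr_def S_def)
  qed
  show "LMA G k S w"
  proof (rule LM_I[where E = "%z. fst (X (i0 z) z)" and N = "%z. fst (snd (X (i0 z) z))"
    and D = "%z. fst (snd (snd (X (i0 z) z)))" and C = "%z. snd (snd (snd (X (i0 z) z)))*rr z^fst (X (i0 z) z)"])
   show "det (BasA G) S (%z. nm (w z) = 0)"
   proof (rule det_fun[OF R])
    fix z z' assume z: "z:S" "z':S" and "R z = R z'"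
    hence "F z = F z'" by (simp add: R_def)
    thus "(nm (w z) = 0) = (nm (w z') = 0)" using zw z hz by blast
   qed
   show "det (BasA G) S (%z. ac k (w z))"
   proof (rule det_fun[OF R])
    fix z z' assume z: "z:S" "z':S" and "R z = R z'"
    hence FF: "F z = F z'" by (simp add: R_def)
    show "ac k (w z) = ac k (w z')"
    proof (cases "nm (h (i0 z) z) = 0")
     case True thus ?thesis using zw z hz[OF FF] by (intro ac_zero) auto
    next
     case False
     have F': "nm (h (i0 z') z') ~= 0" using False hz[OF FF] by blast
     have eW: "ee <= nm (W z)" using Siff[OF ne False] z by (auto simp: S_def)
     hence nW: "nm (W z) ~= 0" using e by auto
     have W': "nm (W z') = nm (W z)" by (rule Weq[OF FF ne False eW])
     have "nm (W z-W z') <= ep k*nm (W z)"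
     proof -
      have "ee*ep k <= nm (W z)*ep k" using eW by (intro mult_right_mono) (auto simp: less_imp_le)
      thus ?thesis using Wcl[OF FF ne False] K by (simp only: mult.commute[of "nm (W z)"])
     qed
     hence "ac k (W z) = ac k (W z')" using ac_approx[OF nW] W' by simp
     moreover have "nm (w z) ~= 0" "nm (w z') ~= 0" using zw z False F' by auto
     moreover have "ac k (pw a) = ac k (pw b)" for a b
     proof -
      have "eqv (nf (pw a)) 1" "eqv (nf (pw b)) 1" unfolding nf_def ord_pw by (rule pw_cancel)+
      hence "eqv (nf (pw a)) (nf (pw b))" using eqv_sym eqv_trans by blast
      thus ?thesis by (simp add: ac_eq_iff eqv_def less_imp_le)
     qed
     ultimately show ?thesis
      using ac_cancel[of "pw (- ord (h (i0 z) z))" "w z" "pw (- ord (h (i0 z') z'))" "w z'" k]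
      unfolding W_def by (simp add: mult.commute)
    qed
   qed
   show "det (BasA G) S (%z. (fst (X (i0 z) z), fst (snd (X (i0 z) z)), fst (snd (snd (X (i0 z) z))),
     snd (snd (snd (X (i0 z) z)))*rr z^fst (X (i0 z) z)))"
   proof (rule det_fun[OF R])
    fix z z' assume z: "z:S" "z':S" and RR: "R z = R z'"
    hence FF: "F z = F z'" and XX: "(\<lambda>i\<in>I. X i z) = (\<lambda>i\<in>I. X i z')" by (simp_all add: R_def)
    have i: "i0 z' = i0 z" "i0 z:I" using i0F[OF FF] i0[OF ne] by auto
    have "X (i0 z) z = X (i0 z) z'" using fun_cong[OF XX, of "i0 z"] i by simp
    thus "(fst (X (i0 z) z), fst (snd (X (i0 z) z)), fst (snd (snd (X (i0 z) z))),
     snd (snd (snd (X (i0 z) z)))*rr z^fst (X (i0 z) z)) = (fst (X (i0 z') z'), fst (snd (X (i0 z') z')), fst (snd (snd (X (i0 z') z'))),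
     snd (snd (snd (X (i0 z') z')))*rr z'^fst (X (i0 z') z'))"
     using i rrF[OF FF z] by simp
   qed
  next
   fix z assume z: "z:S" "nm (w z) ~= 0"
   hence nz: "nm (h (i0 z) z) ~= 0" using zw by blast
   have i: "i0 z:I" using i0[OF ne] by blast
   obtain e' n d c where Xz: "X (i0 z) z = (e', n, d, c)" by (cases "X (i0 z) z")
   have m: "mono_at G (h (i0 z)) z (e', n, d, c)" using X[OF i] z nz Xz by (auto simp: S_def)
   have wW: "nm (w z) = nm (W z)*nm (h (i0 z) z)" using Wn[OF nz] by simp
   have "nm (W z) > 0" using Siff[OF ne nz] z e by (auto simp: S_def)
   moreover have "nm (w z)^e'*nm (d z) = c*nm (W z)^e'*nm (n z)"
    using mono_atD(7)[OF m] by (simp add: wW power_mult_distrib algebra_simps)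
   ultimately show "mono_at G w z (fst (X (i0 z) z), fst (snd (X (i0 z) z)), fst (snd (snd (X (i0 z) z))),
     snd (snd (snd (X (i0 z) z)))*rr z^fst (X (i0 z) z))"
    using mono_atD(1-6)[OF m] nz by (simp add: Xz rr_def mono_at_def)
  qed
 qed
qed

section \<open>Rings of functions, families of polynomials over them, and tame extensions\<close>

declare One_nat_def [simp del]

definition fring :: "('z => 'r) set => bool" where
 "fring A <-> (%z. 0):A & (%z. 1):A & (ALL f:A. ALL g:A. (%z. f z+g z):A) &
   (ALL f:A. ALL g:A. (%z. f z*g z):A) & (ALL f:A. (%z. - f z):A)"

lemma fring_0: "fring A ==> (%z. 0):A" by (simp add: fring_def)
lemma fring_1: "fring A ==> (%z. 1):A" by (simp add: fring_def)
lemma fring_add: "fring A ==> f:A ==> g:A ==> (%z. f z+g z):A" by (simp add: fring_def)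
lemma fring_mult: "fring A ==> f:A ==> g:A ==> (%z. f z*g z):A" by (simp add: fring_def)
lemma fring_neg: "fring A ==> f:A ==> (%z. - f z):A" by (simp add: fring_def)
lemma fring_diff: "fring A ==> f:A ==> g:A ==> (%z. f z-g z):A"
 using fring_add[of A f "%z. - g z"] fring_neg[of A g] by simp
lemma fring_of_nat: "fring A ==> (%z. of_nat n):A"
 by (induction n) (simp_all add: fring_0 fring_1 fring_add)
lemma fring_sum: "fring A ==> (!!i. i:I ==> f i:A) ==> (%z. SUM i:I. f i z):A"
 by (induction I rule: infinite_finite_induct) (simp_all add: fring_0 fring_add)
lemma fring_mon: assumes "fring A" shows "mon A = A"
proof
 show "mon A <= A"
 proof
  fix f assume "f:mon A" thus "f:A"
   using assms by induction (simp_all add: fring_1 fring_mult)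
 qed
qed (auto intro: mon_gen)

definition pfam :: "('z => 'r) set => nat => ('z => 'r poly) => bool" where
 "pfam A n p <-> (ALL z. degree (p z) <= n) & (ALL i. (%z. coeff (p z) i):A)"

lemma pfamI: "(!!z. degree (p z) <= n) ==> (!!i. (%z. coeff (p z) i):A) ==> pfam A n p"
 by (simp add: pfam_def)

lemma pfam_deg: "pfam A n p ==> degree (p z) <= n" by (simp add: pfam_def)
lemma pfam_coeff: "pfam A n p ==> (%z. coeff (p z) i):A" by (simp add: pfam_def)
lemma pfam_mono: "pfam A n p ==> A <= A' ==> n <= n' ==> pfam A' n' p"
 unfolding pfam_def by (meson order_trans subsetD)

lemma pfam_tay: assumes A: "fring A" and c: "c:A" shows "pfam A n p ==> (%z. tay (p z) (c z) i):A"
proof (induction n arbitrary: p i)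
 case 0
 have e: "p z = [:coeff (p z) 0:]" for z
  by (rule poly_eqI) (use pfam_deg[OF 0, of z] in "simp add: coeff_pCons coeff_eq_0 split: nat.split")
 have "tay (p z) (c z) i = (if i = 0 then coeff (p z) 0 else 0)" for z
  by (subst e) (simp add: tay_def coeff_pCons split: nat.split)
 thus ?case using pfam_coeff[OF 0, of 0] fring_0[OF A] by (cases "i = 0") simp_all
next
 case (Suc n)
 define q where "q z = poly_shift 1 (p z)" for z
 have pq: "p z = pCons (coeff (p z) 0) (q z)" for z
  by (rule poly_eqI) (simp add: q_def coeff_pCons coeff_poly_shift One_nat_def split: nat.split)
 have cq: "coeff (q z) i = coeff (p z) (Suc i)" for z i by (simp add: q_def coeff_poly_shift One_nat_def)
 have "degree (q z) <= n" for z
  by (rule degree_le) (use pfam_deg[OF Suc.prems, of z] in "auto simp: cq coeff_eq_0")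
 hence q: "pfam A n q" using pfam_coeff[OF Suc.prems] by (intro pfamI) (simp_all add: cq)
 have t: "tay (p z) (c z) i = (if i = 0 then coeff (p z) 0 else 0)+c z*tay (q z) (c z) i +
   (if i = 0 then 0 else tay (q z) (c z) (i-1))" for z
  by (subst pq) (rule tay_pCons)
 have "(%z. (if i = 0 then coeff (p z) 0 else 0)):A" using pfam_coeff[OF Suc.prems, of 0] fring_0[OF A] by (cases "i = 0") simp_all
 moreover have "(%z. (if i = 0 then 0 else tay (q z) (c z) (i-1))):A" using Suc.IH[OF q, of "i-1"] fring_0[OF A] by (cases "i = 0") simp_all
 ultimately show ?case unfolding t using Suc.IH[OF q] c by (intro fring_add fring_mult A)
qed

lemma pfam_eval: assumes "fring A" "c:A" "pfam A n p" shows "(%z. poly (p z) (c z)):A"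
 using pfam_tay[OF assms, of 0] by (simp add: tay_0)

lemma pfam_dpoly: assumes "fring A" "pfam A n p" shows "pfam A (n-1) (%z. dpoly (p z))"
proof (rule pfamI)
 show "degree (dpoly (p z)) <= n-1" for z
  using degree_dpoly[of "p z"] pfam_deg[OF assms(2), of z] by linarith
 show "(%z. coeff (dpoly (p z)) i):A" for i
  unfolding coeff_dpoly by (intro fring_mult fring_of_nat assms(1) pfam_coeff[OF assms(2)])
qed

text \<open>Every condition expressed by norms and angular components of \<open>A'\<close> can be
  rewritten over \<open>A\<close>, so functions of \<open>A'\<close> may be adjoined freely without
  enlarging the class of definable pieces. All depths \<open>k\<close> are demanded in order to make
  the notion transitive.\<close>

definition tame :: "('z => 'r) set => ('z => 'r) set => bool" where
 "tame A A' <-> fring A' & A <= A' & (ALL h:A'. ALL k. LMA A k UNIV h)"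

lemma tame_refl: "fring A ==> tame A A"
 by (auto simp: tame_def intro: LM_gen)

lemma tame_trans: assumes "tame A B" "tame B C" shows "tame A C"
 unfolding tame_def
proof (intro conjI ballI allI)
 fix h k assume h: "h:C"
 show "LMA A k UNIV h"
  by (rule LMA_trans[of B]) (use assms h in "auto simp: tame_def")
qed (use assms in "auto simp: tame_def")

section \<open>Labelled roots\<close>

text \<open>A root \<open>ta\<close> of \<open>A\<close> whose norm is read off two coefficients, whose angular component is
  prescribed, and at which the derivative is as large as \<open>ee\<close> permits.  The label
  \<open>(l, l', ka)\<close> singles out at most one such root.\<close>

definition Lab :: "'r poly => nat => nat => nat => 'r => real => 'r => bool" where
 "Lab A l l' k ka ee ta <-> nm (coeff A l*ta^l) = nm (coeff A l'*ta^l') &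
   (ALL i. nm (coeff A i*ta^i) <= nm (coeff A l*ta^l)) & 0 < nm (coeff A l*ta^l) &
   ac k ta = ka & ee*nm (coeff A l*ta^l) <= nm (tay A ta 1)*nm ta & nm (poly A ta) = 0"

lemma LabD:
 assumes "Lab A l l' k ka ee ta"
 shows "nm (coeff A l*ta^l) = nm (coeff A l'*ta^l')" "nm (coeff A i*ta^i) <= nm (coeff A l*ta^l)"
  "0 < nm (coeff A l*ta^l)" "ac k ta = ka" "ee*nm (coeff A l*ta^l) <= nm (tay A ta 1)*nm ta"
  "nm (poly A ta) = 0"
 using assms unfolding Lab_def by blast+

lemma Lab_nz: assumes "Lab A l l' k ka ee ta" "l < l'"
 shows "nm ta ~= 0" "nm (coeff A l) ~= 0" "nm (coeff A l') ~= 0"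
proof -
 have "0 < nm (coeff A l)*nm ta^l" "0 < nm (coeff A l')*nm ta^l'"
  using assms(1) by (simp_all add: Lab_def nm_mult nm_power)
 thus "nm (coeff A l) ~= 0" "nm (coeff A l') ~= 0" "nm ta ~= 0"
  using assms(2) by (auto simp: zero_less_mult_iff power_0_left)
qed

lemma Lab_bnd: "Lab A l l' k ka ee ta ==> bnd (nm ta) (nm (coeff A l*ta^l)) A"
 by (auto simp: Lab_def bnd_def nm_mult nm_power)

lemma Lab_norm: assumes "Lab A l l' k ka ee ta" "l < l'"
 shows "nm ta^(l'-l)*nm (coeff A l') = nm (coeff A l)"
proof -
 have "nm ta^l' = nm ta^l*nm ta^(l'-l)" using assms(2) by (simp add: power_add[symmetric])
 hence "nm ta^l*(nm ta^(l'-l)*nm (coeff A l')) = nm ta^l*nm (coeff A l)"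
  using assms(1) unfolding Lab_def nm_mult nm_power by (simp only: ac_simps)
 thus ?thesis using Lab_nz(1)[OF assms] by simp
qed

text \<open>The coefficients at \<open>l\<close> and \<open>l'\<close> fix the norm, and a common
  angular component of depth \<open>k\<close> brings the two roots within the radius where Hensel
  roots are unique, as \<open>ep k < ee\<close>.\<close>

lemma Lab_unique:
 assumes L: "Lab A l l' k ka ee ta" "Lab A l l' k ka ee ta'" and l: "l < l'" and k: "ep k < ee"
 shows "nm (ta-ta') = 0"
proof -
 have nz: "nm ta > 0" "nm ta ~= 0" using Lab_nz(1)[OF L(1) l] nm_pos by auto
 have "nm ta^(l'-l) = nm ta'^(l'-l)"
  using Lab_norm[OF L(1) l] Lab_norm[OF L(2) l] Lab_nz(3)[OF L(1) l] by (metis mult_right_cancel)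
 hence n: "nm ta = nm ta'" using l by (metis nm_ge0 power_eq_imp_eq_base zero_less_diff)
 have "ac k ta = ac k ta'" using L by (simp add: Lab_def)
 hence c: "nm (ta-ta') <= ep k*nm ta" using ac_eq_nm[OF nz(2) n] by simp
 have "nm (ta'-ta) = 0"
 proof (rule hensel_unique[of "nm ta" "nm (coeff A l*ta^l)" "tlr A ta" ee])
  show "bnd (nm ta) (nm (coeff A l*ta^l)) (tlr A ta)" by (rule bnd_tlr[OF Lab_bnd[OF L(1)] order_refl nz(1)])
  show "nm (ta'-ta) < ee*nm ta" using c k nz by (subst nm_minus_commute) (meson mult_strict_right_mono order_le_less_trans)
 qed (use L nz in "auto simp: Lab_def coeff_tlr_0 coeff_tlr_1 poly_tlr")
 thus ?thesis by (simp add: nm_minus_commute)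
qed

lemma ep_mult_nat: "nm x ~= 0 ==> nm y ~= 0 ==> nm x <= ep j*nm y <-> int j <= ord x-ord y"
proof -
 assume nz: "nm x ~= 0" "nm y ~= 0"
 have "nm x <= ep j*nm y <-> Q powi (- ord x) <= Q powi (- int j+- ord y)"
  unfolding nm_ord[OF nz(1)] nm_ord[OF nz(2)] ep_def using Q_gt1 by (subst power_int_add) auto
 thus ?thesis unfolding powi_le by linarith
qed

text \<open>\<open>labX / labY\<close> is the \<open>(l' - l)\<close>-th power of the ratio of the \<open>i\<close>-th to the \<open>l\<close>-th term of
  the polynomial at a point whose norm is read off the \<open>l\<close>-th and \<open>l'\<close>-th coefficients.
  The truncated subtractions make both sides polynomial.\<close>

definition labX :: "(nat => 'r) => nat => nat => nat => 'r" where
 "labX a l l' i = a i^(l'-l)*a l^(i-l')*a l'^(l-i)"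
definition labY :: "(nat => 'r) => nat => nat => nat => 'r" where
 "labY a l l' i = a l^(l'-i)*a l'^(i-l)"

lemma lab_thr:
 assumes nz: "nm (a i) ~= 0" "nm (a l) ~= 0" "nm (a l') ~= 0" "nm ta ~= 0" and l: "l < l'"
  and g: "int (l'-l) * ord ta = ord (a l)-ord (a l')"
 shows "nm (a i*ta^i) <= ep j*nm (a l*ta^l) <-> nm (labX a l l' i) <= ep ((l'-l)*j)*nm (labY a l l' i)"
proof -
 define n where "n = int (l'-l)"
 have n: "n > 0" using l by (simp add: n_def)
 have nzX: "nm (labX a l l' i) ~= 0" "nm (labY a l l' i) ~= 0"
  using nz by (simp_all add: labX_def labY_def nm_mult nm_power)
 define De where "De = ord (a i)+int i * ord ta-(ord (a l)+int l * ord ta)"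
 have sub: "int (x-y)-int (y-x) = int x-int y" for x y :: nat by linarith
 have "ord (labX a l l' i)-ord (labY a l l' i) = n * ord (a i)+(int (i-l')-int (l'-i)) * ord (a l)
   +(int (l-i)-int (i-l)) * ord (a l')"
  using nz by (simp add: labX_def labY_def ord_mult ord_power nm_mult nm_power n_def algebra_simps)
 also have "... = n * ord (a i)+(int i-int l') * ord (a l)+(int l-int i) * ord (a l')" by (simp only: sub)
 also have "... = n * ord (a i)+(int i-int l)*(ord (a l)-ord (a l'))-n * ord (a l)"
  using l by (simp add: n_def algebra_simps)
 also have "... = n*De" unfolding g[symmetric] De_def n_def[symmetric] by (simp add: algebra_simps)
 finally have e: "ord (labX a l l' i)-ord (labY a l l' i) = n*De" .
 have "nm (a i*ta^i) <= ep j*nm (a l*ta^l) <-> int j <= De"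
  using nz by (subst ep_mult_nat) (simp_all add: nm_mult nm_power ord_mult ord_power De_def)
 also have "... <-> n*int j <= n*De" using n by simp
 also have "... <-> nm (labX a l l' i) <= ep ((l'-l)*j)*nm (labY a l l' i)"
  unfolding ep_mult_nat[OF nzX] e by (simp add: n_def)
 finally show ?thesis .
qed

text \<open>The labelled root of \<open>A\<close> yields an approximate root of \<open>A'\<close>
  with the same unit part and with the order dictated by the coefficients of \<open>A'\<close>. All
  normalised terms agree up to \<open>ep K\<close>, so value and derivative are under control and
  Hensel's lemma corrects the approximation without changing the angular component of depth
  \<open>k'\<close>.\<close>

lemma Lab_transfer:
 assumes L: "Lab A l l' k ka ee ta" and l: "l < l'" and e: "0 < ee" and k: "k <= k'"
  and K: "ep K < ee\<^sup>2" "ep K < ee*ep k'" "k' <= K"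
  and z: "!!i. nm (coeff A i) = 0 <-> nm (coeff A' i) = 0"
  and a: "!!i. ac K (coeff A i) = ac K (coeff A' i)"
  and dv: "int (l'-l) dvd (ord (coeff A l)-ord (coeff A l')) <-> int (l'-l) dvd (ord (coeff A' l)-ord (coeff A' l'))"
  and t: "!!i j. j <= K ==> nm (labX (coeff A) l l' i) <= ep ((l'-l)*j)*nm (labY (coeff A) l l' i) <->
    nm (labX (coeff A') l l' i) <= ep ((l'-l)*j)*nm (labY (coeff A') l l' i)"
 shows "EX ta'. Lab A' l l' k ka ee ta' & ac k' ta' = ac k' ta"
proof -
 define n where "n = l'-l"
 have n: "n > 0" using l by (simp add: n_def)
 have nz: "nm ta ~= 0" "nm (coeff A l) ~= 0" "nm (coeff A l') ~= 0" using Lab_nz[OF L l] by auto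
 have nz': "nm (coeff A' l) ~= 0" "nm (coeff A' l') ~= 0" using z nz by auto
 have "nm (ta^n*coeff A l') = nm (coeff A l)" using Lab_norm[OF L l] by (simp add: n_def nm_mult nm_power)
 hence "ord (ta^n*coeff A l') = ord (coeff A l)" by (rule ord_eqv)
 hence g: "int n * ord ta = ord (coeff A l)-ord (coeff A l')"
  using nz by (simp add: ord_mult ord_power nm_power)
 hence "int n dvd (ord (coeff A' l)-ord (coeff A' l'))" using dv unfolding n_def[symmetric] by (metis dvd_triv_left)
 then obtain ga where ga: "int n*ga = ord (coeff A' l)-ord (coeff A' l')" by (metis dvdE)
 \<comment> \<open>The order \<open>ga\<close> is the slope of the edge of the Newton polygon of
   \<open>A'\<close> from \<open>l\<close> to \<open>l'\<close>; the divisibility hypothesis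
   \<open>dv\<close> makes it an integer.\<close>
 define gs where "gs = nf ta*pw ga"
 have ns: "nm gs = Q powi (- ga)" by (simp add: gs_def nm_mult nm_nf nz nm_pw)
 hence nzs: "nm gs ~= 0" by (metis powi_pos order_less_irrefl)
 have os: "ord gs = ga" by (rule ordI[OF ns])
 have acs: "ac q gs = ac q ta" for q
 proof -
  have "eqv (nf ta*(pw ga*pw (- ga))) (nf ta*1)" by (intro eqv_mult pw_cancel) auto
  hence "eqv (nf gs) (nf ta)" unfolding nf_def[of gs] os by (simp add: gs_def mult.assoc)
  thus ?thesis by (simp add: ac_eq_iff eqv_def less_imp_le)
 qed
 let ?y = "coeff A l*ta^l" and ?y' = "coeff A' l*gs^l"
 have yz: "nm ?y ~= 0" "nm ?y' ~= 0" using nz nz' nzs by (simp_all add: nm_mult nm_power)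
 have acp: "ac K (ta^i) = ac K (gs^i)" for i
 proof (induction i)
  case (Suc i)
  thus ?case unfolding power_Suc using nz nzs acs by (intro ac_mult) (simp_all add: nm_power)
 qed simp
 have xz: "nm (coeff A i*ta^i) = 0 <-> nm (coeff A' i*gs^i) = 0" for i
  using z nz nzs by (simp add: nm_mult nm_power)
 have xa: "ac K (coeff A i*ta^i) = ac K (coeff A' i*gs^i)" for i
 proof (cases "nm (coeff A i) = 0")
  case True thus ?thesis using z by (intro ac_zero) (simp_all add: nm_mult)
 next
  case False thus ?thesis using z nz nzs a acp by (intro ac_mult) (simp_all add: nm_power)
 qed
 have xt: "nm (coeff A i*ta^i) <= ep j*nm ?y <-> nm (coeff A' i*gs^i) <= ep j*nm ?y'" if "j <= K" for i j
 proof (cases "nm (coeff A i) = 0")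
  case True
  hence "nm (coeff A i*ta^i) = 0" "nm (coeff A' i*gs^i) = 0" using z[of i] by (simp_all add: nm_mult)
  thus ?thesis by (simp add: less_imp_le)
 next
  case False
  hence F': "nm (coeff A' i) ~= 0" using z by simp
  show ?thesis
   using lab_thr[of "coeff A" i l l' ta j, OF False nz(2,3,1) l g[unfolded n_def]]
    lab_thr[of "coeff A'" i l l' gs j, OF F' nz' nzs l] t[OF that, of i] ga[unfolded n_def] os
   by simp
 qed
 have ep0: "ep 0 = 1" by (simp add: ep_def)
 have le: "nm (coeff A i*ta^i) <= nm ?y" for i by (rule LabD(2)[OF L])
 have le': "nm (coeff A' i*gs^i) <= nm ?y'" for i using xt[of 0 i] le[of i] by (simp add: ep0)
 let ?P = "pw (- ord ?y)" and ?P' = "pw (- ord ?y')"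
 have tc: "nm (coeff A i*ta^i*?P-coeff A' i*gs^i*?P') <= ep K" for i
  by (rule term_close[OF yz xz xa xt le])
 define N where "N = max (degree A) (degree A')+1"
 have sc: "nm (x*?P')*nm ?y' = nm x" "nm (x*?P)*nm ?y = nm x" for x
  unfolding nm_mult[of x] nm_pw using nm_ord[OF yz(1)] nm_ord[OF yz(2)] Q_gt1 by (simp_all add: power_int_minus)
 have "poly A ta*?P-poly A' gs*?P' = (SUM i<=N. coeff A i*ta^i*?P-coeff A' i*gs^i*?P')"
  unfolding poly_sum_le[of A N ta, unfolded N_def, simplified] using poly_sum_le[of A N ta] poly_sum_le[of A' N gs]
  by (simp add: N_def sum_distrib_right sum_subtractf)
 hence "nm (poly A ta*?P-poly A' gs*?P') <= ep K"
  using nm_sum_le[of "{..N}" "%i. coeff A i*ta^i*?P-coeff A' i*gs^i*?P'" "ep K"] tc by (simp add: less_imp_le)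
 moreover have "nm (poly A ta*?P) <= ep K" using L by (simp add: Lab_def nm_mult less_imp_le)
 ultimately have "nm (poly A' gs*?P') <= ep K"
  using nm_diff_le[of "poly A ta*?P" "ep K" "poly A ta*?P-poly A' gs*?P'"] by simp
 hence p0: "nm (poly A' gs) <= ep K*nm ?y'"
  using sc(1)[of "poly A' gs"] by (metis mult_right_mono nm_ge0)
 have der: "tay B x 1*x = (SUM i<=M. of_nat i*(coeff B i*x^i))" if "degree B <= M" for B x M
 proof -
  have "poly (dpoly B) x = (SUM i<=M. coeff (dpoly B) i*x^i)"
   using degree_dpoly[of B] that by (intro poly_sum_le) linarith
  hence "tay B x 1*x = (SUM i<=M. of_nat (Suc i)*coeff B (Suc i)*x^i)*x"
   unfolding poly_dpoly coeff_dpoly by (rule arg_cong)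
  also have "... = (SUM i<=M. of_nat (Suc i)*(coeff B (Suc i)*x^Suc i))"
   unfolding sum_distrib_right by (simp only: power_Suc ac_simps)
  also have "... = (SUM i<=Suc M. of_nat i*(coeff B i*x^i))"
   by (subst sum.atMost_Suc_shift) simp
  also have "... = (SUM i<=M. of_nat i*(coeff B i*x^i))" using that by (simp add: coeff_eq_0)
  finally show ?thesis .
 qed
 have "tay A ta 1*ta*?P-tay A' gs 1*gs*?P' = (SUM i<=N. of_nat i*(coeff A i*ta^i*?P-coeff A' i*gs^i*?P'))"
 proof -
  have "degree A <= N" "degree A' <= N" by (simp_all add: N_def)
  note d = der[OF this(1), of ta] der[OF this(2), of gs]
  show ?thesis unfolding d by (simp add: sum_distrib_right sum_subtractf right_diff_distrib mult.assoc)
 qed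
 moreover have "nm (SUM i<=N. of_nat i*(coeff A i*ta^i*?P-coeff A' i*gs^i*?P')) <= ep K"
 proof (rule nm_sum_le)
  fix i show "nm (of_nat i*(coeff A i*ta^i*?P-coeff A' i*gs^i*?P')) <= ep K"
   using mult_mono[OF nm_of_nat[of i] tc[of i]] by (simp add: nm_mult less_imp_le)
 qed (simp add: less_imp_le)
 ultimately have dd: "nm (tay A ta 1*ta*?P-tay A' gs 1*gs*?P') <= ep K" by simp
 have ey: "ee <= nm (tay A ta 1*ta*?P)"
 proof -
  have "ee*nm ?y <= nm (tay A ta 1*ta*?P)*nm ?y" unfolding sc nm_mult[of "tay A ta 1" ta] by (rule LabD(5)[OF L])
  thus ?thesis using nm_pos[OF yz(1)] by simp
 qed
 have Ke: "ep K < ee"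
 proof -
  have "ee*ep k' <= ee*1" using e ep_le1[of k'] by (intro mult_left_mono) auto
  thus ?thesis using K by linarith
 qed
 have "nm (tay A' gs 1*gs*?P') = nm (tay A ta 1*ta*?P)" using dd ey Ke by (intro nm_close) linarith
 hence d1: "ee*nm ?y' <= nm (tay A' gs 1)*nm gs"
  using ey sc(1)[of "tay A' gs 1*gs"] by (metis mult_right_mono nm_ge0 nm_mult)
 have sp: "nm gs > 0" "nm ?y' > 0" using nm_pos nzs yz by auto
 have b': "bnd (nm gs) (nm ?y') A'" using le' by (simp add: bnd_def nm_mult nm_power)
 have bt: "bnd (nm gs) (nm ?y') (tlr A' gs)" by (rule bnd_tlr[OF b' order_refl sp(1)])
 have "EX h. nm h <= ep K/ee*nm gs & nm (poly (tlr A' gs) h) = 0"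
  by (rule hensel[OF bt sp e]) (use p0 d1 K in "simp_all add: coeff_tlr_0 coeff_tlr_1")
 then obtain h where h: "nm h <= ep K/ee*nm gs" "nm (poly A' (gs+h)) = 0" by (auto simp: poly_tlr)
 have kk: "ep K/ee <= ep k'" using K e by (simp add: divide_le_eq mult.commute less_imp_le)
 have h2: "nm h <= ep k'*nm gs" using h(1) kk sp by (meson less_imp_le mult_right_mono order_trans)
 have K1: "ep K/ee < 1" using Ke e by simp
 have hs: "nm h < nm gs"
 proof -
  have "ep K/ee*nm gs < 1*nm gs" using K1 sp(1) by (rule mult_strict_right_mono)
  thus ?thesis using h(1) by simp
 qed
 define ta' where "ta' = gs+h"
 have nt: "nm ta' = nm gs" unfolding ta'_def by (rule nm_add_dom[OF hs])
 have nn: "nm (x*ta'^i) = nm (x*gs^i)" for x i by (simp add: nm_mult nm_power nt)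
 have "ac k' ta' = ac k' gs"
  using ac_approx[of ta' gs k'] h2 nt nzs by (simp add: ta'_def)
 hence ac': "ac k' ta' = ac k' ta" using acs by simp
 hence ack: "ac k ta' = ka" using ac_mono[OF k, of ta' ta] L by (simp add: Lab_def)
 have "nm (tay (tlr A' gs) h 1-coeff (tlr A' gs) 1)*nm gs <= nm ?y'*(ep K/ee*nm gs/nm gs)"
  using K1 sp e by (intro bnd_deriv_close[OF bt h(1) _ sp(1)]) (simp add: divide_le_eq mult_right_mono)
 also have "... = nm ?y'*(ep K/ee)" using sp by simp
 also have "... < nm ?y'*ee" using K(1) e sp by (intro mult_strict_left_mono) (simp_all add: divide_less_eq power2_eq_square)
 also have "... <= nm (tay A' gs 1)*nm gs" using d1 by (simp add: mult.commute)
 finally have "nm (tay A' ta' 1-tay A' gs 1) < nm (tay A' gs 1)"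
  using sp by (simp add: tay_tlr coeff_tlr ta'_def)
 hence "nm (tay A' ta' 1) = nm (tay A' gs 1)" using nm_close[of "tay A' gs 1" "tay A' ta' 1"] by (simp add: nm_minus_commute)
 hence d2: "ee*nm ?y' <= nm (tay A' ta' 1)*nm ta'" using d1 nt by simp
 have eqs: "nm (coeff A' l*gs^l) = nm (coeff A' l'*gs^l')"
 proof -
  have "ord (coeff A' l*gs^l) = ord (coeff A' l'*gs^l')"
   using nz' nzs ga os l by (simp add: ord_mult ord_power nm_power n_def algebra_simps of_nat_diff)
  thus ?thesis using nz' nzs by (subst nm_eq_iff_ord) (simp_all add: nm_mult nm_power)
 qed
 have "Lab A' l l' k ka ee ta'"
  unfolding Lab_def nn using eqs le' sp(2) ack d2 h(2) by (auto simp: ta'_def)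
 thus ?thesis using ac' by blast
qed

definition troot :: "'r poly => nat => nat => nat => 'r => real => 'r" where
 "troot A l l' k ka ee = (if EX ta. Lab A l l' k ka ee ta then SOME ta. Lab A l l' k ka ee ta else 0)"

lemma troot_Lab: "EX ta. Lab A l l' k ka ee ta ==> Lab A l l' k ka ee (troot A l l' k ka ee)"
 unfolding troot_def using someI_ex by simp

lemma ord_mod_det:
 assumes "LMA G k V f" "n > 0" shows "det (BasA G) V (%z. ord (f z) mod int n)"
proof (rule det_fun)
 show "det (BasA G) V (%z. \<lambda>r\<in>{..<n}. int n dvd (ord (f z)-int r))"
  by (intro det_restrict LM_dvd[OF assms(1)]) (use assms(2) in simp_all)
 fix z z' assume e: "(\<lambda>r\<in>{..<n}. int n dvd (ord (f z)-int r)) = (\<lambda>r\<in>{..<n}. int n dvd (ord (f z')-int r))"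
 define r where "r = nat (ord (f z) mod int n)"
 have r: "r < n" "int r = ord (f z) mod int n" using assms(2) by (auto simp: r_def nat_less_iff)
 hence "int n dvd (ord (f z)-int r)" by (metis mod_eq_dvd_iff mod_mod_trivial)
 hence "int n dvd (ord (f z')-int r)" using fun_cong[OF e, of r] r(1) by simp
 hence "ord (f z') mod int n = int r mod int n" by (simp add: mod_eq_dvd_iff)
 thus "ord (f z) mod int n = ord (f z') mod int n" using r by simp
qed

text \<open>By \<open>Lab_transfer\<close> the existence of the labelled root and its angular
  component depend only on the finite data \<open>F\<close> of the coefficients. Its norm is an
  \<open>(l'-l)\<close>-th root of a quotient of two coefficients by
  \<open>Lab_norm\<close>.\<close>

lemma troot_LM:
 assumes Q: "fring G" and A: "pfam G D A" and l: "l < l'" and e: "0 < ee" and k: "ep k < ee"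
 shows "det (BasA G) V (%z. EX ta. Lab (A z) l l' k ka ee ta)"
  and "LMA G k' V (%z. troot (A z) l l' k ka ee)"
proof -
 let ?T = "%z. troot (A z) l l' k ka ee" and ?D = "%z. EX ta. Lab (A z) l l' k ka ee ta"
 define k2 where "k2 = max k k'"
 obtain K1 where K1: "ep K1 < min (ee\<^sup>2) (ee*ep k2)" using ep_ex[of "min (ee\<^sup>2) (ee*ep k2)"] e by auto
 define K where "K = max K1 k2"
 have "ep K <= ep K1" by (rule ep_mono) (simp add: K_def)
 hence K: "ep K < ee\<^sup>2" "ep K < ee*ep k2" "k2 <= K" using K1 by (auto simp: K_def)
 define n where "n = l'-l"
 have n: "n > 0" using l by (simp add: n_def)
 have cG: "(%z. coeff (A z) i):G" for i by (rule pfam_coeff[OF A])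
 have big: "coeff (A z) i = 0" if "~ i <= D" for i z using pfam_deg[OF A, of z] that by (intro coeff_eq_0) simp
 define a where "a z = coeff (A z)" for z
 have LX: "LMA G 0 V (%z. labX (a z) l l' i)" "LMA G 0 V (%z. labY (a z) l l' i)" for i
  unfolding labX_def labY_def a_def by (intro LM_mult LM_power LM_gen cG)+
 define F where "F z = ((\<lambda>i\<in>{..D}. nm (a z i) = 0), (\<lambda>i\<in>{..D}. ac K (a z i)),
   ord (a z l) mod int n, ord (a z l') mod int n,
   (\<lambda>i\<in>{..D}. \<lambda>j\<in>{..K}. nm (labX (a z) l l' i) <= ep (n*j)*nm (labY (a z) l l' i)))" for z
 have F: "det (BasA G) V F" unfolding F_def
  by (intro det_pair det_restrict finite_atMost LM_cmp[OF LX] ord_mod_det[OF _ n, where k = 0])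
    (unfold a_def, (intro LM_zero_det[OF LM_gen[OF cG, where k = 0]] LM_ac_det[OF LM_gen[OF cG]] LM_gen[OF cG])+)
 have tr: "EX ta'. Lab (A z') l l' k ka ee ta' & ac k2 ta' = ac k2 ta"
  if FF: "F z = F z'" and L: "Lab (A z) l l' k ka ee ta" for z z' ta
 proof -
  have f: "(\<lambda>i\<in>{..D}. nm (a z i) = 0) = (\<lambda>i\<in>{..D}. nm (a z' i) = 0)"
   "(\<lambda>i\<in>{..D}. ac K (a z i)) = (\<lambda>i\<in>{..D}. ac K (a z' i))"
   "ord (a z l) mod int n = ord (a z' l) mod int n" "ord (a z l') mod int n = ord (a z' l') mod int n"
   "(\<lambda>i\<in>{..D}. \<lambda>j\<in>{..K}. nm (labX (a z) l l' i) <= ep (n*j)*nm (labY (a z) l l' i))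
    = (\<lambda>i\<in>{..D}. \<lambda>j\<in>{..K}. nm (labX (a z') l l' i) <= ep (n*j)*nm (labY (a z') l l' i))"
   using FF by (simp_all add: F_def)
  show ?thesis
  proof (rule Lab_transfer[OF L l e _ K])
   show "k <= k2" by (simp add: k2_def)
   show "nm (coeff (A z) i) = 0 <-> nm (coeff (A z') i) = 0" for i
    using fun_cong[OF f(1), of i] big[of i] by (cases "i <= D") (auto simp: a_def)
   show "ac K (coeff (A z) i) = ac K (coeff (A z') i)" for i
    using fun_cong[OF f(2), of i] big[of i] by (cases "i <= D") (auto simp: a_def)
   show "int (l'-l) dvd ord (coeff (A z) l)-ord (coeff (A z) l') <-> int (l'-l) dvd ord (coeff (A z') l)-ord (coeff (A z') l')"
    using f(3,4) by (simp add: mod_eq_dvd_iff[symmetric] n_def a_def)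
   fix i j assume j: "j <= K"
   show "nm (labX (coeff (A z)) l l' i) <= ep ((l'-l)*j)*nm (labY (coeff (A z)) l l' i) <->
    nm (labX (coeff (A z')) l l' i) <= ep ((l'-l)*j)*nm (labY (coeff (A z')) l l' i)"
   proof (cases "i <= D")
    case True
    thus ?thesis using fun_cong[OF fun_cong[OF f(5), of i], of j] j by (simp add: n_def a_def)
   next
    case False
    thus ?thesis using big[of i] l by (simp add: labX_def power_0_left less_imp_le)
   qed
  qed
 qed
 have Deq: "?D z <-> ?D z'" if "F z = F z'" for z z'
  using tr[OF that] tr[OF that[symmetric]] by blast
 show D: "det (BasA G) V ?D" by (rule det_fun[OF F]) (rule Deq)
 have zer: "nm (?T z) = 0 <-> ~ ?D z" for z
 proof (cases "?D z")
  case True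
  thus ?thesis using Lab_nz(1)[OF troot_Lab[OF True] l] by simp
 next
  case False thus ?thesis by (simp add: troot_def)
 qed
 show "LMA G k' V ?T"
 proof (rule LM_I[where E = "%z. n" and N = "%z z. a z l" and D = "%z z. a z l'" and C = "%z. 1"])
  show "det (BasA G) V (%z. nm (?T z) = 0)" unfolding zer by (rule det_not[OF D])
  show "det (BasA G) V (%z. ac k' (?T z))"
  proof (rule det_fun[OF F])
   fix z z' assume FF: "F z = F z'"
   show "ac k' (?T z) = ac k' (?T z')"
   proof (cases "?D z")
    case True
    obtain ta' where t: "Lab (A z') l l' k ka ee ta'" "ac k2 ta' = ac k2 (?T z)"
     using tr[OF FF troot_Lab[OF True]] by blast
    have "Lab (A z') l l' k ka ee (?T z')" using t(1) by (intro troot_Lab) blast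
    hence "eqv ta' (?T z')" unfolding eqv_def by (rule Lab_unique[OF t(1) _ l k])
    hence "ac k2 (?T z') = ac k2 (?T z)" using t(2) ac_eqv by metis
    thus ?thesis using ac_mono[of k' k2 "?T z'" "?T z"] by (simp add: k2_def)
   next
    case False
    hence "~ ?D z'" using Deq[OF FF] by blast
    thus ?thesis using False zer by (intro ac_zero) blast+
   qed
  qed
 next
  fix z assume "z:V" and nz: "nm (?T z) ~= 0"
  hence L: "Lab (A z) l l' k ka ee (?T z)" using zer troot_Lab by blast
  show "mono_at G ?T z (n, %z. a z l, %z. a z l', 1)"
   using Lab_norm[OF L l] Lab_nz[OF L l] n cG by (auto simp: mono_at_def n_def a_def mon_gen)
 qed simp
qed

text \<open>First-order expansion: near the root the distance from \<open>b\<close> is, up to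
  relative error \<open>ep k\<close>, minus the value at \<open>b\<close> divided by the derivative
  at \<open>b\<close>. Both lie in any ring of functions containing \<open>b\<close> and the
  coefficients.\<close>

lemma near_root:
 assumes L: "Lab A l l' k0 ka ee ta" and l: "l < l'" and e: "0 < ee"
  and c: "nm (ta-b) < dl*nm ta" and d: "dl <= ee*ep k" "dl <= 1"
 shows "nm (tay A b 1) ~= 0" "nm (tay A b 1*(ta-b)) = nm (- poly A b)"
  "nm (tay A b 1*(ta-b) - - poly A b) <= ep k*nm (- poly A b)"
proof -
 define rh m h where "rh = nm ta" and "m = nm (coeff A l*ta^l)" and "h = b-ta"
 have pos: "rh > 0" "m > 0" using Lab_nz(1)[OF L l] nm_pos LabD(3)[OF L] by (auto simp: rh_def m_def)
 have b: "bnd rh m (tlr A ta)" unfolding rh_def m_def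
  by (rule bnd_tlr[OF Lab_bnd[OF L] order_refl]) (use pos in "simp add: rh_def")
 have h0: "nm h < dl*rh" using c by (simp add: h_def rh_def nm_minus_commute)
 have h1: "nm h <= rh" using h0 d(2) pos by (meson less_imp_le mult_left_le_one_le order_trans mult_right_mono mult_le_cancel_right2 not_le)
 define e1 where "e1 = tay A ta 1"
 have e1: "ee*m <= nm e1*rh" using LabD(5)[OF L] by (simp add: e1_def m_def rh_def)
 have e1p: "nm e1 > 0" using e1 e pos by (metis mult_pos_pos nm_ge0 order_less_le_trans zero_less_mult_pos2)
 have m1: "m/rh <= nm e1/ee" using e1 e pos by (simp add: field_simps)
 define tt where "tt = nm h/(ee*rh)"
 have th: "tt < ep k" "0 <= tt" using h0 d(1) e pos
  by (simp_all add: tt_def divide_less_eq) (metis mult.assoc mult.commute mult_le_cancel_right_pos order_less_le_trans)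
 have th1: "tt < 1" using th ep_le1[of k] by linarith
 have "nm (tay A b 1-e1)*rh <= m*(nm h/rh)"
  using bnd_deriv_close[OF b order_refl h1 pos(1)] by (simp add: tay_tlr coeff_tlr h_def e1_def)
 hence "nm (tay A b 1-e1) <= (m/rh)*(nm h/rh)" using pos by (simp add: field_simps)
 also have "... <= (nm e1/ee)*(nm h/rh)" using m1 pos by (intro mult_right_mono) auto
 finally have de: "nm (tay A b 1-e1) <= nm e1*tt" by (simp add: tt_def)
 also have "... < nm e1" using th1 e1p by simp
 finally have "nm (e1-tay A b 1) < nm e1" by (simp add: nm_minus_commute)
 hence n1: "nm (tay A b 1) = nm e1" by (rule nm_close)
 thus "nm (tay A b 1) ~= 0" using e1p by simp
 have "nm (poly (tlr A ta) h-coeff (tlr A ta) 0-coeff (tlr A ta) 1*h) <= m*(nm h/rh)\<^sup>2"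
  by (rule bnd_tail[OF b order_refl h1 pos(1)])
 also have "... = (m/rh)*(nm h*nm h/rh)" by (simp add: power2_eq_square)
 also have "... <= (nm e1/ee)*(nm h*nm h/rh)" using m1 pos by (intro mult_right_mono) auto
 finally have t1: "nm (poly A b-poly A ta-e1*h) <= nm e1*nm h*tt"
  by (simp add: tt_def h_def poly_tlr coeff_tlr_0 coeff_tlr_1 e1_def mult.assoc)
 have t2: "nm (poly A ta) <= nm e1*nm h*tt" using LabD(6)[OF L] th by simp
 have t3: "nm ((e1-tay A b 1)*h) <= nm e1*nm h*tt"
  using mult_right_mono[OF de nm_ge0[of h]] unfolding nm_mult nm_minus_commute[of e1] by (simp only: ac_simps)
 have "tay A b 1*(ta-b) - - poly A b = (poly A b-poly A ta-e1*h)+(poly A ta+(e1-tay A b 1)*h)"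
  by (simp add: h_def algebra_simps)
 hence eq: "tay A b 1*(ta-b) - - poly A b = (poly A b-poly A ta-e1*h)+(poly A ta+(e1-tay A b 1)*h)" .
 have t: "nm (tay A b 1*(ta-b) - - poly A b) <= nm e1*nm h*tt"
  unfolding eq by (rule nm_add_le[OF t1 nm_add_le[OF t2 t3]])
 have P: "nm (tay A b 1*(ta-b)) = nm e1*nm h" by (simp add: nm_mult n1 h_def nm_minus_commute)
 show nP: "nm (tay A b 1*(ta-b)) = nm (- poly A b)"
 proof (cases "nm h = 0")
  case True
  hence "nm (tay A b 1*(ta-b) - - poly A b) = 0" using t nm_ge0 by (metis mult_zero_left mult_zero_right order_antisym)
  thus ?thesis by (rule nm_eq0)
 next
  case False
  hence "nm e1*nm h*tt < nm e1*nm h" using th1 e1p nm_pos by simp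
  thus ?thesis using nm_close[of "tay A b 1*(ta-b)" "- poly A b"] t P by simp
 qed
 have "nm e1*nm h*tt <= nm e1*nm h*ep k" using th by (intro mult_left_mono) auto
 thus "nm (tay A b 1*(ta-b) - - poly A b) <= ep k*nm (- poly A b)"
  using t nP P by (simp add: mult.commute)
qed

text \<open>Either root and \<open>b\<close> do not cancel, and \<open>LM_sum\<close> applies to
  their difference; or they are close, and \<open>near_root\<close> presents the difference as a
  quotient of functions already known.\<close>

lemma LM_root_diff:
 assumes Q: "fring G" and A: "pfam G D A" and l: "l < l'" and e: "0 < ee" and k0: "ep k0 < ee"
  and tm: "tame G G'" and b: "b:G'" and V: "!!z. z:V ==> EX ta. Lab (A z) l l' k0 ka ee ta"
 shows "LMA G k V (%z. troot (A z) l l' k0 ka ee-b z)"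
proof -
 let ?T = "%z. troot (A z) l l' k0 ka ee"
 have G': "fring G'" "G <= G'" and LG: "!!h k. h:G' ==> LMA G k V h"
  using tm LM_dom[OF _ subset_UNIV] unfolding tame_def by blast+
 define h where "h i = (if i = (0::nat) then ?T else (%z. - b z))" for i
 have hL: "LMA G k V (h i)" for i k
  using troot_LM(2)[OF Q A l e k0] LG[OF fring_neg[OF G'(1) b]] by (cases "i = 0") (simp_all add: h_def)
 obtain K where K: "ep K < ee*ep k" using ep_ex[of "ee*ep k"] e by auto
 note S = LM_sum[of "{0,1}" G V h "ep K", OF _ hL ep_pos]
 have w: "(SUM i:{0,1}. h i z) = ?T z-b z" for z by (simp add: h_def)
 define S where "S = {z. ALL i:{0,1}. ep K*nm (h i z) <= nm (?T z-b z)}"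
 show ?thesis
 proof (rule LM_split[of _ _ S])
  show "det (BasA G) V (%z. z:S)" using S(1) unfolding w S_def by simp
  have "V Int S = {z:V. ALL i:{0,1}. ep K*nm (h i z) <= nm (?T z-b z)}" by (auto simp: S_def)
  thus "LMA G k (V Int S) (%z. ?T z-b z)" using S(2)[of k] unfolding w by simp
  have pA: "pfam G' D A" by (rule pfam_mono[OF A G'(2)]) simp
  show "LMA G k (V-S) (%z. ?T z-b z)"
  proof (rule LM_quot)
   show "LMA G k (V-S) (%z. - poly (A z) (b z))"
    by (rule LM_dom[OF LG]) (intro fring_neg pfam_eval[OF G'(1) b pA] G', simp)
   show "LMA G k (V-S) (%z. tay (A z) (b z) 1)"
    by (rule LM_dom[OF LG]) (intro pfam_tay[OF G'(1) b pA], simp)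
   fix z assume z: "z:V-S"
   hence L: "Lab (A z) l l' k0 ka ee (?T z)" using V troot_Lab by blast
   have nS: "nm (?T z-b z) < ep K*nm (?T z) | nm (?T z-b z) < ep K*nm (b z)"
    using z by (auto simp: S_def h_def not_le)
   have cl: "nm (?T z-b z) < ep K*nm (?T z)"
   proof (rule ccontr)
    assume n: "~ nm (?T z-b z) < ep K*nm (?T z)"
    hence 1: "nm (?T z-b z) < ep K*nm (b z)" using nS by blast
    also have "... <= 1*nm (b z)" using ep_le1 by (intro mult_right_mono) auto
    finally have "nm (b z-?T z) < nm (b z)" by (simp add: nm_minus_commute)
    hence "nm (?T z) = nm (b z)" by (rule nm_close)
    thus False using 1 n by simp
   qed
   show "nm (tay (A z) (b z) 1) ~= 0 & nm (tay (A z) (b z) 1*(?T z-b z)) = nm (- poly (A z) (b z)) &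
    nm (tay (A z) (b z) 1*(?T z-b z) - - poly (A z) (b z)) <= ep k*nm (- poly (A z) (b z))"
    using near_root[OF L l e cl less_imp_le[OF K] ep_le1] by blast
  qed
 qed
qed

text \<open>Pseudo-division by a polynomial of true degree \<open>e\<close>. At a root of the
  divisor the value of \<open>R\<close> is obtained, up to a power of the leading coefficient, from
  a polynomial of degree below \<open>e\<close>; this drop makes the induction on the degree
  possible.\<close>

lemma pseudo_rem:
 assumes Q: "fring G" and p: "pfam G D p" and e: "e >= 1"
 shows "pfam G B R ==> EX N R'. pfam G (e-1) R' &
  (ALL z y. (ALL i>e. nm (coeff (p z) i) = 0) --> nm (poly (p z) y) = 0 -->
   eqv (coeff (p z) e^N*poly (R z) y) (poly (R' z) y))"
proof (induction B arbitrary: R)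
 case 0
 hence "pfam G (e-1) R" by (rule pfam_mono) auto
 thus ?case by (intro exI[of _ 0] exI[of _ R]) simp
next
 case (Suc B)
 show ?case
 proof (cases "Suc B < e")
  case True
  hence "pfam G (e-1) R" using Suc.prems by (elim pfam_mono) auto
  thus ?thesis by (intro exI[of _ 0] exI[of _ R]) simp
 next
  case False
  \<comment> \<open>The coefficients above \<open>e\<close> are null at the points considered but
    need not be zero, so they are cut off before dividing.\<close>
  define ptr where "ptr z = (SUM i<=e. monom (coeff (p z) i) i)" for z
  have cp: "coeff (ptr z) i = (if i <= e then coeff (p z) i else 0)" for z i
   by (simp add: ptr_def coeff_sum coeff_monom sum.delta)
  define R1 where "R1 z = smult (coeff (p z) e) (R z)-monom (coeff (R z) (Suc B)) (Suc B-e)*ptr z" for z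
  have c1: "coeff (R1 z) i = coeff (p z) e*coeff (R z) i -
    (if Suc B-e <= i then coeff (R z) (Suc B)*coeff (ptr z) (i-(Suc B-e)) else 0)" for z i
   by (simp add: R1_def coeff_monom_mult)
  have "pfam G B R1"
  proof (rule pfamI)
   fix z
   show "degree (R1 z) <= B"
   proof (rule degree_le, intro allI impI)
    fix i assume i: "B < i"
    show "coeff (R1 z) i = 0"
    proof (cases "i = Suc B")
     case True thus ?thesis using False by (simp add: c1 cp mult.commute)
    next
     case F: False
     hence "degree (R z) < i" using pfam_deg[OF Suc.prems, of z] i by linarith
     moreover have "~ i-(Suc B-e) <= e" using F i False by linarith
     ultimately show ?thesis by (simp add: c1 cp coeff_eq_0)
    qed
   qed
  next
   fix i
   have "(%z. coeff (ptr z) j):G" for j using pfam_coeff[OF p] fring_0[OF Q] by (cases "j <= e") (simp_all add: cp)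
   hence "(%z. coeff (R z) (Suc B)*coeff (ptr z) (i-(Suc B-e))):G"
    by (intro fring_mult Q pfam_coeff[OF Suc.prems])
   hence "(%z. (if Suc B-e <= i then coeff (R z) (Suc B)*coeff (ptr z) (i-(Suc B-e)) else 0)):G"
    using fring_0[OF Q] by (cases "Suc B-e <= i") simp_all
   thus "(%z. coeff (R1 z) i):G" unfolding c1
    by (intro fring_diff fring_mult Q pfam_coeff[OF p] pfam_coeff[OF Suc.prems])
  qed
  then obtain N R' where R': "pfam G (e-1) R'"
   "!!z y. (ALL i>e. nm (coeff (p z) i) = 0) ==> nm (poly (p z) y) = 0 ==>
    eqv (coeff (p z) e^N*poly (R1 z) y) (poly (R' z) y)" using Suc.IH by blast
  show ?thesis
  proof (intro exI[of _ "Suc N"] exI[of _ R'] conjI R'(1) allI impI)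
   fix z y assume a: "ALL i>e. nm (coeff (p z) i) = 0" and b: "nm (poly (p z) y) = 0"
   define M where "M = max (degree (p z)) e"
   have "poly (p z) y = (SUM i<=M. coeff (p z) i*y^i)" by (rule poly_sum_le) (simp add: M_def)
   moreover have "degree (ptr z) <= M" by (rule degree_le) (simp add: cp M_def)
   hence "poly (ptr z) y = (SUM i<=M. coeff (ptr z) i*y^i)" by (rule poly_sum_le)
   moreover have "eqv (SUM i<=M. coeff (ptr z) i*y^i) (SUM i<=M. coeff (p z) i*y^i)"
    by (intro eqv_sum eqv_mult eqv_refl) (use a in "auto simp: cp eqv_0 intro: eqv_sym")
   ultimately have "eqv (poly (ptr z) y) 0" using b eqv_0 eqv_trans by metis
   hence "eqv (poly (monom (coeff (R z) (Suc B)) (Suc B-e)) y*poly (ptr z) y) (poly (monom (coeff (R z) (Suc B)) (Suc B-e)) y*0)"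
    by (intro eqv_mult eqv_refl)
   hence "eqv (poly (R1 z) y) (coeff (p z) e*poly (R z) y-0)"
    unfolding R1_def poly_diff poly_smult poly_mult by (intro eqv_diff eqv_refl) simp
   hence "eqv (coeff (p z) e^N*poly (R1 z) y) (coeff (p z) e^N*(coeff (p z) e*poly (R z) y))"
    by (intro eqv_mult eqv_refl) simp
   hence "eqv (coeff (p z) e^Suc N*poly (R z) y) (coeff (p z) e^N*poly (R1 z) y)"
    by (simp add: eqv_sym mult.assoc mult.left_commute)
   thus "eqv (coeff (p z) e^Suc N*poly (R z) y) (poly (R' z) y)"
    using R'(2)[OF a b] eqv_trans by blast
  qed
 qed
qed

section \<open>Cell decomposition in one variable\<close>

lemma Lab_lead: assumes "Lab A l l' k ka ee ta" "l < l'" "degree A <= D"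
 shows "EX e:{1..D}. nm (coeff A e) ~= 0 & (ALL i>e. nm (coeff A i) = 0)"
proof -
 define S where "S = {i. i <= D & nm (coeff A i) ~= 0}"
 have fin: "finite S" by (simp add: S_def)
 have nz: "nm (coeff A l') ~= 0" by (rule Lab_nz[OF assms(1,2)])
 hence "l' <= D" using coeff_eq_0[of A l'] assms(3) by (metis nm_zero not_le order_le_less_trans)
 hence l: "l':S" using nz by (simp add: S_def)
 define e where "e = Max S"
 have "e:S" unfolding e_def using Max_in[OF fin] l by blast
 moreover have "l' <= e" unfolding e_def by (rule Max_ge[OF fin l])
 moreover have "nm (coeff A i) = 0" if "i > e" for i
 proof (rule ccontr)
  assume n: "nm (coeff A i) ~= 0"
  hence "i <= D" using coeff_eq_0[of A i] assms(3) by (metis nm_zero not_le order_le_less_trans)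
  hence "i:S" using n by (simp add: S_def)
  thus False using Max_ge[OF fin] that unfolding e_def by fastforce
 qed
 ultimately show ?thesis using assms(2) by (intro bexI[of _ e]) (auto simp: S_def)
qed

definition good :: "'r => 'r poly => real => 'r => bool" where
 "good c p ee y <-> (ALL i. ee*nm (tay p c i*(y-c)^i) <= nm (poly p y))"

text \<open>Cell decomposition in one variable: over a tame extension finitely many centers suffice so
  that at each point no cancellation occurs in one of the Taylor expansions.\<close>

definition CD :: "'z itself => nat => bool" where
 "CD t D <-> (ALL (G :: ('z => 'r) set) Ps. fring G --> finite Ps --> (ALL p:Ps. pfam G D p) -->
   (EX G' C ee. tame G G' & finite C & C <= G' & 0 < ee &
    (ALL z y. EX c:C. ALL p:Ps. good (c z) (p z) ee y)))"

text \<open>Here the induction on the degree is used. A pseudo-remainder modulo \<open>A\<close> has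
  degree at most \<open>D\<close>, so the decomposition for \<open>D\<close> supplies centers
  \<open>c\<close> at which its expansion does not cancel. The terms of the expansion involve the
  root only through its distance to \<open>c\<close>, which \<open>LM_root_diff\<close>
  handles.\<close>

lemma LM_root_poly:
 assumes CD: "CD TYPE('z) D" and Q: "fring (G :: ('z => 'r) set)" and A: "pfam G (Suc D) A" and l: "l < l'"
  and e: "0 < ee" and k0: "ep k0 < ee" and R: "pfam G B R"
 shows "LMA G k UNIV (%z. poly (R z) (troot (A z) l l' k0 ka ee))"
proof -
 let ?T = "%z. troot (A z) l l' k0 ka ee"
 define Dm where "Dm = {z. EX ta. Lab (A z) l l' k0 ka ee ta}"
 show ?thesis
 proof (rule LM_split[of _ _ Dm])
  show "det (BasA G) UNIV (%z. z:Dm)" unfolding Dm_def mem_Collect_eq by (rule troot_LM(1)[OF Q A l e k0])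
  have "LMA G k (UNIV-Dm) (%z. poly (R z) 0)"
   by (intro LM_gen pfam_eval[OF Q _ R] fring_0[OF Q])
  thus "LMA G k (UNIV-Dm) (%z. poly (R z) (?T z))"
   by (rule LM_cong) (simp add: Dm_def troot_def)
  \<comment> \<open>Fixing which coefficients are null makes the true degree \<open>e0\<close>
    constant on each piece.\<close>
  define F where "F z = (\<lambda>i\<in>{..Suc D}. nm (coeff (A z) i) = 0)" for z
  have F: "det (BasA G) (UNIV Int Dm) F" unfolding F_def
   by (intro det_restrict finite_atMost LM_zero_det[OF LM_gen[OF pfam_coeff[OF A], where k = 0]])
  show "LMA G k (UNIV Int Dm) (%z. poly (R z) (?T z))"
  proof (rule LM_glue[OF F])
   fix a assume "a:F ` (UNIV Int Dm)"
   then obtain z0 where z0: "z0:Dm" "a = F z0" by blast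
   define W where "W = {z:UNIV Int Dm. F z = a}"
   have WL: "EX ta. Lab (A z) l l' k0 ka ee ta" if "z:W" for z using that by (simp add: W_def Dm_def)
   obtain e0 where e0: "e0:{1..Suc D}" "nm (coeff (A z0) e0) ~= 0" "ALL i>e0. nm (coeff (A z0) i) = 0"
    using Lab_lead[OF _ l pfam_deg[OF A]] z0(1) unfolding Dm_def by blast
   have zi: "nm (coeff (A z) i) = 0 <-> nm (coeff (A z0) i) = 0" if "z:W" for z i
   proof (cases "i <= Suc D")
    case True
    have "F z = F z0" using that z0 by (simp add: W_def)
    hence "F z i = F z0 i" by simp
    thus ?thesis using True by (simp add: F_def)
   next
    case False
    hence "degree (A z) < i" "degree (A z0) < i" using pfam_deg[OF A] by (meson not_le order_le_less_trans)+
    thus ?thesis by (simp add: coeff_eq_0)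
   qed
   obtain N R' where R': "pfam G (e0-1) R'" and Re: "!!z y. (ALL i>e0. nm (coeff (A z) i) = 0) ==> nm (poly (A z) y) = 0 ==>
     eqv (coeff (A z) e0^N*poly (R z) y) (poly (R' z) y)"
    using pseudo_rem[OF Q A _ R, of e0] e0(1) unfolding atLeastAtMost_iff by blast
   have R'D: "pfam G D R'" by (rule pfam_mono[OF R' order_refl]) (use e0 in auto)
   obtain G' C ee' where tm: "tame G G'" and C: "finite C" "C <= G'" and e': "0 < ee'"
    and cov: "!!z y. EX c:C. ALL p:{R'}. good (c z) (p z) ee' y"
    using CD[unfolded CD_def, rule_format, of G "{R'}"] Q R'D by auto
   have G': "fring G'" "G <= G'" using tm by (auto simp: tame_def)
   have LG: "LMA G k V h" if "h:G'" for h k V using tm that LM_dom[OF _ subset_UNIV] unfolding tame_def by blast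
   have R'G: "pfam G' D R'" by (rule pfam_mono[OF R'D G'(2)]) simp
   have L1: "LMA G k W (%z. poly (R' z) (?T z))" for k
   proof (rule LM_cover[OF C(1), where S = "%c. {z. ALL i:{..D}. ee'*nm (tay (R' z) (c z) i*(?T z-c z)^i) <= nm (poly (R' z) (?T z))}"])
    show "W <= (UN c:C. {z. ALL i:{..D}. ee'*nm (tay (R' z) (c z) i*(?T z-c z)^i) <= nm (poly (R' z) (?T z))})"
     using cov unfolding good_def by fastforce
   next
    fix c assume c: "c:C"
    hence cG: "c:G'" using C by blast
    define h where "h i z = tay (R' z) (c z) i*(?T z-c z)^i" for i z
    have hL: "LMA G k W (h i)" for i k unfolding h_def
     by (intro LM_mult LM_power LG pfam_tay[OF G'(1) cG R'G] LM_root_diff[OF Q A l e k0 tm cG WL])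
    have w: "(SUM i:{..D}. h i z) = poly (R' z) (?T z)" for z
     unfolding h_def by (rule poly_tay[symmetric]) (rule pfam_deg[OF R'D])
    note S = LM_sum[of "{..D}" G W h ee', OF finite_atMost hL e', unfolded w]
    show "det (BasA G) W (%z. z:{z. ALL i:{..D}. ee'*nm (tay (R' z) (c z) i*(?T z-c z)^i) <= nm (poly (R' z) (?T z))})"
     using S(1) by (simp add: h_def)
    have "W Int {z. ALL i:{..D}. ee'*nm (tay (R' z) (c z) i*(?T z-c z)^i) <= nm (poly (R' z) (?T z))}
     = {z:W. ALL i:{..D}. ee'*nm (h i z) <= nm (poly (R' z) (?T z))}" by (auto simp: h_def)
    thus "LMA G k (W Int {z. ALL i:{..D}. ee'*nm (tay (R' z) (c z) i*(?T z-c z)^i) <= nm (poly (R' z) (?T z))}) (%z. poly (R' z) (?T z))"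
     using S(2)[of k] by simp
   qed
   have "LMA G k W (%z. poly (R z) (?T z))"
   proof (rule LM_quot[OF L1])
    show "LMA G k W (%z. coeff (A z) e0^N)" by (intro LM_power LM_gen pfam_coeff[OF A])
    fix z assume z: "z:W"
    have nz: "nm (coeff (A z) e0) ~= 0" using zi[OF z] e0 by simp
    have "nm (poly (A z) (?T z)) = 0" by (rule LabD(6)[OF troot_Lab[OF WL[OF z]]])
    hence q: "eqv (coeff (A z) e0^N*poly (R z) (?T z)) (poly (R' z) (?T z))"
     by (rule Re[rotated]) (use zi[OF z] e0 in simp)
    show "nm (coeff (A z) e0^N) ~= 0 & nm (coeff (A z) e0^N*poly (R z) (?T z)) = nm (poly (R' z) (?T z)) &
     nm (coeff (A z) e0^N*poly (R z) (?T z)-poly (R' z) (?T z)) <= ep k*nm (poly (R' z) (?T z))"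
     using nz eqv_nm[OF q] q by (simp add: nm_power eqv_def less_imp_le)
   qed
   thus "LMA G k {z:UNIV Int Dm. F z = a} (%z. poly (R z) (?T z))" by (simp add: W_def)
  qed
 qed
qed

lemma pfam_tlr: assumes "fring G" "c:G" "pfam G D p" shows "pfam G D (%z. tlr (p z) (c z))"
proof (rule pfamI)
 show "degree (tlr (p z) (c z)) <= D" for z using degree_tlr[of "p z" "c z"] pfam_deg[OF assms(3), of z] by linarith
qed (simp add: coeff_tlr pfam_tay[OF assms])

lemma pfam_const: "fring G ==> f:G ==> pfam G 0 (%z. [:f z:])"
proof (rule pfamI)
 fix i assume "fring G" "f:G"
 thus "(%z. coeff [:f z:] i):G" by (cases i) (simp_all add: fring_0)
qed simp

lemma pfam_add: assumes "fring G" "pfam G m p" "pfam G n q" shows "pfam G (max m n) (%z. p z+q z)"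
proof (rule pfamI)
 show "degree (p z+q z) <= max m n" for z
  using degree_add_le_max[of "p z" "q z"] pfam_deg[OF assms(2), of z] pfam_deg[OF assms(3), of z] by linarith
qed (simp add: fring_add assms pfam_coeff[OF assms(2)] pfam_coeff[OF assms(3)])

lemma pfam_neg: assumes "fring G" "pfam G m p" shows "pfam G m (%z. - p z)"
 by (rule pfamI) (simp_all add: pfam_deg[OF assms(2)] fring_neg assms pfam_coeff[OF assms(2)])

lemma pfam_mult: assumes "fring G" "pfam G m p" "pfam G n q" shows "pfam G (m+n) (%z. p z*q z)"
proof (rule pfamI)
 show "degree (p z*q z) <= m+n" for z
  using degree_mult_le[of "p z" "q z"] pfam_deg[OF assms(2), of z] pfam_deg[OF assms(3), of z] by linarith
 show "(%z. coeff (p z*q z) i):G" for i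
  unfolding coeff_mult by (intro fring_sum fring_mult assms pfam_coeff[OF assms(2)] pfam_coeff[OF assms(3)])
qed

text \<open>The new ring consists of all polynomial expressions in the root function with
  coefficients in \<open>G\<close>; its tameness is \<open>LM_root_poly\<close>.\<close>

lemma adjoin_root:
 assumes CD: "CD TYPE('z) D" and Q: "fring (G :: ('z => 'r) set)" and p: "pfam G (Suc D) p" and c: "c:G"
  and l: "l < l'" and e: "0 < ee" and k0: "ep k0 < ee"
 shows "EX G'. tame G G' & (%z. c z+troot (tlr (p z) (c z)) l l' k0 ka ee):G'"
proof -
 let ?A = "%z. tlr (p z) (c z)"
 let ?T = "%z. troot (?A z) l l' k0 ka ee"
 define G' where "G' = {(%z. poly (R z) (?T z)) | R B. pfam G B R}"
 have G'I: "(%z. poly (R z) (?T z)):G'" if "pfam G B R" for R B using that by (auto simp: G'_def)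
 have sub: "G <= G'"
 proof
  fix f assume "f:G"
  thus "f:G'" using G'I[OF pfam_const[OF Q]] by fastforce
 qed
 have "fring G'" unfolding fring_def
 proof (intro conjI ballI)
  show "(%z. 0):G'" "(%z. 1):G'" using sub fring_0[OF Q] fring_1[OF Q] by auto
  fix f g assume "f:G'" "g:G'"
  then obtain R B R' B' where R: "f = (%z. poly (R z) (?T z))" "pfam G B R" "g = (%z. poly (R' z) (?T z))" "pfam G B' R'"
   by (auto simp: G'_def)
  show "(%z. f z+g z):G'" using G'I[OF pfam_add[OF Q R(2,4)]] by (simp add: R)
  show "(%z. f z*g z):G'" using G'I[OF pfam_mult[OF Q R(2,4)]] by (simp add: R)
  show "(%z. - f z):G'" using G'I[OF pfam_neg[OF Q R(2)]] by (simp add: R)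
 qed
 moreover have "LMA G k UNIV h" if "h:G'" for h k
  using that LM_root_poly[OF CD Q pfam_tlr[OF Q c p] l e k0] by (auto simp: G'_def)
 ultimately have tm: "tame G G'" using sub by (simp add: tame_def)
 have "pfam G 1 (%z. [:c z, 1:])"
 proof (rule pfamI)
  fix i show "(%z. coeff [:c z, 1:] i):G"
  proof -
   consider "i = 0" | "i = Suc 0" | j where "i = Suc (Suc j)" by (metis nat.exhaust)
   thus ?thesis by cases (simp_all add: c fring_0[OF Q] fring_1[OF Q])
  qed
 qed simp
 hence "(%z. poly [:c z, 1:] (?T z)):G'" by (rule G'I)
 thus ?thesis using tm by auto
qed

lemma adjoin_roots:
 assumes CD: "CD TYPE('z) D" and e: "0 < ee" and k0: "ep k0 < ee" and I: "finite I"
 shows "fring (G :: ('z => 'r) set) ==> pfam G (Suc D) p ==> (!!i. i:I ==> c i:G & l i < l' i) ==>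
  EX G'. tame G G' & (ALL i:I. (%z. c i z+troot (tlr (p z) (c i z)) (l i) (l' i) k0 (ka i) ee):G')"
 using I
proof (induction I)
 case empty
 thus ?case using tame_refl by blast
next
 case (insert i I)
 then obtain G1 where 1: "tame G G1" "ALL i:I. (%z. c i z+troot (tlr (p z) (c i z)) (l i) (l' i) k0 (ka i) ee):G1"
  by blast
 have G1: "fring G1" "G <= G1" using 1(1) by (auto simp: tame_def)
 have "pfam G1 (Suc D) p" by (rule pfam_mono[OF insert.prems(2) G1(2)]) simp
 moreover have "c i:G1" "l i < l' i" using insert.prems(3)[of i] G1(2) by auto
 ultimately obtain G2 where 2: "tame G1 G2" "(%z. c i z+troot (tlr (p z) (c i z)) (l i) (l' i) k0 (ka i) ee):G2"
  using adjoin_root[OF CD G1(1) _ _ _ e k0] by blast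
 have "G1 <= G2" using 2(1) by (simp add: tame_def)
 thus ?case using 1(2) 2(2) tame_trans[OF 1(1) 2(1)] by (intro exI[of _ G2]) blast
qed

text \<open>The new center lies on the boundary of the disc around \<open>c\<close> that reaches to
  \<open>y\<close>. Expansions at two centers in one disc have the same Gauss norm, so polynomials
  without cancellation at the old center have none at the new one.\<close>

lemma good_keep:
 assumes g: "good c q ee y" and e: "0 < ee" and t: "nm ta = nm (y-c)" "nm ta > 0" "nm (y-(c+ta)) <= nm ta"
 shows "good (c+ta) q ee y"
proof -
 define M where "M = nm (poly q y)/ee"
 have "bnd (nm ta) M (tlr q c)" unfolding bnd_def
 proof
  fix i
  have "ee*(nm (tay q c i)*nm ta^i) <= nm (poly q y)" using g t(1) unfolding good_def nm_mult nm_power by simp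
  thus "nm (coeff (tlr q c) i)*nm ta^i <= M" using e by (simp add: coeff_tlr M_def field_simps)
 qed
 hence "bnd (nm ta) M (tlr (tlr q c) ta)" using t(2) by (rule bnd_tlr[OF _ order_refl])
 hence b: "nm (tay q (c+ta) i)*nm ta^i <= M" for i by (simp add: bnd_def tlr_tlr coeff_tlr)
 show ?thesis unfolding good_def
 proof
  fix i
  have "nm (tay q (c+ta) i)*nm (y-(c+ta))^i <= nm (tay q (c+ta) i)*nm ta^i"
   using t(3) by (intro mult_left_mono power_mono) auto
  hence "nm (tay q (c+ta) i*(y-(c+ta))^i) <= M" using b[of i] by (simp add: nm_mult nm_power)
  thus "ee*nm (tay q (c+ta) i*(y-(c+ta))^i) <= nm (poly q y)" using e by (simp add: M_def field_simps)
 qed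
qed

text \<open>If the derivative does not cancel at \<open>y\<close> but \<open>p\<close> does, then
  \<open>p\<close> is small there compared with its derivative, and Hensel's lemma produces a root
  near \<open>y\<close>. That root is labelled, and in the expansion at the root the linear term
  dominates, so there is no cancellation at all.\<close>

lemma new_center:
 assumes n: "degree p <= n" and e: "0 < ee" and nu: "0 < nv" "!!i. 1 <= i ==> i <= n ==> nv <= nm (of_nat i)"
  and gd: "good c (dpoly p) ee y" and ng: "~ good c p dl y" and d: "0 < dl" "dl < (ee*nv)\<^sup>2" "dl <= 1"
 shows "EX ta l l'. l < l' & l' <= n & Lab (tlr p c) l l' k (ac k ta) (ee*nv) ta & nm ta = nm (y-c) & nm ta > 0 &
   nm (y-(c+ta)) <= nm ta & good (c+ta) p 1 y"
proof -
 define ee1 where "ee1 = ee*nv"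
 have e1: "ee1 > 0" "dl < ee1*ee1" using e nu d by (auto simp: ee1_def power2_eq_square)
 define a where "a = tay p c"
 define rh where "rh = nm (y-c)"
 define m where "m = Max ((%i. nm (a i)*rh^i) ` {..n})"
 have fi: "finite ((%i. nm (a i)*rh^i) ` {..n})" "(%i. nm (a i)*rh^i) ` {..n} ~= {}" by auto
 have big: "a i = 0" if "i > n" for i using tay_big[of p i c] that n by (simp add: a_def)
 have am0: "nm (a i)*rh^i <= m" if "i <= n" for i unfolding m_def using that by (intro Max_ge fi) auto
 have m0: "0 <= m" using am0[of 0] nm_ge0[of "a 0"] by (simp add: order_trans[OF nm_ge0])
 have am: "nm (a i)*rh^i <= m" for i using am0[of i] big[of i] m0 by (cases "i <= n") auto
 obtain j0 where j0: "j0 <= n" "nm (a j0)*rh^j0 = m" using Max_in[OF fi] unfolding m_def by (metis (no_types, lifting) atMost_iff imageE)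
 obtain i1 where i1: "nm (poly p y) < dl*nm (a i1*(y-c)^i1)" using ng by (auto simp: good_def a_def not_le)
 have "dl*nm (a i1*(y-c)^i1) <= dl*m" using am[of i1] d by (intro mult_left_mono) (auto simp: nm_mult nm_power rh_def)
 hence pd: "nm (poly p y) < dl*m" using i1 by linarith
 have mp: "m > 0" using pd d nm_ge0[of "poly p y"] by (metis less_eq_real_def m0 mult_zero_right not_less)
 have dm: "dl*m <= m" using d mp by simp
 have sum: "poly p x = (SUM i<=n. a i*(x-c)^i)" for x unfolding a_def by (rule poly_tay[OF n])
 \<comment> \<open>A value below \<open>m\<close> forces at least two terms of maximal norm. Applied
   at \<open>y\<close> this gives a maximal term of positive degree; applied at the root it gives
   the two indices of the label.\<close>
 have mlt: "nm (poly p x) < m ==> nm (x-c) = rh ==> i <= n ==> nm (a i)*rh^i = m ==>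
   EX j<=n. j ~= i & nm (a j)*rh^j = m" for x i
 proof (rule ccontr)
  assume x: "nm (poly p x) < m" "nm (x-c) = rh" and i: "i <= n" "nm (a i)*rh^i = m"
   and "~ (EX j<=n. j ~= i & nm (a j)*rh^j = m)"
  hence lt: "nm (a j)*rh^j < m" if "j <= n" "j ~= i" for j using am[of j] that by force
  have "nm (SUM j:{..n}-{i}. a j*(x-c)^j) < m"
   by (rule nm_sum_less) (use lt mp in "auto simp: nm_mult nm_power x(2)")
  moreover have "poly p x = a i*(x-c)^i+(SUM j:{..n}-{i}. a j*(x-c)^j)"
   unfolding sum using i by (subst sum.remove[of _ i]) auto
  moreover have "nm (a i*(x-c)^i) = m" using i x by (simp add: nm_mult nm_power)
  ultimately have "nm (poly p x) = m" using nm_add_dom by metis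
  thus False using x by simp
 qed
 have pm: "nm (poly p y) < m" using pd dm by linarith
 \<comment> \<open>A maximal term of positive degree bounds the derivative from below; the factor
   \<open>nv\<close> accounts for the integer \<open>i\<close> produced by differentiation.\<close>
 obtain i where i: "1 <= i" "i <= n" "nm (a i)*rh^i = m"
 proof (cases "j0 = 0")
  case True
  thus thesis using mlt[OF pm _ j0] that by (metis rh_def less_one not_less)
 next
  case False thus thesis using j0 that by (metis less_one not_less)
 qed
 have rp: "rh > 0"
 proof (rule ccontr)
  assume "~ rh > 0"
  hence r0: "rh = 0" using nm_ge0[of "y-c"] by (simp add: rh_def)
  thus False using i mp by (simp add: power_0_left)
 qed
 define B where "B = tlr p y"
 have tA: "bnd rh m (tlr p c)" using am by (simp add: bnd_def coeff_tlr a_def)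
 have "bnd rh m (tlr (tlr p c) (y-c))" by (rule bnd_tlr[OF tA _ rp]) (simp add: rh_def)
 hence bB: "bnd rh m B" by (simp add: tlr_tlr B_def)
 have d1: "ee1*m <= nm (coeff B 1)*rh"
 proof -
  obtain j where j: "i = Suc j" using i(1) by (cases i) auto
  have "ee*(nm (of_nat (Suc j))*nm (a (Suc j))*rh^j) <= nm (poly (dpoly p) y)"
   using gd unfolding good_def tay_dpoly by (simp only: nm_mult nm_power a_def rh_def)
  hence "ee*(nm (of_nat (Suc j))*nm (a (Suc j))*rh^j)*rh <= nm (poly (dpoly p) y)*rh"
   using rp by (intro mult_right_mono) auto
  moreover have "ee*(nm (of_nat (Suc j))*nm (a (Suc j))*rh^j)*rh = ee*nm (of_nat i)*m"
   unfolding i(3)[symmetric] j power_Suc by (simp only: ac_simps)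
  moreover have "ee*nv*m <= ee*nm (of_nat i)*m" using nu(2)[OF i(1,2)] e mp by simp
  ultimately show ?thesis unfolding ee1_def B_def coeff_tlr_1 poly_dpoly by linarith
 qed
 have e11: "ee1 <= 1"
 proof -
  have "ee1*m <= 1*m" using d1 bnd_coeff1[OF bB] by linarith
  thus ?thesis using mp by (simp only: mult_le_cancel_right_pos)
 qed
 have "EX h. nm h <= dl/ee1*rh & nm (poly B h) = 0"
  by (rule hensel[OF bB rp mp e1(1) _ d1]) (use pd e1 in "auto simp: B_def coeff_tlr_0 power2_eq_square")
 then obtain h where h: "nm h <= dl/ee1*rh" "nm (poly p (y+h)) = 0" by (auto simp: B_def poly_tlr)
 have de: "dl/ee1 < ee1" "dl/ee1 < 1" proof -
  show "dl/ee1 < ee1" using e1 by (simp add: divide_less_eq)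
  thus "dl/ee1 < 1" using e11 by linarith
 qed
 have hr: "nm h < rh"
 proof -
  have "dl/ee1*rh < 1*rh" using de(2) rp by (rule mult_strict_right_mono)
  thus ?thesis using h(1) by simp
 qed
 define ta where "ta = y-c+h"
 have nt: "nm ta = rh" unfolding ta_def using nm_add_dom[of h "y-c"] hr by (simp add: rh_def)
 have ct: "c+ta = y+h" by (simp add: ta_def)
 obtain j where j: "j <= n" "j ~= j0" "nm (a j)*rh^j = m"
  using mlt[of "y+h", OF _ _ j0] h(2) mp nt by (auto simp: ta_def algebra_simps)
 define l l' where "l = min j j0" and "l' = max j j0"
 have ll: "l < l'" "l' <= n" "nm (a l)*rh^l = m" "nm (a l')*rh^l' = m"
  using j j0 by (auto simp: l_def l'_def min_def max_def)
 have "nm (tay B h 1-coeff B 1)*rh <= m*(dl/ee1*rh/rh)"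
  using de(2) rp d e1 by (intro bnd_deriv_close[OF bB h(1) _ rp]) (auto simp: divide_le_eq mult_right_mono)
 also have "... = m*(dl/ee1)" using rp by simp
 also have "... < m*ee1" using de(1) mp by (rule mult_strict_left_mono)
 also have "... <= nm (coeff B 1)*rh" using d1 by (simp add: mult.commute)
 finally have "nm (coeff B 1-tay B h 1) < nm (coeff B 1)" using rp by (simp add: nm_minus_commute)
 hence "nm (tay B h 1) = nm (coeff B 1)" by (rule nm_close)
 hence dt: "ee1*m <= nm (tay p (y+h) 1)*rh" using d1 by (simp add: B_def tay_tlr)
 have L: "Lab (tlr p c) l l' k (ac k ta) ee1 ta"
  unfolding Lab_def using ll am mp dt h(2) ct
  by (auto simp: coeff_tlr nm_mult nm_power nt tay_tlr poly_tlr a_def[symmetric])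
 define u where "u = y-(c+ta)"
 have u: "u = - h" by (simp add: u_def ct)
 define Cp where "Cp = tlr p (c+ta)"
 have "bnd rh m (tlr (tlr p c) ta)" by (rule bnd_tlr[OF tA _ rp]) (simp add: nt)
 hence bC: "bnd rh m Cp" by (simp add: tlr_tlr Cp_def)
 have C0: "nm (coeff Cp 0) = 0" using h(2) by (simp add: Cp_def coeff_tlr_0 ct)
 have C1: "ee1*m <= nm (coeff Cp 1)*rh" using dt by (simp add: Cp_def coeff_tlr_1 ct)
 define et where "et = nm h/rh"
 have eta: "0 <= et" "et <= dl/ee1" "et < 1" using h(1) hr rp by (auto simp: et_def divide_le_eq)
 have py: "poly p y = poly Cp u" by (simp add: Cp_def poly_tlr u_def)
 have nu': "nm u = nm h" by (simp add: u)
 have tl: "nm (poly Cp u-coeff Cp 0-coeff Cp 1*u) <= m*et\<^sup>2"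
  using bnd_tail[OF bC, of u "nm h"] hr rp nu' by (simp add: et_def)
 have g1: "good (c+ta) p 1 y"
 proof (cases "nm h = 0")
  case True
  have "nm (tay p (c+ta) i*(y-(c+ta))^i) = 0" for i
   using C0 True by (cases "i = 0") (simp_all add: Cp_def coeff_tlr nm_mult nm_power nu' u_def[symmetric])
  thus ?thesis by (simp add: good_def)
 next
  case False
  hence hp: "nm h > 0" by (rule nm_pos)
  hence ep: "et > 0" using rp by (simp add: et_def)
  \<comment> \<open>The distance from the root is at most \<open>dl/ee1\<close> relative to
    \<open>rh\<close>, which is less than \<open>ee1\<close>, so the quadratic tail is smaller than
    the linear term.\<close>
  have lt: "m*et\<^sup>2 < nm (coeff Cp 1)*nm u"
  proof -
   have "m*et\<^sup>2 = m*et*et" by (simp add: power2_eq_square)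
   also have "... <= m*(dl/ee1)*et" using eta mp by (intro mult_right_mono mult_left_mono) auto
   also have "... < m*ee1*et" by (intro mult_strict_right_mono mult_strict_left_mono de(1) mp ep)
   also have "... <= nm (coeff Cp 1)*rh*et" using C1 eta by (intro mult_right_mono) (auto simp: mult.commute)
   also have "... = nm (coeff Cp 1)*nm u" using rp by (simp add: et_def nu')
   finally show ?thesis .
  qed
  have "nm (poly Cp u-coeff Cp 1*u) <= m*et\<^sup>2"
  proof -
   have "eqv (poly Cp u-coeff Cp 0-coeff Cp 1*u) (poly Cp u-0-coeff Cp 1*u)"
    using C0 by (intro eqv_diff) (auto simp: eqv_0)
   thus ?thesis using tl eqv_nm by fastforce
  qed
  hence "nm (coeff Cp 1*u-poly Cp u) < nm (coeff Cp 1*u)" using lt by (simp add: nm_mult nm_minus_commute)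
  hence P: "nm (poly p y) = nm (coeff Cp 1)*nm u" unfolding py using nm_close nm_mult by metis
  show ?thesis unfolding good_def
  proof
   fix i :: nat
   consider "i = 0" | "i = 1" | "i >= 2" by linarith
   thus "1*nm (tay p (c+ta) i*(y-(c+ta))^i) <= nm (poly p y)"
   proof cases
    case 1 thus ?thesis using C0 by (simp add: Cp_def coeff_tlr nm_mult)
   next
    case 2 thus ?thesis using P by (simp add: Cp_def coeff_tlr nm_mult u_def)
   next
    case 3
    have "nm (tay p (c+ta) i*(y-(c+ta))^i) = (nm (coeff Cp i)*rh^i)*et^i"
     using rp by (simp add: nm_mult nm_power Cp_def coeff_tlr nu' u_def[symmetric] et_def power_divide)
    also have "... <= m*et^i" using bC eta by (intro mult_right_mono) (auto simp: bnd_def)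
    also have "... <= m*et\<^sup>2" using 3 eta mp by (intro mult_left_mono power_decreasing) auto
    finally show ?thesis using lt P by simp
   qed
  qed
 qed
 show ?thesis
  by (rule exI[of _ ta], rule exI[of _ l], rule exI[of _ l'])
    (use ll L nt rp g1 hr nu' in "auto simp: ee1_def rh_def u_def")
qed

lemma eqv_tay: "eqv c c' ==> eqv (tay p c i) (tay p c' i)"
proof (induction p arbitrary: i)
 case 0
 thus ?case by (simp add: tay_def)
next
 case (pCons a p)
 have "eqv (if i = 0 then 0 else tay p c (i-1)) (if i = 0 then 0 else tay p c' (i-1))" using pCons by simp
 thus ?case unfolding tay_pCons using pCons by (intro eqv_add eqv_mult eqv_refl)
qed

lemma good_eqv: assumes "eqv c c'" "good c p ee y" shows "good c' p ee y"
proof -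
 have "eqv (tay p c i*(y-c)^i) (tay p c' i*(y-c')^i)" for i
  using assms(1) by (intro eqv_mult eqv_power eqv_diff eqv_tay) auto
 thus ?thesis using assms(2) eqv_nm unfolding good_def by metis
qed

lemma good_mono: "good c p ee y ==> dl <= ee ==> good c p dl y"
 unfolding good_def by (meson mult_right_mono nm_ge0 order_trans)

text \<open>One polynomial is added once its derivative is already covered. The new centers are the
  old ones shifted by labelled roots, finitely many because labels are pairs of indices with an
  angular component.\<close>

lemma CD_insert:
 assumes CD: "CD TYPE('z) D" and Q: "fring (G :: ('z => 'r) set)" and p: "pfam G (Suc D) p" and dp: "(%z. dpoly (p z)):Ps"
  and old: "tame G G'" "finite C" "C <= G'" "0 < ee" "ALL z y. EX c:C. ALL q:Ps. good (c z) (q z) ee y"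
 shows "EX G' C ee. tame G G' & finite C & C <= G' & 0 < ee & (ALL z y. EX c:C. ALL q:insert p Ps. good (c z) (q z) ee y)"
proof -
 have G': "fring G'" "G <= G'" using old(1) by (auto simp: tame_def)
 \<comment> \<open>The least norm of the integers from 1 to \<open>Suc D\<close>. It is smaller than
   1 when the residue characteristic divides one of them, and it is positive because the
   characteristic is zero.\<close>
 define nv where "nv = Min (insert 1 ((%i. nm (of_nat i)) ` {1..Suc D}))"
 have nu: "0 < nv" unfolding nv_def using char0 nm_pos by (subst Min_gr_iff) auto
 have nu2: "nv <= nm (of_nat i)" if "1 <= i" "i <= Suc D" for i unfolding nv_def using that by (intro Min_le) auto
 define ee1 where "ee1 = ee*nv"
 have e1: "0 < ee1" using old(4) nu by (simp add: ee1_def)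
 \<comment> \<open>Half of \<open>ee1^2\<close> gives the strict inequality demanded by Hensel's
   lemma; cancellation in \<open>p\<close> is judged at this level.\<close>
 define dl where "dl = min (ee1\<^sup>2/2) 1"
 have d: "0 < dl" "dl < (ee*nv)\<^sup>2" "dl <= 1" using e1 by (auto simp: dl_def ee1_def min_less_iff_disj)
 obtain k where k: "ep k < ee1" using ep_ex[OF e1] by blast
 define I where "I = C \<times> {(l, l'). l < l' & l' <= Suc D} \<times> range (ac k)"
 have "finite {(l, l'). l < l' & l' <= Suc D}" by (rule finite_subset[of _ "{..Suc D} \<times> {..Suc D}"]) auto
 hence fI: "finite I" unfolding I_def using old(2) finite_range_ac by blast
 define nc where "nc = (%(c, (l, l'), ka) z. c z+troot (tlr (p z) (c z)) l l' k ka ee1)"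
 have "EX G''. tame G' G'' & (ALL i:I. (%z. fst i z+troot (tlr (p z) (fst i z)) (fst (fst (snd i))) (snd (fst (snd i))) k (snd (snd i)) ee1):G'')"
  by (rule adjoin_roots[OF CD e1 k fI G'(1) pfam_mono[OF p G'(2) order_refl]]) (use old(3) in "auto simp: I_def")
 then obtain G'' where G'': "tame G' G''" "ALL i:I. nc i:G''" by (auto simp: nc_def case_prod_beta)
 have tm: "tame G G''" by (rule tame_trans[OF old(1) G''(1)])
 have sub: "G' <= G''" using G''(1) by (simp add: tame_def)
 define ee2 where "ee2 = min (min ee dl) 1"
 have e2: "0 < ee2" "ee2 <= ee" "ee2 <= dl" "ee2 <= 1" using old(4) d by (auto simp: ee2_def)
 have cov: "EX c:C Un nc ` I. ALL q:insert p Ps. good (c z) (q z) ee2 y" for z y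
 proof -
  obtain c where c: "c:C" "ALL q:Ps. good (c z) (q z) ee y" using old(5) by blast
  show ?thesis
  proof (cases "good (c z) (p z) dl y")
   case True
   thus ?thesis using c e2 good_mono by (intro bexI[of _ c]) auto
  next
   case False
   have gd: "good (c z) (dpoly (p z)) ee y" using c(2) dp by force
   obtain ta l l' where L: "l < l'" "l' <= Suc D" "Lab (tlr (p z) (c z)) l l' k (ac k ta) ee1 ta" "nm ta = nm (y-c z)" "nm ta > 0"
     "nm (y-(c z+ta)) <= nm ta" "good (c z+ta) (p z) 1 y"
    using new_center[OF pfam_deg[OF p] old(4) nu nu2 gd False d, of k] unfolding ee1_def by blast
   define i where "i = (c, (l, l'), ac k ta)"
   have iI: "i:I" using c(1) L by (auto simp: I_def i_def)
   have "Lab (tlr (p z) (c z)) l l' k (ac k ta) ee1 (troot (tlr (p z) (c z)) l l' k (ac k ta) ee1)"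
    using L(3) by (intro troot_Lab) blast
   hence "eqv ta (troot (tlr (p z) (c z)) l l' k (ac k ta) ee1)" unfolding eqv_def by (rule Lab_unique[OF L(3) _ L(1) k])
   hence q: "eqv (c z+ta) (nc i z)" by (simp add: nc_def i_def eqv_add)
   have "good (nc i z) (q z) ee2 y" if "q:insert p Ps" for q
   proof (cases "q = p")
    case True
    thus ?thesis using good_eqv[OF q good_mono[OF L(7) e2(4)]] by simp
   next
    case False
    hence "good (c z) (q z) ee y" using c(2) that by blast
    hence "good (c z+ta) (q z) ee y" by (rule good_keep[OF _ old(4) L(4-6)])
    thus ?thesis by (rule good_eqv[OF q good_mono[OF _ e2(2)]])
   qed
   thus ?thesis using iI by blast
  qed
 qed
 show ?thesis
  by (rule exI[of _ G''], rule exI[of _ "C Un nc ` I"], rule exI[of _ ee2])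
    (use tm fI old(2,3) sub G''(2) e2(1) cov in auto)
qed

text \<open>Induction on the degree: the induction hypothesis covers all derivatives at once, and
  then the polynomials are inserted one at a time. Constants have no cancellation at the center
  0.\<close>

theorem cell_decomposition: "CD TYPE('z) D"
proof (induction D)
 case 0
 show ?case unfolding CD_def
 proof (intro allI impI)
  fix G :: "('z => 'r) set" and Ps assume G: "fring G" "ALL p:Ps. pfam G 0 p"
  have "good 0 (p z) 1 y" if "p:Ps" for p z y
  proof -
   have "pfam G 0 p" using G(2) that by blast
   hence dg: "degree (p z) = 0" using pfam_deg[of G 0 p z] by simp
   have "poly (p z) y = tay (p z) 0 0" using poly_tay[of "p z" 0 y 0] dg by simp
   moreover have "tay (p z) 0 i = 0" if "i > 0" for i using tay_big[of "p z" i] dg that by simp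
   ultimately have "1*nm (tay (p z) 0 i*(y-0)^i) <= nm (poly (p z) y)" for i by (cases "i = 0") simp_all
   thus ?thesis by (simp only: good_def) blast
  qed
  thus "EX G' C ee. tame G G' & finite C & C <= G' & 0 < ee & (ALL z y. EX c:C. ALL p:Ps. good (c z) (p z) ee y)"
   using tame_refl[OF G(1)] fring_0[OF G(1)]
   by (intro exI[of _ G] exI[of _ "{%z. 0}"] exI[of _ "1::real"]) simp
 qed
next
 case (Suc D)
 show ?case unfolding CD_def
 proof (intro allI impI)
  fix G :: "('z => 'r) set" and Ps assume G: "fring G" "finite Ps" "ALL p:Ps. pfam G (Suc D) p"
  define dPs where "dPs = (%p z. dpoly (p z)) ` Ps"
  have pf: "ALL p:dPs. pfam G D p" unfolding dPs_def using pfam_dpoly[OF G(1), of "Suc D"] G(3) by auto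
  have "finite dPs" using G(2) by (simp add: dPs_def)
  hence base: "EX G' C ee. tame G G' & finite C & C <= G' & 0 < ee & (ALL z y. EX c:C. ALL p:dPs. good (c z) (p z) ee y)"
   using Suc.IH[unfolded CD_def, THEN spec, of G, THEN spec, of dPs] G(1) pf by blast
  have "EX G' C ee. tame G G' & finite C & C <= G' & 0 < ee & (ALL z y. EX c:C. ALL p:dPs Un Ps'. good (c z) (p z) ee y)"
   if "finite Ps'" "Ps' <= Ps" for Ps' using that
  proof (induction Ps')
   case empty
   thus ?case using base by simp
  next
   case (insert p Ps')
   hence "EX G' C ee. tame G G' & finite C & C <= G' & 0 < ee & (ALL z y. EX c:C. ALL p:dPs Un Ps'. good (c z) (p z) ee y)" by simp
   then obtain G' C ee where o: "tame G G'" "finite C" "C <= G'" "0 < ee" "ALL z y. EX c:C. ALL p:dPs Un Ps'. good (c z) (p z) ee y" by blast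
   have "(%z. dpoly (p z)):dPs Un Ps'" using insert.prems by (auto simp: dPs_def)
   moreover have "pfam G (Suc D) p" using G(3) insert.prems by blast
   ultimately show ?case using CD_insert[OF Suc.IH G(1) _ _ o, of p] by simp
  qed
  from this[OF G(2) order_refl] obtain G' C ee where o: "tame G G'" "finite C" "C <= G'" "0 < ee"
   "ALL z y. EX c:C. ALL p:dPs Un Ps. good (c z) (p z) ee y" by blast
  thus "EX G' C ee. tame G G' & finite C & C <= G' & 0 < ee & (ALL z y. EX c:C. ALL p:Ps. good (c z) (p z) ee y)"
   by (intro exI[of _ G'] exI[of _ C] exI[of _ ee]) (metis UnI2)
 qed
qed

section \<open>Towers of centers\<close>

inductive_set polyf :: "nat => ((nat => 'r) => 'r) set" for n where
 polyf_const: "(%z. a):polyf n"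
| polyf_var: "i < n ==> (%z. z i):polyf n"
| polyf_add: "f:polyf n ==> g:polyf n ==> (%z. f z+g z):polyf n"
| polyf_mult: "f:polyf n ==> g:polyf n ==> (%z. f z*g z):polyf n"

lemma fring_polyf: "fring (polyf n)"
 unfolding fring_def
proof (intro conjI ballI)
 fix f assume "f:polyf n"
 thus "(%z. - f z):polyf n" using polyf_mult[OF polyf_const[of "-1"]] by fastforce
qed (auto intro: polyf.intros)

lemma polyf_cong: "f:polyf n ==> (!!i. i < n ==> z i = z' i) ==> f z = f z'"
 by (induction rule: polyf.induct) auto

lemma polyf_rep: "f:polyf (Suc n) ==> EX D p. pfam (polyf n) D p & (ALL z. f z = poly (p z) (z n))"
proof (induction rule: polyf.induct)
 case (polyf_const a)
 show ?case using pfam_const[OF fring_polyf polyf.polyf_const[of a n]] by (intro exI[of _ 0] exI[of _ "%z. [:a:]"]) simp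
next
 case (polyf_var i)
 show ?case
 proof (cases "i = n")
  case True
  have "pfam (polyf n) 1 (%z. [:0, 1:])" by (rule pfamI) (auto intro: polyf.polyf_const)
  thus ?thesis using True by (intro exI[of _ 1] exI[of _ "%z. [:0, 1:]"]) simp
 next
  case False
  hence "(%z. z i):polyf n" using polyf_var by (intro polyf.polyf_var) simp
  thus ?thesis using pfam_const[OF fring_polyf] by (intro exI[of _ 0] exI[of _ "%z. [:z i:]"]) simp
 qed
next
 case (polyf_add f g)
 then obtain D p D' p' where "pfam (polyf n) D p" "ALL z. f z = poly (p z) (z n)" "pfam (polyf n) D' p'" "ALL z. g z = poly (p' z) (z n)"
  by blast
 thus ?case using pfam_add[OF fring_polyf, of n D p D' p']
  by (intro exI[of _ "max D D'"] exI[of _ "%z. p z+p' z"]) simp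
next
 case (polyf_mult f g)
 then obtain D p D' p' where "pfam (polyf n) D p" "ALL z. f z = poly (p z) (z n)" "pfam (polyf n) D' p'" "ALL z. g z = poly (p' z) (z n)"
  by blast
 thus ?case using pfam_mult[OF fring_polyf, of n D p D' p']
  by (intro exI[of _ "D+D'"] exI[of _ "%z. p z*p' z"]) simp
qed

text \<open>Functions obtained by choosing roots need not visibly ignore later coordinates.
  Composition with \<open>tr n\<close> enforces this, and basic sets over \<open>polyf n\<close> do
  not notice it.\<close>

definition tr :: "nat => (nat => 'r) => nat => 'r" where
 "tr n z = (%i. if i < n then z i else 0)"

lemma polyf_tr: "f:polyf n ==> f (tr n z) = f z"
 by (rule polyf_cong) (auto simp: tr_def)

lemma tr_cong: "(!!i. i < n ==> z i = z' i) ==> tr n z = tr n z'"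
 by (auto simp: tr_def)

lemma Bas_tr: assumes "B:Bas (polyf n) k" shows "tr n z:B <-> z:B"
 using assms by (cases rule: BasE) (simp_all add: fring_mon[OF fring_polyf] polyf_tr)

lemma det_tr: assumes "det (BasA (polyf n)) UNIV F" shows "det (BasA (polyf n)) UNIV (%z. F (tr n z))"
proof (rule detE[OF assms])
 fix bb assume b: "finite bb" "bb <= BasA (polyf n)" and F: "ALL z:UNIV. ALL z':UNIV. agree bb z z' --> F z = F z'"
 show ?thesis
 proof (rule detI[OF b])
  fix z z' assume a: "agree bb z z'"
  have "tr n w:B <-> w:B" if "B:bb" for B w using b(2) that Bas_tr by (auto simp: BasA_def)
  hence "agree bb (tr n z) (tr n z')" using a by (simp add: agree_def)
  thus "F (tr n z) = F (tr n z')" by (rule F[rule_format, OF UNIV_I UNIV_I])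
 qed
qed

lemma LMA_tr: assumes "LMA (polyf n) k UNIV h" shows "LMA (polyf n) k UNIV (%z. h (tr n z))"
proof -
 obtain E N D C where X: "det (BasA (polyf n)) UNIV (%z. (E z, N z, D z, C z))"
  "ALL z:UNIV. nm (h z) ~= 0 --> mono_at (polyf n) h z (E z, N z, D z, C z)"
  using LM_X[OF assms] by blast
 show ?thesis
 proof (rule LM_I)
  show "det (BasA (polyf n)) UNIV (%z. nm (h (tr n z)) = 0)" by (rule det_tr[OF LM_zero_det[OF assms]])
  show "det (BasA (polyf n)) UNIV (%z. ac k (h (tr n z)))" by (rule det_tr[OF LM_ac_det[OF assms]])
  show "det (BasA (polyf n)) UNIV (%z. (E (tr n z), N (tr n z), D (tr n z), C (tr n z)))" by (rule det_tr[OF X(1)])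
  fix z assume nz: "nm (h (tr n z)) ~= 0"
  have m: "mono_at (polyf n) h (tr n z) (E (tr n z), N (tr n z), D (tr n z), C (tr n z))"
   using X(2)[rule_format, OF UNIV_I nz] .
  hence "N (tr n z) (tr n z) = N (tr n z) z" "D (tr n z) (tr n z) = D (tr n z) z"
   using mono_atD(3,4)[OF m] fring_mon[OF fring_polyf] polyf_tr by auto
  thus "mono_at (polyf n) (%z. h (tr n z)) z (E (tr n z), N (tr n z), D (tr n z), C (tr n z))"
   using m by (simp add: mono_at_def)
 qed
qed

text \<open>Centers \<open>c\<^sub>i\<close> depending on the coordinates below \<open>i\<close> only; they turn \<open>z\<close> into the
  coordinates \<open>z\<^sub>i - c\<^sub>i z\<close> by a triangular substitution of Jacobian one.\<close>

definition cen :: "nat => (nat => (nat => 'r) => 'r) => bool" where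
 "cen n c <-> (ALL i<n. (ALL z z'. (ALL j<i. z j = z' j) --> c i z = c i z') &
   (ALL a r. det (BasA (polyf i)) UNIV (%z. nm (c i z-a) <= r)))"

definition tc :: "(nat => (nat => 'r) => 'r) => nat => (nat => 'r) => 'r" where
 "tc c i = (%z. z i-c i z)"

lemma LM_const_fun: assumes "!!z z'. f z = f z'" shows "LM BB G k V f"
proof -
 define a where "a = f undefined"
 have "f = (%z. a)" unfolding a_def using assms by (intro ext)
 moreover have "LM BB G k V (%z. a)"
 proof (cases "nm a = 0")
  case True
  thus ?thesis by (intro LM_zero) simp
 next
  case False
  show ?thesis
   by (rule LM_I[where E = "%z. 1" and N = "%z z. 1" and D = "%z z. 1" and C = "%z. nm a"])
     (use False nm_pos mon_one in "auto simp: mono_at_def")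
 qed
 ultimately show ?thesis by simp
qed

text \<open>Cell decomposition in the last coordinate makes the given functions locally monomial in
  its distance from a center together with polynomials in the earlier coordinates. Finitely many of
  these polynomials and one depth suffice; they go into the induction hypothesis, and
  \<open>LM_trans\<close> composes the two descriptions.\<close>

theorem tower:
 "finite F ==> F <= polyf n ==> EX L. finite L & (ALL z. EX (c, V):L. z:V) & (ALL (c, V):L. cen n c &
   det (BasA (tc c ` {..<n})) UNIV (%z. z:V) & (ALL f:F. LMA (tc c ` {..<n}) k V f))"
proof (induction n arbitrary: F k)
 case 0
 have "LMA (tc (%_ _. 0) ` {..<0}) k UNIV f" if "f:F" for f
  by (rule LM_const_fun) (use 0 that polyf_cong in blast)
 thus ?case by (intro exI[of _ "{(%_ _. 0, UNIV)}"]) (simp add: cen_def)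
next
 case (Suc n)
 have "ALL f:F. EX D p. pfam (polyf n) D p & (ALL z. f z = poly (p z) (z n))" using Suc.prems polyf_rep by blast
 then obtain Df p where p: "!!f. f:F ==> pfam (polyf n) (Df f) (p f)" "!!f z. f:F ==> f z = poly (p f z) (z n)" by metis
 define D where "D = Max (insert 0 (Df ` F))"
 have pD: "pfam (polyf n) D (p f)" if "f:F" for f
  by (rule pfam_mono[OF p(1)[OF that] order_refl]) (use Suc.prems(1) that in "auto simp: D_def")
 have ptr: "p f (tr n z) = p f z" if "f:F" for f z
  by (rule poly_eqI) (rule polyf_tr[OF pfam_coeff[OF pD[OF that]]])
 have "EX G' C ee. tame (polyf n) G' & finite C & C <= G' & 0 < ee & (ALL z y. EX c:C. ALL q:p ` F. good (c z) (q z) ee y)"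
  using cell_decomposition[of D, unfolded CD_def, THEN spec, of "polyf n", THEN spec, of "p ` F"] fring_polyf Suc.prems(1) pD by blast
 then obtain G' C ee where tm: "tame (polyf n) G'" and C: "finite C" "C <= G'" and e: "0 < ee"
  and cov: "!!z y. EX c:C. ALL q:p ` F. good (c z) (q z) ee y" by blast
 have G': "fring G'" "polyf n <= G'" and LG: "!!h k. h:G' ==> LMA (polyf n) k UNIV h" using tm by (auto simp: tame_def)
 define ct where "ct c z = c (tr n z)" for c :: "(nat => 'r) => 'r" and z
 define H where "H c = insert (%z. z n-ct c z) (polyf n)" for c
 define S where "S c f = {z. ALL i:{..D}. ee*nm (tay (p f z) (ct c z) i*(z n-ct c z)^i) <= nm (f z)}" for c f
 have SL: "det (BasA (H c)) UNIV (%z. z:S c f)" "LMA (H c) k (S c f) f" if c: "c:C" and f: "f:F" for c f k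
 proof -
  have cG: "c:G'" using C c by blast
  define h where "h i z = tay (p f z) (ct c z) i*(z n-ct c z)^i" for i z
  have "LMA (polyf n) k UNIV (%z. tay (p f z) (ct c z) i)" for k i
  proof -
   have "LMA (polyf n) k UNIV (%z. (%w. tay (p f w) (c w) i) (tr n z))"
    by (rule LMA_tr[OF LG]) (rule pfam_tay[OF G'(1) cG pfam_mono[OF pD[OF f] G'(2) order_refl]])
   thus ?thesis by (simp add: ptr[OF f] ct_def)
  qed
  hence L1: "LMA (H c) k UNIV (%z. tay (p f z) (ct c z) i)" for k i
   by (rule LM_mono[OF _ order_refl BasA_mono _ order_refl]) (auto simp: H_def)
  have hL: "LMA (H c) k UNIV (h i)" for k i
   unfolding h_def by (intro LM_mult LM_power L1 LM_gen) (simp add: H_def)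
  have w: "(SUM i:{..D}. h i z) = f z" for z
  proof -
   have "poly (p f z) (z n) = (SUM i:{..D}. h i z)"
    unfolding h_def by (rule poly_tay) (rule pfam_deg[OF pD[OF f]])
   thus ?thesis using p(2)[OF f, of z] by (rule trans[symmetric, rotated])
  qed
  have R: "det (BasA (H c)) UNIV (%z. ALL i:{..D}. ee*nm (h i z) <= nm (SUM i:{..D}. h i z))"
   "LMA (H c) k {z:UNIV. ALL i:{..D}. ee*nm (h i z) <= nm (SUM i:{..D}. h i z)} (%z. SUM i:{..D}. h i z)"
   by (rule LM_sum; (rule finite_atMost hL e))+
  show "det (BasA (H c)) UNIV (%z. z:S c f)" using R(1) unfolding w by (simp add: S_def h_def)
  show "LMA (H c) k (S c f) f" using R(2) unfolding w by (simp add: S_def h_def)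
 qed
 define Gd where "Gd c = {z. ALL f:F. z:S c f}" for c
 have Gd: "det (BasA (H c)) UNIV (%z. z:Gd c)" if "c:C" for c
  unfolding Gd_def mem_Collect_eq by (rule det_ball[OF Suc.prems(1) SL(1)[OF that]])
 have GL: "LMA (H c) k (Gd c) f" if "c:C" "f:F" for c f k
  by (rule LM_dom[OF SL(2)[OF that]]) (use that in "auto simp: Gd_def")
 have "EX G0 K. finite G0 & G0 <= H c & k <= K & det (Bas G0 K) UNIV (%z. z:Gd c) & (ALL f:F. LM (Bas G0 K) G0 k (Gd c) f)"
  if c: "c:C" for c
 proof -
  obtain G1 K1 where 1: "finite G1" "G1 <= H c" "det (Bas G1 K1) UNIV (%z. z:Gd c)" using det_BasA_finite[OF Gd[OF c]] by blast
  have "ALL f:F. EX G0 K. finite G0 & G0 <= H c & k <= K & LM (Bas G0 K) G0 k (Gd c) f"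
   using LMA_finite[OF GL[OF c]] by blast
  then obtain G2 K2 where 2: "!!f. f:F ==> finite (G2 f) & G2 f <= H c & k <= K2 f & LM (Bas (G2 f) (K2 f)) (G2 f) k (Gd c) f" by metis
  define G0 K where "G0 = G1 Un (UN f:F. G2 f)" and "K = Max (insert k (insert K1 (K2 ` F)))"
  have fi: "finite (insert k (insert K1 (K2 ` F)))" using Suc.prems(1) by simp
  have lK: "k <= K" "K1 <= K" "f:F ==> K2 f <= K" for f
   unfolding K_def by (rule Max_ge[OF fi], simp)+
  have "Bas G1 K1 <= Bas G0 K" by (rule Bas_mono) (use lK in "auto simp: G0_def")
  hence "det (Bas G0 K) UNIV (%z. z:Gd c)" using det_mono[OF 1(3) order_refl] by blast
  moreover have "LM (Bas G0 K) G0 k (Gd c) f" if f: "f:F" for f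
  proof (rule LM_mono[OF conjunct2[OF conjunct2[OF conjunct2[OF 2[OF f]]]] order_refl])
   show "G2 f <= G0" using f by (auto simp: G0_def)
   thus "Bas (G2 f) (K2 f) <= Bas G0 K" by (rule Bas_mono) (rule lK(3)[OF f])
  qed simp
  moreover have "finite G0" unfolding G0_def by (rule finite_UnI[OF 1(1) finite_UN_I[OF Suc.prems(1)]]) (use 2 in blast)
  moreover have "G0 <= H c" unfolding G0_def by (rule Un_least[OF 1(2) UN_least]) (use 2 in blast)
  moreover note lK(1)
  ultimately show ?thesis by (intro exI[of _ G0] exI[of _ K]) simp
 qed
 then obtain G0 K where G0: "!!c. c:C ==> finite (G0 c) & G0 c <= H c & k <= K c &
   det (Bas (G0 c) (K c)) UNIV (%z. z:Gd c) & (ALL f:F. LM (Bas (G0 c) (K c)) (G0 c) k (Gd c) f)" by metis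
 \<comment> \<open>The generators in earlier coordinates, for all centers \<open>c\<close> together,
   and a depth sufficient for each of them.\<close>
 define F' K' where "F' = (UN c:C. G0 c) Int polyf n" and "K' = Max (insert 0 (K ` C))"
 have "finite (UN c:C. G0 c)" by (rule finite_UN_I[OF C(1)]) (use G0 in blast)
 hence F': "finite F'" "F' <= polyf n" by (auto simp: F'_def)
 have K': "K c <= K'" if "c:C" for c using C(1) that by (auto simp: K'_def)
 obtain L where L: "finite L" "ALL z. EX (c, V):L. z:V" "ALL (c, V):L. cen n c &
   det (BasA (tc c ` {..<n})) UNIV (%z. z:V) & (ALL f:F'. LMA (tc c ` {..<n}) K' V f)"
  using Suc.IH[OF F', of K'] by blast
 define ext where "ext = (%((ga :: nat => (nat => 'r) => 'r, V), c). (ga(n := ct c), V Int Gd c))"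
 show ?case
 proof (intro exI[of _ "ext ` (L \<times> C)"] conjI allI ballI)
  show "finite (ext ` (L \<times> C))" using L(1) C(1) by simp
 next
  fix z
  obtain ga V where g: "(ga, V):L" "z:V" using L(2) by blast
  obtain c where c: "c:C" "ALL q:p ` F. good (c (tr n z)) (q (tr n z)) ee (z n)" using cov by blast
  have zG: "z:Gd c" unfolding Gd_def S_def
  proof (clarify)
   fix f i assume f: "f:F"
   have "good (ct c z) (p f z) ee (z n)" using c(2) f ptr[OF f] by (auto simp: ct_def)
   thus "ee*nm (tay (p f z) (ct c z) i*(z n-ct c z)^i) <= nm (f z)"
    unfolding good_def using p(2)[OF f, of z] by (metis order.refl)
  qed
  have "ext ((ga, V), c):ext ` (L \<times> C)" using g(1) c(1) by blast
  moreover have "case ext ((ga, V), c) of (c, V) => z:V" using zG g(2) by (simp add: ext_def)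
  ultimately show "EX (c, V):ext ` (L \<times> C). z:V" by (rule bexI[rotated])
 next
  fix x assume "x:ext ` (L \<times> C)"
  then obtain ga V c where x: "x = (ga(n := ct c), V Int Gd c)" "(ga, V):L" "c:C" by (auto simp: ext_def)
  have g: "cen n ga" "det (BasA (tc ga ` {..<n})) UNIV (%z. z:V)" "!!f. f:F' ==> LMA (tc ga ` {..<n}) K' V f"
   using L(3) x(2) by auto
  have cG: "c:G'" using C x(3) by blast
  have T: "tc (ga(n := ct c)) ` {..<Suc n} = insert (%z. z n-ct c z) (tc ga ` {..<n})"
  proof -
   have "tc (ga(n := ct c)) i = tc ga i" if "i < n" for i using that by (simp add: tc_def)
   moreover have "tc (ga(n := ct c)) n = (%z. z n-ct c z)" by (simp add: tc_def)
   ultimately show ?thesis by (simp add: lessThan_Suc)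
  qed
  let ?T = "insert (%z. z n-ct c z) (tc ga ` {..<n})"
  have sub: "tc ga ` {..<n} <= ?T" by blast
  have "cen (Suc n) (ga(n := ct c))" unfolding cen_def
  proof (intro allI impI)
   fix i assume i: "i < Suc n"
   show "(ALL z z'. (ALL j<i. z j = z' j) --> (ga(n := ct c)) i z = (ga(n := ct c)) i z') &
    (ALL a r. det (BasA (polyf i)) UNIV (%z. nm ((ga(n := ct c)) i z-a) <= r))"
   proof (cases "i = n")
    case False
    thus ?thesis using g(1) i by (simp add: cen_def)
   next
    case True
    have "ct c z = ct c z'" if "ALL j<n. z j = z' j" for z z' using that tr_cong[of n z z'] by (simp add: ct_def)
    moreover have "det (BasA (polyf n)) UNIV (%z. nm (ct c z-a) <= r)" for a r
    proof -
     have "(%z. c z-a):G'" by (rule fring_diff[OF G'(1) cG subsetD[OF G'(2) polyf_const]])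
     hence "LMA (polyf n) 0 UNIV (%z. (%w. c w-a) (tr n z))" by (rule LMA_tr[OF LG])
     hence "det (BasA (polyf n)) UNIV (%z. nm (c (tr n z)-a) <= r*nm 1)"
      by (rule LM_cmp) (rule LM_one)
     thus ?thesis by (simp add: ct_def)
    qed
    ultimately show ?thesis using True by simp
   qed
  qed
  moreover have gL: "LMA ?T (K c) V f" if "f:G0 c" for f
  proof -
   have "f:H c" using G0[OF x(3)] that by blast
   hence "f = (%z. z n-ct c z) | f:F'" using that x(3) by (auto simp: H_def F'_def)
   then consider "f = (%z. z n-ct c z)" | "f:F'" by blast
   thus ?thesis
   proof cases
    case 1 thus ?thesis by (intro LM_gen) simp
   next
    case 2
    show ?thesis by (rule LM_mono[OF g(3)[OF 2] order_refl BasA_mono[OF sub] sub K'[OF x(3)]])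
   qed
  qed
  have dV: "det (BasA ?T) UNIV (%z. z:V)" by (rule det_mono[OF g(2) order_refl BasA_mono[OF sub]])
  have G0c: "k <= K c" "det (Bas (G0 c) (K c)) UNIV (%z. z:Gd c)" "!!f. f:F ==> LM (Bas (G0 c) (K c)) (G0 c) k (Gd c) f"
   using G0[OF x(3)] by auto
  have dG: "det (BasA ?T) V (%z. z:Gd c)" by (rule LM_det_trans[OF det_dom[OF G0c(2) subset_UNIV] gL])
  have "det (BasA ?T) UNIV (%z. z:V Int Gd c)"
  proof (rule det_glue[OF dV])
   fix a assume "a:(%z. z:V) ` UNIV"
   show "det (BasA ?T) {z:UNIV. (z:V) = a} (%z. z:V Int Gd c)"
   proof (cases a)
    case True
    hence "{z:UNIV. (z:V) = a} = V" by auto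
    thus ?thesis using det_cong[OF dG, of "%z. z:V Int Gd c"] by simp
   next
    case False
    show ?thesis by (rule det_cong[OF det_const[of _ _ False]]) (use False in auto)
   qed
  qed
  moreover have "LMA ?T k (V Int Gd c) f" if "f:F" for f
   by (rule LM_trans[OF LM_dom[OF G0c(3)[OF that]] G0c(1) LM_dom[OF gL]]) auto
  ultimately show "case x of (c, V) => cen (Suc n) c & det (BasA (tc c ` {..<Suc n})) UNIV (%z. z:V) &
    (ALL f:F. LMA (tc c ` {..<Suc n}) k V f)"
   unfolding x(1) prod.case T by blast
 qed
qed

end

section \<open>Integer points of polyhedra\<close>

text \<open>Dickson's lemma. The elements whose \<open>j\<close>-th entry is at least all those of
  \<open>B0\<close> are dominated by \<open>B0\<close>; each of the finitely many smaller values of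
  that entry is treated by the induction hypothesis separately.\<close>

lemma dickson:
 fixes mm :: "'a => 'i => nat"
 assumes "finite I" shows "EX B<=A. finite B & (ALL a:A. EX b:B. ALL i:I. mm b i <= mm a i)"
 using assms
proof (induction I arbitrary: A rule: finite_induct)
 case empty
 show ?case
 proof (cases "A = {}")
  case False
  then obtain a where "a:A" by blast
  thus ?thesis by (intro exI[of _ "{a}"]) auto
 qed simp
next
 case (insert j I)
 obtain B0 where B0: "B0 <= A" "finite B0" "ALL a:A. EX b:B0. ALL i:I. mm b i <= mm a i" using insert.IH[of A] by blast
 define n where "n = Max (insert 0 ((%b. mm b j) ` B0))"
 have n: "mm b j <= n" if "b:B0" for b using B0(2) that by (simp add: n_def)
 define A' where "A' k = {a:A. mm a j = k}" for k
 have "ALL k. EX B<=A' k. finite B & (ALL a:A' k. EX b:B. ALL i:I. mm b i <= mm a i)" using insert.IH by blast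
 then obtain B where B: "!!k. B k <= A' k" "!!k. finite (B k)" "!!k a. a:A' k ==> EX b:B k. ALL i:I. mm b i <= mm a i"
  by metis
 show ?case
 proof (intro exI[of _ "B0 Un (\<Union>k<n. B k)"] conjI ballI)
  show "B0 Un (\<Union>k<n. B k) <= A" using B0(1) B(1) by (auto simp: A'_def)
  show "finite (B0 Un (\<Union>k<n. B k))" using B0(2) B(2) by simp
  fix a assume a: "a:A"
  show "EX b:B0 Un (\<Union>k<n. B k). ALL i:insert j I. mm b i <= mm a i"
  proof (cases "n <= mm a j")
   case True
   obtain b where "b:B0" "ALL i:I. mm b i <= mm a i" using B0(3) a by blast
   thus ?thesis using n[of b] True by (intro bexI[of _ b]) auto
  next
   case False
   have "a:A' (mm a j)" using a by (simp add: A'_def)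
   then obtain b where b: "b:B (mm a j)" "ALL i:I. mm b i <= mm a i" using B(3) by blast
   moreover have "mm b j = mm a j" using B(1) b(1) by (auto simp: A'_def)
   ultimately show ?thesis using False by (intro bexI[of _ b]) auto
  qed
 qed
qed

inductive_set lspan :: "(nat => int) set => (nat => int) => (nat => int) set" for G b where
 lspan_base: "b:lspan G b"
| lspan_step: "v:lspan G b ==> g:G ==> (%i. v i+g i):lspan G b"

lemma lspan_shift: "v:lspan G b ==> (%i. v i+t i):lspan G (%i. b i+t i)"
proof (induction rule: lspan.induct)
 case (lspan_step v g)
 thus ?case using lspan.lspan_step[of "%i. v i+t i" G _ g] by (simp add: algebra_simps)
qed (rule lspan.lspan_base)

lemma lspan_mult: "g:G ==> (%i. b i+int n*g i):lspan G b"
proof (induction n)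
 case (Suc n)
 thus ?case using lspan_step[of "%i. b i+int n*g i" G b g] by (simp add: algebra_simps)
qed (simp add: lspan_base)

lemma lspan_insert: "v:lspan (insert g G) b ==> EX n. v:lspan G (%i. b i+int n*g i)"
proof (induction rule: lspan.induct)
 case lspan_base
 show ?case using lspan.lspan_base[of b G] by (intro exI[of _ 0]) simp
next
 case (lspan_step v h)
 then obtain n where n: "v:lspan G (%i. b i+int n*g i)" by blast
 show ?case
 proof (cases "h:G")
  case True
  thus ?thesis using lspan.lspan_step[OF n] by blast
 next
  case False
  hence "h = g" using lspan_step.hyps by simp
  thus ?thesis using lspan_shift[OF n, of g] by (intro exI[of _ "Suc n"]) (simp add: algebra_simps)
 qed
qed

text \<open>Gordan's lemma with congruences. \<open>De\<close> is the monoid of recession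
  directions; Dickson's lemma provides finitely many generators for it and finitely many minimal
  base points for \<open>Ga\<close>.\<close>

lemma polyhedral_lspan:
 fixes N :: int and rh :: "nat => int" and J :: "nat set" and I :: "((nat => int) \<times> int) set"
 assumes fin: "finite J" "finite I"
 defines "Ga == {ga. (ALL i. i ~: J --> ga i = 0) & (ALL i:J. N dvd ga i-rh i) & (ALL p:I. 0 <= (SUM i:J. fst p i*ga i) + snd p)}"
 shows "EX B G. finite B & finite G & Ga = (UN b:B. lspan G b)"
proof -
 define De where "De = {ga. (ALL i. i ~: J --> ga i = 0) & (ALL i:J. N dvd ga i) & (ALL p:I. 0 <= (SUM i:J. fst p i*ga i))}"
 define X :: "(nat+nat+((nat => int) \<times> int)) set" where "X = Inl ` J Un (Inr o Inl) ` J Un (Inr o Inr) ` I"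
 \<comment> \<open>Positive parts, negative parts and slacks of the inequalities, as natural
   numbers; \<open>b\<close> is 0 for the homogeneous system and 1 for the given one. If
   \<open>dl\<close> is dominated by \<open>ga\<close> in all these entries, the difference is again
   a recession direction.\<close>
 define mm where "mm b ga x = (case x of Inl i => nat (ga i) | Inr (Inl i) => nat (- ga i)
  | Inr (Inr p) => nat ((SUM i:J. fst p i*ga i)+b * snd p))" for b :: int and ga :: "nat => int" and x
 have fX: "finite X" using fin by (simp add: X_def)
 have add: "(SUM i:J. fst p i*(ga i-dl i)) = (SUM i:J. fst p i*ga i)-(SUM i:J. fst p i*dl i)"
  "(SUM i:J. fst p i*(ga i+dl i)) = (SUM i:J. fst p i*ga i)+(SUM i:J. fst p i*dl i)"
  for p :: "(nat => int) \<times> int" and ga dl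
  by (simp_all add: algebra_simps sum_subtractf sum.distrib)
 have mmD: "nat (dl i) <= nat (ga i)" "nat (- dl i) <= nat (- ga i)" if "ALL x:X. mm b dl x <= mm b ga x" "i:J" for b ga dl i
  using that(1)[THEN bspec, of "Inl i"] that(1)[THEN bspec, of "Inr (Inl i)"] that(2) by (auto simp: X_def mm_def)
 have mmI: "nat ((SUM i:J. fst p i*dl i)+b * snd p) <= nat ((SUM i:J. fst p i*ga i)+b * snd p)"
  if "ALL x:X. mm b dl x <= mm b ga x" "p:I" for b ga dl p
  using that(1)[THEN bspec, of "Inr (Inr p)"] that(2) by (auto simp: X_def mm_def)
 have d1: "(%i. ga i-dl i):De" if "ga:De" "dl:De" "ALL x:X. mm 0 dl x <= mm 0 ga x" for ga dl
  unfolding De_def mem_Collect_eq add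
 proof (intro conjI ballI)
  fix p assume p: "p:I"
  have "0 <= (SUM i:J. fst p i*dl i)" "0 <= (SUM i:J. fst p i*ga i)" using that p by (auto simp: De_def)
  thus "0 <= (SUM i:J. fst p i*ga i)-(SUM i:J. fst p i*dl i)" using mmI[OF that(3) p] by simp
 qed (use that in "auto simp: De_def")
 have d2: "(%i. ga i-dl i):De" if "ga:Ga" "dl:Ga" "ALL x:X. mm 1 dl x <= mm 1 ga x" for ga dl
  unfolding De_def mem_Collect_eq add
 proof (intro conjI ballI)
  fix p assume p: "p:I"
  have "0 <= (SUM i:J. fst p i*dl i) + snd p" "0 <= (SUM i:J. fst p i*ga i) + snd p" using that p by (auto simp: Ga_def)
  thus "0 <= (SUM i:J. fst p i*ga i)-(SUM i:J. fst p i*dl i)" using mmI[OF that(3) p] by simp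
 next
  fix i assume i: "i:J"
  have "N dvd ga i-rh i" "N dvd dl i-rh i" using that(1,2) i unfolding Ga_def by blast+
  hence "N dvd (ga i-rh i)-(dl i-rh i)" by (rule dvd_diff)
  thus "N dvd ga i-dl i" by simp
 qed (use that in "auto simp: Ga_def")
 have d3: "(%i. ga i+dl i):Ga" if "ga:Ga" "dl:De" for ga dl
  unfolding Ga_def mem_Collect_eq add
 proof (intro conjI ballI)
  fix p assume p: "p:I"
  have "0 <= (SUM i:J. fst p i*dl i)" "0 <= (SUM i:J. fst p i*ga i) + snd p" using that p by (auto simp: Ga_def De_def)
  thus "0 <= (SUM i:J. fst p i*ga i)+(SUM i:J. fst p i*dl i) + snd p" by simp
 next
  fix i assume i: "i:J"
  hence "N dvd (ga i-rh i)+dl i" using that by (intro dvd_add) (auto simp: Ga_def De_def)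
  thus "N dvd ga i+dl i-rh i" by (simp add: algebra_simps)
 qed (use that in "auto simp: Ga_def De_def")
 obtain G where G: "G <= De-{%i. 0}" "finite G" "ALL a:De-{%i. 0}. EX b:G. ALL x:X. mm 0 b x <= mm 0 a x"
  using dickson[OF fX, of "De-{%i. 0}" "mm 0"] by blast
 obtain B where B: "B <= Ga" "finite B" "ALL a:Ga. EX b:B. ALL x:X. mm 1 b x <= mm 1 a x"
  using dickson[OF fX, of Ga "mm 1"] by blast
 \<comment> \<open>Descent on the sum of absolute values. Domination in the positive and the
   negative parts excludes sign changes, so subtracting a generator strictly decreases it.\<close>
 have gen: "dl:De ==> (%i. b i+dl i):lspan G b" for dl b
 proof (induction "SUM i:J. nat \<bar>dl i\<bar>" arbitrary: dl rule: less_induct)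
  case less
  show ?case
  proof (cases "dl = (%i. 0)")
   case True
   thus ?thesis using lspan_base[of b G] by simp
  next
   case False
   then obtain g where g: "g:G" "ALL x:X. mm 0 g x <= mm 0 dl x" using G(3) less.prems by blast
   have gD: "g:De" "g ~= (%i. 0)" using G(1) g(1) by auto
   then obtain j where "g j ~= 0" by auto
   hence j: "j:J" "g j ~= 0" using gD(1) by (auto simp: De_def)
   have d: "(%i. dl i-g i):De" by (rule d1[OF less.prems gD(1) g(2)])
   have le: "nat \<bar>dl i-g i\<bar>+nat \<bar>g i\<bar> = nat \<bar>dl i\<bar>" if "i:J" for i
   proof -
    have "nat d <= nat c ==> nat (- d) <= nat (- c) ==> nat \<bar>c-d\<bar>+nat \<bar>d\<bar> = nat \<bar>c\<bar>" for c d :: int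
     by (cases "0 <= c"; cases "0 <= d"; simp)
    thus ?thesis using mmD[OF g(2) that] by blast
   qed
   have "(SUM i:J. nat \<bar>dl i-g i\<bar>) < (SUM i:J. nat \<bar>dl i\<bar>)"
    by (rule sum_strict_mono_ex1[OF fin(1)]) (use le le[OF j(1)] j in "force, force")
   hence "(%i. b i+(dl i-g i)):lspan G b" by (rule less.hyps[OF _ d])
   from lspan_step[OF this g(1)] show ?thesis by simp
  qed
 qed
 have "Ga = (UN b:B. lspan G b)"
 proof (intro subset_antisym subsetI)
  fix ga assume g: "ga:Ga"
  obtain b where b: "b:B" "ALL x:X. mm 1 b x <= mm 1 ga x" using B(3)[rule_format, OF g] by (elim bexE)
  hence "(%i. b i+(ga i-b i)):lspan G b" using B(1) by (intro gen d2[OF g]) auto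
  thus "ga:(UN b:B. lspan G b)" using b(1) by auto
 next
  fix ga assume "ga:(UN b:B. lspan G b)"
  then obtain b where b: "b:B" "ga:lspan G b" by blast
  from b(2) show "ga:Ga"
  proof (induction rule: lspan.induct)
   case lspan_base thus ?case using B(1) b(1) by blast
  next
   case (lspan_step v g) thus ?case using d3 G(1) by blast
  qed
 qed
 thus ?thesis using B(2) G(2) by blast
qed

text \<open>A generator on which \<open>A\<close> is positive contributes a geometric series; one
  that does not move the projection contributes nothing new. The constant must not depend on the
  base point, since the induction shifts it by multiples of the generator removed.\<close>

lemma lspan_bound:
 fixes A :: "(nat => int) => real" and pr :: "(nat => int) => 'p"
 assumes "finite G" and A: "!!v g. A (%i. v i+g i) = A v + A g" and x: "0 < x" "x < 1"
  and G: "!!g. g:G ==> A g > 0 | (ALL v. pr (%i. v i+g i) = pr v)"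
 shows "EX C>=0. ALL b T c. finite T & T <= pr ` lspan G b & (ALL v:lspan G b. w (pr v) = c+A v) -->
  (SUM p:T. x powr w p) <= C*x powr (c+A b)"
 using assms(1) G
proof (induction G rule: finite_induct)
 case empty
 show ?case
 proof (intro exI[of _ 1] conjI allI impI)
  fix b T c assume a: "finite T & T <= pr ` lspan {} b & (ALL v:lspan {} b. w (pr v) = c+A v)"
  have "v = b" if "v:lspan {} b" for v using that by (cases rule: lspan.cases) auto
  hence "T <= {pr b}" "w (pr b) = c+A b" using a lspan_base[of b "{}"] by auto
  hence "(SUM p:T. x powr w p) <= (SUM p:{pr b}. x powr w p)" by (intro sum_mono2) auto
  thus "(SUM p:T. x powr w p) <= 1*x powr (c+A b)" using `w (pr b) = c+A b` by simp
 qed simp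
next
 case (insert g G)
 obtain C where C: "C >= 0" and IH: "!!b T c. finite T ==> T <= pr ` lspan G b ==> (ALL v:lspan G b. w (pr v) = c+A v) ==>
  (SUM p:T. x powr w p) <= C*x powr (c+A b)" using insert.IH insert.prems by auto
 define bn where "bn b n = (%i. b i+int n*g i)" for b n
 have sub: "lspan G (bn b n) <= lspan (insert g G) b" for b n
 proof
  fix v assume "v:lspan G (bn b n)" thus "v:lspan (insert g G) b"
  proof (induction rule: lspan.induct)
   case lspan_base show ?case unfolding bn_def by (rule lspan_mult) simp
  next
   case (lspan_step v h) thus ?case by (intro lspan.lspan_step) auto
  qed
 qed
 have Abn: "A (bn b n) = A b+real n*A g" for b n
 proof (induction n)
  case (Suc n)
  have "bn b (Suc n) = (%i. bn b n i+g i)" by (auto simp: bn_def algebra_simps)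
  thus ?case using A[of "bn b n" g] Suc by (simp add: algebra_simps)
 qed (simp add: bn_def)
 consider "A g > 0" | "ALL v. pr (%i. v i+g i) = pr v" using insert.prems[of g] by blast
 thus ?case
 proof cases
  case 1
  define r where "r = x powr A g"
  have r: "0 < r" "r < 1" using x 1 by (auto simp: r_def powr01_less_one)
  show ?thesis
  proof (intro exI[of _ "C/(1-r)"] conjI allI impI)
   show "0 <= C/(1-r)" using C r by simp
   fix b T c assume a: "finite T & T <= pr ` lspan (insert g G) b & (ALL v:lspan (insert g G) b. w (pr v) = c+A v)"
   \<comment> \<open>Each projected point is charged to one multiplicity of \<open>g\<close>, so
     that points hit repeatedly are counted once.\<close>
   have "ALL p:T. EX n. p:pr ` lspan G (bn b n)" using a lspan_insert unfolding bn_def by blast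
   then obtain idx where idx: "!!p. p:T ==> p:pr ` lspan G (bn b (idx p))" by metis
   define k where "k = Suc (Max (insert 0 (idx ` T)))"
   have k: "idx ` T <= {..<k}" using a by (auto simp: k_def less_Suc_eq_le)
   have "(SUM p:T. x powr w p) = (SUM n<k. SUM p:{p:T. idx p = n}. x powr w p)"
    using sum.group[of T "{..<k}" idx "%p. x powr w p"] a k by simp
   also have "... <= (SUM n<k. C*x powr (c+A (bn b n)))"
   proof (rule sum_mono)
    fix n
    have "ALL v:lspan G (bn b n). w (pr v) = c+A v" using a sub by blast
    thus "(SUM p:{p:T. idx p = n}. x powr w p) <= C*x powr (c+A (bn b n))"
     by (rule IH[rotated 2]) (use a idx in auto)
   qed
   also have "... = C*x powr (c+A b)*(SUM n<k. r^n)"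
   proof -
    have "x powr (c+A (bn b n)) = x powr (c+A b)*r^n" for n
     using x by (simp add: Abn powr_add r_def powr_realpow[symmetric] powr_powr mult.commute)
    thus ?thesis by (simp add: sum_distrib_left mult.assoc)
   qed
   also have "... <= C*x powr (c+A b)*(1/(1-r))"
   proof (rule mult_left_mono)
    have "(1-r)*(SUM n<k. r^n) = 1-r^k" by (rule one_diff_power_eq[symmetric])
    moreover have "0 < r^k" using r by simp
    ultimately show "(SUM n<k. r^n) <= 1/(1-r)" using r by (simp add: pos_le_divide_eq mult.commute)
   qed (use C in simp)
   finally show "(SUM p:T. x powr w p) <= C/(1-r)*x powr (c+A b)" by simp
  qed
 next
  case 2
  show ?thesis
  proof (intro exI[of _ C] conjI allI impI C)
   fix b T c assume a: "finite T & T <= pr ` lspan (insert g G) b & (ALL v:lspan (insert g G) b. w (pr v) = c+A v)"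
   have shift: "pr (%i. v i+int n*g i) = pr v" for v n
   proof (induction n)
    case (Suc n)
    thus ?case using 2[rule_format, of "%i. v i+int n*g i"] by (simp add: algebra_simps)
   qed simp
   have "T <= pr ` lspan G b"
   proof
    fix p assume "p:T"
    then obtain v n where v: "v:lspan G (bn b n)" "p = pr v" using a lspan_insert unfolding bn_def by blast
    have "(%i. v i+- int n*g i):lspan G (%i. bn b n i+- int n*g i)" by (rule lspan_shift[OF v(1)])
    hence "(%i. v i+- int n*g i):lspan G b" by (simp add: bn_def)
    moreover have "pr (%i. v i+- int n*g i) = p" using shift[of "%i. v i+- int n*g i" n] v(2) by simp
    ultimately show "p:pr ` lspan G b" by blast
   qed
   moreover have "lspan G b <= lspan (insert g G) b" using sub[of b 0] by (simp add: bn_def)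
   ultimately show "(SUM p:T. x powr w p) <= C*x powr (c+A b)" using a by (intro IH) auto
  qed
 qed
qed

text \<open>Otherwise the points \<open>b + n*g\<close> have pairwise distinct projections and
  weights bounded below by the weight at \<open>b\<close>, so the sums would be unbounded.\<close>

lemma lspan_pos:
 fixes A :: "(nat => int) => real"
 assumes A: "!!v g. A (%i. v i+g i) = A v + A g" and x: "0 < x" "x < 1"
  and g: "g:G" "i < m" "g i ~= 0"
  and w: "!!v. v:lspan G b ==> w (map v [0..<m]) = c+A v"
  and C: "!!T. finite T ==> T <= (%v. map v [0..<m]) ` lspan G b ==> (SUM p:T. x powr w p) <= C"
 shows "A g > 0"
proof (rule ccontr)
 assume n: "~ A g > 0"
 define bn where "bn n = (%i. b i+int n*g i)" for n
 have Abn: "A (bn n) = A b+real n*A g" for n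
 proof (induction n)
  case (Suc n)
  have "bn (Suc n) = (%i. bn n i+g i)" by (auto simp: bn_def algebra_simps)
  thus ?case using A[of "bn n" g] Suc by (simp add: algebra_simps)
 qed (simp add: bn_def)
 have mem: "bn n:lspan G b" for n unfolding bn_def by (rule lspan_mult[OF g(1)])
 define y where "y = x powr (c+A b)"
 have y: "y > 0" using x by (simp add: y_def)
 define p where "p n = map (bn n) [0..<m]" for n
 have inj: "inj p"
 proof (rule injI)
  fix k l assume "p k = p l"
  hence "bn k i = bn l i" using g(2) by (auto simp: p_def)
  thus "k = l" using g(3) by (simp add: bn_def)
 qed
 have "real k*y <= C" for k
 proof -
  have "real k*y = (SUM q:p ` {..<k}. y)" using card_image[OF inj_on_subset[OF inj subset_UNIV], of "{..<k}"] by simp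
  also have "... <= (SUM q:p ` {..<k}. x powr w q)"
  proof (rule sum_mono)
   fix q assume "q:p ` {..<k}"
   then obtain l where l: "q = p l" by blast
   have "w q = c+A b+real l*A g" using w[OF mem, of l] by (simp add: l p_def Abn)
   also have "... <= c+A b" using n by (simp add: mult_nonneg_nonpos)
   finally show "y <= x powr w q" unfolding y_def using x by (intro powr_mono') auto
  qed
  also have "... <= C" by (rule C) (use mem in "auto simp: p_def")
  finally show ?thesis .
 qed
 moreover obtain k where "C < real k*y" using reals_Archimedean3[OF y] by blast
 ultimately show False by (meson not_le)
qed

theorem lspan_exponent_change:
 fixes A :: "(nat => int) => real"
 assumes fin: "finite G" and A: "!!v g. A (%i. v i+g i) = A v + A g"
  and x0: "0 < x0" "x0 < 1" and x: "0 < x" "x < 1"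
  and w: "!!v. v:lspan G b ==> w (map v [0..<m]) = c+A v"
  and C: "!!T. finite T ==> T <= (%v. map v [0..<m]) ` lspan G b ==> (SUM p:T. x0 powr w p) <= C"
 shows "EX C. ALL T. finite T & T <= (%v. map v [0..<m]) ` lspan G b --> (SUM p:T. x powr w p) <= C"
proof -
 have *: "A g > 0 | (ALL v. map (%i. v i+g i) [0..<m] = map v [0..<m])" if "g:G" for g
  using lspan_pos[OF A x0 that _ _ w C] by (cases "EX i<m. g i ~= 0") auto
 have "EX C>=0. ALL b T c. finite T & T <= (%v. map v [0..<m]) ` lspan G b & (ALL v:lspan G b. w (map v [0..<m]) = c+A v) -->
  (SUM p:T. x powr w p) <= C*x powr (c+A b)"
  by (rule lspan_bound[OF fin _ x]) (rule A, rule *)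
 then obtain C' where C': "!!T. finite T ==> T <= (%v. map v [0..<m]) ` lspan G b ==>
  (ALL v:lspan G b. w (map v [0..<m]) = c+A v) ==> (SUM p:T. x powr w p) <= C'*x powr (c+A b)"
  by meson
 show ?thesis by (intro exI[of _ "C'*x powr (c+A b)"] allI impI, elim conjE, rule C') (simp_all add: w)
qed

context vring
begin

section \<open>Cells\<close>

definition pat :: "(nat => (nat => 'r) => 'r) => nat => nat set => (nat => 'r) => bool" where
 "pat c M J z <-> (ALL i<M. nm (tc c i z) ~= 0 <-> i:J)"

definition tlin :: "(nat => (nat => 'r) => 'r) => nat set => (nat => int) \<times> int => (nat => 'r) => int" where
 "tlin c J p z = (SUM i:J. fst p i * ord (tc c i z)) + snd p"

definition same :: "(nat => (nat => 'r) => 'r) => nat set => nat => int => ((nat => int) \<times> int) set =>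
  (nat => 'r) => (nat => 'r) => bool" where
 "same c J k N I z z' <-> (ALL i:J. ac k (tc c i z) = ac k (tc c i z') & N dvd ord (tc c i z)-ord (tc c i z')) &
   (ALL p:I. 0 <= tlin c J p z <-> 0 <= tlin c J p z')"

definition tdat :: "(nat => (nat => 'r) => 'r) => nat => nat set => nat => (nat => 'r) => (nat => int) => (nat => 'r) => bool" where
 "tdat c M J k ka ga z <-> (ALL i<M. if i:J then nm (tc c i z) ~= 0 & ac k (tc c i z) = ka i & ord (tc c i z) = ga i
   else nm (tc c i z) = 0)"

lemma same_mono: "same c J k N I z z' ==> k' <= k ==> N' dvd N ==> I' <= I ==> same c J k' N' I' z z'"
 unfolding same_def by (meson ac_mono dvd_trans subsetD)

lemma mon_ord:
 assumes "f:mon (tc c ` {..<M})" and J: "J <= {..<M}"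
 shows "(ALL z. pat c M J z --> nm (f z) = 0) |
  (EX a. ALL z. pat c M J z --> nm (f z) ~= 0 & ord (f z) = (SUM i:J. a i * ord (tc c i z)))"
 using assms(1)
proof (induction rule: mon.induct)
 case mon_one
 have "ord 1 = 0" by (rule ordI) simp
 thus ?case by (intro disjI2 exI[of _ "%i. 0"]) simp
next
 case (mon_cons f g)
 then obtain j where j: "f = tc c j" "j < M" by blast
 have fJ: "finite J" using J finite_subset by blast
 show ?case
 proof (cases "j:J & ~ (ALL z. pat c M J z --> nm (g z) = 0)")
  case False
  have "nm (f z*g z) = 0" if "pat c M J z" for z
   using False j that by (auto simp: pat_def nm_mult)
  thus ?thesis by blast
 next
  case True
  then obtain a where a: "!!z. pat c M J z ==> nm (g z) ~= 0 & ord (g z) = (SUM i:J. a i * ord (tc c i z))"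
   using mon_cons.IH by blast
  have "nm (f z*g z) ~= 0 & ord (f z*g z) = (SUM i:J. (a i+(if i = j then 1 else 0)) * ord (tc c i z))"
   if z: "pat c M J z" for z
  proof -
   have 1: "nm (f z) ~= 0" using z j True by (simp add: pat_def)
   have "(SUM i:J. (a i+(if i = j then 1 else 0)) * ord (tc c i z)) = (SUM i:J. a i * ord (tc c i z))+(SUM i:J. if i = j then ord (tc c i z) else 0)"
    unfolding sum.distrib[symmetric] by (intro sum.cong) (auto simp: distrib_right)
   also have "(SUM i:J. if i = j then ord (tc c i z) else 0) = ord (f z)" using True fJ by (simp add: j(1))
   finally have 2: "(SUM i:J. (a i+(if i = j then 1 else 0)) * ord (tc c i z)) = ord (g z) + ord (f z)" using a[OF z] by simp
   have 3: "nm (g z) ~= 0" using a[OF z] by blast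
   have "nm (f z*g z) ~= 0" using 1 3 by (simp add: nm_mult)
   moreover have "ord (f z*g z) = (SUM i:J. (a i+(if i = j then 1 else 0)) * ord (tc c i z))"
    unfolding ord_mult[OF 1 3] by (rule trans[OF add.commute 2[symmetric]])
   ultimately show ?thesis by (rule conjI)
  qed
  thus ?thesis by (intro disjI2 exI[of _ "%i. a i+(if i = j then 1 else 0)"] allI impI)
 qed
qed

lemma powi_le_iff: "(ALL n. ~ Q powi n <= r) | (EX n0. ALL n. Q powi n <= r <-> n <= n0)"
proof (cases "r > 0")
 case True
 have "Q powi n <= r <-> n <= \<lfloor>log Q r\<rfloor>" for n
 proof -
  have "Q powi n = Q powr (of_int n)" using Q_gt1 by (simp add: powr_real_of_int')
  thus ?thesis using le_log_iff[OF Q_gt1 True, of "of_int n"] by (simp add: le_floor_iff)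
 qed
 thus ?thesis by blast
next
 case False
 hence "~ Q powi n <= r" for n using powi_pos[of n] by linarith
 thus ?thesis by blast
qed

lemma nm_le_ord: assumes "nm x ~= 0" "nm y ~= 0" shows "nm x <= r*nm y <-> Q powi (ord y-ord x) <= r"
proof -
 have "nm x = Q powi (ord y-ord x)*nm y"
  unfolding nm_ord[OF assms(1)] nm_ord[OF assms(2)] using Q_gt1 by (simp add: power_int_add[symmetric])
 thus ?thesis using nm_pos[OF assms(2)] mult_le_cancel_right_pos by metis
qed

text \<open>Once it is fixed which differences \<open>z i - c i z\<close> vanish, each kind of basic
  set is constant or becomes one clause of \<open>same\<close>: a linear inequality between orders,
  an angular component, or a congruence.\<close>

lemma basic_same:
 assumes B: "B:BasA (tc c ` {..<M})" and J: "J <= {..<M}"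
 shows "EX k N I. N > 0 & finite I & (ALL z z'. pat c M J z --> pat c M J z' --> same c J k N I z z' --> (z:B <-> z':B))"
proof -
 have const: ?thesis if "!!z. pat c M J z ==> z:B <-> P" for P
  by (rule exI[of _ 0], rule exI[of _ 1], rule exI[of _ "{}"]) (simp add: that)
 obtain k0 where "B:Bas (tc c ` {..<M}) k0" using B by (auto simp: BasA_def)
 thus ?thesis
 proof (cases rule: BasE)
  case (cmp f g r)
  show ?thesis
  proof (cases "ALL z. pat c M J z --> nm (g z) = 0")
   case g0: True
   show ?thesis
   proof (cases "ALL z. pat c M J z --> nm (f z) = 0")
    case True
    thus ?thesis using g0 cmp(3) by (intro const[of True]) simp
   next
    case False
    hence "ALL z. pat c M J z --> nm (f z) ~= 0" using mon_ord[OF cmp(1) J] by blast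
    thus ?thesis using g0 cmp(3) by (intro const[of False]) (simp add: not_le nm_pos)
   qed
  next
   case False
   then obtain b where b: "!!z. pat c M J z ==> nm (g z) ~= 0" "!!z. pat c M J z ==> ord (g z) = (SUM i:J. b i * ord (tc c i z))"
    using mon_ord[OF cmp(2) J] by blast
   show ?thesis
   proof (cases "ALL z. pat c M J z --> nm (f z) = 0")
    case True
    show ?thesis
    proof (rule const[of "0 <= r"])
     fix z assume z: "pat c M J z"
     show "z:B <-> 0 <= r"
      unfolding cmp(3) using True z mult_le_cancel_right_pos[OF nm_pos[OF b(1)[OF z]], of 0 r] by simp
    qed
   next
    case False
    then obtain a where a: "!!z. pat c M J z ==> nm (f z) ~= 0" "!!z. pat c M J z ==> ord (f z) = (SUM i:J. a i * ord (tc c i z))"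
     using mon_ord[OF cmp(1) J] by blast
    have e: "z:B <-> Q powi (ord (g z)-ord (f z)) <= r" if "pat c M J z" for z
     unfolding cmp(3) using nm_le_ord[OF a(1)[OF that] b(1)[OF that]] by simp
    show ?thesis
    proof (cases "ALL n. ~ Q powi n <= r")
     case True
     thus ?thesis using e by (intro const[of False]) simp
    next
     case False
     then obtain n0 where n0: "!!n. Q powi n <= r <-> n <= n0" using powi_le_iff[of r] by blast
     let ?p = "(%i. a i-b i, n0)"
     have "z:B <-> 0 <= tlin c J ?p z" if z: "pat c M J z" for z
      unfolding e[OF z] n0 tlin_def a(2)[OF z] b(2)[OF z] by (simp add: left_diff_distrib sum_subtractf) linarith
     thus ?thesis by (intro exI[of _ 0] exI[of _ 1] exI[of _ "{?p}"]) (simp add: same_def)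
    qed
   qed
  qed
 next
  case (ac f l u)
  then obtain j where j: "f = tc c j" "j < M" by blast
  show ?thesis
  proof (cases "j:J")
   case True
   thus ?thesis by (intro exI[of _ l] exI[of _ 1] exI[of _ "{}"]) (simp add: same_def ac(3) j(1))
  next
   case False
   hence "ac l (f z) = ac l 0" if "pat c M J z" for z using that j by (intro ac_zero) (auto simp: pat_def)
   thus ?thesis using ac(3) by (intro const[of "ac l 0 = u"]) simp
  qed
 next
  case (dvd f n a)
  show ?thesis
  proof (cases "ALL z. pat c M J z --> nm (f z) = 0")
   case True
   thus ?thesis using dvd(3) ord_zero by (intro const[of "n dvd-a"]) simp
  next
   case False
   then obtain b where b: "!!z. pat c M J z ==> ord (f z) = (SUM i:J. b i * ord (tc c i z))"
    using mon_ord[OF dvd(1) J] by blast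
   have "z:B <-> z':B" if z: "pat c M J z" "pat c M J z'" and s: "same c J 0 n {} z z'" for z z'
   proof -
    have "n dvd (SUM i:J. b i*(ord (tc c i z)-ord (tc c i z')))"
     using s by (intro dvd_sum dvd_mult) (simp add: same_def)
    hence "n dvd (ord (f z)-a)-(ord (f z')-a)"
     by (simp add: b[OF z(1)] b[OF z(2)] right_diff_distrib sum_subtractf)
    thus ?thesis unfolding dvd(3) mem_Collect_eq by (metis dvd_diff_commute dvd_diff_right_iff dvd_diff_left_iff)
   qed
   thus ?thesis using dvd(2) by (intro exI[of _ 0] exI[of _ n] exI[of _ "{}"]) simp
  qed
 qed
qed

lemma agree_same:
 assumes "finite bb" "bb <= BasA (tc c ` {..<M})" and J: "J <= {..<M}"
 shows "EX k N I. N > 0 & finite I & (ALL z z'. pat c M J z --> pat c M J z' --> same c J k N I z z' --> agree bb z z')"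
 using assms(1,2)
proof (induction bb rule: finite_induct)
 case empty
 show ?case by (rule exI[of _ 0], rule exI[of _ 1], rule exI[of _ "{}"]) (simp add: agree_def)
next
 case (insert B bb)
 then obtain k N I where 1: "N > 0" "finite I" "!!z z'. pat c M J z ==> pat c M J z' ==> same c J k N I z z' ==> agree bb z z'"
  by blast
 obtain k' N' I' where 2: "N' > 0" "finite I'" "!!z z'. pat c M J z ==> pat c M J z' ==> same c J k' N' I' z z' ==> z:B <-> z':B"
  using basic_same[OF _ J, of B c] insert.prems by blast
 have "agree (insert B bb) z z'" if z: "pat c M J z" "pat c M J z'" and s: "same c J (max k k') (N*N') (I Un I') z z'" for z z'
 proof -
  have "same c J k N I z z'" "same c J k' N' I' z z'" by (rule same_mono[OF s]; simp)+
  hence "agree bb z z'" "z:B <-> z':B" using 1(3)[OF z] 2(3)[OF z] by blast+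
  thus ?thesis by (simp add: agree_def)
 qed
 thus ?case using 1(1,2) 2(1,2) by (intro exI[of _ "max k k'"] exI[of _ "N*N'"] exI[of _ "I Un I'"]) simp
qed

type_synonym 'x cell = "(nat => (nat => 'x) => 'x) \<times> nat set \<times> nat \<times> (nat => 'x) \<times> (nat => int) set \<times> (nat => int)"

text \<open>Coordinate \<open>m\<close> is going to carry the value of the function. Its order is
  affine in \<open>v\<close> only after multiplication by \<open>e\<close>, the root exponent of the
  monomial description. The prescribed angular components have to be attained, so that every
  \<open>v\<close> is realised by points.\<close>

definition cell_ok :: "(nat => 'r) set => nat => nat => 'r cell => bool" where
 "cell_ok S m M = (%(c, J, k, ka, G, b). cen M c & J <= {..<M} & finite G & (ALL i:J. EX x. nm x ~= 0 & ac k x = ka i) &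
   (ALL v:lspan G b. ALL z. tdat c M J k ka v z --> z:S) &
   ((ALL v:lspan G b. ALL z. tdat c M J k ka v z --> nm (z m) = 0) \<or>
   (EX e>0. EX aa bb. ALL v:lspan G b. ALL z. tdat c M J k ka v z --> nm (z m) ~= 0 &
     int e * ord (z m) = (SUM i:J. aa i * v i)+bb)))"

definition in_cell :: "nat => (nat => 'r) => 'r cell => bool" where
 "in_cell M z = (%(c, J, k, ka, G, b). EX v:lspan G b. tdat c M J k ka v z)"

lemma nm_root_ord:
 assumes "nm x ~= 0" "nm d ~= 0" "nm n ~= 0" "nm x^e*nm d = C*nm n"
 shows "C = Q powi (ord n-ord d-int e * ord x)"
proof -
 have 1: "(Q powi (- ord x))^e*Q powi (- ord d) = C*Q powi (- ord n)"
  using assms(4) unfolding nm_ord[OF assms(1)] nm_ord[OF assms(2)] nm_ord[OF assms(3)] .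
 have 2: "(Q powi (- ord x))^e = Q powi (- (int e * ord x))"
  using power_int_mult[of Q "- ord x" "int e"] by (simp add: mult.commute)
 have "C = C*(Q powi (- ord n)*Q powi (ord n))" using Q_gt1 by (simp add: power_int_add[symmetric])
 also have "... = Q powi (- (int e * ord x))*Q powi (- ord d)*Q powi ord n" using 1 unfolding 2 by simp
 also have "... = Q powi (ord n-ord d-int e * ord x)" using Q_gt1 by (simp add: power_int_add[symmetric] algebra_simps)
 finally show ?thesis .
qed

text \<open>For a fixed pattern \<open>J\<close> the points fall into finitely many classes
  according to angular components, residues of orders and signs of linear forms. The admissible
  order vectors of a class are the integer points of a polyhedron with congruences, and
  \<open>polyhedral_lspan\<close> cuts them into pieces of the required shape.\<close>

lemma cells_pat:
 assumes c: "cen M c" and J: "J <= {..<M}" and L: "LMA (tc c ` {..<M}) 0 V (%z. z m)"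
  and V: "det (BasA (tc c ` {..<M})) UNIV (%z. z:V)" and S: "det (BasA (tc c ` {..<M})) V (%z. z:S)"
 shows "EX P. finite P & (ALL p:P. cell_ok S m M p) & (ALL z:V Int S. pat c M J z --> (EX p:P. in_cell M z p))"
proof -
 let ?T = "tc c ` {..<M}"
 have fJ: "finite J" using J finite_subset by blast
 obtain E N D C where X: "det (BasA ?T) V (%z. (E z, N z, D z, C z))"
  "!!z. z:V ==> nm (z m) ~= 0 ==> mono_at ?T (%z. z m) z (E z, N z, D z, C z)"
  using LM_X[OF L] by blast
 define F where "F z = (z:S, nm (z m) = 0, E z, N z, D z, C z)" for z
 \<comment> \<open>The value \<open>None\<close> outside \<open>V\<close> makes equality of
   \<open>F'\<close> also transport membership in \<open>V\<close>.\<close>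
 define F' where "F' z = (if z:V then Some (F z) else None)" for z
 have FV: "det (BasA ?T) V F" unfolding F_def by (intro det_pair[OF S] det_pair[OF LM_zero_det[OF L]] X(1))
 have "det (BasA ?T) UNIV F'"
 proof (rule det_glue[OF V])
  fix a
  show "det (BasA ?T) {z:UNIV. (z:V) = a} F'"
  proof (cases a)
   case True
   hence "{z:UNIV. (z:V) = a} = V" by auto
   thus ?thesis using det_cong[OF det_comp[OF FV, of Some], of F'] by (simp add: F'_def)
  next
   case False
   show ?thesis by (rule det_cong[OF det_const[of _ _ None]]) (use False in "auto simp: F'_def")
  qed
 qed
 then obtain bb where b: "finite bb" "bb <= BasA ?T" "ALL z:UNIV. ALL z':UNIV. agree bb z z' --> F' z = F' z'" by (rule detE)
 obtain k n I where s: "n > 0" "finite I" "!!z z'. pat c M J z ==> pat c M J z' ==> same c J k n I z z' ==> agree bb z z'"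
  using agree_same[OF b(1,2) J] by blast
 have sF: "F' z = F' z'" if "pat c M J z" "pat c M J z'" "same c J k n I z z'" for z z'
  by (rule b(3)[rule_format, OF UNIV_I UNIV_I s(3)[OF that]])
 define ka where "ka z = restrict (%i. ac k (tc c i z)) J" for z
 define rh where "rh z = restrict (%i. ord (tc c i z) mod n) J" for z
 define io where "io z = {p:I. 0 <= tlin c J p z}" for z
 define d where "d z = (ka z, rh z, io z)" for z
 define W where "W = {z:V Int S. pat c M J z}"
 have fd: "finite (d ` W)"
 proof (rule finite_subset)
  show "d ` W <= (J \<rightarrow>\<^sub>E range (ac k)) \<times> (J \<rightarrow>\<^sub>E {0..<n}) \<times> Pow I"
   using s(1) by (auto simp: d_def ka_def rh_def io_def)
  show "finite ((J \<rightarrow>\<^sub>E range (ac k)) \<times> (J \<rightarrow>\<^sub>E {0..<n}) \<times> Pow I)"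
   using fJ s(2) finite_range_ac by (intro finite_cartesian_product finite_PiE) auto
 qed
 define vv where "vv z = (%i. if i:J then ord (tc c i z) else 0)" for z
 \<comment> \<open>The forms that are negative at \<open>z\<close> enter with opposite sign; over
   the integers \<open>x < 0\<close> is \<open>0 <= -x-1\<close>, whence the -1.\<close>
 define Ip where "Ip z = io z Un (%p. (%i. - fst p i, - snd p-1)) ` (I-io z)" for z
 define Ga where "Ga z = {ga. (ALL i. i ~: J --> ga i = 0) & (ALL i:J. n dvd ga i-ord (tc c i z)) &
   (ALL p:Ip z. 0 <= (SUM i:J. fst p i*ga i) + snd p)}" for z
 have "ALL z. EX B G. finite B & finite G & Ga z = (UN b:B. lspan G b)"
  unfolding Ga_def by (intro allI polyhedral_lspan fJ) (use s(2) in "auto simp: Ip_def io_def")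
 then obtain B G where BG: "!!z. finite (B z)" "!!z. finite (G z)" "!!z. Ga z = (UN b:B z. lspan (G z) b)" by metis
 have pt: "pat c M J z" if "tdat c M J k ka' v z" for ka' v z
  using that J by (auto simp: tdat_def pat_def split: if_splits)
 have same: "same c J k n I z0 z" if v: "v:Ga z0" and t: "tdat c M J k (ka z0) v z" for z0 v z
  unfolding same_def
 proof (intro conjI ballI)
  fix i assume i: "i:J"
  hence t': "ac k (tc c i z) = ka z0 i" "ord (tc c i z) = v i" using t J by (auto simp: tdat_def)
  show "ac k (tc c i z0) = ac k (tc c i z)" using t'(1) i by (simp add: ka_def)
  show "n dvd ord (tc c i z0)-ord (tc c i z)" using v i t'(2) by (simp add: Ga_def dvd_diff_commute)
 next
  fix p assume p: "p:I"
  have e: "tlin c J p z = (SUM i:J. fst p i * v i) + snd p"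
   unfolding tlin_def using t J by (intro arg_cong2[where f = "(+)"] sum.cong) (auto simp: tdat_def)
  show "0 <= tlin c J p z0 <-> 0 <= tlin c J p z"
  proof (cases "p:io z0")
   case True
   hence "0 <= (SUM i:J. fst p i * v i) + snd p" using v by (auto simp: Ga_def Ip_def)
   thus ?thesis using True e by (simp add: io_def)
  next
   case False
   hence "(%i. - fst p i, - snd p-1):Ip z0" using p by (auto simp: Ip_def)
   hence "0 <= (SUM i:J. - fst p i * v i)+(- snd p-1)" using v by (fastforce simp: Ga_def)
   thus ?thesis using False p e by (simp add: io_def sum_negf)
  qed
 qed
 have ok: "cell_ok S m M (c, J, k, ka z0, G z0, b0)" if z0: "z0:W" and b0: "b0:B z0" for z0 b0
 proof -
  have sub: "lspan (G z0) b0 <= Ga z0" using b0 BG(3) by blast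
  have p0: "pat c M J z0" "z0:V" "z0:S" using z0 by (auto simp: W_def)
  have FF: "z:V" "F z = F z0" if "v:lspan (G z0) b0" "tdat c M J k (ka z0) v z" for v z
  proof -
   have "F' z0 = F' z" by (rule sF[OF p0(1) pt[OF that(2)] same[OF _ that(2)]]) (use that(1) sub in blast)
   thus "z:V" "F z = F z0" using p0(2) by (auto simp: F'_def split: if_splits)
  qed
  have x: "ALL i:J. EX x. nm x ~= 0 & ac k x = ka z0 i"
  proof
   fix i assume i: "i:J"
   hence "nm (tc c i z0) ~= 0" using p0(1) J by (auto simp: pat_def)
   thus "EX x. nm x ~= 0 & ac k x = ka z0 i" using i by (intro exI[of _ "tc c i z0"]) (simp add: ka_def)
  qed
  have inS: "ALL v:lspan (G z0) b0. ALL z. tdat c M J k (ka z0) v z --> z:S"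
   using FF(2) p0(3) by (auto simp: F_def)
  have "(ALL v:lspan (G z0) b0. ALL z. tdat c M J k (ka z0) v z --> nm (z m) = 0) |
   (EX e>0. EX aa bb. ALL v:lspan (G z0) b0. ALL z. tdat c M J k (ka z0) v z --> nm (z m) ~= 0 &
     int e * ord (z m) = (SUM i:J. aa i * v i)+bb)"
  proof (cases "nm (z0 m) = 0")
   case True
   hence "ALL v:lspan (G z0) b0. ALL z. tdat c M J k (ka z0) v z --> nm (z m) = 0"
    using FF(2) by (auto simp: F_def)
   thus ?thesis by blast
  next
   case False
   note m0 = mono_atD[OF X(2)[OF p0(2) False]]
   obtain a where a: "!!z. pat c M J z ==> nm (N z0 z) ~= 0 & ord (N z0 z) = (SUM i:J. a i * ord (tc c i z))"
    using mon_ord[OF m0(3) J] p0(1) m0(5) by blast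
   obtain a' where a': "!!z. pat c M J z ==> nm (D z0 z) ~= 0 & ord (D z0 z) = (SUM i:J. a' i * ord (tc c i z))"
    using mon_ord[OF m0(4) J] p0(1) m0(6) by blast
   \<comment> \<open>The constant \<open>C\<close> of the monomial description is the same
     throughout the class, so the affine constant may be computed at the representative
     \<open>z0\<close>.\<close>
   define bb0 where "bb0 = int (E z0) * ord (z0 m)-ord (N z0 z0) + ord (D z0 z0)"
   have R: "nm (z m) ~= 0 & int (E z0) * ord (z m) = (SUM i:J. (a i-a' i) * v i)+bb0"
    if v: "v:lspan (G z0) b0" and t: "tdat c M J k (ka z0) v z" for v z
   proof -
    have nz: "nm (z m) ~= 0" and e: "E z = E z0" "N z = N z0" "D z = D z0" "C z = C z0"
     using FF(2)[OF v t] False by (auto simp: F_def)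
    note m1 = mono_atD[OF X(2)[OF FF(1)[OF v t] nz], unfolded e]
    have "Q powi (ord (N z0 z)-ord (D z0 z)-int (E z0) * ord (z m)) = Q powi (ord (N z0 z0)-ord (D z0 z0)-int (E z0) * ord (z0 m))"
     using nm_root_ord[OF nz m1(6,5,7)] nm_root_ord[OF False m0(6,5,7)] by simp
    hence "int (E z0) * ord (z m) = ord (N z0 z)-ord (D z0 z)+bb0" unfolding powi_inj bb0_def by linarith
    also have "ord (N z0 z)-ord (D z0 z) = (SUM i:J. (a i-a' i) * ord (tc c i z))"
     using a[OF pt[OF t]] a'[OF pt[OF t]] by (simp add: left_diff_distrib sum_subtractf)
    also have "... = (SUM i:J. (a i-a' i) * v i)" using t J by (intro sum.cong) (auto simp: tdat_def)
    finally show ?thesis using nz by simp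
   qed
   have "E z0 > 0" using m0(1) by linarith
   thus ?thesis
    by (intro disjI2 exI[of _ "E z0"] conjI exI[of _ "%i. a i-a' i"] exI[of _ bb0] ballI allI impI R)
  qed
  thus ?thesis unfolding cell_ok_def prod.case
   by (rule conjI[OF c conjI[OF J conjI[OF BG(2) conjI[OF x conjI[OF inS]]]]])
 qed
 define r where "r = inv_into W d"
 have r: "r y:W" "d (r y) = y" if "y:d ` W" for y
  unfolding r_def using inv_into_into[OF that] f_inv_into_f[OF that] by simp_all
 define P where "P = (UN y:d ` W. (%b0. (c, J, k, ka (r y), G (r y), b0)) ` B (r y))"
 have "finite P" unfolding P_def by (intro finite_UN_I fd finite_imageI BG(1))
 moreover have "ALL p:P. cell_ok S m M p" unfolding P_def using ok r(1) by blast
 moreover have "EX p:P. in_cell M z p" if z: "z:W" for z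
 proof -
  define z0 where "z0 = r (d z)"
  have z0: "d z0 = d z" unfolding z0_def using r(2) z by blast
  have p: "pat c M J z" using z by (simp add: W_def)
  have "vv z:Ga z0" unfolding Ga_def mem_Collect_eq
  proof (intro conjI ballI allI impI)
   fix i assume i: "i:J"
   have "rh z0 i = rh z i" using z0 by (simp add: d_def)
   hence "ord (tc c i z) mod n = ord (tc c i z0) mod n" using i by (simp add: rh_def)
   thus "n dvd vv z i-ord (tc c i z0)" using i by (simp add: vv_def mod_eq_dvd_iff)
  next
   fix p assume p: "p:Ip z0"
   have l: "(SUM i:J. fst q i * vv z i) + snd q = tlin c J q z" for q
    unfolding tlin_def by (simp add: vv_def)
   have i: "io z0 = io z" using z0 by (simp add: d_def)
   show "0 <= (SUM i:J. fst p i * vv z i) + snd p"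
   proof (cases "p:io z0")
    case True
    hence "p:io z" using i by simp
    thus ?thesis unfolding l by (simp add: io_def)
   next
    case False
    then obtain q where q: "q:I-io z" "p = (%i. - fst q i, - snd q-1)" using p i by (auto simp: Ip_def)
    hence "tlin c J q z < 0" by (auto simp: io_def)
    thus ?thesis using l[of q] q(2) by (simp add: sum_negf)
   qed
  qed (simp add: vv_def)
  then obtain b0 where b0: "b0:B z0" "vv z:lspan (G z0) b0" using BG(3) by blast
  have kk: "ka z0 = ka z" using z0 by (simp add: d_def)
  have "tdat c M J k (ka z0) (vv z) z" unfolding kk using p by (auto simp: tdat_def ka_def vv_def pat_def)
  hence "in_cell M z (c, J, k, ka z0, G z0, b0)" using b0(2) by (auto simp: in_cell_def)
  moreover have "(c, J, k, ka z0, G z0, b0):P" unfolding P_def z0_def using z b0(1) by (auto simp: z0_def)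
  ultimately show ?thesis by blast
 qed
 ultimately show ?thesis unfolding W_def by blast
qed

theorem cells_exist:
 assumes S: "det (BasA (polyf M)) UNIV (%z. z:S)" and m: "m < M"
 shows "EX P. finite P & (ALL p:P. cell_ok S m M p) & (ALL z:S. EX p:P. in_cell M z p)"
proof -
 obtain G k where G: "finite G" "G <= polyf M" "det (Bas G k) UNIV (%z. z:S)" using det_BasA_finite[OF S] by blast
 \<comment> \<open>The coordinate \<open>m\<close> joins the generators of \<open>S\<close>, so that
   its order is controlled on the same pieces.\<close>
 have "finite (insert (%z. z m) G)" "insert (%z. z m) G <= polyf M" using G m polyf_var by auto
 from tower[OF this, of k] obtain L where L: "finite L" "ALL z. EX (c, V):L. z:V" "ALL (c, V):L. cen M c &
   det (BasA (tc c ` {..<M})) UNIV (%z. z:V) & (ALL f:insert (%z. z m) G. LMA (tc c ` {..<M}) k V f)" by blast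
 have "ALL l:L. ALL J:Pow {..<M}. EX P. finite P & (ALL p:P. cell_ok S m M p) & (ALL z:snd l Int S. pat (fst l) M J z --> (EX p:P. in_cell M z p))"
 proof (intro ballI)
  fix l J assume l: "l:L" and J: "J:Pow {..<M}"
  obtain c V where cV: "l = (c, V)" by (cases l)
  have 1: "cen M c" "det (BasA (tc c ` {..<M})) UNIV (%z. z:V)" "!!f. f:insert (%z. z m) G ==> LMA (tc c ` {..<M}) k V f"
   using L(3) l cV by auto
  have "det (BasA (tc c ` {..<M})) V (%z. z:S)"
   by (rule LM_det_trans[OF det_dom[OF G(3) subset_UNIV] 1(3)]) simp
  moreover have "LMA (tc c ` {..<M}) 0 V (%z. z m)"
   by (rule LM_mono[OF 1(3) order_refl order_refl order_refl]) simp_all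
  ultimately show "EX P. finite P & (ALL p:P. cell_ok S m M p) & (ALL z:snd l Int S. pat (fst l) M J z --> (EX p:P. in_cell M z p))"
   using cells_pat[OF 1(1) _ _ 1(2)] J cV by simp
 qed
 then obtain P where P: "!!l J. l:L ==> J:Pow {..<M} ==> finite (P l J) & (ALL p:P l J. cell_ok S m M p) &
   (ALL z:snd l Int S. pat (fst l) M J z --> (EX p:P l J. in_cell M z p))" by metis
 have "EX p:(UN l:L. UN J:Pow {..<M}. P l J). in_cell M z p" if z: "z:S" for z
 proof -
  obtain c V where l: "(c, V):L" "z:V" using L(2) by blast
  define J where "J = {i. i < M & nm (tc c i z) ~= 0}"
  have "pat c M J z" "J:Pow {..<M}" by (auto simp: pat_def J_def)
  hence "EX p:P (c, V) J. in_cell M z p" using P[OF l(1)] l(2) z by auto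
  thus ?thesis using l(1) `J:Pow {..<M}` by blast
 qed
 moreover have "finite (UN l:L. UN J:Pow {..<M}. P l J)"
  by (intro finite_UN_I L(1)) (use P in auto)
 moreover have "ALL p:(UN l:L. UN J:Pow {..<M}. P l J). cell_ok S m M p" using P by blast
 ultimately show ?thesis by blast
qed

lemma ac_shift: assumes "nm x ~= 0" shows "EX y. nm y ~= 0 & ord y = n & ac k y = ac k x"
proof -
 define y where "y = nf x*pw n"
 have n1: "nm (nf x) = 1" by (rule nm_nf[OF assms])
 have ny: "nm y = Q powi (- n)" by (simp add: y_def nm_mult n1 nm_pw)
 have o: "ord y = n" by (rule ordI[OF ny])
 have o2: "nm y ~= 0" unfolding ny using powi_pos[of "- n"] by linarith
 have "eqv (nf y) (nf x)"
 proof -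
  have "nf y = y*pw (- n)" by (simp add: nf_def o)
  also have "... = nf x*(pw n*pw (- n))" by (simp add: y_def mult.assoc)
  also have "eqv (nf x*(pw n*pw (- n))) (nf x*1)" by (intro eqv_mult eqv_refl pw_cancel)
  finally show ?thesis by simp
 qed
 hence "ac k y = ac k x" unfolding ac_eq_iff eqv_def using less_imp_le[OF ep_pos[of k]] by simp
 thus ?thesis using o o2 by blast
qed

text \<open>Coordinates are solved for one after another: a center depends on earlier coordinates
  only, so adding to it an element with the prescribed order and angular component, or 0, gives the
  next coordinate.\<close>

lemma tdat_extend:
 assumes c: "cen M c" and ka: "ALL i:J. EX x. nm x ~= 0 & ac k x = ka i" and m: "m <= M" and x: "tdat c m J k ka v x"
 shows "EX z. (ALL i<m. z i = x i) & tdat c M J k ka v z"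
 using m c
proof (induction M rule: dec_induct)
 case base
 show ?case using x by blast
next
 case (step n)
 hence "cen n c" by (simp add: cen_def)
 then obtain z where z: "ALL i<m. z i = x i" "tdat c n J k ka v z" using step.IH by blast
 have "EX s. if n:J then nm s ~= 0 & ac k s = ka n & ord s = v n else nm s = 0"
 proof (cases "n:J")
  case True
  then obtain x where "nm x ~= 0" "ac k x = ka n" using ka by blast
  thus ?thesis using ac_shift[of x "v n" k] True by auto
 qed (auto intro: exI[of _ 0])
 then obtain s where s: "if n:J then nm s ~= 0 & ac k s = ka n & ord s = v n else nm s = 0" by blast
 define z' where "z' = z(n := c n z + s)"
 have cc: "c i z' = c i z" if "i <= n" for i
 proof -
  have "ALL z z'. (ALL j<i. z j = z' j) --> c i z = c i z'" using step.prems that by (auto simp: cen_def)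
  thus ?thesis by (elim allE impE) (use that in "simp_all add: z'_def")
 qed
 have "tdat c (Suc n) J k ka v z'" unfolding tdat_def
 proof (intro allI impI)
  fix i assume "i < Suc n"
  then consider "i < n" | "i = n" by linarith
  thus "if i:J then nm (tc c i z') ~= 0 & ac k (tc c i z') = ka i & ord (tc c i z') = v i else nm (tc c i z') = 0"
  proof cases
   case 1
   hence "tc c i z' = tc c i z" using cc[of i] by (simp add: tc_def z'_def)
   thus ?thesis using z(2) 1 by (simp add: tdat_def)
  next
   case 2
   hence "tc c i z' = s" using cc[of n] by (simp add: tc_def z'_def)
   thus ?thesis using s 2 by simp
  qed
 qed
 moreover have "ALL i<m. z' i = x i" using z(1) step.hyps by (simp add: z'_def)
 ultimately show ?case by blast
qed

section \<open>Measures of sets given by centers\<close>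

lemma powi_ge0 [simp]: "0 <= Q powi a" by (simp add: less_imp_le)
lemma ep_ge0 [simp]: "0 <= ep k" by (simp add: less_imp_le)

text \<open>Measurability of a function into the valued ring, tested on closed balls.\<close>

definition msr :: "'x measure => ('x => 'r) => bool" where
 "msr M h <-> (ALL a n. {x:space M. nm (h x-a) <= Q powi n}:sets M)"

lemma msrD: "msr M h ==> {x:space M. nm (h x-a) <= Q powi n}:sets M"
 by (simp add: msr_def)

lemma dense_countable: "EX D. countable D & (ALL x n. EX d:D. nm (x-d) <= Q powi n)"
proof -
 have "ALL k. EX U. finite U & (ALL x. nm x <= 1 --> (EX u:U. nm (x-u) <= ep k))" using fin_res_ep by blast
 then obtain U where U: "!!k. finite (U k)" "!!k x. nm x <= 1 ==> EX u:U k. nm (x-u) <= ep k" by metis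
 define D where "D = (UN j. UN k. (%u. u*pw j) ` U k)"
 have "EX d:D. nm (x-d) <= Q powi n" for x n
 proof -
  define j where "j = ord x"
  obtain k where k: "ep k < Q powi (n+j)" using ep_ex[of "Q powi (n+j)"] by auto
  obtain u where u: "u:U k" "nm (nf x-u) <= ep k" using U(2)[OF nm_nf_le] by blast
  have "nm (x-u*pw j) <= Q powi n"
  proof (cases "nm x = 0")
   case True
   hence j0: "j = 0" by (simp add: j_def ord_zero)
   have "nm (nf x) = 0" using True by (simp add: nf_def nm_mult)
   hence "nm u <= ep k" using nm_diff_le[of "nf x" "ep k" "nf x-u"] u(2) by (simp del: nm_neg)
   hence "nm (u*pw j) <= Q powi n" using k by (simp add: j0 nm_mult nm_pw)
   thus ?thesis using True nm_diff_le[of x "Q powi n" "u*pw j"] by simp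
  next
   case False
   have "nm (x-nf x*pw j) = 0" using nf_pw[OF False] by (simp add: j_def eqv_def nm_minus_commute)
   moreover have "nm (nf x*pw j-u*pw j) <= Q powi n"
   proof -
    have "nm (nf x*pw j-u*pw j) = nm (nf x-u)*Q powi (- j)"
     by (simp only: left_diff_distrib[symmetric] nm_mult nm_pw)
    also have "... <= Q powi (n+j)*Q powi (- j)"
     using u(2) k by (intro mult_right_mono) auto
    also have "... = Q powi n" using Q_gt1 by (simp add: power_int_add[symmetric])
    finally show ?thesis .
   qed
   ultimately show ?thesis using nm_diff_trans[of x "nf x*pw j" "Q powi n"] by simp
  qed
  thus ?thesis using u(1) by (intro bexI[of _ "u*pw j"]) (auto simp: D_def)
 qed
 moreover have "countable D" unfolding D_def using U(1) by (intro countable_UN countable_image) (auto simp: countable_finite)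
 ultimately show ?thesis by blast
qed

lemma msr_const: "msr M (%x. a)"
 unfolding msr_def using sets.empty_sets sets.top by (auto intro: sets.sets_Collect_const)

text \<open>In an ultrametric space a sum lies in a ball exactly if, for some \<open>d\<close> of a
  countable dense set, the summands lie in the balls of the same radius around \<open>d\<close> and
  \<open>a-d\<close>.\<close>

lemma msr_add:
 assumes f: "msr M f" and g: "msr M g" shows "msr M (%x. f x+g x)"
 unfolding msr_def
proof (intro allI)
 fix a n
 obtain D where D: "countable D" "!!x n. EX d:D. nm (x-d) <= Q powi n" using dense_countable by blast
 have "nm (f x+g x-a) <= Q powi n <-> (EX d:D. nm (f x-d) <= Q powi n & nm (g x-(a-d)) <= Q powi n)" for x
 proof
  assume 1: "nm (f x+g x-a) <= Q powi n"
  obtain d where d: "d:D" "nm (f x-d) <= Q powi n" using D(2) by blast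
  have "nm (g x-(a-d)) <= Q powi n" using nm_diff_le[OF 1 d(2)] by (simp add: algebra_simps)
  thus "EX d:D. nm (f x-d) <= Q powi n & nm (g x-(a-d)) <= Q powi n" using d by blast
 next
  assume "EX d:D. nm (f x-d) <= Q powi n & nm (g x-(a-d)) <= Q powi n"
  then obtain d where "nm (f x-d) <= Q powi n" "nm (g x-(a-d)) <= Q powi n" by blast
  from nm_add_le[OF this] show "nm (f x+g x-a) <= Q powi n" by (simp add: algebra_simps)
 qed
 hence "{x:space M. nm (f x+g x-a) <= Q powi n} =
  (UN d:D. {x:space M. nm (f x-d) <= Q powi n} Int {x:space M. nm (g x-(a-d)) <= Q powi n})" by auto
 also have "...:sets M" by (intro sets.countable_UN'' D(1) sets.Int msrD[OF f] msrD[OF g])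
 finally show "{x:space M. nm (f x+g x-a) <= Q powi n}:sets M" .
qed

lemma powi_ex_less: "dl > 0 ==> EX k. Q powi (- int k) <= dl"
 using ep_ex unfolding ep_def by (meson less_imp_le)

lemma msr_mult:
 assumes f: "msr M f" and g: "msr M g" shows "msr M (%x. f x*g x)"
 unfolding msr_def
proof (intro allI)
 fix a n
 obtain D where D: "countable D" "!!x n. EX d:D. nm (x-d) <= Q powi n" using dense_countable by blast
 \<comment> \<open>Conditions on approximations \<open>d\<close>, \<open>d'\<close> of precision
   \<open>k\<close> under which the product changes by no more than the radius of the target
   ball.\<close>
 define ok where "ok d d' k <-> Q powi k*nm d <= Q powi n & Q powi k*nm d' <= Q powi n & Q powi k*Q powi k <= Q powi n &
  nm (d*d'-a) <= Q powi n" for d d' k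
 have e: "x*y-d*d' = (x-d)*(y-d')+((x-d)*d'+d*(y-d'))" for x y d d' :: 'r
  by (simp add: algebra_simps)
 have close: "nm (x*y-d*d') <= Q powi n" if "nm (x-d) <= Q powi k" "nm (y-d') <= Q powi k"
  "Q powi k*nm d <= Q powi n" "Q powi k*nm d' <= Q powi n" "Q powi k*Q powi k <= Q powi n" for x y d d' k
  unfolding e
 proof (intro nm_add_le)
  show "nm ((x-d)*(y-d')) <= Q powi n" unfolding nm_mult
   using mult_mono[OF that(1,2)] that(5) by (simp add: less_imp_le)
  show "nm ((x-d)*d') <= Q powi n" unfolding nm_mult
   using mult_right_mono[OF that(1), of "nm d'"] that(4) by simp
  show "nm (d*(y-d')) <= Q powi n" unfolding nm_mult
   using mult_right_mono[OF that(2), of "nm d"] that(3) by (simp add: mult.commute)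
 qed
 have "nm (f x*g x-a) <= Q powi n <->
  (EX d:D. EX d':D. EX k. ok d d' k & nm (f x-d) <= Q powi k & nm (g x-d') <= Q powi k)" for x
 proof
  assume 1: "nm (f x*g x-a) <= Q powi n"
  define b where "b = nm (f x)+nm (g x)+1"
  have b: "b > 0" "nm (f x) <= b" "nm (g x) <= b" "1 <= b"
   using nm_ge0[of "f x"] nm_ge0[of "g x"] unfolding b_def by linarith+
  obtain k where k: "Q powi (- int k) <= Q powi n/b" using powi_ex_less[of "Q powi n/b"] b(1) by auto
  have k1: "Q powi (- int k)*b <= Q powi n" using k b(1) by (simp add: pos_le_divide_eq)
  have k2: "Q powi (- int k) <= 1" using powi_le[of "- int k" 0] by simp
  obtain d d' where d: "d:D" "nm (f x-d) <= Q powi (- int k)" "d':D" "nm (g x-d') <= Q powi (- int k)" using D(2) by meson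
  have "nm d <= b" "nm d' <= b"
   using nm_diff_le[of "f x" b "f x-d"] nm_diff_le[of "g x" b "g x-d'"] d k2 b by auto
  have m: "Q powi (- int k)*y <= Q powi n" if "y <= b" for y
   using mult_left_mono[OF that powi_ge0[of "- int k"]] k1 by linarith
  have 2: "Q powi (- int k)*nm d <= Q powi n" "Q powi (- int k)*nm d' <= Q powi n" "Q powi (- int k)*Q powi (- int k) <= Q powi n"
   by (rule m, use `nm d <= b` `nm d' <= b` k2 b(4) in linarith)+
  have "nm (d*d'-a) <= Q powi n"
   by (rule nm_diff_trans[OF _ 1]) (subst nm_minus_commute, rule close[OF d(2,4) 2])
  thus "EX d:D. EX d':D. EX k. ok d d' k & nm (f x-d) <= Q powi k & nm (g x-d') <= Q powi k"
   using d 2 unfolding ok_def by blast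
 next
  assume "EX d:D. EX d':D. EX k. ok d d' k & nm (f x-d) <= Q powi k & nm (g x-d') <= Q powi k"
  then obtain d d' k where d: "ok d d' k" "nm (f x-d) <= Q powi k" "nm (g x-d') <= Q powi k" by blast
  have "nm (f x*g x-d*d') <= Q powi n" using d by (intro close[OF d(2,3)]) (simp_all add: ok_def)
  thus "nm (f x*g x-a) <= Q powi n" by (rule nm_diff_trans) (use d(1) in "simp add: ok_def")
 qed
 hence "{x:space M. nm (f x*g x-a) <= Q powi n} =
  (UN d:D. UN d':D. UN k:{k. ok d d' k}. {x:space M. nm (f x-d) <= Q powi k} Int {x:space M. nm (g x-d') <= Q powi k})" by auto
 also have "...:sets M"
  by (intro sets.countable_UN'' D(1) sets.Int msrD[OF f] msrD[OF g] countableI_type)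
 finally show "{x:space M. nm (f x*g x-a) <= Q powi n}:sets M" .
qed

lemma msr_polyf:
 assumes "f:polyf n" "!!i. i < n ==> msr M (%x. z x i)" shows "msr M (%x. f (z x))"
 using assms(1) by induction (auto intro: msr_const msr_add msr_mult assms(2))

lemma nm_measurable: assumes "msr M h" shows "(%x. nm (h x)):borel_measurable M"
proof (rule borel_measurableI_le)
 fix r
 have z: "{x:space M. nm (h x) <= Q powi n}:sets M" for n using msrD[OF assms, of 0 n] by simp
 show "{x:space M. nm (h x) <= r}:sets M"
 proof (cases "r > 0")
  case True
  then obtain k where "Q powi (- int k) <= r" using powi_ex_less by blast
  then obtain n0 where n0: "!!n. Q powi n <= r <-> n <= n0" using powi_le_iff[of r] by blast
  have "nm y <= r <-> nm y <= Q powi n0" for y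
  proof (cases "nm y = 0")
   case False
   show ?thesis unfolding nm_ord[OF False] powi_le n0 ..
  qed (use True in simp)
  thus ?thesis using z by simp
 next
  case False
  show ?thesis
  proof (cases "r = 0")
   case True
   have "nm y <= 0 <-> (ALL k. nm y <= Q powi (- int k))" for y
   proof (intro iffI allI)
    assume a: "ALL k. nm y <= Q powi (- int k)"
    show "nm y <= 0"
    proof (rule ccontr)
     assume "~ nm y <= 0"
     then obtain k where "ep k < nm y" using ep_ex by force
     thus False using a[rule_format, of k] by (simp add: ep_def)
    qed
   qed (meson order_trans less_imp_le powi_pos)
   hence "{x:space M. nm (h x) <= r} = (\<Inter>k. {x:space M. nm (h x) <= Q powi (- int k)})" using True by auto
   also have "...:sets M" using z by (intro sets.countable_INT') auto
   finally show ?thesis .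
  next
   case 2: False
   have "~ nm y <= r" for y using 2 False nm_ge0[of y] by linarith
   thus ?thesis by simp
  qed
 qed
qed

lemma ord_measurable: assumes "msr M h" shows "{x:space M. ord (h x) = n}:sets M"
proof -
 note [measurable] = nm_measurable[OF assms]
 have "ord y = n <-> (nm y = 0 & n = 0) | nm y = Q powi (- n)" for y
  using ordI[of y n] nm_ord[of y] ord_zero[of y] by auto
 moreover have "{x:space M. nm (h x) = c}:sets M" for c by measurable
 ultimately show ?thesis by (simp only:) (intro sets.sets_Collect_disj sets.sets_Collect_conj sets.sets_Collect_const)
qed

lemma Bas_measurable:
 assumes B: "B:BasA (polyf n)" and z: "!!i. i < n ==> msr M (%x. z x i)"
 shows "{x:space M. z x:B}:sets M"
proof -
 obtain k where "B:Bas (polyf n) k" using B by (auto simp: BasA_def)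
 thus ?thesis
 proof (cases rule: BasE)
  case (cmp f g r)
  have fg: "f:polyf n" "g:polyf n" using cmp(1,2) fring_mon[OF fring_polyf] by blast+
  have [measurable]: "(%x. nm (f (z x))):borel_measurable M" by (rule nm_measurable[OF msr_polyf[OF fg(1) z]])
  have [measurable]: "(%x. nm (g (z x))):borel_measurable M" by (rule nm_measurable[OF msr_polyf[OF fg(2) z]])
  show ?thesis unfolding cmp(3) mem_Collect_eq by measurable
 next
  case (ac f l u)
  have f: "msr M (%x. f (z x))" by (rule msr_polyf[OF ac(1) z])
  show ?thesis
  proof (cases "EX y. ac l y = u")
   case True
   then obtain y where y: "ac l y = u" by blast
   have "{x:space M. z x:B} = (UN j. {x:space M. ord (f (z x)) = j} Int {x:space M. nm (f (z x)*pw (- j)-nf y) <= Q powi (- int l)})"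
    unfolding ac(3) y[symmetric] mem_Collect_eq ac_eq_iff by (auto simp: nf_def ep_def)
   also have "...:sets M"
    by (intro sets.countable_UN'' sets.Int ord_measurable[OF f] msrD[OF msr_mult[OF f msr_const]]) simp
   finally show ?thesis .
  next
   case False
   hence "{x:space M. z x:B} = {}" unfolding ac(3) by auto
   thus ?thesis by (simp only: sets.empty_sets)
  qed
 next
  case (dvd f d a)
  hence f: "msr M (%x. f (z x))" using fring_mon[OF fring_polyf] by (intro msr_polyf[OF _ z]) blast+
  have "{x:space M. z x:B} = (UN j:{j. d dvd j-a}. {x:space M. ord (f (z x)) = j})" unfolding dvd(3) by auto
  also have "...:sets M" by (intro sets.countable_UN'' ord_measurable[OF f]) simp
  finally show ?thesis .
 qed
qed

lemma det_measurable:
 assumes P: "det (BasA (polyf n)) UNIV P" and z: "!!i. i < n ==> msr M (%x. z x i)"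
 shows "{x:space M. P (z x)}:sets M"
proof -
 obtain bb where b: "finite bb" "bb <= BasA (polyf n)" "ALL w:UNIV. ALL w':UNIV. agree bb w w' --> P w = P w'"
  by (rule detE[OF P])
 define atm where "atm w = {B:bb. w:B}" for w
 have P: "P w = P w'" if "atm w = atm w'" for w w'
  by (rule b(3)[rule_format, OF UNIV_I UNIV_I]) (use that in "auto simp: agree_def atm_def")
 have "{x:space M. P (z x)} = (UN ga:atm ` {w. P w}. {x:space M. ALL B:bb. z x:B <-> B:ga})"
 proof (intro subset_antisym subsetI)
  fix x assume "x:{x:space M. P (z x)}"
  thus "x:(UN ga:atm ` {w. P w}. {x:space M. ALL B:bb. z x:B <-> B:ga})" by (auto simp: atm_def)
 next
  fix x assume "x:(UN ga:atm ` {w. P w}. {x:space M. ALL B:bb. z x:B <-> B:ga})"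
  then obtain w where w: "P w" "x:space M" "ALL B:bb. z x:B <-> B:atm w" by auto
  have "atm (z x) = atm w" using w(3) by (auto simp: atm_def)
  thus "x:{x:space M. P (z x)}" using P w(1,2) by blast
 qed
 also have "...:sets M"
 proof (intro sets.finite_UN)
  show "finite (atm ` {w. P w})" by (rule finite_subset[of _ "Pow bb"]) (use b(1) in "auto simp: atm_def")
  fix ga
  have "{x:space M. ALL B:bb. z x:B <-> B:ga}:sets M"
  proof (rule sets.sets_Collect_finite_All[OF _ b(1)])
   fix B assume "B:bb"
   hence "B:BasA (polyf n)" using b(2) by blast
   hence "{x:space M. z x:B}:sets M" by (rule Bas_measurable) (rule z)
   thus "{x:space M. z x:B <-> B:ga}:sets M" by (cases "B:ga") (simp_all add: sets.sets_Collect_neg)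
  qed
  thus "{x:space M. ALL B:bb. z x:B <-> B:ga}:sets M" .
 qed
 finally show ?thesis .
qed

text \<open>The second clause of \<open>cen\<close> serves this purpose: centers are not
  polynomials, but their closeness to a constant is decided by finitely many polynomial
  conditions.\<close>

lemma cen_measurable:
 assumes c: "cen M c" and i: "i < M" and z: "!!j. j < i ==> msr N (%x. z x j)"
 shows "msr N (%x. c i (z x))"
 unfolding msr_def
proof (intro allI)
 fix a n
 have "det (BasA (polyf i)) UNIV (%z. nm (c i z-a) <= Q powi n)" using c i by (simp add: cen_def)
 thus "{x:space N. nm (c i (z x)-a) <= Q powi n}:sets N" by (rule det_measurable) (rule z)
qed

end

text \<open>Fubini, one coordinate at a time. The \<open>i\<close>-th condition involves only the
  coordinates up to \<open>i\<close>, and the measures of its sections have bounds independent of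
  the earlier coordinates, so the bounds multiply.\<close>

lemma triangular_measure:
 fixes h :: "'b measure" and P :: "nat => (nat => 'b) => bool"
 assumes sf: "sigma_finite_measure h"
  and P: "!!i. i < m ==> {x:space (PiM {..<Suc i} (%_. h)). P i x}:sets (PiM {..<Suc i} (%_. h))"
  and dep: "!!i x x'. (!!j. j <= i ==> x j = x' j) ==> P i x = P i x'"
  and lo: "!!i x. i < m ==> x:space (PiM {..<i} (%_. h)) ==> lo i <= emeasure h {y:space h. P i (x(i := y))}"
  and up: "!!i x. i < m ==> x:space (PiM {..<i} (%_. h)) ==> emeasure h {y:space h. P i (x(i := y))} <= up i"
 defines "W == %m. {x:space (PiM {..<m} (%_. h)). ALL i<m. P i x}"
 shows "W m:sets (PiM {..<m} (%_. h)) & (PROD i<m. lo i) <= emeasure (PiM {..<m} (%_. h)) (W m) &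
  emeasure (PiM {..<m} (%_. h)) (W m) <= (PROD i<m. up i)"
 using P lo up
proof (induction m)
 case 0
 have "W 0 = {%_. undefined}" by (auto simp: W_def space_PiM)
 thus ?case by (simp add: PiM_empty)
next
 case (Suc m)
 interpret product_sigma_finite "%_::nat. h" by (rule product_sigma_finite.intro) (rule sf)
 let ?M = "%m. PiM {..<m} (%_::nat. h)"
 have IH: "W m:sets (?M m)" "(PROD i<m. lo i) <= emeasure (?M m) (W m)" "emeasure (?M m) (W m) <= (PROD i<m. up i)"
  using Suc.IH Suc.prems by auto
 have rst: "(%x. restrict x {..<m}):measurable (?M (Suc m)) (?M m)"
  by (rule measurable_restrict_subset) auto
 have Weq: "W (Suc m) = ((%x. restrict x {..<m}) -` W m Int space (?M (Suc m))) Int {x:space (?M (Suc m)). P m x}"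
 proof -
  have "P i (restrict x {..<m}) = P i x" if "i < m" for i x by (rule dep) (use that in simp)
  moreover have "restrict x {..<m}:space (?M m)" if "x:space (?M (Suc m))" for x
   using measurable_space[OF rst that] .
  ultimately show ?thesis by (auto simp: W_def less_Suc_eq)
 qed
 have WS: "W (Suc m):sets (?M (Suc m))"
  unfolding Weq by (intro sets.Int measurable_sets[OF rst IH(1)] Suc.prems(1)) simp
 have ins: "{..<Suc m} = insert m {..<m}" by auto
 have ind: "indicator (W (Suc m)) (x(m := y)) = (indicator (W m) x*indicator {y:space h. P m (x(m := y))} y :: ennreal)"
  if x: "x:space (?M m)" and y: "y:space h" for x y
 proof -
  have "P i (x(m := y)) = P i x" if "i < m" for i by (rule dep) (use that in simp)
  moreover have "x(m := y):space (?M (Suc m))" using x y unfolding space_PiM ins by (rule PiE_fun_upd[rotated])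
  ultimately show ?thesis using x y by (auto simp: W_def less_Suc_eq indicator_def)
 qed
 have sec: "{y:space h. P m (x(m := y))}:sets h" if x: "x:space (?M m)" for x
 proof -
  have "(%y. x(m := y)):measurable h (?M (Suc m))" unfolding ins
   by (rule measurable_fun_upd[where J = "{..<m}"]) (use x in auto)
  from measurable_sets[OF this Suc.prems(1)[OF lessI]] measurable_space[OF this]
  have "{y:space h. x(m := y):space (?M (Suc m)) & P m (x(m := y))}:sets h"
   by (simp add: vimage_def Int_def conj_commute)
  moreover have "{y:space h. x(m := y):space (?M (Suc m)) & P m (x(m := y))} = {y:space h. P m (x(m := y))}"
   using measurable_space[OF `(%y. x(m := y)):measurable h (?M (Suc m))`] by auto
  ultimately show ?thesis by simp
 qed
 have "emeasure (?M (Suc m)) (W (Suc m)) = (\<integral>\<^sup>+ x. indicator (W (Suc m)) x \<partial>?M (Suc m))" using WS by simp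
 also have "... = (\<integral>\<^sup>+ x. (\<integral>\<^sup>+ y. indicator (W (Suc m)) (x(m := y)) \<partial>h) \<partial>?M m)"
  unfolding ins by (rule product_nn_integral_insert) (use WS in "auto simp: ins")
 also have "... = (\<integral>\<^sup>+ x. indicator (W m) x*emeasure h {y:space h. P m (x(m := y))} \<partial>?M m)"
 proof (rule nn_integral_cong)
  fix x assume x: "x:space (?M m)"
  have "(\<integral>\<^sup>+ y. indicator (W (Suc m)) (x(m := y)) \<partial>h) = (\<integral>\<^sup>+ y. indicator (W m) x*indicator {y:space h. P m (x(m := y))} y \<partial>h)"
   by (intro nn_integral_cong ind x)
  also have "... = indicator (W m) x*emeasure h {y:space h. P m (x(m := y))}"
   using sec[OF x] by (simp add: nn_integral_cmult)
  finally show "(\<integral>\<^sup>+ y. indicator (W (Suc m)) (x(m := y)) \<partial>h) = indicator (W m) x*emeasure h {y:space h. P m (x(m := y))}" .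
 qed
 finally have E: "emeasure (?M (Suc m)) (W (Suc m)) = ..." .
 have "emeasure (?M m) (W m)*lo m = (\<integral>\<^sup>+ x. lo m*indicator (W m) x \<partial>?M m)"
  using IH(1) by (simp add: nn_integral_cmult_indicator mult.commute)
 also have "... <= emeasure (?M (Suc m)) (W (Suc m))" unfolding E
  by (intro nn_integral_mono) (auto simp: indicator_def intro!: Suc.prems(2))
 finally have 1: "emeasure (?M m) (W m)*lo m <= emeasure (?M (Suc m)) (W (Suc m))" .
 have "emeasure (?M (Suc m)) (W (Suc m)) <= (\<integral>\<^sup>+ x. up m*indicator (W m) x \<partial>?M m)" unfolding E
  by (intro nn_integral_mono) (auto simp: indicator_def intro!: Suc.prems(3))
 also have "... = emeasure (?M m) (W m)*up m"
  using IH(1) by (simp add: nn_integral_cmult_indicator mult.commute)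
 finally have 2: "emeasure (?M (Suc m)) (W (Suc m)) <= emeasure (?M m) (W m)*up m" .
 show ?case
  using WS order_trans[OF mult_right_mono[OF IH(2)] 1] order_trans[OF 2 mult_right_mono[OF IH(3)]] by simp
qed

section \<open>A Haar measure on the line obtained from Lebesgue measure\<close>

context vring
begin

text \<open>Base-\<open>q\<close> digits of \<open>k\<close>, read as residues at the places \<open>\<pi>\<^sup>0, \<pi>\<^sup>-\<^sup>1, \<dots>\<close>; this enumerates the ring
  modulo the maximal ideal and turns Lebesgue measure on \<open>[0, \<infinity>)\<close> into a Haar measure.\<close>

function dig :: "(nat => 'r) => nat => nat => 'r" where
 "dig r q k = (if k = 0 | q < 2 then 0 else r (k mod q)+pw (- 1)*dig r q (k div q))"
 by auto
termination by (relation "Wellfounded.measure (%(r, q, k). k)") auto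

declare dig.simps [simp del]

definition residues_rep :: "nat => (nat => 'r) => bool" where
 "residues_rep q r <-> Q = real q & r 0 = 0 & (ALL d<q. nm (r d) <= 1) & (ALL x. nm x <= 1 --> (EX! d. d < q & nm (x-r d) < 1))"

context
 fixes q r assumes rr: "residues_rep q r"
begin

lemma q2: "q >= 2" and Qq: "Q = real q" and r0: "r 0 = 0" and r_le: "d < q ==> nm (r d) <= 1"
  and r_ex: "nm x <= 1 ==> EX d<q. nm (x-r d) < 1"
  and r_inj: "d < q ==> d' < q ==> nm (r d-r d') < 1 ==> d = d'"
proof -
 show "Q = real q" "r 0 = 0" and l: "d < q ==> nm (r d) <= 1" for d using rr by (auto simp: residues_rep_def)
 thus "q >= 2" using Q_gt1 by simp
 show "nm x <= 1 ==> EX d<q. nm (x-r d) < 1" using rr unfolding residues_rep_def by blast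
 assume d: "d < q" "d' < q" "nm (r d-r d') < 1"
 have "EX! e. e < q & nm (r d-r e) < 1" using rr l[OF d(1)] unfolding residues_rep_def by blast
 thus "d = d'" using d by (metis diff_self nm_zero zero_less_one)
qed

lemma dig_0: "dig r q 0 = 0" by (simp add: dig.simps)

lemma dig_step: assumes "d < q" shows "dig r q (q*k+d) = r d+pw (- 1)*dig r q k"
proof (cases "q*k+d = 0")
 case True
 hence "k = 0" "d = 0" using q2 by auto
 thus ?thesis using r0 by (simp add: dig_0)
next
 case False
 have "(q*k+d) mod q = d" "(q*k+d) div q = k" using assms by auto
 moreover have "~ (q*k+d = 0 | q < 2)" using q2 False by linarith
 ultimately show ?thesis by (subst dig.simps) (simp only: if_False)
qed

lemma lt1_iff: "nm x < 1 <-> nm x <= Q powi (- 1)"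
 using nm_lt1[of x] Q_gt1 by (auto simp: power_int_minus divide_simps intro: le_less_trans[of _ "1/Q"])

lemma scale_le: "nm (pw n*x) <= Q powi m <-> nm x <= Q powi (m+n)"
proof -
 have "nm (pw n*x) <= Q powi m <-> Q powi n*(Q powi (- n)*nm x) <= Q powi n*Q powi m"
  by (simp add: nm_mult nm_pw)
 also have "Q powi n*(Q powi (- n)*nm x) = nm x" using Q_gt1 by (simp add: mult.assoc[symmetric] power_int_add[symmetric])
 also have "Q powi n*Q powi m = Q powi (m+n)" using Q_gt1 by (simp add: power_int_add)
 finally show ?thesis .
qed

lemma dig_surj: "EX k. nm (x-dig r q k) < 1"
proof -
 have "nm x <= Q powi (int n-1) ==> EX k. nm (x-dig r q k) < 1" for n x
 proof (induction n arbitrary: x)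
  case 0
  thus ?case using lt1_iff[of x] by (intro exI[of _ 0]) (simp add: dig_0)
 next
  case (Suc n)
  have "nm (pw 1*x) <= Q powi (int n-1)" unfolding scale_le using Suc.prems by simp
  from Suc.IH[OF this] obtain k where k: "nm (pw 1*x-dig r q k) < 1" by blast
  define y where "y = x-pw (- 1)*dig r q k"
  have "eqv (pw 1*pw (- 1)) 1" by (rule pw_cancel)
  hence "eqv (pw 1*pw (- 1)*dig r q k) (1*dig r q k)" by (rule eqv_mult) simp
  hence "eqv (pw 1*x-pw 1*pw (- 1)*dig r q k) (pw 1*x-dig r q k)" by (intro eqv_diff) simp_all
  hence "nm (pw 1*y) < 1" using k eqv_nm by (simp add: y_def right_diff_distrib mult.assoc)
  hence "nm y <= 1" unfolding lt1_iff scale_le by simp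
  then obtain d where d: "d < q" "nm (y-r d) < 1" using r_ex by blast
  have "x-dig r q (q*k+d) = y-r d" by (simp add: dig_step[OF d(1)] y_def)
  thus ?case using d(2) by metis
 qed
 moreover have "EX n. nm x <= Q powi (int n-1)"
 proof (cases "nm x = 0")
  case False
  have "nm x <= Q powi (int (nat (1-ord x))-1)" unfolding nm_ord[OF False] powi_le by simp
  thus ?thesis by blast
 qed simp
 ultimately show ?thesis by blast
qed

lemma dig_inj: "nm (dig r q k-dig r q l) < 1 ==> k = l"
proof (induction "k+l" arbitrary: k l rule: less_induct)
 case less
 show ?case
 proof (cases "k+l = 0")
  case False
  define k' d l' d' where "k' = k div q" and "d = k mod q" and "l' = l div q" and "d' = l mod q"
  have dq: "d < q" "d' < q" using q2 by (auto simp: d_def d'_def)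
  have k: "k = q*k'+d" and l: "l = q*l'+d'" by (auto simp: k'_def d_def l'_def d'_def)
  have e: "dig r q k-dig r q l = (r d-r d')+pw (- 1)*(dig r q k'-dig r q l')"
   unfolding k l dig_step[OF dq(1)] dig_step[OF dq(2)] by (simp add: algebra_simps)
  have "nm (r d-r d') <= 1" by (intro nm_diff_le r_le dq)
  hence "nm (pw (- 1)*(dig r q k'-dig r q l')) <= Q powi 0"
   using nm_diff_le[of "dig r q k-dig r q l" 1 "r d-r d'"] less.prems unfolding e by simp
  hence "nm (dig r q k'-dig r q l') < 1" unfolding scale_le lt1_iff by simp
  moreover have "k'+l' < k+l" using False q2 unfolding k'_def l'_def
   by (metis add_gr_0 add_less_le_mono add_le_less_mono div_le_dividend div_less_dividend gr0I less_le_trans one_less_numeral_iff semiring_norm(76) not_le)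
  ultimately have kl: "k' = l'" using less.hyps by blast
  hence "nm (r d-r d') < 1" using less.prems unfolding e by simp
  hence "d = d'" by (rule r_inj[OF dq])
  thus ?thesis using k l kl by simp
 qed simp
qed

text \<open>\<open>Ph y\<close> is the limit of the elements obtained by reading the first
  \<open>n\<close> base-\<open>q\<close> digits after the point of \<open>y\<close>; balls then
  correspond to \<open>q\<close>-adic intervals. The enumeration is modulo the maximal ideal, so the
  ball of radius \<open>1/Q\<close> gets measure 1; hence the exponent \<open>n+1\<close>.\<close>

lemma haar_map:
 "EX Ph::real => 'r. ALL a n. {y. 0 <= y & nm (Ph y-a) <= Q powi n}:sets borel &
   emeasure lborel {y. 0 <= y & nm (Ph y-a) <= Q powi n} = ennreal (Q powi (n+1))"
proof -
 define K where "K n y = nat \<lfloor>y*real q^n\<rfloor>" for n y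
 define X where "X n y = pw (int n)*dig r q (K n y)" for n y
 have Kstep: "EX d<q. K (Suc n) y = q*K n y+d" if y: "0 <= y" for n y
 proof -
  define t where "t = \<lfloor>y*real q^Suc n\<rfloor>"
  have t: "0 <= t" using y by (simp add: t_def)
  have "y*real q^n = y*real q^Suc n/real_of_int (int q)" using q2 by simp
  hence "\<lfloor>y*real q^n\<rfloor> = t div int q" using floor_divide_real_eq_div[of "int q" "y*real q^Suc n"] by (simp add: t_def)
  hence "K n y = nat t div q" "K (Suc n) y = nat t" using t by (auto simp: K_def t_def nat_div_distrib)
  thus ?thesis using q2 by (intro exI[of _ "nat t mod q"]) simp
 qed
 have Xstep: "nm (X (Suc n) y-X n y) <= Q powi (- int n-1)" if y: "0 <= y" for n y
 proof -
  obtain d where d: "d < q" "K (Suc n) y = q*K n y+d" using Kstep[OF y] by blast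
  have "eqv (pw (int n)) (pw (int n+1)*pw (- 1))" using pw_add'[of "int n+1" "- 1"] by simp
  hence "eqv (pw (int n)*dig r q (K n y)) (pw (int n+1)*pw (- 1)*dig r q (K n y))" by (rule eqv_mult) simp
  hence "eqv (X (Suc n) y-X n y) (X (Suc n) y-pw (int n+1)*pw (- 1)*dig r q (K n y))"
   unfolding X_def by (intro eqv_diff) simp_all
  also have "X (Suc n) y-pw (int n+1)*pw (- 1)*dig r q (K n y) = pw (int n+1)*r d"
   unfolding X_def d(2) dig_step[OF d(1)] by (simp add: algebra_simps)
  finally have "nm (X (Suc n) y-X n y) = nm (pw (int n+1)*r d)" by (rule eqv_nm)
  also have "... <= Q powi (- int n-1)" unfolding scale_le using r_le[OF d(1)] by simp
  finally show ?thesis .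
 qed
 have Xdiff: "nm (X (n+i) y-X n y) <= Q powi (- int n-1)" if y: "0 <= y" for n i y
 proof (induction i)
  case (Suc i)
  have "nm (X (n+Suc i) y-X (n+i) y) <= Q powi (- int (n+i)-1)" using Xstep[OF y, of "n+i"] by simp
  also have "... <= Q powi (- int n-1)" unfolding powi_le by simp
  finally show ?case using Suc.IH by (rule nm_diff_trans)
 qed simp
 have "EX a. ALL n. nm (a-X n y) <= Q powi (- int n-1)" if y: "0 <= y" for y
 proof -
  have "EX a. ALL ee>0. EX N. ALL i>=N. nm (X i y-a) <= ee"
  proof (rule complete)
   fix ee :: real assume "ee > 0"
   then obtain k where k: "Q powi (- int k) <= ee" using powi_ex_less by blast
   have "nm (X i y-X j y) <= ee" if "i >= k" "j >= k" for i j
   proof -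
    have "nm (X i y-X k y) <= Q powi (- int k-1)" "nm (X k y-X j y) <= Q powi (- int k-1)"
     using Xdiff[OF y, of k "i-k"] Xdiff[OF y, of k "j-k"] that by (simp_all add: nm_minus_commute)
    hence "nm (X i y-X j y) <= Q powi (- int k-1)" by (rule nm_diff_trans)
    also have "... <= Q powi (- int k)" unfolding powi_le by simp
    finally show ?thesis using k by simp
   qed
   thus "EX N. ALL i>=N. ALL j>=N. nm (X i y-X j y) <= ee" by blast
  qed
  then obtain a where a: "!!ee. ee > 0 ==> EX N. ALL i>=N. nm (X i y-a) <= ee" by blast
  have "nm (a-X n y) <= Q powi (- int n-1)" for n
  proof -
   obtain N where N: "ALL i>=N. nm (X i y-a) <= Q powi (- int n-1)" using a[OF powi_pos] by blast
   have "nm (a-X (n+N) y) <= Q powi (- int n-1)" using N by (simp add: nm_minus_commute)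
   thus ?thesis using Xdiff[OF y] by (rule nm_diff_trans)
  qed
  thus ?thesis by blast
 qed
 then obtain Ph where Ph: "!!y n. 0 <= y ==> nm (Ph y-X n y) <= Q powi (- int n-1)" by metis
 define B where "B a n = {y. 0 <= y & nm (Ph y-a) <= Q powi n}" for a n
 \<comment> \<open>A ball of radius at most \<open>1/Q\<close> is given by one value of the integer
   \<open>K n y\<close>, so its preimage is a half-open interval of length
   \<open>1/q^n\<close>.\<close>
 have small: "B a (- int n-1):sets borel & emeasure lborel (B a (- int n-1)) = ennreal (Q powi (- int n))" for a n
 proof -
  obtain k where k: "nm (a*pw (- int n)-dig r q k) < 1" using dig_surj by blast
  have ak: "nm (a-pw (int n)*dig r q k) <= Q powi (- int n-1)"
  proof -
   have "eqv (pw (int n)*pw (- int n)*a) (1*a)" by (rule eqv_mult[OF pw_cancel eqv_refl])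
   hence "eqv (pw (int n)*(a*pw (- int n)-dig r q k)) (a-pw (int n)*dig r q k)"
    by (simp add: right_diff_distrib mult.left_commute mult.commute eqv_diff)
   hence "nm (a-pw (int n)*dig r q k) = nm (pw (int n)*(a*pw (- int n)-dig r q k))" using eqv_nm by simp
   also have "... <= Q powi (- int n-1)" unfolding scale_le using k by (simp add: lt1_iff)
   finally show ?thesis .
  qed
  have 1: "nm (Ph y-a) <= Q powi (- int n-1) <-> K n y = k" if y: "0 <= y" for y
  proof
   assume "nm (Ph y-a) <= Q powi (- int n-1)"
   hence "nm (Ph y-pw (int n)*dig r q k) <= Q powi (- int n-1)" by (rule nm_diff_trans[OF _ ak])
   hence "nm (X n y-pw (int n)*dig r q k) <= Q powi (- int n-1)"
    by (rule nm_diff_trans[rotated]) (subst nm_minus_commute, rule Ph[OF y])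
   hence "nm (dig r q (K n y)-dig r q k) < 1"
    unfolding X_def right_diff_distrib[symmetric] scale_le lt1_iff by simp
   thus "K n y = k" by (rule dig_inj)
  next
   assume "K n y = k"
   hence "nm (X n y-a) <= Q powi (- int n-1)" using ak by (simp add: X_def nm_minus_commute)
   thus "nm (Ph y-a) <= Q powi (- int n-1)" by (rule nm_diff_trans[OF Ph[OF y]])
  qed
  have 2: "0 <= y & K n y = k <-> y:{real k/real q^n ..< (real k+1)/real q^n}" for y
  proof -
   have q: "0 < real q^n" using q2 by simp
   have "y:{real k/real q^n ..< (real k+1)/real q^n} <-> real k <= y*real q^n & y*real q^n < real k+1"
    using q by (simp add: pos_divide_le_eq pos_less_divide_eq)
   also have "... <-> \<lfloor>y*real q^n\<rfloor> = int k" by (simp add: floor_eq_iff)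
   also have "... <-> 0 <= y & K n y = k"
   proof -
    have y: "0 <= y <-> 0 <= y*real q^n" using mult_le_cancel_right_pos[OF q, of 0 y] by simp
    show ?thesis
    proof
     assume a: "\<lfloor>y*real q^n\<rfloor> = int k"
     hence "0 <= y*real q^n" using of_int_floor_le[of "y*real q^n"] by simp
     thus "0 <= y & K n y = k" using a y by (simp add: K_def)
    next
     assume a: "0 <= y & K n y = k"
     hence "0 <= \<lfloor>y*real q^n\<rfloor>" using y by simp
     thus "\<lfloor>y*real q^n\<rfloor> = int k" using a by (auto simp: K_def)
    qed
   qed
   finally show ?thesis by blast
  qed
  have "B a (- int n-1) = {real k/real q^n ..< (real k+1)/real q^n}"
   unfolding B_def by (rule Set.set_eqI) (use 1 2 in blast)
  moreover have "(real k+1)/real q^n-real k/real q^n = Q powi (- int n)"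
   by (simp add: diff_divide_distrib[symmetric] power_int_minus Qq field_simps)
  ultimately show ?thesis by (simp add: divide_right_mono)
 qed
 \<comment> \<open>Larger balls are disjoint unions of \<open>q\<close> balls of the next smaller
   radius, one for each residue.\<close>
 have big: "B a (int n-1):sets borel & emeasure lborel (B a (int n-1)) = ennreal (Q powi (int n))" for a n
 proof (induction n arbitrary: a)
  case 0
  thus ?case using small[of a 0] by simp
 next
  case (Suc n)
  have sc: "nm (pw (int n)*z) <= 1 <-> nm z <= Q powi (int n)" "nm (pw (int n)*z) < 1 <-> nm z <= Q powi (int n-1)" for z
   unfolding lt1_iff using scale_le[of "int n" z 0] scale_le[of "int n" z "- 1"] by simp_all
  have sh: "nm (pw (int n)*(x-(a+pw (- int n)*r d))) = nm (pw (int n)*(x-a)-r d)" for x d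
  proof (rule eqv_nm)
   have "eqv (pw (int n)*pw (- int n)*r d) (1*r d)" by (rule eqv_mult[OF pw_cancel eqv_refl])
   hence "eqv (pw (int n)*(x-a)-pw (int n)*pw (- int n)*r d) (pw (int n)*(x-a)-r d)"
    by (intro eqv_diff) simp_all
   moreover have "pw (int n)*(x-(a+pw (- int n)*r d)) = pw (int n)*(x-a)-pw (int n)*pw (- int n)*r d"
    by (simp add: algebra_simps)
   ultimately show "eqv (pw (int n)*(x-(a+pw (- int n)*r d))) (pw (int n)*(x-a)-r d)" by (simp only:)
  qed
  have eq: "nm (x-a) <= Q powi (int n) <-> (EX d<q. nm (x-(a+pw (- int n)*r d)) <= Q powi (int n-1))" for x
  proof
   assume "nm (x-a) <= Q powi (int n)"
   then obtain d where "d < q" "nm (pw (int n)*(x-a)-r d) < 1" using r_ex sc(1) by blast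
   thus "EX d<q. nm (x-(a+pw (- int n)*r d)) <= Q powi (int n-1)" unfolding sc(2)[symmetric] sh by blast
  next
   assume "EX d<q. nm (x-(a+pw (- int n)*r d)) <= Q powi (int n-1)"
   then obtain d where d: "d < q" "nm (pw (int n)*(x-a)-r d) < 1" unfolding sc(2)[symmetric] sh by blast
   hence "nm (pw (int n)*(x-a)) <= 1" using nm_add_le[of "pw (int n)*(x-a)-r d" 1 "r d"] r_le by simp
   thus "nm (x-a) <= Q powi (int n)" unfolding sc(1) .
  qed
  hence U: "B a (int n) = (\<Union>d<q. B (a+pw (- int n)*r d) (int n-1))" by (auto simp: B_def)
  have disj: "disjoint_family_on (%d. B (a+pw (- int n)*r d) (int n-1)) {..<q}"
   unfolding disjoint_family_on_def
  proof (intro ballI impI)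
   fix d e assume d: "d:{..<q}" "e:{..<q}" "d ~= e"
   show "B (a+pw (- int n)*r d) (int n-1) Int B (a+pw (- int n)*r e) (int n-1) = {}"
   proof (rule ccontr)
    assume "B (a+pw (- int n)*r d) (int n-1) Int B (a+pw (- int n)*r e) (int n-1) ~= {}"
    then obtain x where "nm (x-(a+pw (- int n)*r d)) <= Q powi (int n-1)" "nm (x-(a+pw (- int n)*r e)) <= Q powi (int n-1)"
     unfolding B_def by blast
    hence "nm (pw (int n)*(x-a)-r d) < 1" "nm (pw (int n)*(x-a)-r e) < 1" unfolding sc(2)[symmetric] sh .
    hence "nm (r d-r e) < 1" by (metis nm_diff_trans_less nm_minus_commute)
    thus False using r_inj d by simp
   qed
  qed
  have "emeasure lborel (B a (int n)) = (SUM d<q. emeasure lborel (B (a+pw (- int n)*r d) (int n-1)))"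
   unfolding U by (rule sum_emeasure[symmetric]) (use Suc.IH disj in auto)
  also have "... = of_nat q*ennreal (Q powi (int n))" using Suc.IH by simp
  also have "... = ennreal (Q powi (int (Suc n)))"
   using Q_gt1 by (simp add: Qq ennreal_of_nat_eq_real_of_nat ennreal_mult' power_int_add)
  finally have "emeasure lborel (B a (int n)) = ennreal (Q powi (int (Suc n)))" .
  moreover have "B a (int n):sets borel" unfolding U using Suc.IH by blast
  ultimately show ?case by simp
 qed
 have "B a n:sets borel & emeasure lborel (B a n) = ennreal (Q powi (n+1))" for a n
 proof (cases "n >= -1")
  case True
  thus ?thesis using big[of a "nat (n+1)"] by simp
 next
  case False
  thus ?thesis using small[of a "nat (- n-1)"] by (simp add: add.commute)
 qed
 thus ?thesis unfolding B_def by blast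
qed

end

end

section \<open>Local fields\<close>

text \<open>An integral domain has to be a type in order to be used with polynomials. As the field varies
  inside the theorem, all local fields on one carrier type are covered by a single ring, the product of
  them all; the factor \<open>int\<close> only makes it nontrivial.\<close>

typedef 'b lfring = "{(h :: 'b vfield => 'b, n :: int). ALL F. if local_field0 F then h F:carrier F else h F = undefined}"
 morphisms Rep_lf Abs_lf
proof -
 have "\<zero>\<^bsub>F\<^esub>:carrier F" if "local_field0 F" for F :: "'b vfield"
 proof -
  have "field F" using that by (simp add: local_field0_def valued_field_def)
  then interpret field F .
  show ?thesis by simp
 qed
 thus ?thesis by (intro exI[of _ "(%F. if local_field0 F then \<zero>\<^bsub>F\<^esub> else undefined, 0)"]) auto
qed

definition dn :: "'b vfield => 'b lfring => 'b" where "dn F t = fst (Rep_lf t) F"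
definition ix :: "'b lfring => int" where "ix t = snd (Rep_lf t)"
definition mk :: "('b vfield => 'b) => int => 'b lfring" where
 "mk f n = Abs_lf (%F. if local_field0 F then f F else undefined, n)"

lemma dn_closed: "local_field0 F ==> dn F t:carrier F"
 using Rep_lf[of t] unfolding dn_def by (auto split: prod.splits if_splits)

lemma lf_eqI:
 assumes "ix s = ix t" "!!F. local_field0 F ==> dn F s = dn F t" shows "s = t"
proof -
 have "fst (Rep_lf s) F = fst (Rep_lf t) F" for F
  using assms(2)[of F] Rep_lf[of s] Rep_lf[of t] unfolding dn_def by (cases "local_field0 F") (auto split: prod.splits if_splits)
 hence "fst (Rep_lf s) = fst (Rep_lf t)" by blast
 thus ?thesis using assms(1) Rep_lf_inject[of s t] by (simp add: ix_def prod_eq_iff)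
qed

lemma mk:
 assumes "!!F. local_field0 F ==> f F:carrier F"
 shows "local_field0 F ==> dn F (mk f n) = f F" "ix (mk f n) = n"
proof -
 have "Rep_lf (mk f n) = (%F. if local_field0 F then f F else undefined, n)"
  unfolding mk_def by (rule Abs_lf_inverse) (use assms in auto)
 thus "local_field0 F ==> dn F (mk f n) = f F" "ix (mk f n) = n" by (simp_all add: dn_def ix_def)
qed

lemma lf_field: "local_field0 F ==> field F"
 by (simp add: local_field0_def valued_field_def)

lemma lf_cring: "local_field0 F ==> cring F"
 by (rule domain.axioms(1)[OF field.axioms(1)[OF lf_field]])

lemmas lf_rules = cring.cring_simprules[OF lf_cring]

instantiation lfring :: (type) comm_ring_1
begin

definition "0 = mk (%F. \<zero>\<^bsub>F\<^esub>) 0"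
definition "1 = mk (%F. \<one>\<^bsub>F\<^esub>) 1"
definition "s+t = mk (%F. dn F s \<oplus>\<^bsub>F\<^esub> dn F t) (ix s+ix t)"
definition "s*t = mk (%F. dn F s \<otimes>\<^bsub>F\<^esub> dn F t) (ix s*ix t)"
definition "- s = mk (%F. \<ominus>\<^bsub>F\<^esub> dn F s) (- ix s)"
definition "s-t = (s :: 'a lfring)+- t"

lemma dn_simps:
 assumes "local_field0 F"
 shows "dn F 0 = \<zero>\<^bsub>F\<^esub>" "dn F 1 = \<one>\<^bsub>F\<^esub>" "dn F (s+t) = dn F s \<oplus>\<^bsub>F\<^esub> dn F t"
  "dn F (s*t) = dn F s \<otimes>\<^bsub>F\<^esub> dn F t" "dn F (- s) = \<ominus>\<^bsub>F\<^esub> dn F s" "dn F (s-t) = dn F s \<ominus>\<^bsub>F\<^esub> dn F t"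
 unfolding zero_lfring_def one_lfring_def plus_lfring_def times_lfring_def uminus_lfring_def minus_lfring_def
 by (subst mk; simp add: assms dn_closed lf_rules a_minus_def)+

lemma ix_simps: "ix 0 = 0" "ix 1 = 1" "ix (s+t) = ix s+ix t" "ix (s*t) = ix s*ix t" "ix (- s) = - ix s"
 unfolding zero_lfring_def one_lfring_def plus_lfring_def times_lfring_def uminus_lfring_def
 by (subst mk; simp add: dn_closed lf_rules)+

instance
proof
 fix a b c :: "'a lfring"
 show "a+b+c = a+(b+c)" "a+b = b+a" "0+a = a" "- a+a = 0" "a-b = a+- b"
  "a*b*c = a*(b*c)" "a*b = b*a" "1*a = a" "(a+b)*c = a*c+b*c"
  by (rule lf_eqI; simp add: dn_simps ix_simps dn_closed lf_rules minus_lfring_def algebra_simps)+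
 have "ix (0 :: 'a lfring) ~= ix 1" by (simp add: ix_simps)
 thus "(0 :: 'a lfring) ~= 1" by metis
qed

end

definition upl :: "'b vfield => 'b => 'b lfring" where
 "upl F x = mk (%G. if G = F then x else \<zero>\<^bsub>G\<^esub>) 0"

lemma dn_upl: "local_field0 F ==> x:carrier F ==> dn F (upl F x) = x"
 unfolding upl_def by (subst mk) (auto simp: lf_rules)

text \<open>The one ring carries a seminorm for every local field \<open>F\<close>; its null
  elements are those with vanishing \<open>F\<close>-component, so \<open>eqv\<close> is equality in
  \<open>F\<close>.\<close>

definition nmF :: "'b vfield => 'b lfring => real" where "nmF F t = absv F (dn F t)"

definition unif :: "'b vfield => 'b" where "unif F = (SOME x. x:carrier F & x ~= \<zero>\<^bsub>F\<^esub> & vord F x = 1)"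

definition pwF :: "'b vfield => int => 'b lfring" where "pwF F n = upl F (unif F [^]\<^bsub>units_of F\<^esub> n)"

locale lf =
 fixes F :: "'b vfield" (structure)
 assumes lf: "local_field0 F"
begin

sublocale field F by (rule lf_field[OF lf])

lemma vmult: "x:carrier F ==> y:carrier F ==> x ~= \<zero> ==> y ~= \<zero> ==> vord F (x \<otimes> y) = vord F x + vord F y"
 and vadd: "x:carrier F ==> y:carrier F ==> x ~= \<zero> ==> y ~= \<zero> ==> x \<oplus> y ~= \<zero> ==> min (vord F x) (vord F y) <= vord F (x \<oplus> y)"
 and vsurj: "EX x:carrier F. x ~= \<zero> & vord F x = n"
 using lf unfolding local_field0_def valued_field_def by blast+

lemma unif: "unif F:carrier F" "unif F ~= \<zero>" "vord F (unif F) = 1"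
proof -
 have "EX x. x:carrier F & x ~= \<zero> & vord F x = 1" using vsurj[of 1] by blast
 from someI_ex[OF this] show "unif F:carrier F" "unif F ~= \<zero>" "vord F (unif F) = 1" unfolding unif_def by blast+
qed

lemma vone: "vord F \<one> = 0" using vmult[of \<one> \<one>] by simp

lemma vneg: assumes "x:carrier F" shows "vord F (\<ominus> x) = vord F x"
proof (cases "x = \<zero>")
 case False
 have 1: "\<ominus> \<one> ~= \<zero>" using add.inv_eq_1_iff[of \<one>] by simp
 have "(\<ominus> \<one>) \<otimes> (\<ominus> \<one>) = \<one>" by (simp add: l_minus r_minus)
 hence "2 * vord F (\<ominus> \<one>) = 0" using vmult[of "\<ominus> \<one>" "\<ominus> \<one>"] vone 1 by simp
 moreover have "\<ominus> x = (\<ominus> \<one>) \<otimes> x" using assms by (simp add: l_minus)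
 ultimately show ?thesis using vmult[of "\<ominus> \<one>" x] 1 assms False by simp
qed simp

lemma vdiff: "x:carrier F ==> y:carrier F ==> y \<ominus> x = \<ominus> (x \<ominus> y)"
 by (simp add: a_minus_def minus_add a_comm)

definition "cls x = {y:vO F. y \<ominus> x:vM F}"

lemma qgt1: "qK F > 1"
proof -
 have m: "\<zero>:vO F" "\<one>:vO F" using vone by (auto simp: vO_def)
 have z: "\<zero> \<ominus> \<zero> = \<zero>" by (simp add: a_minus_def)
 have o: "\<zero> \<ominus> \<one> = \<ominus> \<one>" by (simp add: a_minus_def)
 have "\<ominus> \<one> ~= \<zero>" using add.inv_eq_1_iff[of \<one>] by simp
 hence "\<zero>:cls \<zero>" "\<zero> ~: cls \<one>" using m vneg[of \<one>] vone by (auto simp: cls_def vM_def z o)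
 hence ne: "cls \<zero> ~= cls \<one>" by blast
 have "{cls \<zero>, cls \<one>} <= res_classes F" using m unfolding res_classes_def cls_def by blast
 moreover have "finite (res_classes F)" using lf by (simp add: local_field0_def)
 ultimately have "card {cls \<zero>, cls \<one>} <= qK F" unfolding qK_def by (rule card_mono[rotated])
 thus ?thesis using ne by simp
qed

abbreviation "q == real (qK F)"

lemma q1: "q > 1" using qgt1 by simp

lemma absv_powi: "absv F x = (if x = \<zero> then 0 else q powi (- vord F x))"
proof -
 have "q powi (- vord F x) = q powr real_of_int (- vord F x)" using q1 by (intro powr_real_of_int'[symmetric]) auto
 thus ?thesis by (simp only: absv_def of_int_minus)
qed

lemma powi_pos: "q powi n > 0" using q1 by (intro zero_less_power_int) simp

lemma absv_le: "absv F x <= q powi (- n) <-> ereal (real_of_int n) <= eord F x"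
proof (cases "x = \<zero>")
 case False
 have "q powi (- vord F x) <= q powi (- n) <->-vord F x <= - n"
  using power_int_increasing[of _ _ q] power_int_strict_increasing[of _ _ q] q1 by (meson less_imp_le not_le)
 thus ?thesis using False by (simp add: absv_powi eord_def)
qed (use powi_pos[of "-n"] in "simp add: absv_powi eord_def")

lemma eord_le: "eord F x <= eord F y <-> absv F y <= absv F x"
proof (cases "x = \<zero>")
 case True
 thus ?thesis using powi_pos[of "- vord F y"] by (auto simp: absv_powi eord_def)
next
 case False
 thus ?thesis using absv_le[of y "vord F x"] by (simp add: absv_powi eord_def)
qed

lemma absv_eq0: "absv F x = 0 <-> x = \<zero>"
 using less_imp_neq[OF powi_pos, of "- vord F x"] unfolding absv_powi by (cases "x = \<zero>") auto

lemma nmF_eq0: "nmF F t = 0 <-> dn F t = \<zero>" by (simp add: nmF_def absv_eq0)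

lemma nmF_le: "nmF F t <= q powi (- n) <-> ereal (real_of_int n) <= eord F (dn F t)"
 by (simp add: nmF_def absv_le)

lemmas dns [simp] = dn_simps[OF lf] dn_closed[OF lf] dn_upl[OF lf]

lemma dn_of_nat [simp]: "dn F (of_nat n) = natF F n"
proof (induction n)
 case (Suc n)
 have "natF F (Suc n) = natF F n \<oplus> \<one>" by (simp add: natF_def add_pow_def)
 thus ?case using Suc a_comm[of \<one> "dn F (of_nat n)"] dn_closed[OF lf, of "of_nat n"] by simp
qed (simp add: natF_def)

lemma dn_power [simp]: "dn F (t^n) = dn F t [^] (n::nat)"
 by (induction n) (simp_all add: m_comm)

lemma dn_sum [simp]: "dn F (sum f A) = (\<Oplus>i\<in>A. dn F (f i))"
proof (cases "finite A")
 case True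
 thus ?thesis by (induction A rule: finite_induct) simp_all
next
 case False
 thus ?thesis by (simp add: finsum_infinite)
qed

lemma unif_pow: "unif F [^]\<^bsub>units_of F\<^esub> n:carrier F-{\<zero>}" "vord F (unif F [^]\<^bsub>units_of F\<^esub> n) = n"
 "unif F [^]\<^bsub>units_of F\<^esub> (n+n') = unif F [^]\<^bsub>units_of F\<^esub> n \<otimes> unif F [^]\<^bsub>units_of F\<^esub> n'" for n n' :: int
proof -
 let ?u = "%n :: int. unif F [^]\<^bsub>units_of F\<^esub> n"
 interpret U: group "units_of F" by (rule units_group)
 have c: "carrier (units_of F) = carrier F-{\<zero>}" by (simp add: units_of_carrier field_Units)
 have u: "unif F:carrier (units_of F)" using unif c by simp
 show cl: "?u n:carrier F-{\<zero>}" for n :: int using U.int_pow_closed[OF u] c by simp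
 show mu: "?u (n+n') = ?u n \<otimes> ?u n'" for n n' :: int
  using U.int_pow_mult[OF u] by (simp add: units_of_mult)
 have ad: "vord F (?u (n+n')) = vord F (?u n) + vord F (?u n')" for n n' :: int
  unfolding mu by (rule vmult) (use cl in auto)
 have one: "vord F (?u (1::int)) = 1" using U.int_pow_1[OF u] unif(3) by simp
 show "vord F (?u n) = n"
 proof (induction n rule: int_induct[of _ 0])
  case base
  show ?case using ad[of 0 0] by simp
 next
  case (step1 i)
  thus ?case using ad[of i 1] one by simp
 next
  case (step2 i)
  thus ?case using ad[of "i-1" 1] one by simp
 qed
qed

lemma dn_vO: "dn F t:vO F <-> nmF F t <= 1" using nmF_le[of t 0] by (auto simp: vO_def eord_def)

lemma dn_vM: "dn F t:vM F <-> nmF F t < 1"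
proof (cases "dn F t = \<zero>")
 case False
 have "q powi (- vord F (dn F t)) < q powi 0 <-> 0 < vord F (dn F t)"
  using power_int_increasing[of _ _ q] power_int_strict_increasing[of "- vord F (dn F t)" 0 q] q1
  by (metis le_minus_iff less_imp_le minus_zero neg_less_0_iff_less not_le)
 thus ?thesis using False by (simp add: vM_def nmF_def absv_powi)
qed (simp add: vM_def nmF_def absv_powi)

sublocale V: vring "nmF F" q "pwF F"
proof
 show "nmF F 1 = 1" "nmF F 0 = 0" by (simp_all add: nmF_def absv_powi vone)
 show "nmF F (x*y) = nmF F x*nmF F y" for x y
 proof -
  have "q powi (- (a+b)) = q powi (- a)*q powi (- b)" for a b using power_int_add[of q "- a" "- b"] q1 by simp
  thus ?thesis by (simp only: nmF_def absv_powi dns integral_iff) (simp add: vmult)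
 qed
 show "nmF F (x+y) <= max (nmF F x) (nmF F y)" for x y
 proof (cases "dn F x = \<zero> | dn F y = \<zero> | dn F x \<oplus> dn F y = \<zero>")
  case True
  thus ?thesis using powi_pos[of "- vord F (dn F x)"] powi_pos[of "- vord F (dn F y)"]
   by (auto simp: nmF_def absv_powi)
 next
  case False
  define a where "a = min (vord F (dn F x)) (vord F (dn F y))"
  have "nmF F (x+y) <= q powi (- a)" unfolding nmF_le using False vadd[of "dn F x" "dn F y"] by (simp add: a_def eord_def)
  also have "q powi (- a) <= max (nmF F x) (nmF F y)" using False by (simp add: a_def min_def nmF_def absv_powi)
  finally show ?thesis .
 qed
 show "q > 1" by (rule q1)
 show "nmF F x = 0 | (EX n. nmF F x = q powi (- n))" for x by (auto simp: nmF_def absv_powi)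
 show "nmF F (pwF F n) = q powi (- n)" for n using unif_pow(1,2)[of n] by (simp add: nmF_def pwF_def absv_powi)
 show "nmF F (pwF F (a+b)-pwF F a*pwF F b) = 0" for a b
  using unif_pow(1)[of a] unif_pow(1)[of b] by (simp add: nmF_eq0 pwF_def unif_pow(3) a_minus_def r_neg)
 show "EX y. nmF F (x*y-1) = 0" if "nmF F x ~= 0" for x
 proof -
  have "dn F x:Units F" using that by (simp add: nmF_eq0 field_Units)
  thus ?thesis by (intro exI[of _ "upl F (inv (dn F x))"]) (simp add: nmF_eq0 a_minus_def r_neg)
 qed
 show "EX U. finite U & (ALL x. nmF F x <= 1 --> (EX u:U. nmF F (x-u) < 1))"
 proof (intro exI[of _ "(%c. upl F (SOME y. y:c)) ` res_classes F"] conjI allI impI)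
  show "finite ((%c. upl F (SOME y. y:c)) ` res_classes F)" using lf by (simp add: local_field0_def)
  fix x assume x: "nmF F x <= 1"
  have c: "cls (dn F x):res_classes F" using x by (auto simp: res_classes_def cls_def dn_vO)
  have "dn F x:cls (dn F x)" using x by (simp add: cls_def dn_vO vM_def a_minus_def r_neg)
  hence y: "(SOME y. y:cls (dn F x)):cls (dn F x)" by (rule someI)
  define y where "y = (SOME y. y:cls (dn F x))"
  have yc: "y:carrier F" "y \<ominus> dn F x:vM F" using y by (auto simp: y_def cls_def vO_def)
  hence "dn F x \<ominus> y:vM F" using vneg[of "y \<ominus> dn F x"] unfolding vdiff[OF yc(1), of "dn F x", simplified] by (auto simp: vM_def)
  hence "nmF F (x-upl F y) < 1" using yc(1) by (simp add: dn_vM[symmetric])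
  thus "EX u:(%c. upl F (SOME y. y:c)) ` res_classes F. nmF F (x-u) < 1" using c unfolding y_def by blast
 qed
 show "EX a. ALL ee>0. EX N. ALL i>=N. nmF F (s i-a) <= ee"
  if s: "!!ee. ee > 0 ==> EX N. ALL i>=N. ALL j>=N. nmF F (s i-s j) <= ee" for s :: "nat => 'b lfring"
 proof -
  have "EX k0. ALL i>=k0. ALL j>=k0. ereal (real_of_int n) <= eord F (dn F (s i) \<ominus> dn F (s j))" for n
   using s[OF powi_pos[of "- n"]] by (simp add: nmF_le)
  hence "EX a:carrier F. ALL n. EX k0. ALL i>=k0. ereal (real_of_int n) <= eord F (dn F (s i) \<ominus> a)"
   using lf unfolding local_field0_def complete_vf_def by simp
  then obtain a where a: "a:carrier F" "!!n. EX k0. ALL i>=k0. ereal (real_of_int n) <= eord F (dn F (s i) \<ominus> a)" by blast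
  show ?thesis
  proof (intro exI[of _ "upl F a"] allI impI)
   fix ee :: real assume "ee > 0"
   obtain n where "(1/q)^n < ee" using real_arch_pow_inv[OF `ee > 0`, of "1/q"] q1 by auto
   hence n: "q powi (- int n) < ee" by (simp add: power_int_minus field_simps)
   obtain k0 where "ALL i>=k0. ereal (real_of_int (int n)) <= eord F (dn F (s i) \<ominus> a)" using a(2) by blast
   hence "ALL i>=k0. nmF F (s i-upl F a) <= q powi (- int n)" unfolding nmF_le using a(1) by simp
   thus "EX N. ALL i>=N. nmF F (s i-upl F a) <= ee" using n by (meson less_imp_le order_trans)
  qed
 qed
 show "nmF F (of_nat n) ~= 0" if "n > 0" for n :: nat using lf that by (simp add: nmF_eq0 local_field0_def)
qed

lemma cls_eq: assumes "nmF F s <= 1" "nmF F t <= 1" shows "cls (dn F s) = cls (dn F t) <-> nmF F (s-t) < 1"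
proof
 have 1: "dn F s:cls (dn F s)" using assms(1) by (simp add: cls_def dn_vO vM_def a_minus_def r_neg)
 assume "cls (dn F s) = cls (dn F t)"
 hence "dn F s:cls (dn F t)" using 1 by simp
 hence "dn F (s-t):vM F" by (simp add: cls_def)
 thus "nmF F (s-t) < 1" by (simp only: dn_vM)
next
 assume st: "nmF F (s-t) < 1"
 have "cls (dn F s) <= cls (dn F t)" if st: "nmF F (s-t) < 1" for s t
 proof
  fix y assume y: "y:cls (dn F s)"
  hence yc: "y:carrier F" "y:vO F" by (auto simp: cls_def vO_def)
  have "dn F (upl F y-s):vM F" using y yc by (simp add: cls_def)
  hence "nmF F (upl F y-t) < 1" unfolding dn_vM using st by (rule V.nm_diff_trans_less)
  hence "dn F (upl F y-t):vM F" unfolding dn_vM .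
  thus "y:cls (dn F t)" using yc by (simp add: cls_def)
 qed
 from this[OF st] this[of t s] st show "cls (dn F s) = cls (dn F t)" by (auto simp: V.nm_minus_commute)
qed

text \<open>Besides a system of residue representatives the digit expansion needs the digit 0 to be
  the element 0, so the class of zero is set apart before the others are numbered.\<close>

lemma residues_ex: "EX r. V.residues_rep (qK F) r"
proof -
 let ?c0 = "cls \<zero>"
 have fin: "finite (res_classes F)" using lf by (simp add: local_field0_def)
 have c0: "?c0:res_classes F" unfolding res_classes_def cls_def by (auto simp: vO_def)
 have "card {1..<qK F} = card (res_classes F-{?c0})" using fin c0 by (simp add: qK_def)
 with finite_same_card_bij[of "{1..<qK F}" "res_classes F-{?c0}"] fin
 obtain h where h: "bij_betw h {1..<qK F} (res_classes F-{?c0})" by auto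
 have "ALL c:res_classes F. EX t. nmF F t <= 1 & cls (dn F t) = c"
 proof
  fix c assume "c:res_classes F"
  then obtain x where x: "x:vO F" "c = cls x" by (auto simp: res_classes_def cls_def)
  have "x:carrier F" using x(1) by (simp add: vO_def)
  thus "EX t. nmF F t <= 1 & cls (dn F t) = c" using x by (intro exI[of _ "upl F x"]) (simp add: dn_vO[symmetric])
 qed
 from bchoice[OF this] obtain t where t: "ALL c:res_classes F. nmF F (t c) <= 1 & cls (dn F (t c)) = c" by (elim exE)
 define r where "r d = (if d = 0 then 0 else t (h d))" for d
 define g where "g d = (if d = 0 then ?c0 else h d)" for d
 have hin: "h d:res_classes F-{?c0}" if "d < qK F" "d ~= 0" for d using bij_betwE[OF h] that by auto
 have r: "nmF F (r d) <= 1 & cls (dn F (r d)) = g d" if "d < qK F" for d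
  using t hin[OF that] by (simp add: r_def g_def)
 have inj: "inj_on g {..<qK F}"
 proof (rule inj_onI)
  fix d e assume "d:{..<qK F}" "e:{..<qK F}" "g d = g e"
  thus "d = e" using hin[of d] hin[of e] bij_betw_imp_inj_on[OF h, THEN inj_onD, of d e]
   by (cases "d = 0"; cases "e = 0") (auto simp: g_def)
 qed
 have sur: "EX d<qK F. g d = c" if "c:res_classes F" for c
 proof (cases "c = ?c0")
  case True
  thus ?thesis using qgt1 by (intro exI[of _ 0]) (simp add: g_def)
 next
  case False
  hence "c:h ` {1..<qK F}" using bij_betw_imp_surj_on[OF h] that by simp
  then obtain d where "d:{1..<qK F}" "h d = c" by blast
  thus ?thesis by (intro exI[of _ d]) (auto simp: g_def)
 qed
 have "EX! d. d < qK F & nmF F (x-r d) < 1" if x: "nmF F x <= 1" for x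
 proof -
  have *: "nmF F (x-r d) < 1 <-> g d = cls (dn F x)" if "d < qK F" for d
   using cls_eq[OF x, of "r d"] r[OF that] by auto
  have "cls (dn F x):res_classes F" using x by (auto simp: res_classes_def cls_def dn_vO)
  then obtain d where d: "d < qK F" "g d = cls (dn F x)" using sur by blast
  show ?thesis
  proof (rule ex1I[of _ d])
   show "d < qK F & nmF F (x-r d) < 1" using d * by blast
   fix e assume e: "e < qK F & nmF F (x-r e) < 1"
   hence "g e = g d" using *[of e] d by simp
   thus "e = d" by (rule inj_onD[OF inj]) (use e d in auto)
  qed
 qed
 thus ?thesis using r unfolding V.residues_rep_def by (intro exI[of _ r]) (auto simp: r_def)
qed

end

context vring
begin

section \<open>Translation of formulas\<close>

text \<open>Equality of classes in \<open>RV_N\<close>, with the quotient \<open>s/t\<close>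
  cleared: away from null elements it says that \<open>s/t - 1\<close> lies in \<open>N\<close>
  times the maximal ideal.\<close>

definition rl :: "nat => 'r => 'r => bool" where
 "rl N s t <-> (nm s = 0 & nm t = 0) | nm (s-t) < nm (of_nat N)*nm t"

lemma rl_nm: assumes "rl N s t" shows "nm s = nm t"
proof (cases "nm s = 0 & nm t = 0")
 case False
 hence "nm (s-t) < nm (of_nat N)*nm t" using assms unfolding rl_def by blast
 also have "... <= nm t" using nm_of_nat[of N] mult_right_mono[of "nm (of_nat N)" 1 "nm t"] by simp
 finally show ?thesis by (intro nm_close) (simp add: nm_minus_commute)
qed simp

lemma rl_le: "rl N s t ==> nm (s-t) <= nm (of_nat N)*nm t"
 unfolding rl_def using nm_diff_le[of s 0 t] by (auto simp: less_imp_le)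

lemma rl_lt: "rl N s t ==> nm t ~= 0 ==> nm (s-t) < nm (of_nat N)*nm t"
 by (auto simp: rl_def)

lemma rl_refl [simp]: "N >= 1 ==> rl N s s"
 using mult_pos_pos[OF nm_pos[OF char0[of N]] nm_pos[of s]] by (auto simp: rl_def)

lemma rl_sym: "rl N s t ==> rl N t s"
 using rl_nm[of N s t] by (auto simp: rl_def nm_minus_commute)

lemma rl_trans: "rl N s t ==> rl N t u ==> rl N s u"
 using rl_nm[of N s t] rl_nm[of N t u] nm_diff_trans_less[of s t _ u] by (auto simp: rl_def)

lemma rl_mult: assumes "rl N s t" "rl N s' t'" shows "rl N (s * s') (t*t')"
proof (cases "nm t = 0 | nm t' = 0")
 case True
 thus ?thesis using rl_nm[OF assms(1)] rl_nm[OF assms(2)] by (auto simp: rl_def nm_mult)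
next
 case False
 have p: "nm t > 0" "nm t' > 0" using False nm_pos by blast+
 have "s * s'-t*t' = (s-t) * s'+t*(s'-t')" by (simp add: algebra_simps)
 moreover have "nm ((s-t) * s') < nm (of_nat N)*(nm t*nm t')"
  using rl_lt[OF assms(1)] False p by (simp add: nm_mult rl_nm[OF assms(2)] mult.assoc[symmetric])
 moreover have "nm (t*(s'-t')) < nm (of_nat N)*(nm t*nm t')"
  using rl_lt[OF assms(2)] False p by (simp add: nm_mult mult.left_commute)
 ultimately show ?thesis using nm_add_less by (simp add: rl_def nm_mult)
qed

lemma rl_power: "N >= 1 ==> rl N s t ==> rl N (s^n) (t^n)"
 by (induction n) (auto intro: rl_mult)

lemma rl_dvd: assumes "rl M s t" "N dvd M" shows "rl N s t"
proof -
 obtain k where k: "M = N*k" using assms(2) by blast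
 have "nm (of_nat M) <= nm (of_nat N)"
  using mult_left_mono[OF nm_of_nat[of k], of "nm (of_nat N)"] by (simp add: k nm_mult)
 hence "nm (of_nat M)*nm t <= nm (of_nat N)*nm t" by (rule mult_right_mono) simp
 thus ?thesis using assms(1) by (auto simp: rl_def)
qed

lemma close_ge: assumes "nm (s-t) < c" shows "c <= nm s <-> c <= nm t"
 using assms nm_add[of "s-t" t] nm_add[of "t-s" s] by (auto simp: nm_minus_commute)

lemma close_lt: assumes "nm (s-t) < c" shows "nm s < c <-> nm t < c"
 using close_ge[OF assms] by (simp add: not_le[symmetric])

lemma rl_sum_less:
 assumes "!!i. i:I ==> rl N (y i) (w i)" "!!i. i:I ==> nm (w i) <= A" "A > 0" "N >= 1"
 shows "nm (sum y I-sum w I) < nm (of_nat N)*A"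
 unfolding sum_subtractf[symmetric]
proof (rule nm_sum_less)
 have n: "nm (of_nat N) > 0" using nm_pos[OF char0] assms(4) by simp
 thus "0 < nm (of_nat N)*A" using assms(3) by simp
 fix i assume i: "i:I"
 show "nm (y i-w i) < nm (of_nat N)*A"
 proof (cases "nm (w i) = 0")
  case True
  hence "nm (y i-w i) <= 0" using rl_le[OF assms(1)[OF i]] by simp
  thus ?thesis using `0 < nm (of_nat N)*A` by linarith
 next
  case False
  thus ?thesis using rl_lt[OF assms(1)[OF i] False] mult_left_mono[OF assms(2)[OF i], of "nm (of_nat N)"] by simp
 qed
qed

text \<open>Replacing an element by another of its class moves it by less than \<open>|N|\<close>
  times its norm. So the defect \<open>a1+a2-a3\<close> has to be smaller than \<open>|N|\<close>
  times the largest of the three norms, and in that case it can be absorbed entirely by one of the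
  elements.\<close>

lemma roplus_iff:
 assumes N: "N >= 1"
 shows "(EX x1 x2 x3. rl N x1 a1 & rl N x2 a2 & rl N x3 a3 & nm (x1+x2-x3) = 0) <->
  (nm a1 = 0 & nm a2 = 0 & nm a3 = 0) \<or>
  (EX a:{a1, a2, a3}. nm (a1+a2-a3) < nm (of_nat N)*nm a)" (is "?L <-> ?R")
proof
 assume ?L
 then obtain x1 x2 x3 where x: "rl N x1 a1" "rl N x2 a2" "rl N x3 a3" "nm (x1+x2-x3) = 0" by blast
 define A where "A = max (nm a1) (max (nm a2) (nm a3))"
 show ?R
 proof (cases "A > 0")
  case True
  have lt: "nm (x-a) < nm (of_nat N)*A" if "rl N x a" "nm a <= A" for x a
   using rl_sum_less[of "{0::nat}" N "%_. x" "%_. a" A] that True N by simp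
  have e: "a1+a2-a3 = (a1-x1)+((a2-x2)+((x3-a3)+(x1+x2-x3)))" by simp
  have "nm (a1+a2-a3) < nm (of_nat N)*A"
  proof (subst e, intro nm_add_less)
   show "nm (x1+x2-x3) < nm (of_nat N)*A" using x(4) True nm_pos[OF char0[of N]] N by simp
   show "nm (a1-x1) < nm (of_nat N)*A" "nm (a2-x2) < nm (of_nat N)*A" "nm (x3-a3) < nm (of_nat N)*A"
    using lt[OF x(1)] lt[OF x(2)] lt[OF x(3)] by (auto simp: A_def nm_minus_commute)
  qed
  moreover have "A:{nm a1, nm a2, nm a3}" by (auto simp: A_def max_def)
  ultimately show ?thesis by auto
 next
  case False
  have "nm a1 <= A" "nm a2 <= A" "nm a3 <= A" by (auto simp: A_def)
  thus ?thesis using False nm_ge0[of a1] nm_ge0[of a2] nm_ge0[of a3] by (intro disjI1 conjI; linarith)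
 qed
next
 assume ?R
 let ?D = "a1+a2-a3"
 consider "nm a1 = 0 & nm a2 = 0 & nm a3 = 0" | "nm ?D < nm (of_nat N)*nm a1" | "nm ?D < nm (of_nat N)*nm a2"
  | "nm ?D < nm (of_nat N)*nm a3" using `?R` by auto
 moreover have S: "rl N (a-u) a & rl N (a+u) a" if "nm u < nm (of_nat N)*nm a" for a u
  using that by (simp add: rl_def)
 ultimately show ?L
 proof cases
  case 1
  thus ?thesis using N by (intro exI[of _ 0]) (simp add: rl_def)
 next
  case 2
  show ?thesis by (rule exI[of _ "a1-?D"], rule exI[of _ a2], rule exI[of _ a3]) (use S[OF 2] N in simp)
 next
  case 3
  show ?thesis by (rule exI[of _ a1], rule exI[of _ "a2-?D"], rule exI[of _ a3]) (use S[OF 3] N in simp)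
 next
  case 4
  show ?thesis by (rule exI[of _ a1], rule exI[of _ a2], rule exI[of _ "a3+?D"]) (use S[OF 4] N in simp)
 qed
qed

definition pl :: "nat => (nat => 'r) => 'r poly" where "pl d a = (SUM i<=d. monom (a i) i)"

lemma pl: "coeff (pl d a) i = (if i <= d then a i else 0)" "degree (pl d a) <= d"
 "poly (pl d a) x = (SUM i:{0..d}. a i*x^i)" "tay (pl d a) x 1 = (SUM i:{1..d}. of_nat i*(a i*x^(i-1)))"
proof -
 show c: "coeff (pl d a) i = (if i <= d then a i else 0)" for i by (simp add: pl_def coeff_sum)
 show dg: "degree (pl d a) <= d" by (rule degree_le) (simp add: c)
 show "poly (pl d a) x = (SUM i:{0..d}. a i*x^i)" by (simp add: pl_def poly_sum poly_monom atLeast0AtMost)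
 show "tay (pl d a) x 1 = (SUM i:{1..d}. of_nat i*(a i*x^(i-1)))"
 proof (cases d)
  case 0
  thus ?thesis using tay_big[of "pl d a" 1 x] dg by simp
 next
  case (Suc n)
  have "tay (pl d a) x 1 = (SUM i<=n. coeff (dpoly (pl d a)) i*x^i)"
   unfolding poly_dpoly[symmetric] by (rule poly_sum_le) (use degree_dpoly[of "pl d a"] dg Suc in linarith)
  also have "... = (SUM i<d. of_nat (Suc i)*(a (Suc i)*x^i))"
   unfolding Suc lessThan_Suc_atMost by (rule sum.cong) (auto simp: coeff_dpoly c[unfolded Suc] mult.assoc)
  also have "... = (SUM i:{1..d}. of_nat i*(a i*x^(i-1)))"
   using sum.atLeast1_atMost_eq[of "%i. of_nat i*(a i*x^(i-1))" d] by (simp add: One_nat_def)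
  finally show ?thesis .
 qed
qed

section \<open>The relation \<open>P_{N,d}\<close> expressed by orders of polynomials\<close>

context
 fixes N d :: nat and aa :: "nat => 'r" and x0 x :: 'r
 assumes N: "N >= 1" and d: "d >= 1" and x0: "rl N x0 x" and x: "nm x ~= 0"
begin

definition "nv = nm (of_nat N)"
definition "AA = Max ((%i. nm (aa i*x^(i-1))) ` {1..d})"
text \<open>The derivative at \<open>x\<close> of the polynomial with coefficients
  \<open>aa\<close>.\<close>

definition "DD = (SUM i:{1..d}. of_nat i*(aa i*x^(i-1)))"

lemma nu: "nv > 0" "nv <= 1" using nm_pos[OF char0[of N]] N nm_of_nat[of N] by (auto simp: nv_def)

lemma AA: "i:{1..d} ==> nm (aa i*x^(i-1)) <= AA" "EX i:{1..d}. nm (aa i*x^(i-1)) = AA" "0 <= AA"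
proof -
 have f: "finite ((%i. nm (aa i*x^(i-1))) ` {1..d})" "(%i. nm (aa i*x^(i-1))) ` {1..d} ~= {}" using d by auto
 show "i:{1..d} ==> nm (aa i*x^(i-1)) <= AA" unfolding AA_def using f(1) by (intro Max_ge) auto
 have "AA:(%i. nm (aa i*x^(i-1))) ` {1..d}" unfolding AA_def by (rule Max_in[OF f])
 thus "EX i:{1..d}. nm (aa i*x^(i-1)) = AA" by force
 thus "0 <= AA" using nm_ge0 by metis
qed

lemma ball_AA: "(ALL i:{1..d}. nv*nm (aa i*x^(i-1)) <= c) <-> nv*AA <= c"
proof
 obtain i where "i:{1..d}" "nm (aa i*x^(i-1)) = AA" using AA(2) by blast
 moreover assume "ALL i:{1..d}. nv*nm (aa i*x^(i-1)) <= c"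
 ultimately show "nv*AA <= c" by metis
next
 assume "nv*AA <= c"
 thus "ALL i:{1..d}. nv*nm (aa i*x^(i-1)) <= c"
 proof (intro ballI)
  fix i assume i: "i:{1..d}"
  have "nv*nm (aa i*x^(i-1)) <= nv*AA" by (rule mult_left_mono[OF AA(1)[OF i]]) (use nu in simp)
  thus "nv*nm (aa i*x^(i-1)) <= c" using `nv*AA <= c` by simp
 qed
qed

lemma DD_le: "nm DD <= AA"
 unfolding DD_def
proof (rule nm_sum_le)
 fix i assume i: "i:{1..d}"
 have "nm (of_nat i*(aa i*x^(i-1))) <= 1*AA" unfolding nm_mult[of "of_nat i"]
  by (rule mult_mono[OF nm_of_nat AA(1)[OF i]]) simp_all
 thus "nm (of_nat i*(aa i*x^(i-1))) <= AA" by simp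
qed (rule AA(3))

lemma NN: "N^2 >= 1" "N dvd N^2" "nm (of_nat (N^2)) = nv\<^sup>2"
 using N by (auto simp: nv_def nm_power)

lemma slope_close:
 assumes a: "!!i. i <= d ==> rl (N^2) (a i) (aa i)" and A: "AA > 0"
  and y: "!!i. i:{1..d} ==> rl N (y i) (of_nat i*(a i*x0^(i-1)))"
 shows "nm ((SUM i:{1..d}. y i)-DD) < nv*AA"
 unfolding DD_def nv_def
proof (rule rl_sum_less[OF _ _ A N])
 fix i assume i: "i:{1..d}"
 have "rl N (of_nat i*(a i*x0^(i-1))) (of_nat i*(aa i*x^(i-1)))"
  using i by (intro rl_mult rl_power rl_refl N x0 rl_dvd[OF a NN(2)]) simp
 thus "rl N (y i) (of_nat i*(aa i*x^(i-1)))" by (rule rl_trans[OF y[OF i]])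
 have "nm (of_nat i*(aa i*x^(i-1))) <= 1*AA" unfolding nm_mult[of "of_nat i"]
  by (rule mult_mono[OF nm_of_nat AA(1)[OF i]]) simp_all
 thus "nm (of_nat i*(aa i*x^(i-1))) <= AA" by simp
qed

text \<open>Other representatives change the derivative by less than \<open>nv*AA\<close>, which is
  exactly the threshold of the comparison; hence all choices give the same answer.\<close>

lemma slope_iff:
 assumes a: "!!i. i <= d ==> rl (N^2) (a i) (aa i)"
 shows "(ALL y. (ALL i:{1..d}. rl N (y i) (of_nat i*(a i*x0^(i-1)))) -->
   (ALL i:{1..d}. nv*nm (a i*x0^(i-1)) <= nm (SUM i:{1..d}. y i))) <-> nv*AA <= nm DD" (is "?L <-> _")
proof -
 have e: "nm (a i*x0^(i-1)) = nm (aa i*x^(i-1))" if "i:{1..d}" for i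
  using that by (intro rl_nm[where N = N] rl_mult rl_power N x0 rl_dvd[OF a NN(2)]) simp
 have L: "?L <-> (ALL y. (ALL i:{1..d}. rl N (y i) (of_nat i*(a i*x0^(i-1)))) --> nv*AA <= nm (SUM i:{1..d}. y i))"
  unfolding ball_AA[symmetric] using e by simp
 show ?thesis
 proof (cases "AA > 0")
  case True
  have E: "nv*AA <= nm (SUM i:{1..d}. y i) <-> nv*AA <= nm DD"
   if "ALL i:{1..d}. rl N (y i) (of_nat i*(a i*x0^(i-1)))" for y
   by (rule close_ge[OF slope_close[OF a True]]) (use that in auto)
  have w: "ALL i:{1..d}. rl N (of_nat i*(a i*x0^(i-1))) (of_nat i*(a i*x0^(i-1)))" using N by simp
  show ?thesis unfolding L
  proof (intro iffI allI impI)
   assume "ALL y. (ALL i:{1..d}. rl N (y i) (of_nat i*(a i*x0^(i-1)))) --> nv*AA <= nm (SUM i:{1..d}. y i)"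
   from mp[OF spec[OF this] w] show "nv*AA <= nm DD" by (rule iffD1[OF E[OF w]])
  qed (use E in blast)
 next
  case False
  hence "AA = 0" using AA(3) by simp
  thus ?thesis unfolding L by simp
 qed
qed

text \<open>The coefficients are known modulo \<open>N^2\<close> and the point modulo
  \<open>N\<close>. The former and the quadratic terms cause errors below
  \<open>nv^2*nm x*AA\<close>, which the slope condition bounds by \<open>nm x*nv*nm DD\<close>; the
  linear term is below the same bound since the point moves by less than
  \<open>nv*nm x\<close>.\<close>

lemma value_close:
 assumes C1: "nv*AA <= nm DD" and A: "AA > 0" and b: "nm (aa 0) <= nm x*AA"
  and x1: "rl N x1 x" and y: "!!i. i:{0..d} ==> rl (N^2) (y i) (aa i*x1^i)"
 shows "nm ((SUM i:{0..d}. y i)-(SUM i:{0..d}. aa i*x^i)) < nm x*nv*nm DD"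
proof -
 have xp: "nm x > 0" using nm_pos[OF x] .
 have nx: "nm x1 = nm x" by (rule rl_nm[OF x1])
 define B where "B = nm x*AA"
 have B: "B > 0" using A xp by (simp add: B_def)
 have bi: "nm (aa i*u^i) <= B" if "i <= d" "nm u = nm x" for i u
 proof (cases i)
  case (Suc j)
  thus ?thesis using AA(1)[of i] that xp by (simp add: B_def nm_mult nm_power mult.left_commute)
 qed (use b in "simp add: B_def")
 have sm: "nv\<^sup>2*B <= nm x*nv*nm DD"
  using mult_left_mono[OF C1, of "nm x*nv"] nu xp by (simp add: B_def power2_eq_square ac_simps)
 have bnd: "bnd (nm x) B (pl d aa)" unfolding bnd_def pl(1) using bi[of _ x] B by (simp add: nm_mult nm_power less_imp_le)
 define h where "h = x1-x"
 have h: "nm h < nv*nm x" using rl_lt[OF x1 x] by (simp add: h_def nv_def)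
 have hx: "nm h <= nm x" using h nu mult_right_mono[of nv 1 "nm x"] by simp
 let ?p = "tlr (pl d aa) x"
 have "nm (poly ?p h-coeff ?p 0-coeff ?p 1*h) <= B*(nm h/nm x)\<^sup>2"
  by (rule bnd_tail[OF bnd_tlr[OF bnd order_refl xp] order_refl hx xp])
 also have "... < B*nv\<^sup>2"
  using B h xp by (intro mult_strict_left_mono power_strict_mono) (simp_all add: divide_less_eq)
 finally have t1: "nm (poly ?p h-coeff ?p 0-coeff ?p 1*h) < nm x*nv*nm DD" using sm by (simp add: mult.commute)
 have D: "nm DD > 0" using C1 nu A by (meson less_le_trans mult_pos_pos)
 have "coeff ?p 1 = DD" "coeff ?p 0 = (SUM i:{0..d}. aa i*x^i)" by (simp_all add: coeff_tlr pl(4) DD_def tay_0 pl(3))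
 moreover have "poly ?p h = (SUM i:{0..d}. aa i*x1^i)" by (simp add: poly_tlr h_def pl(3))
 moreover have "nm (DD*h) < nm x*nv*nm DD" using h D by (simp add: nm_mult mult.commute mult.left_commute)
 ultimately have t2: "nm ((SUM i:{0..d}. aa i*x1^i)-(SUM i:{0..d}. aa i*x^i)) < nm x*nv*nm DD"
  using nm_add_less[OF t1, of "coeff ?p 1*h"] by simp
 have "nm ((SUM i:{0..d}. y i)-(SUM i:{0..d}. aa i*x1^i)) < nm (of_nat (N^2))*B"
  by (rule rl_sum_less[OF y bi[OF _ nx] B NN(1)]) simp_all
 hence "nm ((SUM i:{0..d}. y i)-(SUM i:{0..d}. aa i*x1^i)) < nm x*nv*nm DD" unfolding NN(3) using sm by simp
 thus ?thesis using t2 by (rule nm_diff_trans_less)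
qed

text \<open>Under the slope condition a lift with 0 in the sum exists exactly if the value at
  \<open>x\<close> is smaller than \<open>nm x*nv*nm DD\<close>. One direction is
  \<open>value_close\<close>, the other is Hensel's lemma, whose root lies in the class of
  \<open>x\<close>. The polynomial with null coefficients is exceptional because the strict
  inequality fails for it.\<close>

lemma root_iff:
 assumes a: "!!i. i <= d ==> rl (N^2) (a i) (aa i)" and C1: "nv*AA <= nm DD"
 shows "(EX x1. rl N x1 x0 & (EX y. (ALL i:{0..d}. rl (N^2) (y i) (a i*x1^i)) & nm (SUM i:{0..d}. y i) = 0)) <->
  nm (SUM i:{0..d}. aa i*x^i) < nm x*nv*nm DD \<or> (ALL i<=d. nm (aa i) = 0)" (is "?L <-> ?P | ?Z")
proof -
 have xp: "nm x > 0" using nm_pos[OF x] .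
 have al: "rl (N^2) (y i) (aa i*x1^i)" if "rl (N^2) (y i) (a i*x1^i)" "i <= d" for y x1 i
  by (rule rl_trans[OF that(1)]) (intro rl_mult a that(2) rl_refl NN(1))
 have S: "sum f {0..d} = f 0 + sum f {1..d}" for f :: "nat => 'r"
  using sum.atLeast_Suc_atMost[of 0 d f] by (simp add: One_nat_def)
 have small: "nm (SUM i:{1..d}. aa i*u^i) <= nm x*AA" if "nm u = nm x" for u
 proof (rule nm_sum_le)
  fix i assume i: "i:{1..d}"
  then obtain j where "i = Suc j" by (cases i) auto
  thus "nm (aa i*u^i) <= nm x*AA"
   using mult_left_mono[OF AA(1)[OF i], of "nm x"] that by (simp add: nm_mult nm_power mult.left_commute)
 qed (use AA(3) in simp)
 show ?thesis
 proof
  assume ?L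
  then obtain x1 y where x1: "rl N x1 x0" and y: "!!i. i:{0..d} ==> rl (N^2) (y i) (a i*x1^i)"
   and y0: "nm (SUM i:{0..d}. y i) = 0" by blast
  have x1': "rl N x1 x" by (rule rl_trans[OF x1 x0])
  have nx: "nm x1 = nm x" by (rule rl_nm[OF x1'])
  have y': "rl (N^2) (y i) (aa i*x1^i)" if "i:{0..d}" for i by (rule al) (use y that in auto)
  define B where "B = max (nm (aa 0)) (nm x*AA)"
  show "?P | ?Z"
  proof (cases "B > 0")
   case False
   have le: "nm (aa 0) <= B" "nm x*AA <= B" by (auto simp: B_def)
   hence "nm (aa 0) = 0" using False nm_ge0[of "aa 0"] by linarith
   moreover have "AA = 0" using le(2) False AA(3) xp by (smt (verit) mult_pos_pos)
   hence "nm (aa i) = 0" if "i:{1..d}" for i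
   proof -
    have "nm (aa i*x^(i-1)) = 0" using AA(1)[OF that] `AA = 0` nm_ge0[of "aa i*x^(i-1)"] by linarith
    thus ?thesis using x by (simp add: nm_mult nm_power)
   qed
   ultimately have "nm (aa i) = 0" if "i <= d" for i using that by (cases "i = 0") auto
   thus ?thesis by blast
  next
   case True
   have "nm (aa i*x1^i) <= B" if "i:{0..d}" for i
   proof (cases i)
    case (Suc j)
    thus ?thesis using mult_left_mono[OF AA(1)[of i], of "nm x"] that nx
     by (simp add: B_def nm_mult nm_power mult.left_commute le_max_iff_disj)
   qed (simp add: B_def)
   hence "nm (sum y {0..d}-(SUM i:{0..d}. aa i*x1^i)) < nm (of_nat (N^2))*B"
    by (intro rl_sum_less[OF y' _ True NN(1)]) auto
   also have "... <= B" using True nm_of_nat[of "N^2"] by simp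
   finally have "nm (SUM i:{0..d}. aa i*x1^i) < B"
    using nm_diff_less[of "sum y {0..d}" B "sum y {0..d}-(SUM i:{0..d}. aa i*x1^i)"] y0 True by simp
   hence *: "nm (aa 0+(SUM i:{1..d}. aa i*x1^i)) < B" by (simp add: S[of "%i. aa i*x1^i"])
   have b: "nm (aa 0) <= nm x*AA"
   proof (rule ccontr)
    assume n: "~ nm (aa 0) <= nm x*AA"
    hence "nm (aa 0+(SUM i:{1..d}. aa i*x1^i)) = nm (aa 0)"
     using small[OF nx] by (intro nm_add_dom) linarith
    thus False using * n by (simp add: B_def)
   qed
   hence "AA > 0" using True AA(3) xp by (auto simp: B_def zero_less_mult_iff)
   from value_close[OF C1 this b x1' y'] have "nm (sum y {0..d}-(SUM i:{0..d}. aa i*x^i)) < nm x*nv*nm DD" by blast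
   from close_lt[OF this] y0 show ?thesis using nu xp C1 `AA > 0` by (smt (verit) mult_pos_pos)
  qed
 next
  assume "?P | ?Z"
  thus ?L
  proof
   assume Z: ?Z
   have "rl (N^2) 0 (a i*x0^i)" if "i:{0..d}" for i using Z that rl_nm[OF a, of i] by (simp add: rl_def nm_mult)
   thus ?L using N by (intro exI[of _ x0] conjI exI[of _ "%_. 0"]) auto
  next
   assume P: ?P
   have "nm x*nv*nm DD > 0" using P nm_ge0 le_less_trans by blast
   hence "nm DD ~= 0" by auto
   hence D: "nm DD > 0" by (rule nm_pos)
   have A: "AA > 0" using D DD_le by simp
   have "nm x*nv*nm DD <= nm x*1*AA" using xp nu DD_le by (intro mult_mono) auto
   hence PA: "nm (SUM i:{0..d}. aa i*x^i) < nm x*AA" using P by simp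
   have b: "nm (aa 0) <= nm x*AA"
    using nm_diff_le[OF less_imp_le[OF PA] small[of x]] by (simp add: S[of "%i. aa i*x^i"])
   have ya: "rl (N^2) (a i*x0^i) (aa i*x0^i)" if "i:{0..d}" for i
    using that by (intro rl_mult a rl_refl NN(1)) simp
   let ?p = "tlr (pl d a) x0"
   have p0: "coeff ?p 0 = (SUM i:{0..d}. a i*x0^i)" and p1: "coeff ?p 1 = (SUM i:{1..d}. of_nat i*(a i*x0^(i-1)))"
    by (simp_all add: coeff_tlr tay_0 pl(3,4))
   have n0: "nm (coeff ?p 0) < nm x*nv*nm DD"
    using close_lt[OF value_close[OF C1 A b x0 ya]] P unfolding p0 by simp
   have "nm (coeff ?p 1-DD) < nv*AA" unfolding p1 by (rule slope_close[OF a A]) (use N in auto)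
   hence "nm (DD-coeff ?p 1) < nm DD" using C1 by (simp add: nm_minus_commute)
   hence n1: "nm (coeff ?p 1) = nm DD" by (rule nm_close)
   have bnd: "bnd (nm x) (nm x*AA) (pl d a)" unfolding bnd_def
   proof
    fix i
    show "nm (coeff (pl d a) i)*nm x^i <= nm x*AA"
    proof (cases "i <= d")
     case True
     hence e: "nm (coeff (pl d a) i) = nm (aa i)" using rl_nm[OF a] by (simp add: pl(1))
     show ?thesis
     proof (cases i)
      case (Suc j)
      thus ?thesis unfolding e using mult_left_mono[OF AA(1)[of i], of "nm x"] True
       by (simp add: nm_mult nm_power mult.left_commute)
     qed (use b e in simp)
    qed (use A xp in "simp add: pl(1)")
   qed
   have B: "nm x*AA > 0" using A xp by simp
   \<comment> \<open>In the units of Hensel's lemma the hypothesis \<open>?P\<close> reads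
     \<open>dl < nv*ee\<close>, and the slope condition reads \<open>nv <= ee\<close>; together they
     give \<open>dl < ee^2\<close>.\<close>
   define dl where "dl = nm (coeff ?p 0)/(nm x*AA)"
   define ee where "ee = nm DD/AA"
   have e: "ee > 0" using D A by (simp add: ee_def)
   have "nv <= ee" using C1 A by (simp add: ee_def pos_le_divide_eq)
   hence "nv*ee <= ee\<^sup>2" using e by (simp add: power2_eq_square)
   moreover have "dl < nv*ee" using n0 B A xp by (simp add: dl_def ee_def divide_simps ac_simps)
   ultimately have de: "dl < ee\<^sup>2" by linarith
   have "EX h. nm h <= dl/ee*nm x & nm (poly ?p h) = 0"
   proof (rule hensel[OF bnd_tlr[OF bnd _ xp] xp B e _ _ de])
    show "nm x0 <= nm x" using rl_nm[OF x0] by simp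
    show "nm (coeff ?p 0) <= dl*(nm x*AA)" unfolding dl_def
     by (rule eq_refl[OF sym[OF nonzero_eq_divide_eq[THEN iffD1, OF _ refl]]]) (use A xp in simp)
    show "ee*(nm x*AA) <= nm (coeff ?p 1)*nm x" using A by (simp add: ee_def n1)
   qed
   then obtain h where h: "nm h <= dl/ee*nm x" "nm (poly ?p h) = 0" by blast
   have "dl/ee*nm x < nv*nm x" using `dl < nv*ee` e xp by (simp add: divide_less_eq)
   hence "nm h < nv*nm x0" using h(1) rl_nm[OF x0] by simp
   hence "rl N (x0+h) x0" by (simp add: rl_def nv_def)
   moreover have "nm (SUM i:{0..d}. a i*(x0+h)^i) = 0" using h(2) by (simp add: poly_tlr pl(3))
   ultimately show ?L using NN(1) by (intro exI[of _ "x0+h"] conjI exI[of _ "%i. a i*(x0+h)^i"]) auto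
  qed
 qed
qed

lemma rP_iff:
 "(EX a. (ALL i<=d. rl (N^2) (a i) (aa i)) &
   (ALL y. (ALL i:{1..d}. rl N (y i) (of_nat i*(a i*x0^(i-1)))) -->
     (ALL i:{1..d}. nm (of_nat N)*nm (a i*x0^(i-1)) <= nm (SUM i:{1..d}. y i))) &
   (EX x1. rl N x1 x0 & (EX y. (ALL i:{0..d}. rl (N^2) (y i) (a i*x1^i)) & nm (SUM i:{0..d}. y i) = 0))) <->
  (ALL i:{1..d}. nm (of_nat N)*nm (aa i*x^(i-1)) <= nm DD) &
  (nm (SUM i:{0..d}. aa i*x^i) < nm x*nm (of_nat N)*nm DD \<or> (ALL i<=d. nm (aa i) = 0))"
 (is "(EX a. ?A a & ?B a & ?C a) <-> ?R1 & ?R2")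
proof -
 have R1: "?R1 <-> nv*AA <= nm DD" using ball_AA[of "nm DD"] by (simp add: nv_def)
 have B: "?B a <-> nv*AA <= nm DD" if "?A a" for a using slope_iff[of a] that by (simp add: nv_def)
 have C: "?C a <-> ?R2" if "?A a" "nv*AA <= nm DD" for a
  by (rule root_iff[OF _ that(2), of a, unfolded nv_def]) (use that(1) in blast)
 have A: "?A aa" using NN(1) by simp
 show ?thesis unfolding R1
 proof (intro iffI conjI)
  assume "EX a. ?A a & ?B a & ?C a"
  then obtain a where abc: "?A a & ?B a & ?C a" by (rule exE)
  note a = conjunct1[OF abc] conjunct1[OF conjunct2[OF abc]] conjunct2[OF conjunct2[OF abc]]
  show 1: "nv*AA <= nm DD" using B[OF a(1)] a(2) by (rule iffD1)
  show ?R2 using C[OF a(1) 1] a(3) by (rule iffD1)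
 next
  assume a: "nv*AA <= nm DD & ?R2"
  have "?B aa" using B[OF A] conjunct1[OF a] by (rule iffD2)
  moreover have "?C aa" using C[OF A conjunct1[OF a]] conjunct2[OF a] by (rule iffD2)
  ultimately show "EX a. ?A a & ?B a & ?C a" by (intro exI[of _ aa] conjI A)
 qed
qed

end

end

text \<open>Formulas that only compare orders of polynomials. Every formula of the given language is
  equivalent to one of these once the variables of the sorts \<open>RV\<close> are replaced by representatives.\<close>

datatype 'p ocf = OLe "'p vterm" "'p vterm" | ONot "'p ocf" | OAnd "'p ocf" "'p ocf"

fun osat :: "'a vfield => ('p => 'a) => (nat => 'a) => 'p ocf => bool" where
 "osat F c rh (OLe s t) <-> eord F (vval F c rh s) <= eord F (vval F c rh t)"
| "osat F c rh (ONot f) <-> ~ osat F c rh f"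
| "osat F c rh (OAnd f g) <-> osat F c rh f & osat F c rh g"

fun oconsts :: "'p ocf => 'p set" where
 "oconsts (OLe s t) = vconsts s Un vconsts t"
| "oconsts (ONot f) = oconsts f"
| "oconsts (OAnd f g) = oconsts f Un oconsts g"

abbreviation "OLt s t == ONot (OLe t s)"
abbreviation "OOr f g == ONot (OAnd (ONot f) (ONot g))"
definition "OAll fs = foldr OAnd fs (OLe VZero VZero)"

primrec natt :: "nat => 'p vterm" where
 "natt 0 = VZero" | "natt (Suc n) = VAdd (natt n) VOne"

primrec powt :: "'p vterm => nat => 'p vterm" where
 "powt t 0 = VOne" | "powt t (Suc n) = VMul t (powt t n)"

definition "sumt ts = foldr VAdd ts VZero"

lemma natt_consts [simp]: "vconsts (natt n) = {}" by (induction n) auto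
lemma powt_consts [simp]: "vconsts (powt t n) = (if n = 0 then {} else vconsts t)" by (induction n) auto
lemma sumt_consts [simp]: "vconsts (sumt ts) = \<Union>(vconsts ` set ts)" by (induction ts) (auto simp: sumt_def)
lemma OAll_consts [simp]: "oconsts (OAll fs) = \<Union>(oconsts ` set fs)" by (induction fs) (auto simp: OAll_def)

text \<open>The variables below \<open>n\<close> keep their place, the other \<open>VF\<close> variables and the representatives of
  the \<open>RV\<close> variables alternate behind them.\<close>

definition "vcode n i = (if i < n then i else n+2*i)" for n i :: nat
definition "rcode n N i = n+2*prod_encode (N, i)+1" for n :: nat

fun trv :: "nat => 'p vterm => 'p vterm" where
 "trv n (VVar i) = VVar (vcode n i)"
| "trv n (VAdd s t) = VAdd (trv n s) (trv n t)"
| "trv n (VNeg s) = VNeg (trv n s)"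
| "trv n (VMul s t) = VMul (trv n s) (trv n t)"
| "trv n t = t"

fun trr :: "nat => 'p rterm => 'p vterm" where
 "trr n (RVar N i) = VVar (rcode n N i)"
| "trr n (RZero N) = VZero"
| "trr n (ROne N) = VOne"
| "trr n (RMul a b) = VMul (trr n a) (trr n b)"
| "trr n (Rv N t) = trv n t"
| "trr n (RProj N r) = trr n r"

text \<open>The order of zero is infinite, so this comparison says that \<open>t\<close>
  vanishes.\<close>

abbreviation "Ozero t == OLe VZero t"

definition "Orl N x y = OOr (OAnd (Ozero x) (Ozero y)) (OLt (VMul (natt N) y) (VAdd x (VNeg y)))"

definition "Oplus N x y z = OOr (OAnd (Ozero x) (OAnd (Ozero y) (Ozero z)))
 (ONot (OAll (map (%t. OLe (VAdd (VAdd x y) (VNeg z)) (VMul (natt N) t)) [x, y, z])))"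

definition "slopet d x as = sumt (map (%i. VMul (natt i) (VMul (as ! i) (powt x (i-1)))) [1..<Suc d])"

definition "ORP N d x as = OAnd (ONot (Ozero x))
 (OAnd (OAll (map (%i. OLe (slopet d x as) (VMul (natt N) (VMul (as ! i) (powt x (i-1))))) [1..<Suc d]))
  (OOr (OLt (VMul (VMul x (natt N)) (slopet d x as)) (sumt (map (%i. VMul (as ! i) (powt x i)) [0..<Suc d])))
   (OAll (map (%i. Ozero (as ! i)) [0..<Suc d]))))"

fun trq :: "nat => 'p qf => 'p ocf" where
 "trq n QTrue = Ozero VZero"
| "trq n (VEq s t) = Ozero (VAdd (trv n s) (VNeg (trv n t)))"
| "trq n (REq a b) = Orl (rsort a) (trr n a) (trr n b)"
| "trq n (RDvd a b) = OLe (trr n a) (trr n b)"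
| "trq n (ROplus a b d) = Oplus (rsort a) (trr n a) (trr n b) (trr n d)"
| "trq n (RP N x zs) = ORP N (length zs-1) (trr n x) (map (trr n) zs)"
| "trq n (QNot p) = ONot (trq n p)"
| "trq n (QAnd p q) = OAnd (trq n p) (trq n q)"
| "trq n (QOr p q) = OOr (trq n p) (trq n q)"

lemma trv_consts [simp]: "vconsts (trv n t) = vconsts t" by (induction t) auto
lemma trr_consts [simp]: "vconsts (trr n r) = rconsts r" by (induction r) auto
lemma ORP_consts:
 assumes "length as = Suc d" shows "oconsts (ORP N d x as) <= vconsts x Un \<Union>(vconsts ` set as)"
proof -
 define U where "U = \<Union>(vconsts ` set as)"
 have n: "p:U" if "p:vconsts (as ! i)" "i < Suc d" for i p using that assms by (force simp: U_def)
 have s: "p:vconsts x Un U" if "p:vconsts (slopet d x as)" for p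
  using that unfolding slopet_def by (auto split: if_splits simp del: upt_Suc intro: n)
 show ?thesis unfolding ORP_def U_def[symmetric] using s by (auto split: if_splits simp del: upt_Suc intro: n)
qed

lemma trq_consts: "qwf f ==> oconsts (trq n f) <= qconsts f"
proof (induction f)
 case (RP N x zs)
 hence "2 <= length zs" by simp
 hence "length (map (trr n) zs) = Suc (length zs-1)" unfolding length_map by linarith
 from ORP_consts[OF this, of N "trr n x"] show ?case by simp
qed (auto simp: Orl_def Oplus_def)

fun ev :: "('p => 'r) => (nat => 'r) => 'p vterm => 'r::comm_ring_1" where
 "ev ka z (VVar i) = z i"
| "ev ka z (VConst p) = ka p"
| "ev ka z VZero = 0"
| "ev ka z VOne = 1"
| "ev ka z (VAdd s t) = ev ka z s+ev ka z t"
| "ev ka z (VNeg s) = - ev ka z s"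
| "ev ka z (VMul s t) = ev ka z s*ev ka z t"

text \<open>Evaluation in the ring by norms; a larger order is a smaller norm, so the two sides
  change places.\<close>

fun oev :: "('r => real) => ('p => 'r) => (nat => 'r::comm_ring_1) => 'p ocf => bool" where
 "oev nm ka z (OLe s t) <-> nm (ev ka z t) <= nm (ev ka z s)"
| "oev nm ka z (ONot f) <-> ~ oev nm ka z f"
| "oev nm ka z (OAnd f g) <-> oev nm ka z f & oev nm ka z g"

lemma oev_OAll [simp]: "oev nm ka z (OAll fs) <-> (ALL f:set fs. oev nm ka z f)"
 by (induction fs) (auto simp: OAll_def)

lemma ev_natt [simp]: "ev ka z (natt n) = of_nat n" by (induction n) (simp_all add: add.commute)
lemma ev_powt [simp]: "ev ka z (powt t n) = ev ka z t^n" by (induction n) simp_all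
lemma ev_sumt [simp]: "ev ka z (sumt ts) = sum_list (map (ev ka z) ts)" by (induction ts) (simp_all add: sumt_def)

lemma ev_slopet: "length as > d ==> ev ka z (slopet d x as) = (SUM i:{1..d}. of_nat i*(ev ka z (as ! i)*ev ka z x^(i-1)))"
 by (simp add: slopet_def o_def interv_sum_list_conv_sum_set_nat atLeastLessThanSuc_atLeastAtMost del: upt_Suc)

lemma (in vring) polyf_mono: "f:polyf n ==> n <= n' ==> f:polyf n'"
 by (induction rule: polyf.induct) (auto intro: polyf.intros)

lemma (in vring) ev_polyf: "EX M. (%z. ev ka z t):polyf M"
proof (induction t)
 case (VVar i)
 show ?case using polyf_var[of i "Suc i"] by auto
next
 case (VAdd s t)
 then obtain M M' where "(%z. ev ka z s):polyf (max M M')" "(%z. ev ka z t):polyf (max M M')"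
  by (meson max.cobounded1 max.cobounded2 polyf_mono)
 thus ?case by (auto intro: polyf_add)
next
 case (VMul s t)
 then obtain M M' where "(%z. ev ka z s):polyf (max M M')" "(%z. ev ka z t):polyf (max M M')"
  by (meson max.cobounded1 max.cobounded2 polyf_mono)
 thus ?case by (auto intro: polyf_mult)
next
 case (VNeg s)
 thus ?case using polyf_mult[OF polyf_const[of "-1"]] by fastforce
qed (auto intro: polyf_const)

section \<open>Satisfaction of formulas in a local field through its seminorm\<close>

context lf
begin

lemma diff_eq0: assumes "x:carrier F" "y:carrier F" shows "x \<ominus> y = \<zero> <-> x = y"
proof
 assume "x \<ominus> y = \<zero>"
 hence "x \<ominus> y \<oplus> y = y" using assms by simp
 moreover have "x \<ominus> y \<oplus> y = x" using assms by (simp add: a_minus_def a_assoc l_neg)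
 ultimately show "x = y" by simp
qed (use assms in "simp add: a_minus_def r_neg")

lemma rv_iff: assumes N: "N >= 1" shows "dn F t:rv F N (dn F s) <-> V.rl N t s"
proof (cases "dn F s = \<zero>")
 case True
 hence "nmF F s = 0" by (simp add: nmF_eq0)
 moreover have "~ nmF F (t-s) < 0" by (simp only: not_less V.nm_ge0)
 ultimately have "V.rl N t s <-> nmF F t = 0" by (simp add: V.rl_def)
 thus ?thesis using True by (simp add: rv_def nmF_eq0)
next
 case False
 define si where "si = upl F (inv (dn F s))"
 have u: "dn F s:Units F" using False by (simp add: field_Units)
 hence si: "dn F si = inv (dn F s)" by (simp add: si_def)
 have ns: "nmF F s > 0" using V.nm_pos False nmF_eq0 by blast
 have eq: "V.eqv ((t * si-1) * s) (t-s)"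
 proof -
  have "V.eqv (si * s) 1" using u by (simp add: V.eqv_def nmF_eq0 si a_minus_def r_neg)
  hence "V.eqv (t*(si * s)-s) (t*1-s)" by (intro V.eqv_diff V.eqv_mult) simp_all
  thus ?thesis by (simp add: algebra_simps)
 qed
 have e: "nmF F (t * si-1)*nmF F s = nmF F (t-s)" using V.eqv_nm[OF eq] by (simp only: V.nm_mult)
 have "dn F t:rv F N (dn F s) <-> dn F t ~= \<zero> & ~ eord F (dn F (t * si-1)) <= eord F (dn F (of_nat N))"
  using False by (simp add: rv_def si not_le)
 also have "~ eord F (dn F (t * si-1)) <= eord F (dn F (of_nat N)) <-> nmF F (t * si-1) < nmF F (of_nat N)"
  unfolding eord_le nmF_def[symmetric] by (rule not_le)
 also have "... <-> nmF F (t-s) < nmF F (of_nat N)*nmF F s" unfolding e[symmetric] using ns by simp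
 also have "dn F t ~= \<zero> & nmF F (t-s) < nmF F (of_nat N)*nmF F s <-> V.rl N t s"
  using V.rl_nm[of N t s] ns by (auto simp: V.rl_def nmF_eq0[symmetric])
 finally show ?thesis .
qed

lemma rv_carrier: "rv F N x <= carrier F" by (auto simp: rv_def)

lemma rv_eq: assumes N: "N >= 1" shows "rv F N (dn F s) = rv F N (dn F t) <-> V.rl N s t"
proof
 have "dn F s:rv F N (dn F s)" using rv_iff[OF N] N by simp
 moreover assume "rv F N (dn F s) = rv F N (dn F t)"
 ultimately show "V.rl N s t" using rv_iff[OF N] by simp
next
 have "rv F N (dn F s) <= rv F N (dn F t)" if "V.rl N s t" for s t
 proof
  fix y assume y: "y:rv F N (dn F s)"
  hence c: "y = dn F (upl F y)" using subsetD[OF rv_carrier y] by simp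
  hence "V.rl N (upl F y) s" using y rv_iff[OF N] by metis
  hence "V.rl N (upl F y) t" using that by (rule V.rl_trans)
  thus "y:rv F N (dn F t)" using c rv_iff[OF N] by metis
 qed
 moreover assume "V.rl N s t"
 ultimately show "rv F N (dn F s) = rv F N (dn F t)" using V.rl_sym by blast
qed

lemma rep_rv: assumes N: "N >= 1" obtains s' where "rep (rv F N (dn F s)) = dn F s'" "V.rl N s' s"
proof -
 have "dn F s:rv F N (dn F s)" using rv_iff[OF N] N by simp
 hence r: "rep (rv F N (dn F s)):rv F N (dn F s)" unfolding rep_def by (rule someI)
 have e: "rep (rv F N (dn F s)) = dn F (upl F (rep (rv F N (dn F s))))" using subsetD[OF rv_carrier r] by simp
 thus thesis using that[OF e] r rv_iff[OF N] by metis
qed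

lemma carrier_dn: "x:carrier F ==> EX t. x = dn F t" by (metis dns(8))

lemma ex_sum:
 assumes N: "N >= 1"
 shows "(EX y. (ALL i:I. y i:rv F N (dn F (w i))) & R (finsum F y I)) <-> (EX y. (ALL i:I. V.rl N (y i) (w i)) & R (dn F (sum y I)))"
proof
 assume "EX y. (ALL i:I. y i:rv F N (dn F (w i))) & R (finsum F y I)"
 then obtain y where y: "ALL i:I. y i:rv F N (dn F (w i))" "R (finsum F y I)" by blast
 have c: "dn F (upl F (y i)) = y i" "y i:carrier F" if "i:I" for i using subsetD[OF rv_carrier bspec[OF y(1) that]] by simp_all
 have "finsum F y I = dn F (sum (%i. upl F (y i)) I)" unfolding dn_sum by (rule finsum_cong') (use c in auto)
 moreover have "ALL i:I. V.rl N (upl F (y i)) (w i)" using y(1) rv_iff[OF N] c(1) by metis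
 ultimately show "EX y. (ALL i:I. V.rl N (y i) (w i)) & R (dn F (sum y I))" using y(2) by metis
next
 assume "EX y. (ALL i:I. V.rl N (y i) (w i)) & R (dn F (sum y I))"
 then obtain y where "ALL i:I. V.rl N (y i) (w i)" "R (dn F (sum y I))" by blast
 thus "EX y. (ALL i:I. y i:rv F N (dn F (w i))) & R (finsum F y I)"
  using rv_iff[OF N] by (intro exI[of _ "%i. dn F (y i)"]) simp
qed

lemma all_sum:
 assumes "N >= 1"
 shows "(ALL y. (ALL i:I. y i:rv F N (dn F (w i))) --> R (finsum F y I)) <-> (ALL y. (ALL i:I. V.rl N (y i) (w i)) --> R (dn F (sum y I)))"
 using ex_sum[OF assms, of I w "%s. ~ R s"] by blast

lemma eord_mult: "eord F (dn F (s*t)) = eord F (dn F s)+eord F (dn F t)"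
 by (simp add: eord_def integral_iff vmult)

lemma eord_nm: "eord F (dn F s) <= eord F (dn F t) <-> nmF F t <= nmF F s"
 by (simp add: eord_le nmF_def)

lemma Min_iff:
 fixes d :: nat
 assumes d: "d >= 1"
 shows "eord F (dn F s) <= Min ((%i. eord F (dn F (u i))) ` {1..d})+eord F (natF F N) <->
  (ALL i:{1..d}. nmF F (of_nat N)*nmF F (u i) <= nmF F s)"
proof -
 let ?S = "(%i. eord F (dn F (u i))) ` {1..d}"
 have f: "finite ?S" "?S ~= {}" using d by auto
 have "eord F (dn F s) <= Min ?S+eord F (natF F N) <-> (ALL a:?S. eord F (dn F s) <= a+eord F (natF F N))"
  using Min_in[OF f] Min_le[OF f(1)] by (meson add_right_mono order_trans)
 also have "... <-> (ALL i:{1..d}. eord F (dn F s) <= eord F (dn F (u i * of_nat N)))" unfolding eord_mult by simp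
 also have "... <-> (ALL i:{1..d}. nmF F (of_nat N)*nmF F (u i) <= nmF F s)" unfolding eord_nm by (simp add: V.nm_mult mult.commute)
 finally show ?thesis .
qed

lemma add_pow_dn: "add_pow F n (dn F t) = dn F (of_nat n*t)"
proof (induction n)
 case (Suc n)
 have "add_pow F (Suc n) (dn F t) = add_pow F n (dn F t) \<oplus> dn F t" by (simp add: add_pow_def)
 also have "... = dn F (of_nat n*t+t)" unfolding Suc by (simp only: dns)
 finally show ?case by (simp only: of_nat_Suc distrib_right mult_1_left add.commute)
qed (simp add: add_pow_def)

text \<open>Field elements are written as components of ring elements and cosets as
  \<open>rl\<close>-classes. The lift in \<open>RV_{N^2}\<close> becomes an element
  \<open>x1\<close> in the class of \<open>x0\<close>; replacing \<open>x1\<close> by the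
  representative chosen by \<open>rep\<close> changes its powers only within
  \<open>RV_{N^2}\<close>.\<close>

lemma rP_dn:
 assumes N: "N >= 1" and len: "length zs = Suc d" and d: "d >= 1"
  and zs: "!!i. i <= d ==> zs ! i = rv F (N^2) (dn F (aa i))"
 shows "rP F N (rv F N (dn F x)) zs <-> nmF F x ~= 0 &
  (ALL i:{1..d}. nmF F (of_nat N)*nmF F (aa i*x^(i-1)) <= nmF F (SUM i:{1..d}. of_nat i*(aa i*x^(i-1)))) &
  (nmF F (SUM i:{0..d}. aa i*x^i) < nmF F x*nmF F (of_nat N)*nmF F (SUM i:{1..d}. of_nat i*(aa i*x^(i-1))) \<or>
   (ALL i<=d. nmF F (aa i) = 0))"
proof -
 have N2: "N^2 >= 1" "N dvd N^2" using N by auto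
 obtain x0 where x0: "rep (rv F N (dn F x)) = dn F x0" "V.rl N x0 x" using rep_rv[OF N] by blast
 have nz: "rv F N (dn F x) ~= {\<zero>} <-> nmF F x ~= 0"
  using rv_iff[OF N, of x x] N by (cases "nmF F x = 0") (auto simp: rv_def nmF_eq0)
 define Ph where "Ph a <->
   (ALL y. (ALL i:{1..d}. y i:rv F N (add_pow F i (a i) \<otimes> dn F x0 [^] (i-1))) -->
    eord F (finsum F y {1..d}) <= Min ((%i. eord F (a i \<otimes> dn F x0 [^] (i-1))) ` {1..d})+eord F (natF F N)) &
   (EX xit:RVs F (N^2). rv F N (rep xit) = rv F N (dn F x) &
    (EX y. (ALL i:{0..d}. y i:rv F (N^2) (a i \<otimes> rep xit [^] i)) & finsum F y {0..d} = \<zero>))" for a :: "nat => 'b"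
 define PS where "PS a <->
   (ALL y. (ALL i:{1..d}. V.rl N (y i) (of_nat i*(a i*x0^(i-1)))) -->
     (ALL i:{1..d}. nmF F (of_nat N)*nmF F (a i*x0^(i-1)) <= nmF F (SUM i:{1..d}. y i))) &
   (EX x1. V.rl N x1 x0 & (EX y. (ALL i:{0..d}. V.rl (N^2) (y i) (a i*x1^i)) & nmF F (SUM i:{0..d}. y i) = 0))" for a
 have tr: "Ph a <-> PS a'" if a: "!!i. i <= d ==> a i = dn F (a' i)" for a a'
 proof -
  have 1: "add_pow F i (a i) \<otimes> dn F x0 [^] (i-1) = dn F (of_nat i*(a' i*x0^(i-1)))" if "i:{1..d}" for i
  proof -
   have "add_pow F i (a i) \<otimes> dn F x0 [^] (i-1) = dn F (of_nat i*a' i*x0^(i-1))"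
    using that by (simp only: a add_pow_dn dns dn_power atLeastAtMost_iff)
   thus ?thesis by (simp only: mult.assoc)
  qed
  have 2: "(%i. eord F (a i \<otimes> dn F x0 [^] (i-1))) ` {1..d} = (%i. eord F (dn F (a' i*x0^(i-1)))) ` {1..d}"
   by (rule image_cong) (auto simp: a)
  have A: "(ALL y. (ALL i:{1..d}. y i:rv F N (add_pow F i (a i) \<otimes> dn F x0 [^] (i-1))) -->
    eord F (finsum F y {1..d}) <= Min ((%i. eord F (a i \<otimes> dn F x0 [^] (i-1))) ` {1..d})+eord F (natF F N)) <->
   (ALL y. (ALL i:{1..d}. V.rl N (y i) (of_nat i*(a' i*x0^(i-1)))) -->
     (ALL i:{1..d}. nmF F (of_nat N)*nmF F (a' i*x0^(i-1)) <= nmF F (SUM i:{1..d}. y i)))"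
  proof -
   have 3: "(ALL i:{1..d}. y i:rv F N (add_pow F i (a i) \<otimes> dn F x0 [^] (i-1))) <->
    (ALL i:{1..d}. y i:rv F N (dn F (of_nat i*(a' i*x0^(i-1)))))" for y
    by (rule ball_cong[OF refl]) (simp only: 1)
   show ?thesis unfolding 2 3 Min_iff[OF d, symmetric] by (rule all_sum[OF N])
  qed
  have B: "(EX y. (ALL i:{0..d}. y i:rv F (N^2) (a i \<otimes> dn F x1 [^] i)) & finsum F y {0..d} = \<zero>) <->
   (EX y. (ALL i:{0..d}. V.rl (N^2) (y i) (a' i*x1^i)) & nmF F (SUM i:{0..d}. y i) = 0)" for x1
  proof -
   have "a i \<otimes> dn F x1 [^] i = dn F (a' i*x1^i)" if "i:{0..d}" for i using that by (simp add: a)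
   hence "(ALL i:{0..d}. y i:rv F (N^2) (a i \<otimes> dn F x1 [^] i)) <->
    (ALL i:{0..d}. y i:rv F (N^2) (dn F (a' i*x1^i)))" for y
    by (intro ball_cong[OF refl]) (simp only:)
   thus ?thesis unfolding nmF_eq0 by (simp only:) (rule ex_sum[OF N2(1)])
  qed
  have C: "(EX xit:RVs F (N^2). rv F N (rep xit) = rv F N (dn F x) &
    (EX y. (ALL i:{0..d}. y i:rv F (N^2) (a i \<otimes> rep xit [^] i)) & finsum F y {0..d} = \<zero>)) <->
   (EX x1. V.rl N x1 x0 & (EX y. (ALL i:{0..d}. V.rl (N^2) (y i) (a' i*x1^i)) & nmF F (SUM i:{0..d}. y i) = 0))" (is "?L <-> ?R")
  proof
   assume ?L
   then obtain xit where xi: "xit:RVs F (N^2)" "rv F N (rep xit) = rv F N (dn F x)"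
    "EX y. (ALL i:{0..d}. y i:rv F (N^2) (a i \<otimes> rep xit [^] i)) & finsum F y {0..d} = \<zero>" by blast
   obtain w where w: "xit = rv F (N^2) (dn F w)" using xi(1) carrier_dn unfolding RVs_def by blast
   obtain x1 where x1: "rep xit = dn F x1" using rep_rv[OF N2(1)] w by metis
   have "V.rl N x1 x" using xi(2) unfolding x1 rv_eq[OF N] .
   hence "V.rl N x1 x0" using V.rl_sym[OF x0(2)] by (rule V.rl_trans)
   thus ?R using xi(3) unfolding x1 B by blast
  next
   assume ?R
   then obtain x1 y where x1: "V.rl N x1 x0" and y: "ALL i:{0..d}. V.rl (N^2) (y i) (a' i*x1^i)" "nmF F (SUM i:{0..d}. y i) = 0" by blast
   obtain x2 where x2: "rep (rv F (N^2) (dn F x1)) = dn F x2" "V.rl (N^2) x2 x1" using rep_rv[OF N2(1)] by blast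
   have "V.rl N x2 x" using V.rl_dvd[OF x2(2) N2(2)] V.rl_trans[OF x1 x0(2)] by (rule V.rl_trans)
   hence "rv F N (rep (rv F (N^2) (dn F x1))) = rv F N (dn F x)" unfolding x2(1) rv_eq[OF N] .
   moreover have "ALL i:{0..d}. V.rl (N^2) (y i) (a' i*x2^i)"
    using y(1) N2(1) V.rl_sym[OF x2(2)] by (auto intro!: V.rl_trans[OF bspec[OF y(1)]] V.rl_mult V.rl_power)
   hence "EX y. (ALL i:{0..d}. y i:rv F (N^2) (a i \<otimes> rep (rv F (N^2) (dn F x1)) [^] i)) & finsum F y {0..d} = \<zero>"
    unfolding x2(1) B using y(2) by blast
   moreover have "rv F (N^2) (dn F x1):RVs F (N^2)" by (simp add: RVs_def)
   ultimately show ?L by blast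
  qed
  show ?thesis unfolding Ph_def PS_def A C ..
 qed
 have Z: "(ALL i<Suc d. a i:carrier F & a i:zs ! i) <-> (ALL i<=d. a i:carrier F & a i:rv F (N^2) (dn F (aa i)))" for a
  using zs by (auto simp: less_Suc_eq_le)
 have "rP F N (rv F N (dn F x)) zs <-> nmF F x ~= 0 & (EX a. (ALL i<=d. a i:carrier F & a i:rv F (N^2) (dn F (aa i))) & Ph a)"
  by (simp only: rP_def nz len x0(1) Let_def diff_Suc_1 Z Ph_def)
 also have "(EX a. (ALL i<=d. a i:carrier F & a i:rv F (N^2) (dn F (aa i))) & Ph a) <->
  (EX a'. (ALL i<=d. V.rl (N^2) (a' i) (aa i)) & PS a')"
 proof
  assume "EX a. (ALL i<=d. a i:carrier F & a i:rv F (N^2) (dn F (aa i))) & Ph a"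
  then obtain a where a: "!!i. i <= d ==> a i:carrier F" "!!i. i <= d ==> a i:rv F (N^2) (dn F (aa i))" "Ph a" by blast
  have e: "a i = dn F (upl F (a i))" if "i <= d" for i using a(1)[OF that] by simp
  have 1: "V.rl (N^2) (upl F (a i)) (aa i)" if "i <= d" for i using a(2)[OF that] e[OF that] rv_iff[OF N2(1)] by metis
  show "EX a'. (ALL i<=d. V.rl (N^2) (a' i) (aa i)) & PS a'"
   by (intro exI[of _ "%i. upl F (a i)"] conjI allI impI 1 iffD1[OF tr[OF e] a(3)])
 next
  assume "EX a'. (ALL i<=d. V.rl (N^2) (a' i) (aa i)) & PS a'"
  then obtain a' where a: "!!i. i <= d ==> V.rl (N^2) (a' i) (aa i)" "PS a'" by blast
  have "Ph (%i. dn F (a' i))" using iffD2[OF tr[OF refl] a(2)] .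
  thus "EX a. (ALL i<=d. a i:carrier F & a i:rv F (N^2) (dn F (aa i))) & Ph a"
   using a(1) rv_iff[OF N2(1)] by (intro exI[of _ "%i. dn F (a' i)"]) simp
 qed
 also have "nmF F x ~= 0 & ... <-> nmF F x ~= 0 &
  (ALL i:{1..d}. nmF F (of_nat N)*nmF F (aa i*x^(i-1)) <= nmF F (SUM i:{1..d}. of_nat i*(aa i*x^(i-1)))) &
  (nmF F (SUM i:{0..d}. aa i*x^i) < nmF F x*nmF F (of_nat N)*nmF F (SUM i:{1..d}. of_nat i*(aa i*x^(i-1))) \<or>
   (ALL i<=d. nmF F (aa i) = 0))"
 proof (cases "nmF F x = 0")
  case False
  show ?thesis unfolding PS_def by (rule conj_cong[OF refl])
   (rule V.rP_iff[OF N d x0(2) False, of aa, unfolded V.DD_def[OF N d x0(2) False]])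
 qed simp
 finally show ?thesis .
qed

lemma roplus_dn:
 assumes N: "N >= 1"
 shows "roplus F (rv F N (dn F a1)) (rv F N (dn F a2)) (rv F N (dn F a3)) <->
  (nmF F a1 = 0 & nmF F a2 = 0 & nmF F a3 = 0) \<or> (EX a:{a1, a2, a3}. nmF F (a1+a2-a3) < nmF F (of_nat N)*nmF F a)"
 unfolding V.roplus_iff[OF N, symmetric]
proof
 assume "roplus F (rv F N (dn F a1)) (rv F N (dn F a2)) (rv F N (dn F a3))"
 then obtain x1 x2 x3 where x: "x1:rv F N (dn F a1)" "x2:rv F N (dn F a2)" "x3:rv F N (dn F a3)" "x1 \<oplus> x2 = x3"
  unfolding roplus_def by blast
 have c: "x1:carrier F" "x2:carrier F" using subsetD[OF rv_carrier x(1)] subsetD[OF rv_carrier x(2)] .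
 hence d: "dn F (upl F x1) = x1" "dn F (upl F x2) = x2" "dn F (upl F x1+upl F x2) = x3" using x(4) by simp_all
 have "V.rl N (upl F x1) a1" "V.rl N (upl F x2) a2" "V.rl N (upl F x1+upl F x2) a3"
  using rv_iff[OF N, of "upl F x1" a1] rv_iff[OF N, of "upl F x2" a2] rv_iff[OF N, of "upl F x1+upl F x2" a3] x(1-3)
  by (simp_all only: d)
 thus "EX x1 x2 x3. V.rl N x1 a1 & V.rl N x2 a2 & V.rl N x3 a3 & nmF F (x1+x2-x3) = 0" by (metis V.nm_zero diff_self)
next
 assume "EX x1 x2 x3. V.rl N x1 a1 & V.rl N x2 a2 & V.rl N x3 a3 & nmF F (x1+x2-x3) = 0"
 then obtain x1 x2 x3 where x: "V.rl N x1 a1" "V.rl N x2 a2" "V.rl N x3 a3" "nmF F (x1+x2-x3) = 0" by blast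
 have "dn F x1 \<oplus> dn F x2 = dn F x3" using x(4) by (simp add: nmF_eq0 diff_eq0)
 thus "roplus F (rv F N (dn F a1)) (rv F N (dn F a2)) (rv F N (dn F a3))"
  unfolding roplus_def using x(1-3) rv_iff[OF N] by blast
qed

lemma nm_le0 [simp]: "nmF F t <= 0 <-> nmF F t = 0" using V.nm_ge0[of t] by linarith

lemma vval_ev: "vconsts t <= {p. c p = dn F (ka p)} ==> vval F c (%i. dn F (z i)) t = dn F (ev ka z t)"
 by (induction t) auto

lemma osat_oev: "oconsts f <= {p. c p = dn F (ka p)} ==> osat F c (%i. dn F (z i)) f <-> oev (nmF F) ka z f"
 by (induction f) (simp_all add: vval_ev[where ka = ka] eord_nm)

context
 fixes c :: "'p => 'b" and ka :: "'p => 'b lfring" and z :: "nat => 'b lfring" and n :: nat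
  and rh :: "nat => 'b" and gs :: "nat \<times> nat => 'b set"
 assumes rh: "!!i. rh i = dn F (z (vcode n i))" and gs: "!!N i. 1 <= N ==> gs (N, i) = rv F N (dn F (z (rcode n N i)))"
begin

lemma vval_trv: "vconsts t <= {p. c p = dn F (ka p)} ==> vval F c rh t = dn F (ev ka z (trv n t))"
 by (induction t) (auto simp: rh)

lemma rval_ev:
 "rwf r ==> rconsts r <= {p. c p = dn F (ka p)} ==> rval F c rh gs r = rv F (rsort r) (dn F (ev ka z (trr n r)))"
proof (induction r)
 case (RMul a b)
 have N: "rsort a >= 1" using RMul.prems(1) by (induction a) auto
 have ab: "rval F c rh gs a = rv F (rsort a) (dn F (ev ka z (trr n a)))" "rval F c rh gs b = rv F (rsort a) (dn F (ev ka z (trr n b)))"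
  using RMul by auto
 obtain a' where a': "rep (rv F (rsort a) (dn F (ev ka z (trr n a)))) = dn F a'" "V.rl (rsort a) a' (ev ka z (trr n a))"
  using rep_rv[OF N] by blast
 obtain b' where b': "rep (rv F (rsort a) (dn F (ev ka z (trr n b)))) = dn F b'" "V.rl (rsort a) b' (ev ka z (trr n b))"
  using rep_rv[OF N] by blast
 have "rv F (rsort a) (dn F (a'*b')) = rv F (rsort a) (dn F (ev ka z (trr n a)*ev ka z (trr n b)))"
  unfolding rv_eq[OF N] by (rule V.rl_mult[OF a'(2) b'(2)])
 thus ?case by (simp add: ab a'(1) b'(1))
next
 case (RProj N r)
 have N: "N >= 1" "N dvd rsort r" "rsort r >= 1" using RProj.prems(1) by (auto, induction r, auto)
 have r: "rval F c rh gs r = rv F (rsort r) (dn F (ev ka z (trr n r)))" using RProj by auto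
 obtain r' where r': "rep (rv F (rsort r) (dn F (ev ka z (trr n r)))) = dn F r'" "V.rl (rsort r) r' (ev ka z (trr n r))"
  using rep_rv[OF N(3)] by blast
 show ?case using rv_eq[OF N(1)] V.rl_dvd[OF r'(2) N(2)] by (simp add: r r'(1))
qed (auto simp: gs vval_trv)

lemma rwf_sort: "rwf r ==> rsort r >= 1" by (induction r) auto

lemma sat_oev:
 "qwf f ==> qconsts f <= {p. c p = dn F (ka p)} ==> sat F c rh gs f <-> oev (nmF F) ka z (trq n f)"
proof (induction f)
 case (VEq s t)
 have "oev (nmF F) ka z (trq n (VEq s t)) <-> dn F (ev ka z (trv n s)) = dn F (ev ka z (trv n t))"
  by (simp add: nmF_eq0) (simp add: a_minus_def[symmetric] diff_eq0)
 thus ?case using VEq by (simp add: vval_trv)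
next
 case (REq a b)
 hence N: "rsort a >= 1" using rwf_sort[of a] by simp
 show ?case using REq rv_eq[OF N] by (simp add: rval_ev Orl_def V.rl_def V.nm_mult not_le)
next
 case (RDvd a b)
 hence N: "rsort a >= 1" using rwf_sort[of a] by simp
 obtain a' where a': "rep (rv F (rsort a) (dn F (ev ka z (trr n a)))) = dn F a'" "V.rl (rsort a) a' (ev ka z (trr n a))"
  using rep_rv[OF N] by blast
 obtain b' where b': "rep (rv F (rsort a) (dn F (ev ka z (trr n b)))) = dn F b'" "V.rl (rsort a) b' (ev ka z (trr n b))"
  using rep_rv[OF N] by blast
 have "sat F c rh gs (RDvd a b) <-> eord F (dn F a') <= eord F (dn F b')"
  using RDvd a'(1) b'(1) by (simp add: rval_ev rdvd_def)
 thus ?case unfolding eord_nm V.rl_nm[OF a'(2)] V.rl_nm[OF b'(2)] by simp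
next
 case (ROplus a b d)
 hence N: "rsort a >= 1" using rwf_sort[of a] by simp
 have "sat F c rh gs (ROplus a b d) <-> roplus F (rv F (rsort a) (dn F (ev ka z (trr n a))))
   (rv F (rsort a) (dn F (ev ka z (trr n b)))) (rv F (rsort a) (dn F (ev ka z (trr n d))))"
  using ROplus by (simp add: rval_ev)
 also have "... <-> oev (nmF F) ka z (Oplus (rsort a) (trr n a) (trr n b) (trr n d))"
  unfolding roplus_dn[OF N] by (simp add: Oplus_def V.nm_mult not_le) blast
 finally show ?case by simp
next
 case (RP N x zs)
 define d where "d = length zs-1"
 have len: "length zs = Suc d" "d >= 1" "N >= 1" using RP.prems(1) by (auto simp: d_def)
 have zi: "map (rval F c rh gs) zs ! i = rv F (N^2) (dn F (ev ka z (trr n (zs ! i))))" if "i <= d" for i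
 proof -
  have "zs ! i:set zs" using that len by simp
  hence "rwf (zs ! i)" "rsort (zs ! i) = N^2" "rconsts (zs ! i) <= {p. c p = dn F (ka p)}" using RP.prems by auto
  thus ?thesis using rval_ev[of "zs ! i"] that len by simp
 qed
 let ?X = "ev ka z (trr n x)" and ?a = "%i. ev ka z (trr n (zs ! i))"
 have nth: "ev ka z (map (trr n) zs ! i) = ?a i" if "i <= d" for i using that len by simp
 have slope: "ev ka z (slopet d (trr n x) (map (trr n) zs)) = (SUM i:{1..d}. of_nat i*(?a i*?X^(i-1)))"
  by (subst ev_slopet) (use len nth in "auto intro!: sum.cong")
 have "ev ka z (sumt (map (%i. VMul (map (trr n) zs ! i) (powt (trr n x) i)) [0..<Suc d])) = sum (%i. ev ka z (map (trr n) zs ! i)*?X^i) {0..d}"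
  by (simp add: o_def interv_sum_list_conv_sum_set_nat atLeastLessThanSuc_atLeastAtMost del: upt_Suc)
 also have "... = (SUM i:{0..d}. ?a i*?X^i)" by (rule sum.cong) (use nth in auto)
 finally have val: "ev ka z (sumt (map (%i. VMul (map (trr n) zs ! i) (powt (trr n x) i)) [0..<Suc d])) = (SUM i:{0..d}. ?a i*?X^i)" .
 have "oev (nmF F) ka z (trq n (RP N x zs)) <-> nmF F ?X ~= 0 &
  (ALL i:{1..d}. nmF F (of_nat N)*nmF F (?a i*?X^(i-1)) <= nmF F (SUM i:{1..d}. of_nat i*(?a i*?X^(i-1)))) &
  (nmF F (SUM i:{0..d}. ?a i*?X^i) < nmF F ?X*nmF F (of_nat N)*nmF F (SUM i:{1..d}. of_nat i*(?a i*?X^(i-1))) \<or>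
   (ALL i<=d. nmF F (?a i) = 0))"
  unfolding trq.simps d_def[symmetric] ORP_def oev.simps ev.simps slope val oev_OAll V.nm_mult[symmetric] ev_natt
  by (simp add: nth slope V.nm_mult[symmetric] not_le less_Suc_eq_le atLeastLessThanSuc_atLeastAtMost cong: ball_cong_simp del: upt_Suc)
   (simp add: Ball_def)
 moreover have "sat F c rh gs (RP N x zs) <-> rP F N (rv F N (dn F ?X)) (map (rval F c rh gs) zs)"
  using RP.prems by (simp add: rval_ev)
 moreover note rP_dn[OF len(3) _ len(2) zi, of ?X, unfolded length_map, OF len(1)]
 ultimately show ?case by simp
qed simp_all

end

end

section \<open>Embeddings of local fields\<close>

text \<open>All that is used of a finite extension: a field embedding preserving and reflecting the
  valuation ring.\<close>

definition vemb :: "'a vfield => 'b vfield => ('a => 'b) => bool" where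
 "vemb K L e <-> e:ring_hom K L & (ALL x:carrier K. x ~= \<zero>\<^bsub>K\<^esub> --> (0 <= vord K x <-> 0 <= vord L (e x)))"

locale emb = K: lf K + L: lf L for K :: "'a vfield" and L :: "'b vfield" +
 fixes e :: "'a => 'b"
 assumes vemb: "vemb K L e"
begin

sublocale E: ring_hom_cring K L e
 by unfold_locales (use vemb in "simp add: vemb_def")

lemma e_zero: assumes "x:carrier K" shows "e x = \<zero>\<^bsub>L\<^esub> <-> x = \<zero>\<^bsub>K\<^esub>"
proof
 assume "e x = \<zero>\<^bsub>L\<^esub>"
 show "x = \<zero>\<^bsub>K\<^esub>"
 proof (rule ccontr)
  assume "x ~= \<zero>\<^bsub>K\<^esub>"
  hence u: "x:Units K" using assms by (simp add: K.field_Units)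
  hence "e (x \<otimes>\<^bsub>K\<^esub> inv\<^bsub>K\<^esub> x) = \<zero>\<^bsub>L\<^esub>" using `e x = \<zero>\<^bsub>L\<^esub>` assms by (subst E.hom_mult) auto
  thus False using u by simp
 qed
qed simp

definition "ram = vord L (e (unif K))"

text \<open>A unit and its inverse are both integral, and their images are too, so units are mapped
  to elements of order 0. Powers of the uniformizer account for the rest.\<close>

lemma vord_e: assumes x: "x:carrier K" "x ~= \<zero>\<^bsub>K\<^esub>" shows "vord L (e x) = ram * vord K x"
proof -
 let ?n = "vord K x" and ?p = "%n::int. unif K [^]\<^bsub>units_of K\<^esub> n"
 have p: "?p n:carrier K" "?p n ~= \<zero>\<^bsub>K\<^esub>" "vord K (?p n) = n" for n using K.unif_pow(1,2) by auto
 have vm: "vord L (e (a \<otimes>\<^bsub>K\<^esub> b)) = vord L (e a) + vord L (e b)"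
  if "a:carrier K" "b:carrier K" "a ~= \<zero>\<^bsub>K\<^esub>" "b ~= \<zero>\<^bsub>K\<^esub>" for a b
  using that by (simp add: L.vmult e_zero)
 have z: "vord L (e u) = 0" if u: "u:carrier K" "u ~= \<zero>\<^bsub>K\<^esub>" "vord K u = 0" for u
 proof -
  have U: "u:Units K" using u by (simp add: K.field_Units)
  have i: "inv\<^bsub>K\<^esub> u:carrier K" "inv\<^bsub>K\<^esub> u ~= \<zero>\<^bsub>K\<^esub>" using U K.Units_inv_Units[OF U] K.field_Units by auto
  have "vord K (u \<otimes>\<^bsub>K\<^esub> inv\<^bsub>K\<^esub> u) = 0" "vord L (e (u \<otimes>\<^bsub>K\<^esub> inv\<^bsub>K\<^esub> u)) = 0" using U K.vone L.vone by simp_all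
  hence "vord K (inv\<^bsub>K\<^esub> u) = 0" "vord L (e u) + vord L (e (inv\<^bsub>K\<^esub> u)) = 0" using K.vmult[OF u(1) i(1) u(2) i(2)] vm[OF u(1) i(1) u(2) i(2)] u(3) by simp_all
  moreover have "0 <= vord L (e u)" "0 <= vord L (e (inv\<^bsub>K\<^esub> u))" using vemb u i calculation(1) by (auto simp: vemb_def)
  ultimately show ?thesis by simp
 qed
 have m: "vord L (e (?p (a+b))) = vord L (e (?p a)) + vord L (e (?p b))" for a b
  unfolding K.unif_pow(3) by (rule vm) (use p in auto)
 have "vord L (e (?p n)) = ram*n" for n
 proof -
  interpret U: group "units_of K" by (rule K.units_group)
  have "unif K:carrier (units_of K)" using K.unif by (simp add: units_of_carrier K.field_Units)
  hence 1: "vord L (e (?p 1)) = ram" by (simp add: ram_def)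
  show ?thesis
  proof (induction n rule: int_induct[of _ 0])
   case base show ?case using m[of 0 0] by simp
  next
   case (step1 i) thus ?case using m[of i 1] 1 by (simp add: algebra_simps)
  next
   case (step2 i) thus ?case using m[of "i-1" 1] 1 by (simp add: algebra_simps)
  qed
 qed
 moreover have "vord L (e x) + vord L (e (?p (- ?n))) = 0"
  using vm[OF x(1) p(1) x(2) p(2)] z[of "x \<otimes>\<^bsub>K\<^esub> ?p (- ?n)"] x p K.vmult[OF x(1) p(1) x(2) p(2)] by (simp add: K.integral_iff)
 ultimately show ?thesis by simp
qed

lemma ram_pos: "ram > 0"
proof -
 let ?p = "unif K [^]\<^bsub>units_of K\<^esub> (- 1 :: int)"
 have p: "?p:carrier K" "?p ~= \<zero>\<^bsub>K\<^esub>" "vord K ?p = - 1" using K.unif_pow(1,2)[of "- 1"] by auto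
 have "~ 0 <= vord L (e ?p)" using vemb p unfolding vemb_def by (metis neg_0_le_iff_le not_one_le_zero)
 thus ?thesis unfolding vord_e[OF p(1,2)] p(3) by simp
qed

lemma eord_e: assumes "x:carrier K" "y:carrier K" shows "eord L (e x) <= eord L (e y) <-> eord K x <= eord K y"
 using assms ram_pos by (auto simp: eord_def e_zero vord_e)

lemma vval_e:
 assumes "!!i. rh i:carrier K" "vconsts t <= {p. c p:carrier K}"
 shows "vval K c rh t:carrier K & vval L (%p. e (c p)) (%i. e (rh i)) t = e (vval K c rh t)"
 using assms(2) by (induction t) (auto simp: assms(1))

lemma osat_e:
 assumes "!!i. rh i:carrier K"
 shows "oconsts f <= {p. c p:carrier K} ==> osat L (%p. e (c p)) (%i. e (rh i)) f <-> osat K c rh f"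
 by (induction f) (simp_all add: vval_e[OF assms] eord_e)

end

section \<open>Definable sets through order formulas, and copies of a field carried by the
  reals\<close>

context lf
begin

text \<open>An existential quantifier over \<open>RV_N\<close> is one over the field, since every
  class has a representative and the translated formula depends only on the class.\<close>

lemma dset_iff:
 assumes ph: "qwf ph" "qconsts ph <= {p. c p:carrier F}" and x: "x:{..<n} \<rightarrow>\<^sub>E carrier F"
 shows "x:dset F c n ph <-> (EX rh. (ALL i. rh i:carrier F) & (ALL i<n. rh i = x i) & osat F c rh (trq n ph))" (is "_ = ?A")
proof -
 define ka where "ka p = upl F (c p)" for p
 have ka: "qconsts ph <= {p. c p = dn F (ka p)}" "oconsts (trq n ph) <= {p. c p = dn F (ka p)}"
  using ph trq_consts[OF ph(1), of n] by (auto simp: ka_def)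
 show ?thesis
 proof
  assume "x:dset F c n ph"
  then obtain rh gs where rh: "!!i. rh i:carrier F" "!!i. i < n ==> rh i = x i" and gs: "!!N i. 1 <= N ==> gs (N, i):RVs F N"
   and s: "sat F c rh gs ph" unfolding dset_def by blast
  \<comment> \<open>This decodes \<open>vcode\<close> and \<open>rcode\<close>: from position
    \<open>n\<close> on, even offsets hold the field variables and odd offsets the representatives
    of the \<open>RV\<close> variables.\<close>
  define z where "z j = upl F (if j < n then rh j else if even (j-n) then rh ((j-n) div 2) else rep (gs (prod_decode ((j-n) div 2))))" for j
  have 1: "rh i = dn F (z (vcode n i))" for i using rh(1) by (simp add: z_def vcode_def)
  have 2: "gs (N, i) = rv F N (dn F (z (rcode n N i)))" if N: "1 <= N" for N i
  proof -
   obtain s where s: "gs (N, i) = rv F N (dn F s)" using gs[OF N, of i] carrier_dn unfolding RVs_def by blast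
   obtain s' where s': "rep (gs (N, i)) = dn F s'" "V.rl N s' s" using rep_rv[OF N, of s] s by metis
   have "dn F (z (rcode n N i)) = dn F s'" using s' by (simp add: z_def rcode_def)
   thus ?thesis using s'(2) unfolding s rv_eq[OF N, symmetric] by simp
  qed
  have "osat F c (%i. dn F (z i)) (trq n ph)"
   using s sat_oev[where c = c and ka = ka and z = z and n = n and rh = rh and gs = gs, OF 1 2 ph(1) ka(1)]
    osat_oev[OF ka(2)] by blast
  moreover have "dn F (z i) = x i" if "i < n" for i using 1[of i] rh(2)[OF that] that by (simp add: vcode_def)
  ultimately show ?A
   by (intro exI[of _ "%i. dn F (z i)"]) simp
 next
  assume ?A
  then obtain rh0 where rh0: "!!i. rh0 i:carrier F" "!!i. i < n ==> rh0 i = x i" "osat F c rh0 (trq n ph)" by blast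
  define z where "z i = upl F (rh0 i)" for i
  define rh gs where "rh i = dn F (z (vcode n i))" and "gs = (%(N, i). rv F N (dn F (z (rcode n N i))))" for i
  have 1: "rh i = dn F (z (vcode n i))" "1 <= N ==> gs (N, i) = rv F N (dn F (z (rcode n N i)))" for i N by (simp_all add: rh_def gs_def)
  have "(%i. dn F (z i)) = rh0" using rh0(1) by (simp add: z_def fun_eq_iff)
  hence "sat F c rh gs ph"
   using rh0(3) sat_oev[where c = c and ka = ka and z = z and n = n and rh = rh and gs = gs, OF 1 ph(1) ka(1)]
    osat_oev[OF ka(2), of z] by simp
  moreover have "ALL i<n. rh i = x i" using rh0(1) unfolding rh_def z_def vcode_def by (simp add: rh0(2)[symmetric])
  moreover have "rh i:carrier F" "gs (N, i):RVs F N" for i N by (simp_all add: rh_def gs_def RVs_def)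
  ultimately show "x:dset F c n ph" using x unfolding dset_def by blast
 qed
qed

text \<open>An element is determined by the balls around points of a countable dense set that
  contain it, hence by a set of natural numbers, and such sets embed into the reals. Thus every
  local field has a copy to which hypotheses about fields carried by \<open>real\<close>
  apply.\<close>

lemma inj_real: "EX g::'b => real. inj_on g (carrier F)"
proof -
 obtain D where D: "countable D" "!!x n. EX d:D. nmF F (x-d) <= q powi n" using V.dense_countable by blast
 obtain i :: "nat set => real" where i: "inj i" using nat_sets_eqpoll_reals unfolding eqpoll_def bij_betw_def by blast
 define S where "S x = {prod_encode (to_nat_on D d, to_nat n) | d n. d:D & nmF F (upl F x-d) <= q powi n}" for x
 have "x = y" if xy: "x:carrier F" "y:carrier F" "S x = S y" for x y
 proof -
  have "nmF F (upl F x-upl F y) <= q powi n" for n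
  proof -
   obtain d where d: "d:D" "nmF F (upl F x-d) <= q powi n" using D(2) by blast
   hence "prod_encode (to_nat_on D d, to_nat n):S y" using xy(3) unfolding S_def by blast
   hence "nmF F (upl F y-d) <= q powi n" using D(1) d(1) by (auto simp: S_def)
   thus ?thesis using d(2) V.nm_diff_trans[of "upl F x" d _ "upl F y"] by (simp add: V.nm_minus_commute)
  qed
  hence "nmF F (upl F x-upl F y) = 0" using V.powi_ex_less V.nm_pos by (metis V.nm_ord V.powi_less diff_add_cancel less_add_one minus_diff_eq not_le)
  thus ?thesis using xy by (simp add: nmF_eq0 diff_eq0)
 qed
 hence "inj_on (%x. i (S x)) (carrier F)" using i by (intro inj_onI) (auto dest: injD)
 thus ?thesis by blast
qed

definition "copy (g :: 'b => 'c) = (let h = inv_into (carrier F) g in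
 \<lparr>carrier = g ` carrier F, monoid.mult = %x y. g (h x \<otimes> h y), one = g \<one>, zero = g \<zero>, add = %x y. g (h x \<oplus> h y), vord = %x. vord F (h x)\<rparr>)"

lemma copy_local_field:
 fixes g :: "'b => 'c"
 assumes g: "inj_on g (carrier F)"
 shows "local_field0 (copy g)" "g:ring_hom F (copy g)" "!!x. x:carrier F ==> vord (copy g) (g x) = vord F x"
  "carrier (copy g) = g ` carrier F"
proof -
 let ?C = "copy g"
 have h: "inv_into (carrier F) g (g x) = x" if "x:carrier F" for x using g that by simp
 have C: "carrier ?C = g ` carrier F" "\<one>\<^bsub>?C\<^esub> = g \<one>" "\<zero>\<^bsub>?C\<^esub> = g \<zero>" by (simp_all add: copy_def Let_def)
 have V: "vord ?C (g x) = vord F x" if "x:carrier F" for x by (simp add: copy_def Let_def h that)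
 have O: "g x \<otimes>\<^bsub>?C\<^esub> g y = g (x \<otimes> y)" "g x \<oplus>\<^bsub>?C\<^esub> g y = g (x \<oplus> y)" if "x:carrier F" "y:carrier F" for x y
  by (simp_all add: copy_def Let_def h that)
 have hom: "g:ring_hom F ?C" by (rule ring_hom_memI) (simp_all add: C O)
 have "g:ring_iso F ?C" unfolding ring_iso_def using hom g by (simp add: C bij_betw_def)
 from ring_iso_imp_img_field[OF this] have "field (?C\<lparr>zero := g \<zero>\<rparr>)" .
 moreover have "?C\<lparr>zero := g \<zero>\<rparr> = ?C" by (simp add: copy_def Let_def)
 ultimately have fC: "field ?C" by simp
 interpret C: field ?C by (rule fC)
 interpret G: ring_hom_cring F ?C g by unfold_locales (rule hom)
 have z: "g x = \<zero>\<^bsub>?C\<^esub> <-> x = \<zero>" if "x:carrier F" for x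
  unfolding C(3) using inj_onD[OF g _ that zero_closed] by blast
 have mi: "g x \<ominus>\<^bsub>?C\<^esub> g y = g (x \<ominus> y)" if "x:carrier F" "y:carrier F" for x y
  unfolding a_minus_def using that by (simp only: G.hom_add G.hom_a_inv a_inv_closed)
 have eo: "eord ?C (g x) = eord F x" if "x:carrier F" for x unfolding eord_def z[OF that] V[OF that] ..
 have val: "valued_field ?C" unfolding valued_field_def C(1)
 proof (intro conjI ballI impI allI; (elim imageE)?)
  fix x y a b assume x: "x = g a" and a: "a:carrier F" and y: "y = g b" and b: "b:carrier F" and nz: "x ~= \<zero>\<^bsub>?C\<^esub>" "y ~= \<zero>\<^bsub>?C\<^esub>"
  have nz': "a ~= \<zero>" "b ~= \<zero>" using nz z[OF a] z[OF b] unfolding x y by blast+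
  show "vord ?C (x \<otimes>\<^bsub>?C\<^esub> y) = vord ?C x + vord ?C y"
   unfolding x y O(1)[OF a b] V[OF a] V[OF b] V[OF m_closed[OF a b]] by (rule vmult[OF a b nz'])
  assume s: "x \<oplus>\<^bsub>?C\<^esub> y ~= \<zero>\<^bsub>?C\<^esub>"
  have "a \<oplus> b ~= \<zero>" using s unfolding x y O(2)[OF a b] z[OF add.m_closed[OF a b]] .
  thus "min (vord ?C x) (vord ?C y) <= vord ?C (x \<oplus>\<^bsub>?C\<^esub> y)"
   unfolding x y O(2)[OF a b] V[OF a] V[OF b] V[OF add.m_closed[OF a b]] by (rule vadd[OF a b nz'])
 next
  fix n
  obtain x where "x:carrier F" "x ~= \<zero>" "vord F x = n" using vsurj by blast
  thus "EX x:g ` carrier F. x ~= \<zero>\<^bsub>?C\<^esub> & vord ?C x = n"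
   by (intro bexI[of _ "g x"]) (simp_all only: z V not_False_eq_True imageI)
 qed (rule fC)
 have vo: "vO ?C = g ` vO F" "vM ?C = g ` vM F"
 proof -
  have im: "{y:g ` carrier F. R y} = g ` {x:carrier F. R (g x)}" for R by blast
  show "vO ?C = g ` vO F" "vM ?C = g ` vM F" unfolding vO_def vM_def C(1) im by (simp_all only: z V cong: conj_cong)
 qed
 have "res_classes ?C <= (`) g ` res_classes F"
 proof
  fix c assume "c:res_classes ?C"
  then obtain x where x: "x:vO F" "c = {y:g ` vO F. y \<ominus>\<^bsub>?C\<^esub> g x:g ` vM F}" unfolding res_classes_def vo by blast
  have xc: "x:carrier F" using x(1) by (simp add: vO_def)
  have "g y \<ominus>\<^bsub>?C\<^esub> g x:g ` vM F <-> y \<ominus> x:vM F" if "y:vO F" for y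
  proof -
   have "y:carrier F" using that by (simp add: vO_def)
   moreover have "vM F <= carrier F" by (auto simp: vM_def)
   ultimately show ?thesis using xc by (simp add: mi inj_on_image_mem_iff[OF g])
  qed
  hence "c = g ` {y:vO F. y \<ominus> x:vM F}" unfolding x(2) by auto
  thus "c:(`) g ` res_classes F" using x(1) unfolding res_classes_def by blast
 qed
 hence res: "finite (res_classes ?C)" using lf finite_surj unfolding local_field0_def by blast
 have comp: "complete_vf ?C" unfolding complete_vf_def
 proof (intro allI impI)
  fix s :: "nat => 'c"
  assume s: "ALL k. s k:carrier ?C" and cs: "ALL n. EX k0. ALL i>=k0. ALL j>=k0. ereal (real_of_int n) <= eord ?C (s i \<ominus>\<^bsub>?C\<^esub> s j)"
  from s have "ALL k. EX t. t:carrier F & s k = g t" unfolding C(1) by blast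
  then obtain t where t: "!!k. t k:carrier F" "s = (%k. g (t k))" by (metis ext)
  have m: "eord ?C (s i \<ominus>\<^bsub>?C\<^esub> g a) = eord F (t i \<ominus> a)" if "a:carrier F" for i a using t that by (simp add: mi eo)
  have "ALL n. EX k0. ALL i>=k0. ALL j>=k0. ereal (real_of_int n) <= eord F (t i \<ominus> t j)" using cs m[OF t(1)] unfolding t(2) by simp
  then obtain a where "a:carrier F" "ALL n. EX k0. ALL i>=k0. ereal (real_of_int n) <= eord F (t i \<ominus> a)"
   using lf t(1) unfolding local_field0_def complete_vf_def by blast
  thus "EX a:carrier ?C. ALL n. EX k0. ALL i>=k0. ereal (real_of_int n) <= eord ?C (s i \<ominus>\<^bsub>?C\<^esub> a)"
   by (intro bexI[of _ "g a"]) (simp_all add: m C(1))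
 qed
 have nat: "natF ?C n = g (natF F n) & natF F n:carrier F" for n
 proof (induction n)
  case (Suc n)
  have "natF ?C (Suc n) = natF ?C n \<oplus>\<^bsub>?C\<^esub> \<one>\<^bsub>?C\<^esub>" "natF F (Suc n) = natF F n \<oplus> \<one>" by (simp_all add: natF_def add_pow_def)
  thus ?case unfolding C(2) using Suc O(2)[OF _ one_closed, of "natF F n"] by (metis add.m_closed one_closed)
 qed (simp add: natF_def)
 show "local_field0 ?C" unfolding local_field0_def
  using val comp res lf nat z unfolding local_field0_def by metis
 show "g:ring_hom F ?C" "!!x. x:carrier F ==> vord ?C (g x) = vord F x" "carrier ?C = g ` carrier F"
  using hom V C(1) by auto
qed

text \<open>Membership in definable sets reduces by \<open>dset_iff\<close> to order formulas, and
  these are preserved by the transport along \<open>g\<close>; so functionality is pulled back from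
  the copy.\<close>

lemma defines_fun_copy:
 fixes g :: "'b => 'c"
 assumes g: "inj_on g (carrier F)" and df: "defines_fun (copy g) (%p. g (c p)) m ph ps"
  and wf: "qwf ph" "qwf ps" "qconsts ph <= {p. c p:carrier F}" "qconsts ps <= {p. c p:carrier F}"
 shows "defines_fun F c m ph ps"
proof -
 note cp = copy_local_field[OF g]
 interpret C: lf "copy g" by unfold_locales (rule cp(1))
 interpret G: emb F "copy g" g by unfold_locales (use cp in "simp_all add: vemb_def")
 have C: "{p. c p:carrier F} <= {p. g (c p):carrier (copy g)}" using cp(4) by auto
 define G where "G n x = (\<lambda>i\<in>{..<n}. g (x i))" for n :: nat and x
 have d: "x:dset F c n tt <-> G n x:dset (copy g) (%p. g (c p)) n tt"
  if x: "x:{..<n} \<rightarrow>\<^sub>E carrier F" and tt: "qwf tt" "qconsts tt <= {p. c p:carrier F}" for n x tt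
 proof -
  have Gx: "G n x:{..<n} \<rightarrow>\<^sub>E carrier (copy g)" using x cp(4) by (auto simp: G_def)
  have oc: "oconsts (trq n tt) <= {p. c p:carrier F}" using trq_consts[OF tt(1), of n] tt(2) by blast
  have "(EX rh. (ALL i. rh i:carrier F) & (ALL i<n. rh i = x i) & osat F c rh (trq n tt)) <->
   (EX rh. (ALL i. rh i:carrier (copy g)) & (ALL i<n. rh i = G n x i) & osat (copy g) (%p. g (c p)) rh (trq n tt))" (is "?A = ?B")
  proof
   assume ?A
   then obtain rh where r: "!!i. rh i:carrier F" "ALL i<n. rh i = x i" "osat F c rh (trq n tt)" by blast
   thus ?B
    using G.osat_e[OF r(1) oc] cp(4) by (intro exI[of _ "%i. g (rh i)"]) (simp add: G_def)
  next
   assume ?B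
   then obtain rh' where r: "!!i. rh' i:carrier (copy g)" "ALL i<n. rh' i = G n x i" "osat (copy g) (%p. g (c p)) rh' (trq n tt)" by blast
   have "ALL i. EX t. t:carrier F & rh' i = g t" using r(1) unfolding cp(4) by blast
   then obtain rh where t: "!!i. rh i:carrier F" "rh' = (%i. g (rh i))" by (metis ext)
   have "rh i = x i" if "i < n" for i
    using r(2) that x t(1)[of i] inj_onD[OF g, of "rh i" "x i"] by (auto simp: t(2) G_def)
   thus ?A
    using G.osat_e[OF t(1) oc] r(3) t by (intro exI[of _ rh]) simp
  qed
  thus ?thesis unfolding dset_iff[OF tt x] C.dset_iff[OF tt(1) subset_trans[OF tt(2) C] Gx] .
 qed
 show ?thesis unfolding defines_fun_def
 proof (intro ballI)
  fix x assume x: "x:{..<m} \<rightarrow>\<^sub>E carrier F"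
  have Gx: "G m x:{..<m} \<rightarrow>\<^sub>E carrier (copy g)" using x cp(4) by (auto simp: G_def)
  have xy: "x(m := y):{..<Suc m} \<rightarrow>\<^sub>E carrier F" if "y:carrier F" for y
   using x that unfolding lessThan_Suc by (rule PiE_fun_upd[rotated])
  have "G (Suc m) (x(m := y)) = (G m x)(m := g y)" for y by (auto simp: G_def)
  hence e: "x(m := y):dset F c (Suc m) ps <-> (G m x)(m := g y):dset (copy g) (%p. g (c p)) (Suc m) ps" if "y:carrier F" for y
   using d[OF xy[OF that] wf(2,4)] by simp
  have D: "(x:dset F c m ph --> (EX! y. y:g ` carrier F & (G m x)(m := y):dset (copy g) (%p. g (c p)) (Suc m) ps)) &
   (x ~: dset F c m ph --> ~ (EX y:g ` carrier F. (G m x)(m := y):dset (copy g) (%p. g (c p)) (Suc m) ps))"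
   using bspec[OF df[unfolded defines_fun_def] Gx] unfolding d[OF x wf(1,3)] cp(4) .
  show "(x:dset F c m ph --> (EX! y. y:carrier F & x(m := y):dset F c (Suc m) ps)) &
   (x ~: dset F c m ph --> ~ (EX y:carrier F. x(m := y):dset F c (Suc m) ps))"
  proof (intro conjI impI)
   assume "x:dset F c m ph"
   hence D1: "EX! y. y:g ` carrier F & (G m x)(m := y):dset (copy g) (%p. g (c p)) (Suc m) ps" using D by blast
   then obtain y where y: "y:carrier F" "x(m := y):dset F c (Suc m) ps" using e by blast
   moreover have "y' = y" if "y':carrier F" "x(m := y'):dset F c (Suc m) ps" for y'
   proof -
    have "g y' = g y" using D1 y that e by blast
    thus ?thesis using inj_onD[OF g] that y by blast
   qed
   ultimately show "EX! y. y:carrier F & x(m := y):dset F c (Suc m) ps" by blast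
  next
   assume "x ~: dset F c m ph"
   thus "~ (EX y:carrier F. x(m := y):dset F c (Suc m) ps)" using D e by blast
  qed
 qed
qed

end

section \<open>Composition of finite extensions\<close>

lemma finite_ext_vemb: "finite_ext K L e ==> vemb K L e"
 by (simp add: finite_ext_def vemb_def)

lemma finite_ext_copy:
 assumes "lf F" and g: "inj_on g (carrier F)" shows "finite_ext F (lf.copy F g) g"
proof -
 interpret lf F by fact
 note cp = copy_local_field[OF g]
 interpret C: lf "copy g" by unfold_locales (rule cp(1))
 have "EX cs. length cs = length [\<one>\<^bsub>copy g\<^esub>] & set cs <= carrier F &
  y = finsum (copy g) (%i. g (cs ! i) \<otimes>\<^bsub>copy g\<^esub> ([\<one>\<^bsub>copy g\<^esub>] ! i)) {..<length [\<one>\<^bsub>copy g\<^esub>]}" if y: "y:carrier (copy g)" for y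
 proof (intro exI[of _ "[inv_into (carrier F) g y]"] conjI)
  have "{..<length [\<one>\<^bsub>copy g\<^esub>]} = {0}" by auto
  thus "y = finsum (copy g) (%i. g ([inv_into (carrier F) g y] ! i) \<otimes>\<^bsub>copy g\<^esub> ([\<one>\<^bsub>copy g\<^esub>] ! i)) {..<length [\<one>\<^bsub>copy g\<^esub>]}"
   using y f_inv_into_f[of y g "carrier F"] by (simp add: cp(4))
 qed (use y cp(4) in "simp_all add: inv_into_into")
 thus ?thesis unfolding finite_ext_def using cp C.one_closed by (intro conjI exI[of _ "[\<one>\<^bsub>copy g\<^esub>]"] ballI) simp_all
qed

lemma finite_ext_trans:
 assumes "local_field0 K" "local_field0 L" "local_field0 M" and e: "finite_ext K L e" and f: "finite_ext L M f"
 shows "finite_ext K M (%x. f (e x))"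
proof -
 interpret KL: emb K L e by unfold_locales (use assms finite_ext_vemb in auto)
 interpret LM: emb L M f by unfold_locales (use assms finite_ext_vemb in auto)
 obtain bs where bs: "set bs <= carrier L" "!!y. y:carrier L ==> EX cs. length cs = length bs & set cs <= carrier K &
   y = finsum L (%i. e (cs ! i) \<otimes>\<^bsub>L\<^esub> (bs ! i)) {..<length bs}" using e unfolding finite_ext_def by blast
 obtain ds where ds: "set ds <= carrier M" "!!y. y:carrier M ==> EX cs. length cs = length ds & set cs <= carrier L &
   y = finsum M (%i. f (cs ! i) \<otimes>\<^bsub>M\<^esub> (ds ! i)) {..<length ds}" using f unfolding finite_ext_def by blast
 let ?p = "length bs" and ?q = "length ds"
 \<comment> \<open>The pairwise products of the two spanning families, the pair
   \<open>(i, j)\<close> standing at position \<open>t = j * length bs + i\<close>.\<close>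
 define B where "B = map (%t. f (bs ! (t mod ?p)) \<otimes>\<^bsub>M\<^esub> ds ! (t div ?p)) [0..<?q*?p]"
 have bc: "bs ! i:carrier L" if "i < ?p" for i using bs(1) that nth_mem by blast
 have dc: "ds ! j:carrier M" if "j < ?q" for j using ds(1) that nth_mem by blast
 have md: "t mod ?p < ?p" "t div ?p < ?q" if "t < ?q*?p" for t
  using that by (auto simp: less_mult_imp_div_less intro!: mod_less_divisor gr0I)
 have "EX cs. length cs = length B & set cs <= carrier K & y = finsum M (%i. f (e (cs ! i)) \<otimes>\<^bsub>M\<^esub> (B ! i)) {..<length B}"
  if y: "y:carrier M" for y
 proof -
  obtain cs where cs: "length cs = ?q" "set cs <= carrier L" "y = finsum M (%i. f (cs ! i) \<otimes>\<^bsub>M\<^esub> (ds ! i)) {..<?q}" using ds(2)[OF y] by blast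
  have cc: "cs ! j:carrier L" if "j < ?q" for j using cs(1,2) that nth_mem by (metis subsetD)
  have "ALL j. EX ks. j < ?q --> length ks = ?p & set ks <= carrier K & cs ! j = finsum L (%i. e (ks ! i) \<otimes>\<^bsub>L\<^esub> (bs ! i)) {..<?p}"
   using bs(2) cc by blast
  then obtain ks where ks: "!!j. j < ?q ==> length (ks j) = ?p & set (ks j) <= carrier K &
   cs ! j = finsum L (%i. e (ks j ! i) \<otimes>\<^bsub>L\<^esub> (bs ! i)) {..<?p}" by metis
  have kc: "ks j ! i:carrier K" if "j < ?q" "i < ?p" for i j using ks[OF that(1)] that(2) nth_mem by (metis subsetD)
  define u where "u j i = upl M (f (e (ks j ! i)))*(upl M (f (bs ! i))*upl M (ds ! j))" for i j
  have fs: "f (cs ! j) \<otimes>\<^bsub>M\<^esub> (ds ! j) = dn M (SUM i<?p. u j i)" if j: "j < ?q" for j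
  proof -
   have "f (cs ! j) = finsum M (%i. f (e (ks j ! i)) \<otimes>\<^bsub>M\<^esub> f (bs ! i)) {..<?p}"
   proof -
    have "f (cs ! j) = finsum M (%i. f (e (ks j ! i) \<otimes>\<^bsub>L\<^esub> (bs ! i))) {..<?p}"
     using ks[OF j] kc[OF j] bc by (simp add: LM.E.hom_finsum o_def)
    also have "... = finsum M (%i. f (e (ks j ! i)) \<otimes>\<^bsub>M\<^esub> f (bs ! i)) {..<?p}"
     by (rule LM.L.finsum_cong') (use kc[OF j] bc in auto)
    finally show ?thesis .
   qed
   also have "... = dn M (SUM i<?p. upl M (f (e (ks j ! i)))*upl M (f (bs ! i)))"
    unfolding LM.L.dn_sum by (rule LM.L.finsum_cong') (use kc[OF j] bc in auto)
   finally have "f (cs ! j) \<otimes>\<^bsub>M\<^esub> (ds ! j) = dn M ((SUM i<?p. upl M (f (e (ks j ! i)))*upl M (f (bs ! i)))*upl M (ds ! j))"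
    using dc[OF j] by (simp del: LM.L.dn_sum)
   thus ?thesis by (simp only: sum_distrib_right u_def mult.assoc)
  qed
  have "y = dn M (SUM j<?q. SUM i<?p. u j i)"
   unfolding cs(3) LM.L.dn_sum[of _ "{..<?q}"] by (rule LM.L.finsum_cong') (use fs cc dc in auto)
  also have "(SUM j<?q. SUM i<?p. u j i) = (SUM j<?q. SUM t:{j*?p..<j*?p+?p}. u (t div ?p) (t mod ?p))"
  proof (rule sum.cong[OF refl])
   fix j
   have "(SUM t:{j*?p..<j*?p+?p}. u (t div ?p) (t mod ?p)) = (SUM i:{0..<?p}. u ((i+j*?p) div ?p) ((i+j*?p) mod ?p))"
    using sum.shift_bounds_nat_ivl[of "%t. u (t div ?p) (t mod ?p)" 0 "j*?p" ?p] by (simp add: add.commute)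
   also have "... = (SUM i<?p. u j i)"
   proof -
    have *: "(i+j*p) div p = j" "(i+j*p) mod p = i" if "i < p" for i p :: nat using that by simp_all
    show ?thesis unfolding atLeast0LessThan by (rule sum.cong[OF refl]) (simp only: * lessThan_iff)
   qed
   finally show "(SUM i<?p. u j i) = (SUM t:{j*?p..<j*?p+?p}. u (t div ?p) (t mod ?p))" by simp
  qed
  also have "... = (SUM t<?q*?p. u (t div ?p) (t mod ?p))" by (rule sum.nat_group)
  finally have "y = dn M (SUM t<?q*?p. u (t div ?p) (t mod ?p))" .
  also have "... = finsum M (%i. f (e (map (%t. ks (t div ?p) ! (t mod ?p)) [0..<?q*?p] ! i)) \<otimes>\<^bsub>M\<^esub> (B ! i)) {..<length B}"
   unfolding LM.L.dn_sum by (rule LM.L.finsum_cong') (use md kc bc dc in "auto simp: B_def u_def")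
  finally show ?thesis using md kc
   by (intro exI[of _ "map (%t. ks (t div ?p) ! (t mod ?p)) [0..<?q*?p]"]) (auto simp: B_def)
 qed
 moreover have "set B <= carrier M" using md bc dc by (auto simp: B_def)
 moreover have "(%x. f (e x)):ring_hom K M" by (rule ring_hom_memI) auto
 moreover have "0 <= vord K x <-> 0 <= vord M (f (e x))" if x: "x:carrier K" "x ~= \<zero>\<^bsub>K\<^esub>" for x
  using KL.vord_e[OF x] LM.vord_e[of "e x"] KL.ram_pos LM.ram_pos x by (simp add: KL.e_zero zero_le_mult_iff)
 ultimately show ?thesis unfolding finite_ext_def by blast
qed

context lf
begin

section \<open>Haar measure\<close>

definition "bal a n = {y:carrier F. ereal (real_of_int n) <= eord F (y \<ominus> a)}"

lemma bal_dn: "a:carrier F ==> dn F t:bal a n <-> nmF F (t-upl F a) <= q powi (- n)"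
 by (simp add: bal_def nmF_le)

lemma bal_nm: "a:carrier F ==> y:bal a n <-> y:carrier F & nmF F (upl F y-upl F a) <= q powi (- n)"
 using bal_dn[of a "upl F y" n] by (auto simp: bal_def)

lemma bal_eq: assumes "a:carrier F" "y:bal a n" shows "bal a n = bal y n"
proof -
 have y: "y:carrier F" "nmF F (upl F y-upl F a) <= q powi (- n)" using assms bal_nm by auto
 have "nmF F (u-upl F a) <= q powi (- n) <-> nmF F (u-upl F y) <= q powi (- n)" for u
  using y(2) V.nm_diff_trans[of u "upl F y" _ "upl F a"] V.nm_diff_trans[of u "upl F a" _ "upl F y"] by (auto simp: V.nm_minus_commute)
 thus ?thesis using assms(1) y(1) by (auto simp: bal_nm)
qed

lemma bal_mono: assumes "n <= n'" shows "bal a n' <= bal a n"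
proof -
 have "ereal (real_of_int n) <= ereal (real_of_int n')" using assms by simp
 from order_trans[OF this] show ?thesis unfolding bal_def by blast
qed

lemma bal_cover: "(UN i::nat. bal \<zero> (- int i)) = carrier F"
proof -
 have "EX i::nat. x:bal \<zero> (- int i)" if "x:carrier F" for x
  using that by (intro exI[of _ "nat (- vord F x)"]) (auto simp: bal_def eord_def a_minus_def)
 thus ?thesis by (auto simp: bal_def)
qed

text \<open>Lebesgue measure on the nonnegative reals is pushed forward along the digit map.\<close>

lemma haar_line:
 "EX h. space h = carrier F & sets h = sigma_sets (carrier F) {bal a n | a n. a:carrier F} &
  (ALL a:carrier F. ALL n. emeasure h (bal a n) = ennreal (q powi (- n)))"
proof -
 obtain r where "V.residues_rep (qK F) r" using residues_ex by blast
 from V.haar_map[OF this] obtain Ph :: "real => 'b lfring" where Ph: "!!a n. {y. 0 <= y & nmF F (Ph y-a) <= q powi n}:sets borel"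
  "!!a n. emeasure lborel {y. 0 <= y & nmF F (Ph y-a) <= q powi n} = ennreal (q powi (n+1))" by blast
 let ?B = "{bal a n | a n. a:carrier F}"
 let ?N = "restrict_space lborel {0::real..}"
 let ?S = "sigma (carrier F) ?B"
 let ?f = "%y. dn F (Ph y)"
 have B: "?B <= Pow (carrier F)" by (auto simp: bal_def)
 have pre: "?f -` bal a n Int space ?N = {y. 0 <= y & nmF F (Ph y-upl F a) <= q powi (- n)}" if "a:carrier F" for a n
  by (auto simp: bal_dn[OF that] space_restrict_space)
 have f: "?f:measurable ?N ?S"
 proof (rule measurable_measure_of[OF B])
  show "?f:space ?N \<rightarrow> carrier F" by simp
  fix y assume "y:?B"
  then obtain a n where a: "y = bal a n" "a:carrier F" by blast
  show "?f -` y Int space ?N:sets ?N" unfolding a(1) pre[OF a(2)]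
   by (subst sets_restrict_space_iff) (use Ph(1) in auto)
 qed
 \<comment> \<open>The digit map gives measure 1 to the maximal ideal; the factor \<open>1/q\<close>
   gives it to the valuation ring instead.\<close>
 define h where "h = scale_measure (ennreal (1/q)) (distr ?N ?S ?f)"
 have "emeasure h (bal a n) = ennreal (q powi (- n))" if a: "a:carrier F" for a n
 proof -
  have "emeasure (distr ?N ?S ?f) (bal a n) = emeasure ?N {y. 0 <= y & nmF F (Ph y-upl F a) <= q powi (- n)}"
   unfolding pre[OF a, symmetric] by (rule emeasure_distr[OF f]) (use a B in "auto simp: sets_measure_of intro!: sigma_sets.Basic")
  also have "... = ennreal (q powi (- n+1))" by (subst emeasure_restrict_space) (auto simp: Ph(2))
  finally have "emeasure h (bal a n) = ennreal (1/q)*ennreal (q powi (- n+1))" by (simp add: h_def)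
  also have "... = ennreal (1/q*q powi (- n+1))" using q1 by (intro ennreal_mult[symmetric]) (auto intro: less_imp_le[OF powi_pos])
  also have "1/q*q powi (- n+1) = q powi (- n)" using power_int_add[of q "- n" 1] q1 by simp
  finally show ?thesis .
 qed
 moreover have "space h = carrier F" "sets h = sigma_sets (carrier F) ?B"
  using space_measure_of[OF B] sets_measure_of[OF B] by (simp_all only: h_def space_scale_measure space_distr sets_scale_measure sets_distr)
 ultimately show ?thesis by blast
qed

definition "hm = (SOME h. space h = carrier F & sets h = sigma_sets (carrier F) {bal a n | a n. a:carrier F} &
  (ALL a:carrier F. ALL n. emeasure h (bal a n) = ennreal (q powi (- n))))"

lemma hm: "space hm = carrier F" "sets hm = sigma_sets (carrier F) {bal a n | a n. a:carrier F}"
 "a:carrier F ==> emeasure hm (bal a n) = ennreal (q powi (- n))"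
 using someI_ex[OF haar_line] unfolding hm_def[symmetric] by blast+

lemma bal_sets: "a:carrier F ==> bal a n:sets hm" unfolding hm(2) by (rule sigma_sets.Basic) blast

lemma sigma_finite_hm: "sigma_finite_measure hm"
 by unfold_locales (intro exI[of _ "range (%i::nat. bal \<zero> (- int i))"], use bal_cover bal_sets hm(1,3) in auto)

lemma dense_carrier: "EX D. countable D & D <= carrier F & (ALL x:carrier F. ALL n. EX d:D. x:bal d n)"
proof -
 obtain D where D: "countable D" "!!x n. EX d:D. nmF F (x-d) <= q powi n" using V.dense_countable by blast
 have "EX d:dn F ` D. x:bal d n" if x: "x:carrier F" for x n
 proof -
  obtain d where d: "d:D" "nmF F (upl F x-d) <= q powi (- n)" using D(2) by blast
  hence "x:bal (dn F d) n" using x unfolding bal_def nmF_le by simp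
  thus ?thesis using d(1) by blast
 qed
 thus ?thesis using D(1) by (intro exI[of _ "dn F ` D"]) auto
qed

text \<open>\<open>haar\<close> is chosen by its values on boxes. The product measure has these
  values, and boxes together with the empty set form an intersection-stable generator that exhausts
  the space, so no other measure qualifies.\<close>

lemma haar_PiM: "haar F m = PiM {..<m} (%_. hm)"
proof -
 interpret product_sigma_finite "%_::nat. hm" by (rule product_sigma_finite.intro) (rule sigma_finite_hm)
 let ?P = "PiM {..<m} (%_. hm)"
 let ?\<Omega> = "{..<m} \<rightarrow>\<^sub>E carrier F"
 let ?B = "{box F m a n | a n. a:?\<Omega>}"
 have box: "box F m a n = Pi\<^sub>E {..<m} (%i. bal (a i) n)" for a n
  by (rule Set.set_eqI, simp only: box_def bal_def PiE_iff mem_Collect_eq lessThan_iff Ball_def, blast)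
 have sp: "space ?P = ?\<Omega>" by (simp add: space_PiM hm(1))
 have a: "a i:carrier F" if "a:?\<Omega>" "i < m" for a i using that by auto
 have bs: "box F m a n:sets ?P" if "a:?\<Omega>" for a n
  unfolding box by (rule sets_PiM_I_finite) (use a[OF that] bal_sets in auto)
 have em: "emeasure ?P (box F m a n) = ennreal (q powr (- real_of_int n*real m))" if "a:?\<Omega>" for a n
 proof -
  have "emeasure ?P (box F m a n) = (PROD i<m. ennreal (q powi (- n)))"
   unfolding box by (subst emeasure_PiM) (use a[OF that] bal_sets hm(3) in auto)
  also have "... = ennreal ((q powi (- n))^m)" using powi_pos[of "- n"] by (simp add: ennreal_power)
  also have "q powi (- n) = q powr (- real_of_int n)" using powr_real_of_int'[of q "- n"] q1 by simp
  also have "(q powr (- real_of_int n))^m = q powr (- real_of_int n*real m)"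
   by (subst powr_power) (use q1 in "simp, simp only: mult.commute")
  finally show ?thesis .
 qed
 obtain D where D: "countable D" "D <= carrier F" "ALL x:carrier F. ALL n. EX d:D. x:bal d n" using dense_carrier by (elim exE conjE)
 \<comment> \<open>A box has one radius in all coordinates, so a cylinder over a ball is not itself
   a box; separability makes it a countable union of boxes of the same radius.\<close>
 have cyl: "{f:?\<Omega>. f i:A}:sigma_sets ?\<Omega> ?B" if i: "i < m" and A: "A:sigma_sets (carrier F) {bal a n | a n. a:carrier F}" for i A
  using A
 proof induction
  case (Basic A)
  then obtain c n where c: "A = bal c n" "c:carrier F" by blast
  have "{f:?\<Omega>. f i:A} = (UN d:{..<m} \<rightarrow>\<^sub>E D. box F m (d(i := c)) n)"
  proof (intro subset_antisym subsetI)
   fix f assume f: "f:{f:?\<Omega>. f i:A}"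
   define d where "d j = (SOME d. d:D & f j:bal d n)" for j
   have d: "d j:D & f j:bal (d j) n" if "j < m" for j
   proof -
    have "EX d. d:D & f j:bal d n" using bspec[OF D(3) a[of f j]] f that by blast
    thus ?thesis unfolding d_def by (rule someI_ex)
   qed
   hence "f:box F m ((restrict d {..<m})(i := c)) n" unfolding box using f c by (auto simp: PiE_iff)
   thus "f:(UN d:{..<m} \<rightarrow>\<^sub>E D. box F m (d(i := c)) n)" using d by (intro UN_I[of "restrict d {..<m}"]) auto
  next
   fix f assume "f:(UN d:{..<m} \<rightarrow>\<^sub>E D. box F m (d(i := c)) n)"
   then obtain d where "f:?\<Omega>" "ALL j<m. f j:bal ((d(i := c)) j) n" by (auto simp: box_def bal_def PiE_iff)
   moreover from this(2) have "f i:bal ((d(i := c)) i) n" using i by blast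
   ultimately show "f:{f:?\<Omega>. f i:A}" using c(1) by simp
  qed
  also have "...:sigma_sets ?\<Omega> ?B"
  proof (rule sigma_sets_UNION)
   show "countable ((%d. box F m (d(i := c)) n) ` ({..<m} \<rightarrow>\<^sub>E D))" using D(1) by (intro countable_image countable_PiE) auto
   fix b assume "b:(%d. box F m (d(i := c)) n) ` ({..<m} \<rightarrow>\<^sub>E D)"
   then obtain d where d: "d:{..<m} \<rightarrow>\<^sub>E D" "b = box F m (d(i := c)) n" by blast
   have "d(i := c):?\<Omega>" using d(1) D(2) c(2) i by (auto simp: PiE_iff extensional_def)
   thus "b:sigma_sets ?\<Omega> ?B" unfolding d(2) by (intro sigma_sets.Basic) blast
  qed
  finally show ?case .
 next
  case Empty
  show ?case by (simp add: sigma_sets.Empty)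
 next
  case (Compl A)
  have "{f:?\<Omega>. f i:carrier F-A} = ?\<Omega>-{f:?\<Omega>. f i:A}" using i by auto
  thus ?case using sigma_sets.Compl[OF Compl.IH] by simp
 next
  case (Union A)
  have "{f:?\<Omega>. f i:\<Union> (range A)} = (UN k. {f:?\<Omega>. f i:A k})" by auto
  thus ?case using sigma_sets.Union[OF Union.IH] by simp
 qed
 have sets: "sets ?P = sigma_sets ?\<Omega> ?B"
 proof (rule subset_antisym)
  show "sets ?P <= sigma_sets ?\<Omega> ?B" unfolding sets_PiM_single hm(1)
   by (rule sigma_sets_mono) (use cyl in "auto simp: hm(2)")
  show "sigma_sets ?\<Omega> ?B <= sets ?P" using bs unfolding sp[symmetric] by (intro sets.sigma_sets_subset) auto
 qed
 define spec where "spec mm <-> space mm = ?\<Omega> & sets mm = sigma_sets ?\<Omega> ?B &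
  (ALL a:?\<Omega>. ALL n. emeasure mm (box F m a n) = ennreal (q powr (- real_of_int n*real m)))" for mm
 have P: "spec ?P" unfolding spec_def using sp sets em by blast
 have uniq: "mm = ?P" if mm: "spec mm" for mm
 proof (rule measure_eqI_generator_eq[where E = "insert {} ?B" and \<Omega> = ?\<Omega> and A = "%i. box F m (\<lambda>j\<in>{..<m}. \<zero>) (- int i)"])
  \<comment> \<open>Two ultrametric balls that meet are nested, and the radii are ordered uniformly
    in the coordinates, so two boxes that meet are nested as well.\<close>
  have "box F m a n Int box F m b n':insert {} ?B" if ab: "a:?\<Omega>" "b:?\<Omega>" "n <= n'" for a b n n'
  proof (cases "box F m a n Int box F m b n' = {}")
   case False
   then obtain y where y: "y:box F m a n" "y:box F m b n'" by blast
   have "box F m b n' <= box F m a n" unfolding box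
   proof (rule PiE_mono)
    fix i assume i: "i:{..<m}"
    have "y i:bal (a i) n" "y i:bal (b i) n'" using y i unfolding box by auto
    hence "bal (b i) n' = bal (y i) n'" "bal (a i) n = bal (y i) n" using bal_eq a ab i by auto
    thus "bal (b i) n' <= bal (a i) n" using bal_mono[OF ab(3)] by simp
   qed
   hence "box F m a n Int box F m b n' = box F m b n'" by blast
   thus ?thesis using ab by blast
  qed simp
  thus "Int_stable (insert {} ?B)" unfolding Int_stable_def
   by (smt (verit) Int_commute Int_empty_left insertE insertI1 linorder_le_cases mem_Collect_eq)
  show "insert {} ?B <= Pow ?\<Omega>" by (auto simp: box_def)
  show "emeasure mm X = emeasure ?P X" if "X:insert {} ?B" for X
   using that mm P unfolding spec_def by auto
  have "sigma_sets ?\<Omega> (insert {} ?B) = sigma_sets ?\<Omega> ?B"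
   by (rule sigma_sets_eqI) (auto intro: sigma_sets.Empty sigma_sets.Basic)
  thus "sets mm = sigma_sets ?\<Omega> (insert {} ?B)" "sets ?P = sigma_sets ?\<Omega> (insert {} ?B)"
   using mm P unfolding spec_def by simp_all
  have z: "(\<lambda>j\<in>{..<m}. \<zero>):?\<Omega>" by auto
  thus "range (%i. box F m (\<lambda>j\<in>{..<m}. \<zero>) (- int i)) <= insert {} ?B" by blast
  show "emeasure mm (box F m (\<lambda>j\<in>{..<m}. \<zero>) (- int i)) ~= \<infinity>" for i using mm z unfolding spec_def by simp
  show "(UN i. box F m (\<lambda>j\<in>{..<m}. \<zero>) (- int i)) = ?\<Omega>"
  proof (intro subset_antisym subsetI)
   fix x assume x: "x:?\<Omega>"
   have "ALL j. EX k::nat. j < m --> x j:bal \<zero> (- int k)" using x bal_cover by (metis UN_E a)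
   then obtain k :: "nat => nat" where k: "!!j. j < m ==> x j:bal \<zero> (- int (k j))" by metis
   define K where "K = Max (insert 0 (k ` {..<m}))"
   have "x j:bal \<zero> (- int K)" if "j < m" for j
    using k[OF that] bal_mono[of "- int K" "- int (k j)"] that by (auto simp: K_def)
   hence "x:box F m (\<lambda>j\<in>{..<m}. \<zero>) (- int K)" unfolding box using x by (auto simp: PiE_iff)
   thus "x:(UN i. box F m (\<lambda>j\<in>{..<m}. \<zero>) (- int i))" by blast
  qed (auto simp: box_def)
 qed
 have "haar F m = (SOME mm. spec mm)" unfolding haar_def spec_def ..
 thus ?thesis using uniq[OF someI[of spec, OF P]] by simp
qed

end

context emb
begin

section \<open>Comparison of the indices\<close>

abbreviation "qk == real (qK K)"
abbreviation "ql == real (qK L)"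

definition "up y = (%i. upl L (e (y i)))" for y :: "nat => 'a"

text \<open>Pulled back to \<open>K\<close>, a ball of \<open>L\<close> is empty or a ball. Orders
  are multiplied by the ramification index, so the exponent \<open>t\<close> becomes
  \<open>t/ram\<close> rounded up, and the rounding only decreases the measure.\<close>

lemma section_measure:
 fixes t :: int
 defines "A == %c. {y:carrier K. nmF L (upl L (e y)-c) <= ql powi (- t)}"
 shows "A c:sets K.hm & emeasure K.hm (A c) <= ennreal (qk powr (- (real_of_int t/real_of_int ram)))"
proof (cases "A c = {}")
 case False
 then obtain y0 where y0: "y0:carrier K" "nmF L (upl L (e y0)-c) <= ql powi (- t)" by (auto simp: A_def)
 define n where "n = \<lceil>real_of_int t/real_of_int ram\<rceil>"
 have rp: "real_of_int ram > 0" using ram_pos by simp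
 have "nmF L (upl L (e y)-c) <= ql powi (- t) <-> ereal (real_of_int n) <= eord K (y \<ominus>\<^bsub>K\<^esub> y0)" if y: "y:carrier K" for y
 proof -
  have d: "y \<ominus>\<^bsub>K\<^esub> y0:carrier K" using y y0 by simp
  have "nmF L (upl L (e y)-c) <= ql powi (- t) <-> nmF L (upl L (e y)-upl L (e y0)) <= ql powi (- t)"
   using y0(2) L.V.nm_diff_trans[of "upl L (e y)" "upl L (e y0)" _ c] L.V.nm_diff_trans[of "upl L (e y)" c _ "upl L (e y0)"]
   by (auto simp: L.V.nm_minus_commute)
  also have "... <-> ereal (real_of_int t) <= eord L (e (y \<ominus>\<^bsub>K\<^esub> y0))"
   unfolding L.nmF_le using y y0(1) by (simp add: a_minus_def)
  also have "... <-> y \<ominus>\<^bsub>K\<^esub> y0 = \<zero>\<^bsub>K\<^esub> | t <= ram * vord K (y \<ominus>\<^bsub>K\<^esub> y0)"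
   using e_zero[OF d] vord_e[OF d] by (auto simp: eord_def simp del: of_int_mult)
  also have "t <= ram * vord K (y \<ominus>\<^bsub>K\<^esub> y0) <-> real_of_int t/real_of_int ram <= real_of_int (vord K (y \<ominus>\<^bsub>K\<^esub> y0))"
   using rp by (simp add: pos_divide_le_eq mult.commute of_int_mult[symmetric] del: of_int_mult)
  also have "... <-> n <= vord K (y \<ominus>\<^bsub>K\<^esub> y0)" by (simp add: n_def ceiling_le_iff)
  finally show ?thesis by (simp add: eord_def)
 qed
 hence A: "A c = K.bal y0 n" by (auto simp: A_def K.bal_def)
 have "emeasure K.hm (A c) = ennreal (qk powi (- n))" unfolding A by (rule K.hm(3)[OF y0(1)])
 also have "qk powi (- n) = qk powr (- real_of_int n)" using powr_real_of_int'[of qk "- n"] K.q1 by simp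
 also have "ennreal (qk powr (- real_of_int n)) <= ennreal (qk powr (- (real_of_int t/real_of_int ram)))"
  using K.q1 by (intro ennreal_leI powr_mono) (auto simp: n_def)
 finally show ?thesis unfolding A using K.bal_sets[OF y0(1)] by simp
qed simp

lemma coord_msr: assumes i: "i:I" shows "L.V.msr (PiM I (%_. K.hm)) (%y. up y i)"
 unfolding L.V.msr_def
proof (intro allI)
 fix a n
 let ?A = "{y:carrier K. nmF L (upl L (e y)-a) <= ql powi n}"
 have "?A:sets K.hm" using section_measure[of a "- n"] by simp
 from measurable_sets[OF measurable_component_singleton[OF i] this]
 have "(%y. y i) -` ?A Int space (PiM I (%_. K.hm)):sets (PiM I (%_. K.hm))" .
 moreover have "(%y. y i) -` ?A Int space (PiM I (%_. K.hm)) = {y:space (PiM I (%_. K.hm)). nmF L (up y i-a) <= ql powi n}"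
  using i by (auto simp: up_def space_PiM K.hm(1))
 ultimately show "{y:space (PiM I (%_. K.hm)). nmF L (up y i-a) <= ql powi n}:sets (PiM I (%_. K.hm))" by simp
qed

lemma tc_up_cong: assumes "L.V.cen M c" "i < M" "!!j. j <= i ==> z j = z' j" shows "L.V.tc c i z = L.V.tc c i z'"
proof -
 have "ALL z z'. (ALL j<i. z j = z' j) --> c i z = c i z'" using assms(1,2) unfolding L.V.cen_def by blast
 hence "c i z = c i z'" by (elim allE impE) (use assms(3) in simp_all)
 thus ?thesis using assms(3) by (simp add: L.V.tc_def)
qed

text \<open>The points of \<open>K\<close> are placed in the cells of \<open>L\<close>, with centers
  evaluated there. Coordinates outside \<open>I\<close> are unrestricted and get the trivial bounds
  0 and infinity.\<close>

lemma tri_measure: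
 fixes R :: "nat => real" and s :: "nat => 'b lfring"
 assumes c: "L.V.cen M c" and m: "m <= M" and I: "I <= {..<m}"
  and ab: "!!i w. i:I ==> lo i <= emeasure K.hm {y:carrier K. nmF L (upl L (e y)-w) <= R i} &
   emeasure K.hm {y:carrier K. nmF L (upl L (e y)-w) <= R i} <= b i"
 defines "W == {y:space (haar K m). ALL i:I. nmF L (L.V.tc c i (up y)-s i) <= R i}"
 shows "W:sets (haar K m) & (PROD i<m. if i:I then lo i else 0) <= emeasure (haar K m) W &
  emeasure (haar K m) W <= (PROD i<m. if i:I then b i else \<infinity>)"
proof -
 define P where "P i y <-> (i:I --> nmF L (L.V.tc c i (up y)-s i) <= R i)" for i and y :: "nat => 'a"
 have "W = {y:space (PiM {..<m} (%_. K.hm)). ALL i<m. P i y}" using I by (auto simp: W_def P_def K.haar_PiM)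
 moreover have "{y:space (PiM {..<m} (%_. K.hm)). ALL i<m. P i y}:sets (PiM {..<m} (%_. K.hm)) &
  (PROD i<m. if i:I then lo i else 0) <= emeasure (PiM {..<m} (%_. K.hm)) {y:space (PiM {..<m} (%_. K.hm)). ALL i<m. P i y} &
  emeasure (PiM {..<m} (%_. K.hm)) {y:space (PiM {..<m} (%_. K.hm)). ALL i<m. P i y} <= (PROD i<m. if i:I then b i else \<infinity>)"
 proof (rule triangular_measure[OF K.sigma_finite_hm])
  fix i assume i: "i < m"
  let ?M = "PiM {..<Suc i} (%_. K.hm)"
  have "L.V.msr ?M (%y. up y i+(- 1*c i (up y)+- s i))"
   by (intro L.V.msr_add L.V.msr_mult L.V.msr_const coord_msr L.V.cen_measurable[OF c]) (use i m in auto)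
  from L.V.nm_measurable[OF this] have B: "(%y. nmF L (L.V.tc c i (up y)-s i)):borel_measurable ?M"
   by (simp add: L.V.tc_def algebra_simps)
  have "{y:space ?M. P i y} = (if i:I then (%y. nmF L (L.V.tc c i (up y)-s i)) -` {..R i} Int space ?M else space ?M)"
   by (auto simp: P_def)
  thus "{y:space ?M. P i y}:sets ?M"
   using measurable_sets[OF B, of "{..R i}"] by simp
 next
  fix i and y y' :: "nat => 'a" assume y: "!!j. j <= i ==> y j = y' j"
  have "L.V.tc c i (up y) = L.V.tc c i (up y')" if "i:I"
   using tc_up_cong[OF c, of i "up y" "up y'"] y that I m by (auto simp: up_def)
  thus "P i y = P i y'" by (auto simp: P_def)
 next
  fix i y assume i: "i < m"
  have "nmF L (L.V.tc c i (up (y(i := x)))-s i) = nmF L (upl L (e x)-(c i (up y) + s i))" for x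
  proof -
   have "ALL z z'. (ALL j<i. z j = z' j) --> c i z = c i z'" using c i m by (auto simp: L.V.cen_def)
   hence "c i (up (y(i := x))) = c i (up y)" by (elim allE impE) (simp_all add: up_def)
   thus ?thesis by (simp add: L.V.tc_def up_def algebra_simps)
  qed
  hence e: "{x:space K.hm. P i (y(i := x))} =
   (if i:I then {x:carrier K. nmF L (upl L (e x)-(c i (up y) + s i)) <= R i} else carrier K)"
   by (auto simp: P_def K.hm(1))
  show "(if i:I then lo i else 0) <= emeasure K.hm {x:space K.hm. P i (y(i := x))}"
   "emeasure K.hm {x:space K.hm. P i (y(i := x))} <= (if i:I then b i else \<infinity>)"
   unfolding e using ab[of i "c i (up y) + s i"] by auto
 qed
 ultimately show ?thesis unfolding K.haar_PiM by (simp only:)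
qed

lemma tri_null:
 assumes c: "L.V.cen M c" and m: "m <= M" and i: "i < m"
 shows "AE y in haar K m. nmF L (L.V.tc c i (up y)) ~= 0"
proof -
 have z: "emeasure K.hm {y:carrier K. nmF L (upl L (e y)-w) <= 0} = 0" for w
 proof (rule antisym[OF ennreal_le_epsilon])
  fix ee :: real assume "ee > 0"
  obtain n where n: "(1/qk)^n < ee" using real_arch_pow_inv[OF `ee > 0`, of "1/qk"] K.q1 by auto
  let ?t = "ram*int n"
  have "emeasure K.hm {y:carrier K. nmF L (upl L (e y)-w) <= 0} <= emeasure K.hm {y:carrier K. nmF L (upl L (e y)-w) <= ql powi (- ?t)}"
   using section_measure[of w ?t] less_imp_le[OF L.powi_pos[of "- ?t"]] by (intro emeasure_mono) auto
  also have "... <= ennreal (qk powr (- (real_of_int ?t/real_of_int ram)))" using section_measure[of w ?t] by blast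
  also have "real_of_int ?t/real_of_int ram = real n" using ram_pos by simp
  also have "ennreal (qk powr (- real n)) <= ennreal ee"
   using n K.q1 by (intro ennreal_leI) (simp add: powr_minus powr_realpow power_one_over inverse_eq_divide)
  finally show "emeasure K.hm {y:carrier K. nmF L (upl L (e y)-w) <= 0} <= 0+ennreal ee" by simp
 qed simp
 have "{y:space (haar K m). ALL j:{i}. nmF L (L.V.tc c j (up y)-0) <= 0}:sets (haar K m) &
  (PROD j<m. if j:{i} then 0 else 0) <= emeasure (haar K m) {y:space (haar K m). ALL j:{i}. nmF L (L.V.tc c j (up y)-0) <= 0} &
  emeasure (haar K m) {y:space (haar K m). ALL j:{i}. nmF L (L.V.tc c j (up y)-0) <= 0} <= (PROD j<m. if j:{i} then 0 else \<infinity>)"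
  by (rule tri_measure[where lo = "%_. 0" and b = "%_. 0" and R = "%_. 0" and s = "%_. 0", OF c m]) (use i z in auto)
 hence W: "{y:space (haar K m). nmF L (L.V.tc c i (up y)) <= 0}:sets (haar K m)"
  "emeasure (haar K m) {y:space (haar K m). nmF L (L.V.tc c i (up y)) <= 0} <= (PROD j<m. if j = i then 0 else \<infinity>)" by simp_all
 \<comment> \<open>In \<open>ennreal\<close> a single factor 0 annihilates the infinite factors of
   the unrestricted coordinates.\<close>
 have "(PROD j<m. if j = i then 0 else \<infinity> :: ennreal) = 0" using i by (intro prod_zero) auto
 hence "{y:space (haar K m). nmF L (L.V.tc c i (up y)) <= 0}:null_sets (haar K m)" using W by (simp only: null_sets_def mem_Collect_eq le_zero_eq)
 thus ?thesis by (rule AE_I') auto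
qed

end

text \<open>The radius is \<open>Q powi (- int k - 1)\<close> times the norm of \<open>s\<close>:
  small enough to keep both the order and the first \<open>k\<close> digits of the unit
  part.\<close>

lemma (in vring) tdat_near:
 assumes "nm s ~= 0" "nm (t-s) <= Q powi (- ord s-int k-1)"
 shows "nm t ~= 0 & ac k t = ac k s & ord t = ord s"
proof -
 have s: "nm s = Q powi (- ord s)" by (rule nm_ord[OF assms(1)])
 have "nm (t-s) < nm s" using assms(2) powi_less[of "- ord s-int k-1" "- ord s"] unfolding s by linarith
 hence st: "nm t = nm s" by (intro nm_close) (simp add: nm_minus_commute)
 have "Q powi (- ord s-int k-1) <= Q powi (- int k+- ord s)" unfolding powi_le by simp
 also have "... = ep k*nm s" unfolding s ep_def using power_int_add[of Q "- int k" "- ord s"] Q_gt1 by simp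
 finally have "nm (s-t) <= ep k*nm s" using assms(2) by (simp add: nm_minus_commute)
 hence "ac k s = ac k t" using ac_approx[OF assms(1)] st by simp
 thus ?thesis using st assms(1) ord_eqv[OF st] by simp
qed

lemma bounded_sums_nn_integral:
 fixes f :: "'i => real"
 assumes "!!T. finite T ==> T <= I ==> sum f T <= C" "!!i. 0 <= f i"
 shows "(\<integral>\<^sup>+ i. ennreal (f i) \<partial>count_space I) < \<infinity>"
proof -
 have "f summable_on I" by (rule nonneg_bdd_above_summable_on) (use assms in "auto intro!: bdd_aboveI[of _ C]")
 hence "(%x. norm (f x)) summable_on I" using assms(2) by simp
 from nn_integral_conv_infsetsum[OF iffD1[OF abs_summable_equivalent this]] show ?thesis using assms(2) by simp
qed

lemma (in vring) oev_det: "EX M. ALL M'>=M. det (BasA (polyf M')) UNIV (%z. oev nm ka z f)"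
proof (induction f)
 case (OLe s t)
 obtain M M0 where "(%z. ev ka z s):polyf M" "(%z. ev ka z t):polyf M0" using ev_polyf by blast
 hence "det (BasA (polyf M')) UNIV (%z. nm (ev ka z t) <= 1*nm (ev ka z s))" if "max M M0 <= M'" for M'
  by (intro mon_cmp mon_gen) (use that polyf_mono `_:polyf M` `_:polyf M0` in auto)
 thus ?case by (intro exI[of _ "max M M0"]) simp
next
 case (ONot f)
 then obtain M where "ALL M'>=M. det (BasA (polyf M')) UNIV (%z. oev nm ka z f)" by blast
 thus ?case by (intro exI[of _ M]) (auto intro: det_not)
next
 case (OAnd f g)
 then obtain M M0 where "ALL M'>=M. det (BasA (polyf M')) UNIV (%z. oev nm ka z f)" "ALL M'>=M0. det (BasA (polyf M')) UNIV (%z. oev nm ka z g)" by blast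
 thus ?case by (intro exI[of _ "max M M0"]) (auto intro: det_conj)
qed

text \<open>For each vector \<open>l\<close> of orders, the triangular set of points whose
  differences from the centers lie near \<open>s l i\<close> has a measure equal to the product of
  the radii. These sets are disjoint because they have different orders, so their contributions to
  the integral add up.\<close>

lemma (in lf) L_lower:
 fixes h :: "int list => real" and g :: "(nat => 'b) => ennreal"
 assumes c: "V.cen M c" and m: "m <= M" and T: "finite T" "!!l. l:T ==> length l = m"
  and s: "!!l i. l:T ==> i < m ==> nmF F (s l i) ~= 0 & V.ord (s l i) = l ! i"
  and g: "!!l y. l:T ==> y:space (haar F m) ==>
   (!!i. i < m ==> nmF F (V.tc c i (%j. upl F (y j))-s l i) <= q powi (- (l ! i)-int k-1)) ==> ennreal (q powr (- h l)) <= g y"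
 shows "(SUM l:T. ennreal (q powr (- h l)*(PROD i<m. q powi (- (l ! i)-int k-1)))) <= (\<integral>\<^sup>+ y. g y \<partial>haar F m)"
proof -
 interpret I: emb F F "%x. x" by unfold_locales (simp add: vemb_def ring_hom_def)
 let ?r = "%l i. q powi (- (l ! i)-int k-1)"
 define W where "W l = {y:space (haar F m). ALL i:{..<m}. nmF F (V.tc c i (I.up y)-s l i) <= ?r l i}" for l
 have sec: "emeasure hm {y:carrier F. nmF F (upl F y-w) <= q powi n} = ennreal (q powi n)" for w n
 proof -
  have "{y:carrier F. nmF F (upl F y-w) <= q powi n} = bal (dn F w) (- n)"
   using nmF_le[of _ "- n"] by (auto simp: bal_def)
  thus ?thesis using hm(3)[of "dn F w" "- n"] by simp
 qed
 have W: "W l:sets (haar F m)" "ennreal (PROD i<m. ?r l i) <= emeasure (haar F m) (W l)" for l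
 proof -
  have *: "W l:sets (haar F m) & (PROD i<m. if i:{..<m} then ennreal (?r l i) else 0) <= emeasure (haar F m) (W l) &
   emeasure (haar F m) (W l) <= (PROD i<m. if i:{..<m} then ennreal (?r l i) else \<infinity>)"
   unfolding W_def by (rule I.tri_measure[OF c m subset_refl]) (simp add: sec)
  have "(PROD i<m. if i:{..<m} then ennreal (?r l i) else 0) = (PROD i<m. ennreal (?r l i))" by (intro prod.cong) auto
  also have "... = ennreal (PROD i<m. ?r l i)" by (rule prod_ennreal) (simp add: less_imp_le)
  finally show "W l:sets (haar F m)" "ennreal (PROD i<m. ?r l i) <= emeasure (haar F m) (W l)" using * by simp_all
 qed
 have up: "I.up y = (%j. upl F (y j))" for y by (simp add: I.up_def)
 have disj: "l = l'" if l: "l:T" "l':T" "y:W l" "y:W l'" for l l' y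
 proof (rule nth_equalityI)
  show "length l = length l'" using T l by simp
  fix i assume "i < length l"
  hence i: "i < m" using T l by simp
  have "V.ord (V.tc c i (I.up y)) = l ! i" if "l:T" "y:W l" for l
   using V.tdat_near[of "s l i" "V.tc c i (I.up y)" k] s[OF that(1) i] that(2) i by (auto simp: W_def)
  from this[OF l(1,3)] this[OF l(2,4)] show "l ! i = l' ! i" by simp
 qed
 have "(SUM l:T. ennreal (q powr (- h l)*(PROD i<m. ?r l i))) <= (SUM l:T. ennreal (q powr (- h l))*emeasure (haar F m) (W l))"
  by (intro sum_mono) (auto simp: ennreal_mult' intro!: mult_left_mono W)
 also have "... = (\<integral>\<^sup>+ y. (SUM l:T. ennreal (q powr (- h l))*indicator (W l) y) \<partial>haar F m)"
  using W(1) by (subst nn_integral_sum) (auto simp: nn_integral_cmult_indicator)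
 also have "... <= (\<integral>\<^sup>+ y. g y \<partial>haar F m)"
 proof (rule nn_integral_mono)
  fix y assume y: "y:space (haar F m)"
  show "(SUM l:T. ennreal (q powr (- h l))*indicator (W l) y) <= g y"
  proof (cases "EX l:T. y:W l")
   case True
   then obtain l where l: "l:T" "y:W l" by blast
   have "(SUM l:T. ennreal (q powr (- h l))*indicator (W l) y) = (SUM l':T. if l' = l then ennreal (q powr (- h l)) else 0)"
   proof (intro sum.cong refl)
    fix l' assume "l':T"
    thus "ennreal (q powr (- h l'))*indicator (W l') y = (if l' = l then ennreal (q powr (- h l)) else 0)"
     using disj[of l' l y] l by (cases "y:W l'") auto
   qed
   also have "... <= g y" using g[OF l(1) y] l T(1) by (simp add: W_def up)
   finally show ?thesis .
  next
   case False
   hence "(SUM l:T. ennreal (q powr (- h l))*indicator (W l) y) = 0" by (intro sum.neutral) (simp add: indicator_def)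
   thus ?thesis by simp
  qed
 qed
 finally show ?thesis .
qed

context emb
begin

abbreviation "xk == qk powr (- 1/real_of_int ram)"

text \<open>The set for \<open>l\<close> is enlarged to the polydisc with radii given by
  \<open>l\<close>. Overlaps do no harm to an upper bound, and the measure of its trace on
  \<open>K\<close> is at most \<open>xk\<close> to the sum of the orders. The sum over
  \<open>l\<close> is a measurable majorant of finite integral.\<close>

lemma K_upper:
 fixes h :: "int list => real"
 assumes c: "L.V.cen M c" and m: "m <= M"
  and C: "!!T. finite T ==> T <= La ==> (SUM l:T. xk powr (real_of_int (SUM i<m. l ! i)+h l)) <= C"
 defines "W == %l. {y:space (haar K m). ALL i:{..<m}. nmF L (L.V.tc c i (up y)-0) <= ql powi (- (l ! i))}"
 shows "(%y. \<integral>\<^sup>+ l. ennreal (xk powr h l)*indicator (W l) y \<partial>count_space La):borel_measurable (haar K m)"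
  "(\<integral>\<^sup>+ y. (\<integral>\<^sup>+ l. ennreal (xk powr h l)*indicator (W l) y \<partial>count_space La) \<partial>haar K m) < \<infinity>"
proof -
 let ?r = "%l i. qk powr (- (real_of_int (l ! i)/real_of_int ram))"
 have W: "W l:sets (haar K m)" "emeasure (haar K m) (W l) <= ennreal (xk powr real_of_int (SUM i<m. l ! i))" for l
 proof -
  have *: "W l:sets (haar K m) & (PROD i<m. if i:{..<m} then 0 else 0) <= emeasure (haar K m) (W l) &
   emeasure (haar K m) (W l) <= (PROD i<m. if i:{..<m} then ennreal (?r l i) else \<infinity>)"
   unfolding W_def by (rule tri_measure[OF c m subset_refl]) (use section_measure in auto)
  have "(PROD i<m. if i:{..<m} then ennreal (?r l i) else \<infinity>) = (PROD i<m. ennreal (?r l i))" by (intro prod.cong) auto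
  also have "... = ennreal (PROD i<m. ?r l i)" by (rule prod_ennreal) simp
  also have "(PROD i<m. ?r l i) = xk powr real_of_int (SUM i<m. l ! i)"
   unfolding of_int_sum using K.q1 by (subst powr_sum) (simp_all add: powr_powr)
  finally show "W l:sets (haar K m)" "emeasure (haar K m) (W l) <= ennreal (xk powr real_of_int (SUM i<m. l ! i))" using * by simp_all
 qed
 have f: "(%y. ennreal (xk powr h l)*indicator (W l) y):borel_measurable (haar K m)" for l
  by (intro borel_measurable_times_ennreal borel_measurable_const borel_measurable_indicator W)
 interpret S: sigma_finite_measure "count_space La" by (rule sigma_finite_measure_count_space_countable) simp
 have "(%p. (%l p. ennreal (xk powr h l)*indicator (W l) (fst p)) (snd p) p):borel_measurable (haar K m \<Otimes>\<^sub>M count_space La)"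
 proof (rule measurable_compose_countable'[where I = La])
  show "(%p. ennreal (xk powr h l)*indicator (W l) (fst p)):borel_measurable (haar K m \<Otimes>\<^sub>M count_space La)" for l
   by (rule measurable_compose[OF measurable_fst f])
 qed simp_all
 thus "(%y. \<integral>\<^sup>+ l. ennreal (xk powr h l)*indicator (W l) y \<partial>count_space La):borel_measurable (haar K m)"
  by (rule S.borel_measurable_nn_integral[unfolded case_prod_unfold])
 have "(\<integral>\<^sup>+ y. (\<integral>\<^sup>+ l. ennreal (xk powr h l)*indicator (W l) y \<partial>count_space La) \<partial>haar K m) =
  (\<integral>\<^sup>+ l. (\<integral>\<^sup>+ y. ennreal (xk powr h l)*indicator (W l) y \<partial>haar K m) \<partial>count_space La)"
  by (rule nn_integral_count_space_nn_integral[OF countableI_type f])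
 also have "... <= (\<integral>\<^sup>+ l. ennreal (xk powr (real_of_int (SUM i<m. l ! i)+h l)) \<partial>count_space La)"
 proof (rule nn_integral_mono)
  fix l
  have "ennreal (xk powr h l)*emeasure (haar K m) (W l) <= ennreal (xk powr h l)*ennreal (xk powr real_of_int (SUM i<m. l ! i))"
   by (intro mult_left_mono W) simp
  also have "... = ennreal (xk powr (real_of_int (SUM i<m. l ! i)+h l))" by (simp add: ennreal_mult'[symmetric] powr_add mult.commute)
  finally show "(\<integral>\<^sup>+ y. ennreal (xk powr h l)*indicator (W l) y \<partial>haar K m) <= ennreal (xk powr (real_of_int (SUM i<m. l ! i)+h l))"
   using W(1) by (simp add: nn_integral_cmult_indicator)
 qed
 also have "... < \<infinity>" by (rule bounded_sums_nn_integral[OF C]) simp_all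
 finally show "(\<integral>\<^sup>+ y. (\<integral>\<^sup>+ l. ennreal (xk powr h l)*indicator (W l) y \<partial>count_space La) \<partial>haar K m) < \<infinity>" .
qed

text \<open>On one cell, integrability over \<open>L\<close> is converted to a sum over order
  vectors by \<open>L_lower\<close>, transported from \<open>1/ql\<close> to \<open>xk\<close> by
  \<open>lspan_exponent_change\<close>, and turned into an integrable majorant over \<open>K\<close>
  by \<open>K_upper\<close>.\<close>

lemma cell_K:
 assumes ok: "L.V.cell_ok S m M p" and m: "m < M" and s: "0 < s"
  and gf: "(\<integral>\<^sup>+ x. g x \<partial>haar L m) < \<infinity>"
  and g: "!!x z. x:space (haar L m) ==> z:S ==> (!!i. i < m ==> dn L (z i) = x i) ==> nmF L (z m) ~= 0 ==>
   g x = ennreal (ql powr (- (s*real_of_int (L.V.ord (z m)))))"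
 shows "EX g':borel_measurable (haar K m). (\<integral>\<^sup>+ y. g' y \<partial>haar K m) < \<infinity> &
  (AE y in haar K m. ALL z:S. L.V.in_cell M z p --> (ALL i<m. z i = up y i) -->
   (if nmF L (z m) = 0 then 0 else ennreal (xk powr (s*real_of_int (L.V.ord (z m))))) <= g' y)"
proof -
 obtain c J k ka G b where p: "p = (c, J, k, ka, G, b)" by (cases p)
 have c: "L.V.cen M c" and G: "finite G" and ka: "ALL i:J. EX x. nmF L x ~= 0 & L.V.ac k x = ka i"
  and inS: "!!v z. v:lspan G b ==> L.V.tdat c M J k ka v z ==> z:S"
  and alt: "(ALL v:lspan G b. ALL z. L.V.tdat c M J k ka v z --> nmF L (z m) = 0) |
   (EX e>0. EX aa bb. ALL v:lspan G b. ALL z. L.V.tdat c M J k ka v z --> nmF L (z m) ~= 0 &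
     int e*L.V.ord (z m) = (SUM i:J. aa i * v i)+bb)" using ok unfolding p L.V.cell_ok_def prod.case by blast+
 have ic: "L.V.in_cell M z p <-> (EX v:lspan G b. L.V.tdat c M J k ka v z)" for z by (simp add: p L.V.in_cell_def)
 have tcz: "L.V.tc c i z = L.V.tc c i (up y)" if "ALL i<m. z i = up y i" "i < m" for z y i
  using tc_up_cong[OF c, of i z "up y"] that m by simp
 show ?thesis
 proof (cases "{..<m} <= J")
  case False
  \<comment> \<open>Some coordinate of the argument is bound to its center, so the cell meets the
    points of \<open>K\<close> in a null set.\<close>
  then obtain i where i: "i < m" "i ~: J" by auto
  have "AE y in haar K m. ALL z:S. L.V.in_cell M z p --> (ALL i<m. z i = up y i) -->
   (if nmF L (z m) = 0 then 0 else ennreal (xk powr (s*real_of_int (L.V.ord (z m))))) <= 0"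
   using tri_null[OF c less_imp_le[OF m] i(1)]
  proof (rule AE_mp, intro AE_I2 impI ballI)
   fix y z assume "nmF L (L.V.tc c i (up y)) ~= 0" "L.V.in_cell M z p" "ALL i<m. z i = up y i"
   moreover from this obtain v where "L.V.tdat c M J k ka v z" unfolding ic by blast
   hence "nmF L (L.V.tc c i z) = 0" using less_trans[OF i(1) m] i(2) by (simp add: L.V.tdat_def)
   ultimately have False using tcz[of z y i] i(1) by simp
   thus "(if nmF L (z m) = 0 then 0 else ennreal (xk powr (s*real_of_int (L.V.ord (z m))))) <= 0" ..
  qed
  thus ?thesis by (intro bexI[of _ "%_. 0"]) simp_all
 next
  case J: True
  show ?thesis using alt
  proof (elim disjE exE conjE)
   \<comment> \<open>The function vanishes on the cell, so the majorant 0 suffices.\<close>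
   assume "ALL v:lspan G b. ALL z. L.V.tdat c M J k ka v z --> nmF L (z m) = 0"
   hence "nmF L (z m) = 0" if "L.V.in_cell M z p" for z using that unfolding ic by blast
   thus ?thesis by (intro bexI[of _ "%_. 0"]) simp_all
  next
   fix e' :: nat and aa bb assume e': "e' > 0"
   assume al: "ALL v:lspan G b. ALL z. L.V.tdat c M J k ka v z --> nmF L (z m) ~= 0 &
     int e'*L.V.ord (z m) = (SUM i:J. aa i * v i)+bb"
   define O' where "O' v = (real_of_int (SUM i:J. aa i * v i)+real_of_int bb)/real e'" for v
   have O': "nmF L (z m) ~= 0 & real_of_int (L.V.ord (z m)) = O' v" if "v:lspan G b" "L.V.tdat c M J k ka v z" for v z
   proof -
    note a = al[rule_format, OF that]
    have "real e'*real_of_int (L.V.ord (z m)) = real_of_int (SUM i:J. aa i * v i)+real_of_int bb"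
     using arg_cong[OF conjunct2[OF a], of real_of_int] by (simp only: of_int_mult of_int_add of_int_of_nat_eq)
    thus ?thesis using conjunct1[OF a] e' by (simp add: O'_def eq_divide_eq mult.commute del: of_int_sum)
   qed
   have real: "EX z:S. (ALL i<m. z i = x i) & nmF L (z m) ~= 0 & real_of_int (L.V.ord (z m)) = O' v"
    if "v:lspan G b" "L.V.tdat c m J k ka v x" for v x
    using L.V.tdat_extend[OF c ka less_imp_le[OF m] that(2)] O'[OF that(1)] inS[OF that(1)] by blast
   have gx: "g x = ennreal (ql powr (- (s*O' v)))"
    if v: "v:lspan G b" and t: "L.V.tdat c m J k ka v t" and x: "x:space (haar L m)" "!!i. i < m ==> dn L (t i) = x i" for x v t
   proof -
    obtain z where z: "z:S" "ALL i<m. z i = t i" "nmF L (z m) ~= 0" "real_of_int (L.V.ord (z m)) = O' v" using real[OF v t] by blast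
    have "g x = ennreal (ql powr (- (s*real_of_int (L.V.ord (z m)))))" by (rule g[OF x(1) z(1)]) (use z x in simp_all)
    thus ?thesis by (simp add: z(4))
   qed
   \<comment> \<open>The order of the value depends on the first \<open>m\<close> orders alone
     because the values come from a function: two vectors with these orders in common are realised
     over the same argument \<open>x\<close>, and \<open>g x\<close> has only one value.\<close>
   have uniq: "O' v = O' v'" if v: "v:lspan G b" "v':lspan G b" "map v [0..<m] = map v' [0..<m]" for v v'
   proof -
    have vv: "v i = v' i" if "i < m" for i using v(3) that by (auto simp: map_eq_conv)
    have "L.V.tdat c 0 J k ka v t" for t by (simp add: L.V.tdat_def)
    then obtain t where t: "L.V.tdat c m J k ka v t"
     using L.V.tdat_extend[of m c J k ka 0 v] c m ka by (auto simp: L.V.cen_def)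
    have t': "L.V.tdat c m J k ka v' t" using t vv by (simp add: L.V.tdat_def)
    define x where "x = restrict (%i. dn L (t i)) {..<m}"
    have x: "x:space (haar L m)" by (simp add: x_def L.haar_PiM space_PiM L.hm(1))
    have "ql powr (- (s*O' v)) = ql powr (- (s*O' v'))"
     using gx[OF v(1) t x] gx[OF v(2) t' x] by (simp add: x_def)
    thus ?thesis using s L.q1 by (simp add: powr_inj)
   qed
   define La where "La = (%v. map v [0..<m]) ` lspan G b"
   \<comment> \<open>By \<open>uniq\<close> the choice of \<open>v\<close> does not matter, so the
     exponent descends to lists of the first \<open>m\<close> orders.\<close>
   define h where "h l = s*O' (SOME v. v:lspan G b & map v [0..<m] = l)" for l
   have h: "h (map v [0..<m]) = s*O' v" if v: "v:lspan G b" for v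
   proof -
    have "EX v'. v':lspan G b & map v' [0..<m] = map v [0..<m]" using v by blast
    from someI_ex[OF this] show ?thesis unfolding h_def using uniq v by metis
   qed
   define w where "w l = real_of_int (SUM i<m. l ! i)+h l" for l
   \<comment> \<open>The linear part of the exponent: the sum of the orders from the measure, and
     \<open>s\<close> times the linear part of the order of the value.\<close>
   define A where "A v = real_of_int (SUM i<m. v i) + s*real_of_int (SUM i:J. aa i * v i)/real e'" for v
   have A: "A (%i. v i+g i) = A v + A g" for v g :: "nat => int"
    by (simp add: A_def sum.distrib distrib_left add_divide_distrib)
   have wA: "w (map v [0..<m]) = s*real_of_int bb/real e'+A v" if v: "v:lspan G b" for v
    by (simp add: w_def h[OF v] A_def O'_def algebra_simps add_divide_distrib)
   \<comment> \<open>Centers for the small balls: elements with the order prescribed by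
     \<open>l\<close> and the angular component prescribed by the cell.\<close>
   define gs where "gs l i = (SOME x. nmF L x ~= 0 & L.V.ord x = l ! i & L.V.ac k x = ka i)" for l :: "int list" and i
   have gs: "nmF L (gs l i) ~= 0 & L.V.ord (gs l i) = l ! i & L.V.ac k (gs l i) = ka i" if i: "i < m" for l i
   proof -
    obtain x where "nmF L x ~= 0" "L.V.ac k x = ka i" using ka J i by blast
    hence "EX x. nmF L x ~= 0 & L.V.ord x = l ! i & L.V.ac k x = ka i" using L.V.ac_shift[of x "l ! i" k] by auto
    from someI_ex[OF this] show ?thesis unfolding gs_def .
   qed
   obtain r where r: "0 <= r" "(\<integral>\<^sup>+ x. g x \<partial>haar L m) = ennreal r" using gf by (cases "\<integral>\<^sup>+ x. g x \<partial>haar L m") auto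
   \<comment> \<open>Fixing \<open>k\<close> digits of each of the \<open>m\<close> unit parts costs
     a factor \<open>ql\<close> to the power \<open>-(k+1)\<close> per coordinate, independent of
     \<open>l\<close>.\<close>
   define B where "B = ql powr (- real (m*(k+1)))"
   have B: "B > 0" using L.q1 by (simp add: B_def)
   have lower: "(SUM l:T. (1/ql) powr w l) <= r/B" if T: "finite T" "T <= La" for T
   proof -
    have e: "ql powr (- h l)*(PROD i<m. ql powi (- (l ! i)-int k-1)) = B*(1/ql) powr w l" for l
    proof -
     have 1: "ql powi n = ql powr real_of_int n" for n using powr_real_of_int'[of ql n] L.q1 by simp
     have "(PROD i<m. ql powi (- (l ! i)-int k-1)) = ql powr (- real_of_int (SUM i<m. l ! i)-real (m*(k+1)))"
      unfolding 1 using L.q1 by (induction m) (auto simp: powr_add[symmetric] algebra_simps)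
     moreover have "(1/ql) powr w l = ql powr (- w l)" using L.q1 by (simp add: powr_divide powr_minus inverse_eq_divide)
     moreover have "- h l+(- real_of_int (SUM i<m. l ! i)-real (m*(k+1))) = - real (m*(k+1))+- w l" by (simp add: w_def)
     ultimately show ?thesis by (simp only: B_def powr_add[symmetric])
    qed
    have "(SUM l:T. ennreal (ql powr (- h l)*(PROD i<m. ql powi (- (l ! i)-int k-1)))) <= (\<integral>\<^sup>+ y. g y \<partial>haar L m)"
    proof (rule L.L_lower[OF c less_imp_le[OF m] T(1), of gs])
     fix l assume l: "l:T"
     then obtain v where v: "v:lspan G b" "l = map v [0..<m]" using T(2) unfolding La_def by blast
     show "length l = m" by (simp add: v)
     show "nmF L (gs l i) ~= 0 & L.V.ord (gs l i) = l ! i" if "i < m" for i using gs[OF that] by blast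
     fix y assume y: "y:space (haar L m)"
      and n: "!!i. i < m ==> nmF L (L.V.tc c i (%j. upl L (y j))-gs l i) <= ql powi (- (l ! i)-int k-1)"
     have "L.V.tdat c m J k ka v (%j. upl L (y j))" unfolding L.V.tdat_def
     proof (intro allI impI)
      fix i assume i: "i < m"
      have "i:J" "l ! i = v i" using J i v(2) by auto
      thus "if i:J then nmF L (L.V.tc c i (%j. upl L (y j))) ~= 0 & L.V.ac k (L.V.tc c i (%j. upl L (y j))) = ka i &
       L.V.ord (L.V.tc c i (%j. upl L (y j))) = v i else nmF L (L.V.tc c i (%j. upl L (y j))) = 0"
       using L.V.tdat_near[of "gs l i" "L.V.tc c i (%j. upl L (y j))" k] gs[OF i, of l] n[OF i] by simp
     qed
     from gx[OF v(1) this y] have "g y = ennreal (ql powr (- (s*O' v)))"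
      using y by (simp add: L.haar_PiM space_PiM L.hm(1) PiE_iff)
     thus "ennreal (ql powr (- h l)) <= g y" by (simp add: v(2) h[OF v(1)])
    qed
    hence "ennreal (SUM l:T. B*(1/ql) powr w l) <= ennreal r" using B unfolding e r(2) by (simp add: sum_ennreal)
    hence "(SUM l:T. B*(1/ql) powr w l) <= r" using r(1) by simp
    thus ?thesis using B by (simp add: sum_distrib_left[symmetric] field_simps)
   qed
   have "EX C. ALL T. finite T & T <= (%v. map v [0..<m]) ` lspan G b --> (SUM p:T. xk powr w p) <= C"
   proof (rule lspan_exponent_change[OF G A, where w = w and c = "s*real_of_int bb/real e'" and ?x0.0 = "1/ql" and C = "r/B"])
    show "0 < 1/ql" "1/ql < 1" using L.q1 by auto
    show "0 < xk" using K.q1 by simp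
    have "xk < qk powr 0" using K.q1 ram_pos by (intro powr_less_mono) (auto simp: divide_neg_pos)
    thus "xk < 1" using K.q1 by simp
   qed (use wA lower in "simp_all add: La_def")
   then obtain C where C: "!!T. finite T ==> T <= La ==> (SUM l:T. xk powr (real_of_int (SUM i<m. l ! i)+h l)) <= C"
    unfolding La_def w_def by blast
   define W where "W l = {y:space (haar K m). ALL i:{..<m}. nmF L (L.V.tc c i (up y)-0) <= ql powi (- (l ! i))}" for l
   note U = K_upper[OF c less_imp_le[OF m] C, folded W_def]
   show ?thesis
   proof (intro bexI[OF _ U(1)] conjI U(2) AE_I2 ballI impI)
    fix y z assume y: "y:space (haar K m)" and z: "z:S" "L.V.in_cell M z p" "ALL i<m. z i = up y i"
    obtain v where v: "v:lspan G b" "L.V.tdat c M J k ka v z" using z(2) unfolding ic by blast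
    let ?l = "map v [0..<m]"
    have "nmF L (L.V.tc c i (up y)) <= ql powi (- (?l ! i))" if i: "i < m" for i
    proof -
     have "nmF L (L.V.tc c i z) ~= 0" "L.V.ord (L.V.tc c i z) = v i" using v(2) i J m by (auto simp: L.V.tdat_def)
     thus ?thesis using L.V.nm_ord[of "L.V.tc c i z"] tcz[OF z(3) i] i by simp
    qed
    hence yW: "y:W ?l" using y by (simp add: W_def)
    have "ennreal (xk powr (s*O' v)) = ennreal (xk powr h ?l)*indicator (W ?l) y" using yW by (simp add: h[OF v(1)])
    also have "... <= (\<integral>\<^sup>+ l. ennreal (xk powr h l)*indicator (W l) y \<partial>count_space La)"
     by (rule nn_integral_ge_point) (unfold La_def, rule imageI[OF v(1)])
    finally show "(if nmF L (z m) = 0 then 0 else ennreal (xk powr (s*real_of_int (L.V.ord (z m))))) <=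
     (\<integral>\<^sup>+ l. ennreal (xk powr h l)*indicator (W l) y \<partial>count_space La)" using O'[OF v] by simp
   qed
  qed
 qed
qed

text \<open>The cells are taken from the graph over \<open>L\<close>; functionality translates
  between its points and values of the function, over \<open>L\<close> for the lower bound and over
  \<open>K\<close> for the upper bound. This shows that every exponent integrable over
  \<open>L\<close> is integrable over \<open>K\<close>.\<close>

theorem ind_le:
 assumes wf: "qwf ph" "qwf ps" and co: "qconsts ph <= {p. c p:carrier K}" "qconsts ps <= {p. c p:carrier K}"
  and dfK: "defines_fun K c m ph ps" and dfL: "defines_fun L (%p. e (c p)) m ph ps"
 shows "ind L (%p. e (c p)) m ph ps <= ind K c m ph ps"
proof -
 let ?c = "%p. e (c p)"
 let ?f = "trq (Suc m) ps"
 define ka where "ka p = upl L (?c p)" for p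
 define S where "S = {z. oev (nmF L) ka z ?f}"
 have cK: "oconsts ?f <= {p. c p:carrier K}" using trq_consts[OF wf(2)] co(2) by blast
 hence "oconsts ?f <= {p. ?c p = dn L (ka p)}" by (auto simp: ka_def)
 hence S: "z:S <-> osat L ?c (%i. dn L (z i)) ?f" for z unfolding S_def using L.osat_oev[of ?f ?c ka z] by simp
 have coL: "qconsts ps <= {p. ?c p:carrier L}" using co(2) by auto
 have spL: "space (haar L m) = {..<m} \<rightarrow>\<^sub>E carrier L" by (simp add: L.haar_PiM space_PiM L.hm(1))
 have spK: "space (haar K m) = {..<m} \<rightarrow>\<^sub>E carrier K" by (simp add: K.haar_PiM space_PiM K.hm(1))
 have L_pt: "x:dset L ?c m ph & fval L ?c m ps x = dn L (z m)"
  if x: "x:space (haar L m)" and z: "z:S" "!!i. i < m ==> dn L (z i) = x i" for x z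
 proof -
  have x': "x:{..<m} \<rightarrow>\<^sub>E carrier L" using x unfolding spL .
  have "x(m := dn L (z m)):{..<Suc m} \<rightarrow>\<^sub>E carrier L" using x' by (auto simp: PiE_iff extensional_def)
  from L.dset_iff[OF wf(2) coL this] have y: "x(m := dn L (z m)):dset L ?c (Suc m) ps"
   using z S[of z] by (auto intro!: exI[of _ "%i. dn L (z i)"])
  hence d: "x:dset L ?c m ph" using dfL x' unfolding defines_fun_def by (meson L.dns(6) L.carrier_dn dn_closed[OF L.lf])
  hence "EX! y. y:carrier L & x(m := y):dset L ?c (Suc m) ps" using dfL x' unfolding defines_fun_def by blast
  hence "fval L ?c m ps x = dn L (z m)" unfolding fval_def using y by (intro the1_equality) simp_all
  thus ?thesis using d by blast
 qed
 have K_pt: "EX z:S. (ALL i<m. z i = up y i) & z m = upl L (e (fval K c m ps y)) & fval K c m ps y:carrier K"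
  if y: "y:dset K c m ph" for y
 proof -
  have y': "y:{..<m} \<rightarrow>\<^sub>E carrier K" using y by (simp add: dset_def)
  have "EX! u. u:carrier K & y(m := u):dset K c (Suc m) ps" using dfK y y' unfolding defines_fun_def by blast
  from theI'[OF this] have u: "fval K c m ps y:carrier K" "y(m := fval K c m ps y):dset K c (Suc m) ps" unfolding fval_def by blast+
  have "y(m := fval K c m ps y):{..<Suc m} \<rightarrow>\<^sub>E carrier K" using y' u(1) by (auto simp: PiE_iff extensional_def)
  from K.dset_iff[OF wf(2) co(2) this] u(2) obtain rh where rh: "!!i. rh i:carrier K"
   "!!i. i < Suc m ==> rh i = (y(m := fval K c m ps y)) i" "osat K c rh ?f" by blast
  \<comment> \<open>All coordinates, witnesses included, are mapped to \<open>L\<close>; the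
    embedding preserves every order comparison of the quantifier-free formula.\<close>
  have "(%i. upl L (e (rh i))):S" using S[of "%i. upl L (e (rh i))"] osat_e[OF rh(1) cK] rh(1,3) by simp
  moreover have "ALL i<m. upl L (e (rh i)) = up y i" "rh m = fval K c m ps y" using rh(2) by (simp_all add: up_def)
  ultimately show ?thesis using u(1) by (intro bexI[of _ "%i. upl L (e (rh i))"]) simp_all
 qed
 let ?gL = "%s x. indicator (dset L ?c m ph) x*ennreal (absv L (fval L ?c m ps x) powr s)"
 let ?gK = "%s x. indicator (dset K c m ph) x*ennreal (absv K (fval K c m ps x) powr s)"
 obtain M where M: "!!M'. M' >= M ==> det (L.V.BasA (L.V.polyf M')) UNIV (%z. z:S)"
  unfolding S_def mem_Collect_eq using L.V.oev_det[of ka ?f] by blast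
 define M' where "M' = max M (Suc m)"
 have m: "m < M'" by (simp add: M'_def)
 obtain P where P: "finite P" "!!p. p:P ==> L.V.cell_ok S m M' p" "!!z. z:S ==> EX p:P. L.V.in_cell M' z p"
  using L.V.cells_exist[OF M[of M'] m] unfolding M'_def by auto
 have fin: "(\<integral>\<^sup>+ x. ?gK s x \<partial>haar K m) < \<infinity>" if s: "0 < s" and gf: "(\<integral>\<^sup>+ x. ?gL s x \<partial>haar L m) < \<infinity>" for s
 proof -
  have gL: "?gL s x = ennreal (ql powr (- (s*real_of_int (L.V.ord (z m)))))"
   if x: "x:space (haar L m)" "z:S" "!!i. i < m ==> dn L (z i) = x i" "nmF L (z m) ~= 0" for x z
  proof -
   have "absv L (fval L ?c m ps x) = nmF L (z m)" using L_pt[OF x(1-3)] by (simp add: nmF_def)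
   also have "... = ql powr (- real_of_int (L.V.ord (z m)))"
    using L.V.nm_ord[OF x(4)] powr_real_of_int'[of ql "- L.V.ord (z m)"] L.q1 by simp
   finally show ?thesis using L_pt[OF x(1-3)] by (simp add: powr_powr mult.commute)
  qed
  let ?w = "%z. if nmF L (z m) = 0 then 0 else ennreal (xk powr (s*real_of_int (L.V.ord (z m))))"
  have "ALL p:P. EX g'. g':borel_measurable (haar K m) & (\<integral>\<^sup>+ y. g' y \<partial>haar K m) < \<infinity> &
   (AE y in haar K m. ALL z:S. L.V.in_cell M' z p --> (ALL i<m. z i = up y i) --> ?w z <= g' y)" (is "ALL p:P. ?G p")
  proof
   fix p assume p: "p:P"
   show "?G p"
    unfolding Bex_def[symmetric] by (rule cell_K[OF P(2)[OF p] m s gf], rule gL)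
  qed
  then obtain G where G: "!!p. p:P ==> G p:borel_measurable (haar K m)" "!!p. p:P ==> (\<integral>\<^sup>+ y. G p y \<partial>haar K m) < \<infinity>"
   "!!p. p:P ==> AE y in haar K m. ALL z:S. L.V.in_cell M' z p --> (ALL i<m. z i = up y i) --> ?w z <= G p y"
   by (elim bchoice[elim_format] exE) blast
  have "AE y in haar K m. ALL p:P. ALL z:S. L.V.in_cell M' z p --> (ALL i<m. z i = up y i) --> ?w z <= G p y"
   by (rule AE_finite_allI[OF P(1) G(3)])
  hence "AE y in haar K m. ?gK s y <= (SUM p:P. G p y)"
  proof (rule AE_mp, intro AE_I2 impI)
   fix y assume a: "ALL p:P. ALL z:S. L.V.in_cell M' z p --> (ALL i<m. z i = up y i) --> ?w z <= G p y"
   show "?gK s y <= (SUM p:P. G p y)"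
   proof (cases "y:dset K c m ph")
    case True
    let ?u = "fval K c m ps y"
    obtain z where z: "z:S" "ALL i<m. z i = up y i" "z m = upl L (e ?u)" "?u:carrier K" using K_pt[OF True] by blast
    obtain p where p: "p:P" "L.V.in_cell M' z p" using P(3)[OF z(1)] by blast
    have "ennreal (absv K ?u powr s) = ?w z"
    proof (cases "?u = \<zero>\<^bsub>K\<^esub>")
     case True
     thus ?thesis using z(3) by (simp add: absv_def L.nmF_eq0)
    next
     case False
     have n: "nmF L (z m) ~= 0" using z(3,4) False e_zero[OF z(4)] by (simp add: L.nmF_eq0)
     have "nmF L (z m) = ql powi (- (ram * vord K ?u))"
      using z(3,4) False e_zero[OF z(4)] vord_e[OF z(4) False] by (simp add: nmF_def L.absv_powi)
     hence o: "L.V.ord (z m) = ram * vord K ?u" by (rule L.V.ordI)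
     \<comment> \<open>The order of the image in \<open>L\<close> is \<open>ram\<close> times the
       order in \<open>K\<close>, and the exponent \<open>-1/ram\<close> in \<open>xk\<close> undoes
       this.\<close>
     have "absv K ?u powr s = xk powr (s*real_of_int (ram * vord K ?u))"
      using False ram_pos by (simp add: absv_def powr_powr mult.commute)
     thus ?thesis using n o by simp
    qed
    also have "... <= G p y" using a[rule_format, OF p(1) z(1) p(2)] z(2) by blast
    also have "... <= (SUM p:P. G p y)" by (rule member_le_sum[OF p(1) _ P(1)]) simp
    finally show ?thesis using True by simp
   qed simp
  qed
  hence "(\<integral>\<^sup>+ x. ?gK s x \<partial>haar K m) <= (\<integral>\<^sup>+ x. (SUM p:P. G p x) \<partial>haar K m)" by (rule nn_integral_mono_AE)
  also have "... = (SUM p:P. \<integral>\<^sup>+ x. G p x \<partial>haar K m)" by (rule nn_integral_sum[OF G(1)])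
  also have "... < \<infinity>" using G(2) P(1) by (simp add: ennreal_sum_less_top)
  finally show ?thesis .
 qed
 define SL SK where "SL = {s::real. 0 < s & (\<integral>\<^sup>+ x. ?gL s x \<partial>haar L m) < \<infinity>}"
  and "SK = {s::real. 0 < s & (\<integral>\<^sup>+ x. ?gK s x \<partial>haar K m) < \<infinity>}"
 have sub: "SL <= SK" using fin unfolding SL_def SK_def by blast
 have i: "ind L ?c m ph ps = (if SL = {} then 0 else Sup (ereal ` SL))" "ind K c m ph ps = (if SK = {} then 0 else Sup (ereal ` SK))"
  by (simp_all only: ind_def SL_def SK_def Let_def)
 show ?thesis
 proof (cases "SK = {}")
  case True
  thus ?thesis using sub i by simp
 next
  case False
  then obtain s where s: "s:SK" by blast
  hence "0 < s" unfolding SK_def by blast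
  \<comment> \<open>This covers the case that no exponent is integrable over \<open>L\<close>, where
    the index is 0 by convention.\<close>
  hence "0 <= Sup (ereal ` SK)" using s by (intro Sup_upper2[of "ereal s"]) auto
  thus ?thesis using False sub i by (auto intro: Sup_subset_mono)
 qed
qed

end

text \<open>Functionality is assumed for fields carried by \<open>real\<close> only. Both
  \<open>K\<close> and \<open>L\<close> have copies there, which are finite extensions of
  \<open>K\<close>, and \<open>defines_fun_copy\<close> brings the property back to \<open>K\<close>
  and \<open>L\<close>.\<close>

lemma ind_le_finite_ext:
 assumes K: "local_field0 K" and L: "local_field0 L" and e: "finite_ext K L e"
  and wf: "qwf ph" "qwf ps" and co: "qconsts ph <= {p. c p:carrier K}" "qconsts ps <= {p. c p:carrier K}"
  and df: "!!(F :: real vfield) g. local_field0 F ==> finite_ext K F g ==> defines_fun F (%p. g (c p)) m ph ps"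
 shows "ind L (%p. e (c p)) m ph ps <= ind K c m ph ps"
proof -
 interpret emb K L e by unfold_locales (use K L finite_ext_vemb[OF e] in auto)
 obtain g :: "'a => real" where g: "inj_on g (carrier K)" using K.inj_real by blast
 obtain h :: "'b => real" where h: "inj_on h (carrier L)" using L.inj_real by blast
 have gK: "finite_ext K (K.copy g) g" by (rule finite_ext_copy[OF K.lf_axioms g])
 have hL: "finite_ext K (L.copy h) (%x. h (e x))"
  by (rule finite_ext_trans[OF K L L.copy_local_field(1)[OF h] e finite_ext_copy[OF L.lf_axioms h]])
 have coL: "qconsts ph <= {p. e (c p):carrier L}" "qconsts ps <= {p. e (c p):carrier L}" using co by auto
 show ?thesis
  by (rule ind_le[OF wf co K.defines_fun_copy[OF g df[OF K.copy_local_field(1)[OF g] gK] wf co]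
   L.defines_fun_copy[OF h df[OF L.copy_local_field(1)[OF h] hL] wf coL]])
qed

theorem theorem7p6:
  shows "(\<forall>(\<phi>::'p qf) (\<psi>::'p qf) (m::nat).
            qwf \<phi> \<and> qwf \<psi> \<and> qconsts \<phi> = {} \<and> qconsts \<psi> = {} \<and>
            (\<forall>F::real vfield. local_field0 F \<longrightarrow> defines_fun F (\<lambda>_. ring.zero F) m \<phi> \<psi>) \<longrightarrow>
            (\<forall>(K::'a vfield) (L::'b vfield) e.
               local_field0 K \<and> local_field0 L \<and> finite_ext K L e \<longrightarrow>
               ind L (\<lambda>_. ring.zero L) m \<phi> \<psi> \<le> ind K (\<lambda>_. ring.zero K) m \<phi> \<psi>))
       \<and>
       (\<forall>(K0::'c vfield) (\<phi>::'c qf) (\<psi>::'c qf) (m::nat).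
            local_field0 K0 \<and> qwf \<phi> \<and> qwf \<psi> \<and>
            qconsts \<phi> \<subseteq> carrier K0 \<and> qconsts \<psi> \<subseteq> carrier K0 \<and>
            (\<forall>(F::real vfield) e0. local_field0 F \<and> finite_ext K0 F e0 \<longrightarrow>
               defines_fun F e0 m \<phi> \<psi>) \<longrightarrow>
            (\<forall>(K::'a vfield) e0 (L::'b vfield) e.
               local_field0 K \<and> finite_ext K0 K e0 \<and> local_field0 L \<and> finite_ext K L e \<longrightarrow>
               ind L (e \<circ> e0) m \<phi> \<psi> \<le> ind K e0 m \<phi> \<psi>))"
proof (intro conjI allI impI; elim conjE)
 fix ph ps :: "'p qf" and m and K :: "'a vfield" and L :: "'b vfield" and e
 assume wf: "qwf ph" "qwf ps" and co: "qconsts ph = {}" "qconsts ps = {}"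
  and df: "ALL F::real vfield. local_field0 F --> defines_fun F (%_. \<zero>\<^bsub>F\<^esub>) m ph ps"
  and K: "local_field0 K" and L: "local_field0 L" and e: "finite_ext K L e"
 \<comment> \<open>Without parameters all constants are interpreted by zero. As embeddings preserve
   zero, this interpretation is the image of the one over \<open>K\<close>, so the argument for
   formulas with parameters applies.\<close>
 have z: "g \<zero>\<^bsub>K\<^esub> = \<zero>\<^bsub>F\<^esub>" if "local_field0 F" "finite_ext K F g" for F :: "'d vfield" and g
 proof -
  interpret emb K F g by unfold_locales (use K that finite_ext_vemb in auto)
  show ?thesis by simp
 qed
 have "ind L (%_. e \<zero>\<^bsub>K\<^esub>) m ph ps <= ind K (%_. \<zero>\<^bsub>K\<^esub>) m ph ps"
 proof (rule ind_le_finite_ext[OF K L e wf])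
  show "defines_fun F (%_. g \<zero>\<^bsub>K\<^esub>) m ph ps" if "local_field0 F" "finite_ext K F g" for F :: "real vfield" and g
   using df[rule_format, OF that(1)] unfolding z[OF that] .
 qed (simp_all add: co)
 thus "ind L (%_. \<zero>\<^bsub>L\<^esub>) m ph ps <= ind K (%_. \<zero>\<^bsub>K\<^esub>) m ph ps" unfolding z[OF L e] .
next
 fix K0 :: "'c vfield" and ph ps :: "'c qf" and m and K :: "'a vfield" and e0 and L :: "'b vfield" and e
 assume K0: "local_field0 K0" and wf: "qwf ph" "qwf ps" and co: "qconsts ph <= carrier K0" "qconsts ps <= carrier K0"
  and df: "ALL (F::real vfield) e0. local_field0 F & finite_ext K0 F e0 --> defines_fun F e0 m ph ps"
  and K: "local_field0 K" and e0: "finite_ext K0 K e0" and L: "local_field0 L" and e: "finite_ext K L e"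
 interpret E0: emb K0 K e0 by unfold_locales (use K0 K finite_ext_vemb[OF e0] in auto)
 have "qconsts ph <= {p. e0 p:carrier K}" "qconsts ps <= {p. e0 p:carrier K}" using co by auto
 moreover have "defines_fun F (%p. g (e0 p)) m ph ps" if "local_field0 F" "finite_ext K F g" for F :: "real vfield" and g
  using df that(1) finite_ext_trans[OF K0 K that(1) e0 that(2)] by blast
 ultimately have "ind L (%p. e (e0 p)) m ph ps <= ind K e0 m ph ps" by (rule ind_le_finite_ext[OF K L e wf])
 thus "ind L (e o e0) m ph ps <= ind K e0 m ph ps" by (simp add: comp_def)
qed

end
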